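(* Let $n\ge2$, $m\ge1$ be integers, $k=n-1$. The space $H_F^2(E_{n,m})$ is a reproducing-kernel Hilbert space (of functions on $E_{n,m}$). Its kernel is $$S_{n,m}((z,w),(\zeta,\eta))=C_{n,m}\sum_{\beta=0}^{\infty}\frac{\Gamma(k+\lambda_\beta)}{\Gamma(\lambda_\beta)}\frac{(w\bar\eta)^\beta}{(1-\langle z,\zeta\rangle)^{k+\lambda_\beta}},\qquad (z,w),(\zeta,\eta)\in E_{n,m},$$ where $$\lambda_\beta=\frac{\beta}{m}+\mu_{n,m},\qquad \mu_{n,m}=\frac{n+m}{m(n+1)},\qquad C_{n,m}=\frac{m^{1-2/(n+1)}}{\pi^n}.$$ The series converges absolutely and locally uniformly on $E_{n,m}\times E_{n,m}$.
   Context: $E_{n,m}=\{(z,w)\in\mathbb C^{k}\times\mathbb C: |z|^2+|w|^{2m}<1\}$, $k=n-1$, and $\langle z,\zeta\rangle=\sum_{j=1}^k z_j\bar\zeta_j$. Fractional powers of $1-\langle z,\zeta\rangle$ (which has positive real part) use the principal branch. Let $\rho(z,w)=|z|^2+|w|^{2m}-1$, and on $\partial E_{n,m}$ let $$M(\rho)=-\det\begin{pmatrix}0&\rho_{\bar \ell}\\ \rho_j&\rho_{j\bar \ell}\end{pmatrix}_{1\le j,\ell\le n}$$ (the $(n+1)\times(n+1)$ complex bordered Hessian determinant in the coordinates $(z_1,\dots,z_k,w)$). The Fefferman measure is $d\mu_F=M(\rho)^{1/(n+1)}\,d\sigma/|\nabla\rho|$, with $d\sigma$ Euclidean hypersurface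 measure on $\partial E_{n,m}$ and $|\nabla\rho|$ the Euclidean length of the real gradient. $H_F^2(E_{n,m})$ is the closure in $L^2(\partial E_{n,m},d\mu_F)$ of (the boundary values of) the holomorphic functions defined in a neighbourhood of $\overline{E_{n,m}}$. That it is a reproducing-kernel Hilbert space means that for each $p\in E_{n,m}$ the evaluation $f\mapsto f(p)$, defined on functions holomorphic near $\overline{E_{n,m}}$, is bounded in the $L^2(d\mu_F)$ norm and hence extends to $H_F^2(E_{n,m})$, whose elements are thereby identified with functions on $E_{n,m}$. The kernel is the function $S_{n,m}$ with $S_{n,m}(\cdot,q)\in H_F^2(E_{n,m})$ and $f(q)=\langle f,S_{n,m}(\cdot,q)\rangle_{L^2(d\mu_F)}$ for all $f\in H_F^2(E_{n,m})$, $q\in E_{n,m}$. *)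

theory Defs
  imports "HOL-Analysis.Analysis"
begin

section \<open>Holomorphic functions of several variables\<close>

text \<open>The space \<open>\<complex>^n\<close> is rendered as \<open>(complex ^ 'k) \<times> complex\<close> with \<open>CARD('k) = n - 1\<close>, whose norm is
  the Euclidean one; its \<open>n\<close> coordinates are indexed by \<open>'k option\<close>, with \<open>None\<close> standing for the
  last coordinate \<open>w\<close>.\<close>

definition cscale :: "complex \<Rightarrow> (complex ^ 'k) \<times> complex \<Rightarrow> (complex ^ 'k) \<times> complex" where
  "cscale c p = (c *s fst p, c * snd p)"

definition holomorphic_near ::
    "((complex ^ 'k::finite) \<times> complex \<Rightarrow> complex) \<Rightarrow> ((complex ^ 'k) \<times> complex) set \<Rightarrow> bool" where
  "holomorphic_near f K \<longleftrightarrow>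
     (\<exists>U. open U \<and> K \<subseteq> U \<and>
        (\<forall>p\<in>U. \<exists>f'. (f has_derivative f') (at p) \<and> (\<forall>c v. f' (cscale c v) = c * f' v)))"

definition herm :: "complex ^ 'k \<Rightarrow> complex ^ 'k::finite \<Rightarrow> complex" where
  "herm z \<zeta> = (\<Sum>j\<in>UNIV. z $ j * cnj (\<zeta> $ j))"


section \<open>Euclidean hypersurface measure\<close>

text \<open>Lebesgue measure on the coordinate hyperplane orthogonal to the basis vector \<open>b\<close>.\<close>

definition hyperplane_lborel :: "'a::euclidean_space \<Rightarrow> 'a measure" where
  "hyperplane_lborel b =
     distr (\<Pi>\<^sub>M i\<in>Basis - {b}. lborel) borel (\<lambda>f. \<Sum>i\<in>Basis - {b}. f i *\<^sub>R i)"

text \<open>A relatively open piece of \<open>S\<close> which is the graph, in the coordinate direction \<open>b\<close>, of a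
  continuously differentiable function \<open>h\<close> with gradient \<open>g\<close> on a relatively open subset \<open>U\<close> of
  the hyperplane orthogonal to \<open>b\<close>.\<close>

definition C1_graph_patch ::
    "'a::euclidean_space set \<Rightarrow> 'a \<Rightarrow> 'a set \<Rightarrow> ('a \<Rightarrow> real) \<Rightarrow> ('a \<Rightarrow> 'a) \<Rightarrow> bool" where
  "C1_graph_patch S b U h g \<longleftrightarrow>
     b \<in> Basis \<and>
     openin (top_of_set {y. y \<bullet> b = 0}) U \<and>
     (\<forall>y\<in>U. g y \<bullet> b = 0 \<and> (h has_derivative (\<lambda>v. g y \<bullet> v)) (at y within U)) \<and>
     continuous_on U g \<and>
     openin (top_of_set S) ((\<lambda>y. y + h y *\<^sub>R b) ` U)"

text \<open>The area of a part of a graph is the integral of \<open>sqrt (1 + \<bar>\<nabla>h\<bar>\<^sup>2)\<close>. By the implicit function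
  theorem a \<open>C\<^sup>1\<close> hypersurface is covered by countably many graphs in coordinate directions, so there
  is exactly one measure on it with this property.\<close>

definition is_hypersurface_measure :: "'a::euclidean_space set \<Rightarrow> 'a measure \<Rightarrow> bool" where
  "is_hypersurface_measure S \<sigma> \<longleftrightarrow>
     sets \<sigma> = sets (restrict_space borel S) \<and>
     (\<forall>b U h g. C1_graph_patch S b U h g \<longrightarrow>
        (\<forall>B\<in>sets \<sigma>. B \<subseteq> (\<lambda>y. y + h y *\<^sub>R b) ` U \<longrightarrow>
           emeasure \<sigma> B =
             (\<integral>\<^sup>+y. indicator U y * indicator B (y + h y *\<^sub>R b) * ennreal (sqrt (1 + (norm (g y))\<^sup>2))
                \<partial>hyperplane_lborel b)))"

definition hypersurface_measure :: "'a::euclidean_space set \<Rightarrow> 'a measure" where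
  "hypersurface_measure S = (THE \<sigma>. is_hypersurface_measure S \<sigma>)"


section \<open>Fefferman measure\<close>

definition coord_dir :: "'k option \<Rightarrow> complex \<Rightarrow> (complex ^ 'k::finite) \<times> complex" where
  "coord_dir j c = (case j of Some i \<Rightarrow> (axis i c, 0) | None \<Rightarrow> (0, c))"

definition wirtinger ::
    "'k option \<Rightarrow> ((complex ^ 'k::finite) \<times> complex \<Rightarrow> complex) \<Rightarrow> (complex ^ 'k) \<times> complex \<Rightarrow> complex" where
  "wirtinger j f p =
     (frechet_derivative f (at p) (coord_dir j 1) - \<i> * frechet_derivative f (at p) (coord_dir j \<i>)) / 2"

definition wirtinger_bar ::
    "'k option \<Rightarrow> ((complex ^ 'k::finite) \<times> complex \<Rightarrow> complex) \<Rightarrow> (complex ^ 'k) \<times> complex \<Rightarrow> complex" where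
  "wirtinger_bar j f p =
     (frechet_derivative f (at p) (coord_dir j 1) + \<i> * frechet_derivative f (at p) (coord_dir j \<i>)) / 2"

text \<open>The outer \<open>None\<close> indexes the border row and column.\<close>

definition bordered_hessian ::
    "((complex ^ 'k::finite) \<times> complex \<Rightarrow> real) \<Rightarrow> (complex ^ 'k) \<times> complex \<Rightarrow>
       complex ^ ('k option option) ^ ('k option option)" where
  "bordered_hessian \<rho> p = (\<chi> a b.
     case a of
       None \<Rightarrow> (case b of None \<Rightarrow> 0 | Some l \<Rightarrow> wirtinger_bar l (\<lambda>x. of_real (\<rho> x)) p)
     | Some j \<Rightarrow> (case b of None \<Rightarrow> wirtinger j (\<lambda>x. of_real (\<rho> x)) p
                 | Some l \<Rightarrow> wirtinger j (wirtinger_bar l (\<lambda>x. of_real (\<rho> x))) p))"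

text \<open>The matrix is Hermitian for \<open>\<rho>\<close> of class \<open>C\<^sup>2\<close>, so its determinant is real.\<close>

definition fefferman_M ::
    "((complex ^ 'k::finite) \<times> complex \<Rightarrow> real) \<Rightarrow> (complex ^ 'k) \<times> complex \<Rightarrow> real" where
  "fefferman_M \<rho> p = - Re (det (bordered_hessian \<rho> p))"

definition real_gradient :: "('a::euclidean_space \<Rightarrow> real) \<Rightarrow> 'a \<Rightarrow> 'a" where
  "real_gradient \<rho> p = (\<Sum>b\<in>Basis. frechet_derivative \<rho> (at p) b *\<^sub>R b)"

text \<open>The exponent is \<open>1 / (n + 1)\<close>, since \<open>n = CARD('k option)\<close>.\<close>

definition fefferman_measure ::
    "((complex ^ 'k::finite) \<times> complex) set \<Rightarrow> ((complex ^ 'k) \<times> complex \<Rightarrow> real) \<Rightarrow>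
       ((complex ^ 'k) \<times> complex) measure" where
  "fefferman_measure D \<rho> =
     density (hypersurface_measure (frontier D))
       (\<lambda>p. ennreal (fefferman_M \<rho> p powr (1 / (real CARD('k option) + 1)) / norm (real_gradient \<rho> p)))"


section \<open>Hardy spaces and reproducing kernels\<close>

definition L2_fun :: "'a measure \<Rightarrow> ('a \<Rightarrow> complex) set" where
  "L2_fun \<mu> = {f \<in> borel_measurable \<mu>. integrable \<mu> (\<lambda>x. (norm (f x))\<^sup>2)}"

definition L2_norm :: "'a measure \<Rightarrow> ('a \<Rightarrow> complex) \<Rightarrow> real" where
  "L2_norm \<mu> f = sqrt (\<integral>x. (norm (f x))\<^sup>2 \<partial>\<mu>)"

definition L2_inner :: "'a measure \<Rightarrow> ('a \<Rightarrow> complex) \<Rightarrow> ('a \<Rightarrow> complex) \<Rightarrow> complex" where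
  "L2_inner \<mu> f g = (\<integral>x. f x * cnj (g x) \<partial>\<mu>)"

text \<open>In the following, \<open>\<mu>\<close> is a measure on the boundary of \<open>D\<close>. Elements of \<open>L\<^sup>2(\<mu>)\<close>, and of the closure
  of the holomorphic functions in it, are represented by functions, equality being equality
  almost everywhere.\<close>

definition hardy_space ::
    "((complex ^ 'k::finite) \<times> complex) set \<Rightarrow> ((complex ^ 'k) \<times> complex) measure \<Rightarrow>
       ((complex ^ 'k) \<times> complex \<Rightarrow> complex) set" where
  "hardy_space D \<mu> =
     {f \<in> L2_fun \<mu>. \<forall>\<epsilon>>0. \<exists>g. holomorphic_near g (closure D) \<and> L2_norm \<mu> (\<lambda>x. f x - g x) < \<epsilon>}"

text \<open>The continuous extension to the Hardy space of the evaluation \<open>g \<mapsto> g p\<close> on the functions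
  holomorphic near \<open>closure D\<close>.\<close>

definition hardy_eval ::
    "((complex ^ 'k::finite) \<times> complex) set \<Rightarrow> ((complex ^ 'k) \<times> complex) measure \<Rightarrow>
       ((complex ^ 'k) \<times> complex \<Rightarrow> complex) \<Rightarrow> (complex ^ 'k) \<times> complex \<Rightarrow> complex" where
  "hardy_eval D \<mu> f p =
     (THE c. \<forall>g. (\<forall>i::nat. holomorphic_near (g i) (closure D)) \<longrightarrow>
                 (\<lambda>i. L2_norm \<mu> (\<lambda>x. f x - g i x)) \<longlonglongrightarrow> 0 \<longrightarrow> (\<lambda>i. g i p) \<longlonglongrightarrow> c)"

text \<open>Point evaluations are bounded, and an element of the Hardy space is determined by the function
  on \<open>D\<close> which its evaluations define.\<close>

definition hardy_is_RKHS ::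
    "((complex ^ 'k::finite) \<times> complex) set \<Rightarrow> ((complex ^ 'k) \<times> complex) measure \<Rightarrow> bool" where
  "hardy_is_RKHS D \<mu> \<longleftrightarrow>
     (\<forall>p\<in>D. \<exists>C. \<forall>f. holomorphic_near f (closure D) \<longrightarrow> norm (f p) \<le> C * L2_norm \<mu> f) \<and>
     (\<forall>f\<in>hardy_space D \<mu>. \<forall>g\<in>hardy_space D \<mu>.
        (\<forall>p\<in>D. hardy_eval D \<mu> f p = hardy_eval D \<mu> g p) \<longrightarrow> (AE x in \<mu>. f x = g x))"

definition is_hardy_kernel ::
    "((complex ^ 'k::finite) \<times> complex) set \<Rightarrow> ((complex ^ 'k) \<times> complex) measure \<Rightarrow>
       ((complex ^ 'k) \<times> complex \<Rightarrow> (complex ^ 'k) \<times> complex \<Rightarrow> complex) \<Rightarrow> bool" where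
  "is_hardy_kernel D \<mu> K \<longleftrightarrow>
     (\<forall>q\<in>D. \<exists>F\<in>hardy_space D \<mu>.
        (\<forall>p\<in>D. hardy_eval D \<mu> F p = K p q) \<and>
        (\<forall>f\<in>hardy_space D \<mu>. hardy_eval D \<mu> f q = L2_inner \<mu> f F))"


section \<open>The egg domains and their kernels\<close>

definition egg_rho :: "nat \<Rightarrow> (complex ^ 'k::finite) \<times> complex \<Rightarrow> real" where
  "egg_rho m p = (norm (fst p))\<^sup>2 + norm (snd p) ^ (2 * m) - 1"

definition egg :: "nat \<Rightarrow> ((complex ^ 'k::finite) \<times> complex) set" where
  "egg m = {(z, w). (norm z)\<^sup>2 + norm w ^ (2 * m) < 1}"

definition egg_mu :: "nat \<Rightarrow> nat \<Rightarrow> real" where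
  "egg_mu n m = (real n + real m) / (real m * (real n + 1))"

definition egg_lambda :: "nat \<Rightarrow> nat \<Rightarrow> nat \<Rightarrow> real" where
  "egg_lambda n m \<beta> = real \<beta> / real m + egg_mu n m"

definition egg_const :: "nat \<Rightarrow> nat \<Rightarrow> real" where
  "egg_const n m = real m powr (1 - 2 / (real n + 1)) / pi ^ n"

definition egg_term ::
    "nat \<Rightarrow> nat \<Rightarrow> nat \<Rightarrow> (complex ^ 'k::finite) \<times> complex \<Rightarrow> (complex ^ 'k) \<times> complex \<Rightarrow> complex" where
  "egg_term n m \<beta> p q =
     (let s = real (n - 1) + egg_lambda n m \<beta> in
        of_real (Gamma s / Gamma (egg_lambda n m \<beta>)) * (snd p * cnj (snd q)) ^ \<beta>
          / (1 - herm (fst p) (fst q)) powr of_real s)"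

end

theory Submission
  imports Defs "HOL-Complex_Analysis.Complex_Analysis"
begin

text \<open>
Write \<open>k = n - 1\<close> for the number of variables \<open>z\<close> and \<open>\<langle>z, \<zeta>\<rangle>\<close> for \<open>herm z \<zeta>\<close>.

The measure. The egg is an unconditional body: its defining function is even and strictly increasing in the
absolute value of every real coordinate. Its boundary is covered by the graphs over the coordinate
hyperplanes. Area divided by the gradient length is the Leray form, which projects along direction \<open>b\<close> to
\<open>dy / \<bar>\<nabla>\<rho> \<bullet> b\<bar>\<close>. By one-variable substitutions along the arcs in coordinate two-planes, its integrals do not
depend on \<open>b\<close> (\<open>leray_independent\<close>). Hence the measure defined by one pair of graphs has the right area on
patches in every direction, and it is the only one (\<open>hypersurface_measure_eq\<close>). The bordered Hessian is an arrow
matrix and gives \<open>M(\<rho>) = m\<^sup>2 \<bar>w\<bar>\<^sup>2\<^sup>m\<^sup>-\<^sup>2\<close> on the boundary (\<open>fefferman_M_egg\<close>). In the coordinates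
\<open>(z, t) \<mapsto> (z, r e\<^sup>2\<^sup>\<pi>\<^sup>\<i>\<^sup>t)\<close> with \<open>r\<^sup>2\<^sup>m = 1 - \<bar>z\<bar>\<^sup>2\<close>, the Fefferman measure becomes a constant times
\<open>(1 - \<bar>z\<bar>\<^sup>2) powr (\<mu> - 1) dz dt\<close> with \<open>\<mu> = egg_mu n m\<close> (\<open>fefferman_measure_egg\<close>).

The reproducing formula. Let \<open>f\<close> be holomorphic near the closed egg, with Taylor expansion in \<open>w\<close> with
coefficients \<open>f\<^sub>\<beta> z\<close>. Integrating \<open>f\<close> over \<open>t\<close> against the conjugate of the \<open>\<beta>\<close>-th term of the kernel isolates \<open>f\<^sub>\<beta>\<close>
and produces a factor \<open>r\<^sup>2\<^sup>\<beta> = (1 - \<bar>z\<bar>\<^sup>2) powr (\<beta> / m)\<close>, so the weight becomes \<open>(1 - \<bar>z\<bar>\<^sup>2) powr (\<lambda>\<^sub>\<beta> - 1)\<close>. The powers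
\<open>(1 - \<langle>z, \<zeta>\<rangle>) powr (- (k + \<lambda>\<^sub>\<beta>))\<close> are, up to a constant, the reproducing kernels of the Bergman spaces on the ball
with these weights (\<open>weighted_bergman_reproducing\<close>), and the Gamma quotient in the series normalises them
(\<open>term_integral\<close>). Summation over \<open>\<beta>\<close> gives \<open>f\<close> back (\<open>egg_kernel_reproducing\<close>).

The weighted Bergman formula comes from the Gaussian one. With weight \<open>exp (- \<bar>z\<bar>\<^sup>2)\<close>, a translation and the mean
value property over circles show that \<open>exp \<langle>z, \<zeta>\<rangle>\<close> reproduces (\<open>fock_reproducing\<close>). For homogeneous functions,
Gaussian integrals and weighted integrals over the ball agree up to Gamma factors
(\<open>gaussian_ball_nn_integral\<close>), and the binomial series of the Bergman kernel reassembles the homogeneous parts.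

Convergence. The kernel is a power of \<open>1 - \<langle>z, \<zeta>\<rangle>\<close> times a power series of radius of convergence 1 in
\<open>u = w \<eta>\<^sup>* (1 - \<langle>z, \<zeta>\<rangle>) powr (- 1 / m)\<close>, where \<open>\<eta>\<^sup>*\<close> is the conjugate of \<open>\<eta>\<close>, and \<open>\<bar>u\<bar> < 1\<close> as soon as one point
lies in the egg and the other in its closure (\<open>egg_pair_in_domain\<close>). This gives absolute and locally uniform
convergence, and holomorphy of the kernel near the closed egg in its first variable.

The Hilbert space. Evaluation is the inner product with the kernel, hence bounded. An element of the Hardy
space whose evaluations all vanish is orthogonal to all kernels. Since
\<open>K(p, r x) = K(r p, x)\<close> for real \<open>r\<close>, the reproducing formula at \<open>r p\<close>
writes the dilate \<open>g (r p)\<close> of a function holomorphic near the closure as a superposition of kernels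
(\<open>dilate_orthogonal\<close>). So the element is orthogonal to all such dilates, thus to all functions holomorphic near the
closure, thus to itself.
\<close>

section \<open>Substitution and implicit functions\<close>

text \<open>A one-variable substitution for an injective \<open>\<phi>\<close> of which only the pointwise derivative is known, as for a
function given implicitly. It suffices to compare the two sides as measures, so \<open>f\<close> may be taken to be
the indicator of a set, and then the change of variables theorem for absolutely integrable functions
applies because \<open>B\<close> has finite length.\<close>

lemma nn_integral_substitution_deriv:
  fixes \<phi> \<phi>' :: "real \<Rightarrow> real"
  assumes f [measurable]: "f \<in> borel_measurable borel"
    and A: "A \<in> sets borel" and bij: "bij_betw \<phi> A B" and B: "B \<in> sets borel" "emeasure lborel B < \<infinity>"
    and der: "\<And>x. x \<in> A \<Longrightarrow> (\<phi> has_real_derivative \<phi>' x) (at x)"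
    and m': "(\<lambda>x. indicator A x * \<phi>' x) \<in> borel_measurable borel"
  shows "(\<integral>\<^sup>+x. indicator B x * f x \<partial>lborel)
       = (\<integral>\<^sup>+x. indicator A x * (f (\<phi> x) * ennreal \<bar>\<phi>' x\<bar>) \<partial>lborel)"
proof -
  define \<phi>0 where "\<phi>0 x = (if x \<in> A then \<phi> x else 0)" for x
  have cont: "continuous_on A \<phi>"
    using der by (intro continuous_at_imp_continuous_on) (auto dest: DERIV_isCont)
  have [measurable]: "A \<in> sets borel" "B \<in> sets borel" using A B by auto
  have m0 [measurable]: "\<phi>0 \<in> borel_measurable borel"
    unfolding \<phi>0_def by (rule borel_measurable_continuous_on_if[OF A cont]) auto
  have [measurable]: "(\<lambda>x. indicator A x * \<phi>' x) \<in> borel_measurable lborel" using m' by simp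
  have meq: "(\<lambda>x. indicator A x * ennreal \<bar>\<phi>' x\<bar>) = (\<lambda>x. ennreal \<bar>indicator A x * \<phi>' x\<bar>)"
    by (auto simp: indicator_def fun_eq_iff)
  have mm [measurable]: "(\<lambda>x. indicator A x * ennreal \<bar>\<phi>' x\<bar>) \<in> borel_measurable lborel"
    unfolding meq by measurable
  define M1 where "M1 = density lborel (indicator B)"
  define M2 where "M2 = distr (density lborel (\<lambda>x. indicator A x * ennreal \<bar>\<phi>' x\<bar>)) borel \<phi>0"
  have "M1 = M2"
  proof (rule measure_eqI)
    show "sets M1 = sets M2" by (simp add: M1_def M2_def)
    fix X assume "X \<in> sets M1"
    then have X [measurable]: "X \<in> sets borel" by (simp add: M1_def)
    define C where "C = X \<inter> B"
    define S where "S = {x \<in> A. \<phi> x \<in> X}"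
    have Salt: "S = A \<inter> (\<phi>0 -` X \<inter> space borel)" unfolding S_def \<phi>0_def by auto
    have S [measurable]: "S \<in> sets borel" unfolding Salt by (intro sets.Int measurable_sets[OF m0] X A)
    have C [measurable]: "C \<in> sets borel" unfolding C_def by measurable
    have fin: "emeasure lborel C < \<infinity>"
      using B(2) emeasure_mono[of C B lborel] unfolding C_def by (auto intro: le_less_trans)
    have img: "\<phi> ` S = C" using bij unfolding S_def C_def bij_betw_def by auto
    have inj: "inj_on \<phi> S" using bij unfolding S_def bij_betw_def inj_on_def by auto
    have one: "((\<lambda>x::real. 1::real) absolutely_integrable_on C) \<and> integral C (\<lambda>x. 1::real) = measure lborel C"
    proof -
      have "((\<lambda>x. 1::real) has_integral measure lborel C) C"
        by (rule has_integral_measure_lborel[OF C fin])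
      then show ?thesis
        by (auto simp: has_integral_iff intro: nonnegative_absolutely_integrable_1)
    qed
    have "(\<lambda>x. \<bar>\<phi>' x\<bar> * 1) absolutely_integrable_on S \<and>
           integral S (\<lambda>x. \<bar>\<phi>' x\<bar> * 1) = measure lborel C"
      by (rule iffD2[OF has_absolute_integral_change_of_variables_1'[of S \<phi> \<phi>' "\<lambda>_. 1"]])
        (use one img inj der S in \<open>auto simp: S_def intro: has_field_derivative_at_within\<close>)
    then have hi: "((\<lambda>x. \<bar>\<phi>' x\<bar>) has_integral measure lborel C) S"
      by (auto simp: has_integral_iff absolutely_integrable_on_def)
    then have hi': "((\<lambda>x. \<bar>indicator A x * \<phi>' x\<bar>) has_integral measure lborel C) S"
      by (rule has_integral_eq[rotated]) (auto simp: S_def)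
    have hi'': "((\<lambda>x. indicator S x * \<bar>indicator A x * \<phi>' x\<bar>) has_integral measure lborel C) UNIV"
    proof -
      have "(\<lambda>x. indicator S x * \<bar>indicator A x * \<phi>' x\<bar>) = (\<lambda>x. if x \<in> S then \<bar>indicator A x * \<phi>' x\<bar> else 0)"
        by (auto simp: fun_eq_iff)
      then show ?thesis using hi' by (simp only: has_integral_restrict_UNIV)
    qed
    have "emeasure M2 X = (\<integral>\<^sup>+x. indicator S x * ennreal \<bar>indicator A x * \<phi>' x\<bar> \<partial>lborel)"
    proof -
      have XX: "\<phi>0 -` X \<in> sets borel" using measurable_sets[OF m0 X] by simp
      show ?thesis unfolding M2_def
        by (subst emeasure_distr, simp, simp, simp, subst emeasure_density[OF mm])
          (auto simp: XX Salt indicator_def intro!: nn_integral_cong)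
    qed
    also have "\<dots> = (\<integral>\<^sup>+x. ennreal (indicator S x * \<bar>indicator A x * \<phi>' x\<bar>) \<partial>lborel)"
      by (intro nn_integral_cong) (auto simp: indicator_def)
    also have "\<dots> = ennreal (measure lborel C)"
      by (rule nn_integral_has_integral_lborel[OF _ _ hi'']) (use m' in auto)
    also have "\<dots> = emeasure lborel C" using fin by (simp add: emeasure_eq_ennreal_measure)
    also have "\<dots> = emeasure M1 X" unfolding M1_def C_def
      by (subst emeasure_density) (auto simp: nn_integral_indicator[symmetric] indicator_def simp del: nn_integral_indicator intro!: nn_integral_cong)
    finally show "emeasure M1 X = emeasure M2 X" by simp
  qed
  then have "(\<integral>\<^sup>+x. f x \<partial>M1) = (\<integral>\<^sup>+x. f x \<partial>M2)" by simp
  also have "(\<integral>\<^sup>+x. f x \<partial>M1) = (\<integral>\<^sup>+x. indicator B x * f x \<partial>lborel)"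
    unfolding M1_def by (subst nn_integral_density) auto
  also have "(\<integral>\<^sup>+x. f x \<partial>M2) = (\<integral>\<^sup>+x. indicator A x * (f (\<phi> x) * ennreal \<bar>\<phi>' x\<bar>) \<partial>lborel)"
    unfolding M2_def
    by (subst nn_integral_distr, simp, simp, subst nn_integral_density[OF mm], measurable)
      (auto simp: \<phi>0_def indicator_def mult.commute intro!: nn_integral_cong)
  finally show ?thesis .
qed

lemma nn_integral_fold_positive:
  fixes f :: "real \<Rightarrow> ennreal"
  assumes [measurable]: "f \<in> borel_measurable borel"
  shows "(\<integral>\<^sup>+x. f x \<partial>lborel) = (\<integral>\<^sup>+x. indicator {0<..} x * f x \<partial>lborel) + (\<integral>\<^sup>+x. indicator {0<..} x * f (- x) \<partial>lborel)"
proof -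
  have "(\<integral>\<^sup>+x. f x \<partial>lborel) = (\<integral>\<^sup>+x. indicator {0<..} x * f x + indicator {..<0} x * f x \<partial>lborel)"
    by (rule nn_integral_cong_AE, rule eventually_mono[OF AE_lborel_singleton[of 0]]) (auto simp: indicator_def)
  also have "\<dots> = (\<integral>\<^sup>+x. indicator {0<..} x * f x \<partial>lborel) + (\<integral>\<^sup>+x. indicator {..<0} x * f x \<partial>lborel)"
    by (rule nn_integral_add) auto
  also have "(\<integral>\<^sup>+x. indicator {..<0} x * f x \<partial>lborel) = (\<integral>\<^sup>+x. indicator {0<..} x * f (- x) \<partial>lborel)"
    by (subst nn_integral_real_affine[where c="-1" and t=0]) (auto simp: indicator_def intro!: nn_integral_cong)
  finally show ?thesis .
qed

text \<open>Continuity of \<open>h\<close> improves to differentiability in two rounds. Inserting the graph into the linear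
approximation of \<open>F\<close> gives \<open>a \<bullet> D + \<delta> (a \<bullet> b)\<close> up to \<open>\<epsilon> (\<bar>D\<bar> + \<bar>\<delta>\<bar>)\<close>, where \<open>D\<close> and \<open>\<delta>\<close> are the increments
of \<open>y\<close> and \<open>h y\<close>; with \<open>\<epsilon>\<close> at most half of \<open>\<bar>a \<bullet> b\<bar>\<close> this first bounds \<open>\<delta>\<close> by a multiple \<open>K\<close> of \<open>\<bar>D\<bar>\<close>, and
inserting that bound again gives the derivative.\<close>

lemma implicit_function_derivative:
  fixes F :: "'a::euclidean_space \<Rightarrow> real"
  assumes F: "(F has_derivative (\<lambda>v. a \<bullet> v)) (at (y0 + h y0 *\<^sub>R b))"
    and b: "norm b = 1" and ab: "a \<bullet> b \<noteq> 0"
    and cont: "(h \<longlongrightarrow> h y0) (at y0 within U)"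
    and zero: "\<And>y. y \<in> U \<Longrightarrow> F (y + h y *\<^sub>R b) = 0" and y0: "y0 \<in> U"
  shows "(h has_derivative (\<lambda>v. - (a \<bullet> v) / (a \<bullet> b))) (at y0 within U)"
  unfolding has_derivative_within_alt2
proof (intro conjI allI impI)
  have "bounded_linear (\<lambda>v. (- 1 / (a \<bullet> b)) *\<^sub>R (a \<bullet> v))"
    by (intro bounded_linear_scaleR_right[THEN bounded_linear_compose] bounded_linear_inner_right)
  then show "bounded_linear (\<lambda>v. - (a \<bullet> v) / (a \<bullet> b))" by simp
  fix e :: real assume e: "e > 0"
  define c where "c = \<bar>a \<bullet> b\<bar>"
  have c: "c > 0" using ab by (simp add: c_def)
  \<comment> \<open>\<open>K\<close> will be a Lipschitz constant of \<open>h\<close> at \<open>y0\<close>\<close>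
  define K where "K = 2 * (norm a + c) / c"
  have K: "K \<ge> 0" using c by (simp add: K_def)
  define \<epsilon> where "\<epsilon> = min (c/2) (e * c / (1 + K))"
  have \<epsilon>: "\<epsilon> > 0" "\<epsilon> \<le> c/2" "\<epsilon> * (1 + K) \<le> e * c"
  proof -
    show "\<epsilon> > 0" using c e K by (auto simp: \<epsilon>_def)
    show "\<epsilon> \<le> c/2" unfolding \<epsilon>_def by (rule min.cobounded1)
    have "\<epsilon> * (1 + K) \<le> e * c / (1 + K) * (1 + K)" using K by (intro mult_right_mono) (auto simp: \<epsilon>_def)
    then show "\<epsilon> * (1 + K) \<le> e * c" using K by simp
  qed
  define x where "x y = y + h y *\<^sub>R b" for y
  have lim: "(x \<longlongrightarrow> x y0) (at y0 within U)"
    unfolding x_def by (intro tendsto_intros cont)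
  from F obtain d where d: "d > 0" "\<And>y. norm (y - x y0) < d \<Longrightarrow> norm (F y - F (x y0) - a \<bullet> (y - x y0)) \<le> \<epsilon> * norm (y - x y0)"
    using \<epsilon>(1) unfolding has_derivative_at_alt x_def by blast
  have "\<forall>\<^sub>F y in at y0 within U. dist (x y) (x y0) < d" using lim d(1) by (rule tendstoD)
  moreover have "\<forall>\<^sub>F y in at y0 within U. y \<in> U" by (auto simp: eventually_at_filter)
  ultimately show "\<forall>\<^sub>F y in at y0 within U. norm (h y - h y0 - - (a \<bullet> (y - y0)) / (a \<bullet> b)) \<le> e * norm (y - y0)"
  proof eventually_elim
    case (elim y)
    define D where "D = y - y0"
    define \<delta> where "\<delta> = h y - h y0"
    have xd: "x y - x y0 = D + \<delta> *\<^sub>R b" by (simp add: x_def D_def \<delta>_def algebra_simps)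
    have n: "norm (x y - x y0) \<le> norm D + \<bar>\<delta>\<bar>"
      unfolding xd using norm_triangle_ineq[of D "\<delta> *\<^sub>R b"] b by simp
    have "\<bar>a \<bullet> (x y - x y0)\<bar> \<le> \<epsilon> * norm (x y - x y0)"
      using d(2)[of "x y"] elim zero[of y] zero[OF y0] by (simp add: dist_norm x_def)
    also have "\<dots> \<le> \<epsilon> * (norm D + \<bar>\<delta>\<bar>)" using n \<epsilon>(1) by (intro mult_left_mono) auto
    finally have 1: "\<bar>a \<bullet> D + \<delta> * (a \<bullet> b)\<bar> \<le> \<epsilon> * (norm D + \<bar>\<delta>\<bar>)"
      by (simp add: xd inner_simps)
    have "\<bar>\<delta>\<bar> * c = \<bar>\<delta> * (a \<bullet> b)\<bar>" by (simp add: c_def abs_mult)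
    also have "\<dots> \<le> \<bar>a \<bullet> D\<bar> + \<epsilon> * (norm D + \<bar>\<delta>\<bar>)" using 1 by linarith
    also have "\<dots> \<le> norm a * norm D + c/2 * (norm D + \<bar>\<delta>\<bar>)"
      by (intro add_mono Cauchy_Schwarz_ineq2 mult_right_mono \<epsilon>) auto
    finally have 3: "\<bar>\<delta>\<bar> * c \<le> norm a * norm D + c/2 * (norm D + \<bar>\<delta>\<bar>)" .
    have "c/2 * (norm D + \<bar>\<delta>\<bar>) = c/2 * norm D + (\<bar>\<delta>\<bar> * c) / 2"
      "2 * (norm a + c/2) * norm D = 2 * (norm a * norm D) + 2 * (c/2 * norm D)"
      by (simp_all add: algebra_simps)
    with 3 have "\<bar>\<delta>\<bar> * c \<le> 2 * (norm a + c/2) * norm D" by linarith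
    also have "\<dots> \<le> 2 * (norm a + c) * norm D" using c by (intro mult_right_mono) auto
    finally have "\<bar>\<delta>\<bar> \<le> K * norm D" using c by (simp add: K_def field_simps)
    then have "\<epsilon> * (norm D + \<bar>\<delta>\<bar>) \<le> \<epsilon> * (norm D + K * norm D)" using \<epsilon>(1) by (intro mult_left_mono) auto
    also have "\<dots> = \<epsilon> * (1 + K) * norm D" by (simp add: algebra_simps)
    also have "\<dots> \<le> e * c * norm D" by (intro mult_right_mono \<epsilon>) auto
    finally have 2: "\<bar>a \<bullet> D + \<delta> * (a \<bullet> b)\<bar> \<le> e * c * norm D" using 1 by linarith
    have "\<bar>\<delta> + (a \<bullet> D) / (a \<bullet> b)\<bar> = \<bar>a \<bullet> D + \<delta> * (a \<bullet> b)\<bar> / c"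
      using ab by (simp add: c_def abs_divide[symmetric] add_divide_distrib add.commute)
    also have "\<dots> \<le> e * norm D" using 2 c by (simp add: field_simps)
    finally show ?case by (simp add: \<delta>_def D_def)
  qed
qed

section \<open>Unconditional hypersurfaces as graphs\<close>

text \<open>The sublevel set \<open>\<rho> < 0\<close> is an unconditional body: \<open>\<rho>\<close> is even in every coordinate and strictly increasing
in its absolute value. Its boundary \<open>\<rho> = 0\<close> is therefore, in every coordinate direction, a union of two
mirror-image graphs and a part of the coordinate hyperplane. This replaces the local
implicit function theorem by finitely many explicit graphs.\<close>

locale unconditional_hypersurface =
  fixes \<rho> :: "'a::euclidean_space \<Rightarrow> real" and G :: "'a \<Rightarrow> 'a"
  assumes deriv: "\<And>x. (\<rho> has_derivative (\<lambda>v. G x \<bullet> v)) (at x)"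
    and grad_cont: "continuous_on UNIV G"
    and grad_sign: "\<And>b x. b \<in> Basis \<Longrightarrow> x \<bullet> b \<noteq> 0 \<Longrightarrow> (x \<bullet> b) * (G x \<bullet> b) > 0"
    and reflect: "\<And>b x. b \<in> Basis \<Longrightarrow> \<rho> (x - (2 * (x \<bullet> b)) *\<^sub>R b) = \<rho> x"
    and origin: "\<rho> 0 < 0"
    and bdd: "bounded {x. \<rho> x \<le> 0}"
begin

definition base :: "'a \<Rightarrow> 'a set" where "base b = {y. y \<bullet> b = 0 \<and> \<rho> y < 0}"

definition height :: "'a \<Rightarrow> 'a \<Rightarrow> real" where
  "height b y = (if y \<in> base b then THE t. 0 < t \<and> \<rho> (y + t *\<^sub>R b) = 0 else 0)"

lemma rho_cont: "continuous_on UNIV \<rho>"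
  using deriv by (intro continuous_at_imp_continuous_on) (auto intro: has_derivative_continuous)

lemma rho_mono:
  assumes b: "b \<in> Basis" and y: "y \<bullet> b = 0" and t: "0 \<le> t" "t < t'"
  shows "\<rho> (y + t *\<^sub>R b) < \<rho> (y + t' *\<^sub>R b)"
proof (rule DERIV_pos_imp_increasing_open[OF t(2)])
  fix x assume x: "t < x" "x < t'"
  have "((\<lambda>t. \<rho> (y + t *\<^sub>R b)) has_derivative (\<lambda>h. G (y + x *\<^sub>R b) \<bullet> (h *\<^sub>R b))) (at x)"
    by (rule has_derivative_compose[OF _ deriv, of "\<lambda>t. y + t *\<^sub>R b"]) (auto intro!: derivative_eq_intros)
  then have "((\<lambda>t. \<rho> (y + t *\<^sub>R b)) has_real_derivative (G (y + x *\<^sub>R b) \<bullet> b)) (at x)"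
    by (simp add: has_field_derivative_def mult.commute[of _ "G _ \<bullet> b"])
  moreover have "x * (G (y + x *\<^sub>R b) \<bullet> b) > 0"
    using grad_sign[OF b, of "y + x *\<^sub>R b"] b y x t by (simp add: inner_simps)
  then have "G (y + x *\<^sub>R b) \<bullet> b > 0" using x t by (simp add: zero_less_mult_iff)
  ultimately show "\<exists>z. DERIV (\<lambda>t. \<rho> (y + t *\<^sub>R b)) x :> z \<and> 0 < z" by blast
next
  show "continuous_on {t..t'} (\<lambda>t. \<rho> (y + t *\<^sub>R b))"
    by (intro continuous_on_compose2[OF rho_cont] continuous_intros) auto
qed

lemma rho_abs:
  assumes b: "b \<in> Basis" and y: "y \<bullet> b = 0"
  shows "\<rho> (y + t *\<^sub>R b) = \<rho> (y + \<bar>t\<bar> *\<^sub>R b)"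
proof (cases "t \<ge> 0")
  case False
  have "\<rho> (y + t *\<^sub>R b - (2 * ((y + t *\<^sub>R b) \<bullet> b)) *\<^sub>R b) = \<rho> (y + t *\<^sub>R b)" by (rule reflect[OF b])
  moreover have "y + t *\<^sub>R b - (2 * ((y + t *\<^sub>R b) \<bullet> b)) *\<^sub>R b = y + \<bar>t\<bar> *\<^sub>R b"
    using False b y by (simp add: inner_simps algebra_simps scaleR_left_distrib[symmetric])
  ultimately show ?thesis by simp
qed simp

lemma height_exists:
  assumes b: "b \<in> Basis" and y: "y \<in> base b"
  shows "\<exists>!t. 0 < t \<and> \<rho> (y + t *\<^sub>R b) = 0"
proof -
  have y0: "y \<bullet> b = 0" "\<rho> y < 0" using y by (auto simp: base_def)
  obtain B where B: "\<And>x. \<rho> x \<le> 0 \<Longrightarrow> norm x \<le> B" using bdd by (auto simp: bounded_iff)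
  define T where "T = \<bar>B\<bar> + norm y + 1"
  have T0: "T \<ge> 0" by (simp add: T_def)
  have "norm (T *\<^sub>R b) - norm y \<le> norm (y + T *\<^sub>R b)"
    using norm_triangle_ineq2[of "T *\<^sub>R b" "- y"] by (simp add: add.commute)
  moreover have "norm (T *\<^sub>R b) = T" using b T0 by simp
  ultimately have "norm (y + T *\<^sub>R b) > B" unfolding T_def by linarith
  then have "\<rho> (y + T *\<^sub>R b) > 0" using B[of "y + T *\<^sub>R b"] by force
  moreover have "continuous_on {0..T} (\<lambda>t. \<rho> (y + t *\<^sub>R b))"
    by (intro continuous_on_compose2[OF rho_cont] continuous_intros) auto
  moreover note T0
  ultimately obtain t where t: "0 \<le> t" "t \<le> T" "\<rho> (y + t *\<^sub>R b) = 0"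
    using IVT'[of "\<lambda>t. \<rho> (y + t *\<^sub>R b)" 0 0 T] y0 by force
  then have "t > 0" using y0 by (cases "t = 0") auto
  with t show ?thesis
    using rho_mono[OF b y0(1)] by (metis linorder_neqE_linordered_idom less_irrefl order_less_imp_le)
qed

lemma height_pos: "b \<in> Basis \<Longrightarrow> y \<in> base b \<Longrightarrow> 0 < height b y"
  and height_root: "b \<in> Basis \<Longrightarrow> y \<in> base b \<Longrightarrow> \<rho> (y + height b y *\<^sub>R b) = 0"
  using theI'[OF height_exists] by (auto simp: height_def)

lemma rho_neg_iff:
  assumes b: "b \<in> Basis" and y: "y \<bullet> b = 0"
  shows "\<rho> (y + t *\<^sub>R b) < 0 \<longleftrightarrow> y \<in> base b \<and> \<bar>t\<bar> < height b y"
proof (cases "\<rho> y < 0")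
  case True
  then have yb: "y \<in> base b" using y by (auto simp: base_def)
  show ?thesis
    using rho_mono[OF b y, of "\<bar>t\<bar>" "height b y"] rho_mono[OF b y, of "height b y" "\<bar>t\<bar>"]
      height_pos[OF b yb] height_root[OF b yb] rho_abs[OF b y, of t] yb
    by (cases "\<bar>t\<bar>" "height b y" rule: linorder_cases) auto
next
  case False
  then show ?thesis
    using rho_mono[OF b y, of 0 "\<bar>t\<bar>"] rho_abs[OF b y, of t] by (cases "t = 0") (auto simp: base_def)
qed

lemma rho_zero_iff:
  assumes b: "b \<in> Basis" and y: "y \<bullet> b = 0" and t: "t \<noteq> 0"
  shows "\<rho> (y + t *\<^sub>R b) = 0 \<longleftrightarrow> y \<in> base b \<and> \<bar>t\<bar> = height b y"
proof (cases "\<rho> y < 0")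
  case True
  then have yb: "y \<in> base b" using y by (auto simp: base_def)
  show ?thesis
    using rho_mono[OF b y, of "\<bar>t\<bar>" "height b y"] rho_mono[OF b y, of "height b y" "\<bar>t\<bar>"]
      height_pos[OF b yb] height_root[OF b yb] rho_abs[OF b y, of t] yb
    by (cases "\<bar>t\<bar>" "height b y" rule: linorder_cases) auto
next
  case False
  then show ?thesis
    using rho_mono[OF b y, of 0 "\<bar>t\<bar>"] rho_abs[OF b y, of t] t by (auto simp: base_def)
qed

lemma height_signed_root:
  assumes "b \<in> Basis" "y \<in> base b" "\<bar>s\<bar> = 1"
  shows "\<rho> (y + (s * height b y) *\<^sub>R b) = 0"
proof -
  have "y \<bullet> b = 0" using assms by (auto simp: base_def)
  then show ?thesis
    using rho_zero_iff[of b y "s * height b y"] height_pos[of b y] assms by (auto simp: abs_mult)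
qed

lemma grad_nz:
  assumes "b \<in> Basis" "y \<in> base b" "\<bar>s\<bar> = 1"
  shows "s * (G (y + (s * height b y) *\<^sub>R b) \<bullet> b) > 0"
proof -
  have "y \<bullet> b = 0" using assms by (auto simp: base_def)
  then have "(s * height b y) * (G (y + (s * height b y) *\<^sub>R b) \<bullet> b) > 0"
    using grad_sign[OF assms(1), of "y + (s * height b y) *\<^sub>R b"] height_pos[of b y] assms by (auto simp: inner_simps)
  then have "height b y * (s * (G (y + (s * height b y) *\<^sub>R b) \<bullet> b)) > 0" by (simp only: ac_simps)
  then show ?thesis
    using height_pos[OF assms(1,2)] by (simp add: zero_less_mult_iff)
qed

text \<open>For \<open>a \<ge> 0\<close> the condition \<open>a < height b y\<close> says that \<open>y + a *\<^sub>R b\<close> lies in the open sublevel set, which gives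
lower semicontinuity; for upper semicontinuity, strict monotonicity makes \<open>\<rho>\<close> strictly positive, again an
open condition, at every larger \<open>a\<close>.\<close>

lemma height_tendsto:
  assumes b: "b \<in> Basis" and y: "y0 \<in> base b"
  shows "(height b \<longlongrightarrow> height b y0) (at y0 within base b)"
proof (rule order_tendstoI)
  have U: "\<forall>\<^sub>F y in at y0 within base b. y \<in> base b" by (auto simp: eventually_at_filter)
  have lim: "((\<lambda>y. \<rho> (y + a *\<^sub>R b)) \<longlongrightarrow> \<rho> (y0 + a *\<^sub>R b)) (at y0 within base b)" for a
  proof -
    have "continuous_on UNIV (\<lambda>y. \<rho> (y + a *\<^sub>R b))"
      by (intro continuous_on_compose2[OF rho_cont] continuous_intros) auto
    then show ?thesis
      by (auto simp: continuous_on_def intro: tendsto_within_subset)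
  qed
  have iff: "\<rho> (y + a *\<^sub>R b) < 0 \<longleftrightarrow> \<bar>a\<bar> < height b y" if "y \<in> base b" for y a
    using rho_neg_iff[OF b, of y a] that by (auto simp: base_def)
  {
    fix a assume a: "a < height b y0"
    show "\<forall>\<^sub>F y in at y0 within base b. a < height b y"
    proof (cases "a < 0")
      case True
      show ?thesis using U
      proof eventually_elim
        case (elim y)
        then show ?case using True height_pos[OF b, of y] by simp
      qed
    next
      case False
      then have "\<rho> (y0 + a *\<^sub>R b) < 0" using iff[OF y] a by auto
      from order_tendstoD(2)[OF lim this] U show ?thesis
        by eventually_elim (use iff False in auto)
    qed
  }
  fix a assume a: "height b y0 < a"
  \<comment> \<open>an intermediate point at which \<open>\<rho>\<close> is already nonnegative\<close>
  define a' where "a' = (height b y0 + a) / 2"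
  have a': "height b y0 < a'" "a' < a" "a' > 0" using a height_pos[OF b y] by (auto simp: a'_def)
  have "\<not> \<rho> (y0 + a' *\<^sub>R b) < 0" using iff[OF y] a' by auto
  then have "\<rho> (y0 + a *\<^sub>R b) > 0"
    using rho_mono[OF b, of y0 a' a] a' y by (auto simp: base_def)
  from order_tendstoD(1)[OF lim this] U show "\<forall>\<^sub>F y in at y0 within base b. height b y < a"
  proof eventually_elim
    case (elim y)
    have y: "y \<bullet> b = 0" using elim by (auto simp: base_def)
    have "height b y \<noteq> a" "\<not> a < height b y"
      using elim iff[of y a] a' height_root[OF b, of y] by auto
    then show ?case by simp
  qed
qed

lemma height_continuous: "b \<in> Basis \<Longrightarrow> continuous_on (base b) (height b)"
  unfolding continuous_on_def by (auto intro: height_tendsto)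

lemma signed_height_derivative:
  assumes b: "b \<in> Basis" and y: "y \<in> base b" and s: "\<bar>s\<bar> = 1"
  defines "x \<equiv> y + (s * height b y) *\<^sub>R b"
  shows "((\<lambda>y. s * height b y) has_derivative (\<lambda>v. - (G x \<bullet> v) / (G x \<bullet> b))) (at y within base b)"
  unfolding x_def
proof (rule implicit_function_derivative[where F = \<rho> and b = b])
  show "(\<rho> has_derivative (\<bullet>) (G (y + (s * height b y) *\<^sub>R b))) (at (y + (s * height b y) *\<^sub>R b))"
    by (rule deriv)
qed (use b y s grad_nz[OF b y s] in \<open>auto intro!: height_signed_root tendsto_intros height_tendsto\<close>)

definition height_gradient :: "real \<Rightarrow> 'a \<Rightarrow> 'a \<Rightarrow> 'a" where
  "height_gradient s b y = (let x = y + (s * height b y) *\<^sub>R b in - ((1 / (G x \<bullet> b)) *\<^sub>R (G x - (G x \<bullet> b) *\<^sub>R b)))"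

text \<open>Each half \<open>s * (x \<bullet> b) > 0\<close> of the surface is one single patch. These finitely many patches cover the
surface, so they determine a hypersurface measure.\<close>

lemma height_patch:
  assumes b: "b \<in> Basis" and s: "s \<in> {1, -1}"
  shows "C1_graph_patch {x. \<rho> x = 0} b (base b) (\<lambda>y. s * height b y) (height_gradient s b)"
    and "(\<lambda>y. y + (s * height b y) *\<^sub>R b) ` base b = {x. \<rho> x = 0 \<and> s * (x \<bullet> b) > 0}"
proof -
  have s1: "\<bar>s\<bar> = 1" using s by auto
  show im: "(\<lambda>y. y + (s * height b y) *\<^sub>R b) ` base b = {x. \<rho> x = 0 \<and> s * (x \<bullet> b) > 0}"
  proof (intro equalityI subsetI)
    fix x assume "x \<in> (\<lambda>y. y + (s * height b y) *\<^sub>R b) ` base b"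
    then obtain y where y: "y \<in> base b" "x = y + (s * height b y) *\<^sub>R b" by auto
    have "x \<bullet> b = s * height b y" using y b by (auto simp: base_def inner_simps)
    then have "s * (x \<bullet> b) = height b y" using s by auto
    then show "x \<in> {x. \<rho> x = 0 \<and> s * (x \<bullet> b) > 0}"
      using y height_signed_root[OF b y(1) s1] height_pos[OF b y(1)] by simp
  next
    fix x assume x: "x \<in> {x. \<rho> x = 0 \<and> s * (x \<bullet> b) > 0}"
    define y where "y = x - (x \<bullet> b) *\<^sub>R b"
    have xy: "x = y + (x \<bullet> b) *\<^sub>R b" by (simp add: y_def)
    have yb: "y \<bullet> b = 0" using b by (simp add: y_def inner_simps)
    have nz: "x \<bullet> b \<noteq> 0" using x by auto
    have h: "y \<in> base b" "\<bar>x \<bullet> b\<bar> = height b y"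
      using rho_zero_iff[OF b yb nz] xy x by auto
    then have "s * height b y = x \<bullet> b" using x s by (auto simp: abs_if split: if_splits)
    then show "x \<in> (\<lambda>y. y + (s * height b y) *\<^sub>R b) ` base b"
      using xy h(1) by (intro image_eqI[of _ _ y]) auto
  qed
  have cx: "continuous_on (base b) (\<lambda>y. y + (s * height b y) *\<^sub>R b)"
    by (intro continuous_intros height_continuous b)
  have cG: "continuous_on (base b) (\<lambda>y. G (y + (s * height b y) *\<^sub>R b))"
    by (rule continuous_on_compose2[OF grad_cont cx]) auto
  show "C1_graph_patch {x. \<rho> x = 0} b (base b) (\<lambda>y. s * height b y) (height_gradient s b)"
    unfolding C1_graph_patch_def im
  proof (intro conjI ballI b)
    have "open {x. \<rho> x < 0}"
      using open_Collect_less[OF rho_cont continuous_on_const] by simp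
    moreover have "base b = {y. y \<bullet> b = 0} \<inter> {x. \<rho> x < 0}" by (auto simp: base_def)
    ultimately show "openin (top_of_set {y. y \<bullet> b = 0}) (base b)" by (auto simp: openin_open)
    have "open {x. s * (x \<bullet> b) > 0}" by (intro open_Collect_less continuous_intros)
    moreover have "{x. \<rho> x = 0 \<and> s * (x \<bullet> b) > 0} = {x. \<rho> x = 0} \<inter> {x. s * (x \<bullet> b) > 0}" by auto
    ultimately show "openin (top_of_set {x. \<rho> x = 0}) {x. \<rho> x = 0 \<and> s * (x \<bullet> b) > 0}"
      by (auto simp: openin_open)
    have nz: "G (y + (s * height b y) *\<^sub>R b) \<bullet> b \<noteq> 0" if "y \<in> base b" for y
      using grad_nz[OF b that s1] by auto
    show "continuous_on (base b) (height_gradient s b)"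
      unfolding height_gradient_def Let_def using nz by (intro continuous_intros cG) auto
    fix y assume y: "y \<in> base b"
    show "height_gradient s b y \<bullet> b = 0"
      using b by (simp add: height_gradient_def Let_def inner_simps)
    define x where "x = y + (s * height b y) *\<^sub>R b"
    have nzx: "G x \<bullet> b \<noteq> 0" using nz[OF y] by (simp add: x_def)
    have "((\<lambda>y. s * height b y + y \<bullet> b) has_derivative (\<lambda>v. - (G x \<bullet> v) / (G x \<bullet> b) + v \<bullet> b)) (at y within base b)"
      unfolding x_def by (intro derivative_intros signed_height_derivative b y s1)
    then have "((\<lambda>y. s * height b y) has_derivative (\<lambda>v. - (G x \<bullet> v) / (G x \<bullet> b) + v \<bullet> b)) (at y within base b)"
      by (rule has_derivative_transform[rotated 2]) (use y in \<open>auto simp: base_def\<close>)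
    also have "(\<lambda>v. - (G x \<bullet> v) / (G x \<bullet> b) + v \<bullet> b) = (\<lambda>v. height_gradient s b y \<bullet> v)"
      using nzx by (auto simp: height_gradient_def Let_def x_def[symmetric] inner_simps fun_eq_iff field_simps inner_commute)
    finally show "((\<lambda>y. s * height b y) has_derivative (\<lambda>v. height_gradient s b y \<bullet> v)) (at y within base b)" .
  qed
qed

text \<open>Every point of an arbitrary patch lies on one of the two standard graphs in its direction. Differentiating \<open>\<rho> (y + h y *\<^sub>R b) = 0\<close>
in a direction \<open>v\<close> of the hyperplane gives \<open>G x \<bullet> v + (g y \<bullet> v) * (G x \<bullet> b) = 0\<close>. If \<open>G x \<bullet> b\<close> were zero, the
choice \<open>v = G x\<close> would give \<open>G x = 0\<close>, which does not happen on the surface; so \<open>b\<close> is transverse, \<open>g y\<close> is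
forced, and Pythagoras turns its norm into the stated area factor. Finally \<open>h y\<close> is nonzero, since
\<open>G x \<bullet> b\<close> vanishes on the hyperplane itself.\<close>

lemma patch_geometry:
  assumes P: "C1_graph_patch {x. \<rho> x = 0} b U h g" and y: "y \<in> U"
  defines "x \<equiv> y + h y *\<^sub>R b"
  shows "b \<in> Basis" "y \<in> base b" "\<bar>h y\<bar> = height b y" "sqrt (1 + (norm (g y))\<^sup>2) = norm (G x) / \<bar>G x \<bullet> b\<bar>"
proof -
  show b: "b \<in> Basis" using P by (auto simp: C1_graph_patch_def)
  have nb: "b \<bullet> b = 1" "norm b = 1" using b by auto
  have sub: "openin (top_of_set {y. y \<bullet> b = 0}) U" using P by (auto simp: C1_graph_patch_def)
  then have yb: "y \<bullet> b = 0" and Ub: "\<And>y. y \<in> U \<Longrightarrow> y \<bullet> b = 0" using y openin_subset by fastforce+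
  have im: "(\<lambda>y. y + h y *\<^sub>R b) ` U \<subseteq> {x. \<rho> x = 0}"
  proof -
    have "openin (top_of_set {x. \<rho> x = 0}) ((\<lambda>y. y + h y *\<^sub>R b) ` U)" using P by (simp add: C1_graph_patch_def)
    from openin_imp_subset[OF this] show ?thesis .
  qed
  then have x0: "\<rho> x = 0" using y by (auto simp: x_def)
  have gb: "g y \<bullet> b = 0" and hd: "(h has_derivative (\<lambda>v. g y \<bullet> v)) (at y within U)"
    using P y by (auto simp: C1_graph_patch_def)
  \<comment> \<open>the patch lies in the zero set of \<open>\<rho>\<close>, so \<open>\<rho>\<close> has derivative zero along it\<close>
  have key: "G x \<bullet> v + (g y \<bullet> v) * (G x \<bullet> b) = 0" if v: "v \<bullet> b = 0" for v
  proof -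
    obtain T where T: "open T" "U = {y. y \<bullet> b = 0} \<inter> T" using sub by (auto simp: openin_open)
    define S where "S = (\<lambda>t. y + t *\<^sub>R v) -` T"
    have S: "open S" unfolding S_def by (intro open_vimage T continuous_intros)
    have S0: "0 \<in> S" using y T by (auto simp: S_def)
    have SU: "y + t *\<^sub>R v \<in> U" if "t \<in> S" for t using that T yb v by (auto simp: S_def inner_simps)
    have "((\<lambda>t. h (y + t *\<^sub>R v)) has_derivative (\<lambda>t. g (y + 0 *\<^sub>R v) \<bullet> (t *\<^sub>R v))) (at 0 within S)"
    proof (rule has_derivative_in_compose2[where f="\<lambda>t. y + t *\<^sub>R v" and t=U and g=h and g'="\<lambda>z v. g z \<bullet> v"])
      show "(h has_derivative (\<bullet>) (g x)) (at x within U)" if "x \<in> U" for x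
        using P that by (auto simp: C1_graph_patch_def)
    qed (use SU S0 in \<open>auto intro!: derivative_eq_intros\<close>)
    then have hd': "((\<lambda>t. h (y + t *\<^sub>R v)) has_derivative (\<lambda>t. g y \<bullet> (t *\<^sub>R v))) (at 0)"
      using at_within_open[OF S0 S] by simp
    have "((\<lambda>t. \<rho> (y + t *\<^sub>R v + h (y + t *\<^sub>R v) *\<^sub>R b)) has_derivative
            (\<lambda>t. G x \<bullet> (t *\<^sub>R v + (g y \<bullet> (t *\<^sub>R v)) *\<^sub>R b))) (at 0)"
      by (rule has_derivative_compose[where g=\<rho> and f="\<lambda>t. y + t *\<^sub>R v + h (y + t *\<^sub>R v) *\<^sub>R b"])
        (auto intro!: derivative_eq_intros hd' deriv[of x, unfolded x_def] simp: x_def)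
    moreover have "((\<lambda>t. \<rho> (y + t *\<^sub>R v + h (y + t *\<^sub>R v) *\<^sub>R b)) has_derivative (\<lambda>t. 0)) (at 0)"
      by (rule has_derivative_transform_within_open[OF _ S S0, of "\<lambda>_. 0"])
        (use im SU in \<open>auto simp: image_subset_iff\<close>)
    ultimately have "(\<lambda>t. G x \<bullet> (t *\<^sub>R v + (g y \<bullet> (t *\<^sub>R v)) *\<^sub>R b)) = (\<lambda>t. 0)"
      by (rule has_derivative_unique)
    from fun_cong[OF this, of 1] show ?thesis by (simp add: inner_simps)
  qed
  have xnz: "x \<noteq> 0" using x0 origin by auto
  obtain c where c: "c \<in> Basis" "x \<bullet> c \<noteq> 0" using xnz by (metis euclidean_all_zero_iff)
  then have Gnz: "G x \<noteq> 0" using grad_sign[OF c] by auto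
  have Gb: "G x \<bullet> b \<noteq> 0"
  proof
    assume 0: "G x \<bullet> b = 0"
    have "G x \<bullet> G x = 0" using key[of "G x"] 0 by simp
    then show False using Gnz by simp
  qed
  have xb: "x \<bullet> b = h y" using yb nb by (simp add: x_def inner_simps)
  define w where "w = G x - (G x \<bullet> b) *\<^sub>R b"
  have wb: "w \<bullet> b = 0" using nb by (simp add: w_def inner_simps)
  have gy: "g y = - ((1 / (G x \<bullet> b)) *\<^sub>R w)"
  proof -
    define d where "d = (G x \<bullet> b) *\<^sub>R g y + w"
    have db: "d \<bullet> b = 0" using gb wb by (simp add: d_def inner_simps)
    have "G x \<bullet> d = w \<bullet> d" using db by (simp add: w_def inner_simps inner_commute)
    then have "d \<bullet> d = 0" using key[OF db] by (simp add: d_def inner_simps algebra_simps)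
    then have "d = 0" by simp
    then have "(1 / (G x \<bullet> b)) *\<^sub>R ((G x \<bullet> b) *\<^sub>R g y + w) = 0" unfolding d_def by simp
    then show ?thesis using Gb by (simp add: scaleR_add_right add_eq_0_iff2)
  qed
  have nw: "(norm w)\<^sup>2 = (norm (G x))\<^sup>2 - (G x \<bullet> b)\<^sup>2"
    unfolding power2_norm_eq_inner w_def using nb by (simp add: inner_simps power2_eq_square algebra_simps inner_commute)
  have "1 + (norm (g y))\<^sup>2 = (norm (G x))\<^sup>2 / (G x \<bullet> b)\<^sup>2"
    unfolding gy using Gb by (simp add: power_divide power_mult_distrib nw field_simps)
  then show "sqrt (1 + (norm (g y))\<^sup>2) = norm (G x) / \<bar>G x \<bullet> b\<bar>"
    by (simp add: real_sqrt_divide)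
  have hnz: "h y \<noteq> 0"
  proof
    assume h0: "h y = 0"
    \<comment> \<open>the sign condition forces \<open>G \<bullet> b\<close> to vanish on the hyperplane, by continuity from both sides\<close>
    have cont: "((\<lambda>t. G (x + t *\<^sub>R b) \<bullet> b) \<longlongrightarrow> G (x + 0 *\<^sub>R b) \<bullet> b) F" if "filterlim (\<lambda>t. t) (nhds 0) F" for F
    proof -
      have "continuous_on UNIV (\<lambda>t. G (x + t *\<^sub>R b) \<bullet> b)"
        by (intro continuous_intros continuous_on_compose2[OF grad_cont]) auto
      then have "isCont (\<lambda>t. G (x + t *\<^sub>R b) \<bullet> b) 0" by (simp add: continuous_on_eq_continuous_at)
      then show ?thesis using that isCont_tendsto_compose by blast
    qed
    have sg: "t * (G (x + t *\<^sub>R b) \<bullet> b) > 0" if "t \<noteq> 0" for t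
      using grad_sign[OF b, of "x + t *\<^sub>R b"] xb h0 nb that by (simp add: inner_simps)
    have pos: "0 \<le> G (x + t *\<^sub>R b) \<bullet> b" if "t > 0" for t using sg[of t] that by (simp add: zero_less_mult_iff)
    have neg: "G (x + t *\<^sub>R b) \<bullet> b \<le> 0" if "t < 0" for t using sg[of t] that by (simp add: zero_less_mult_iff)
    have "0 \<le> G (x + 0 *\<^sub>R b) \<bullet> b"
      by (rule tendsto_lowerbound[OF cont[of "at_right 0"]])
        (auto simp: tendsto_ident_at eventually_at_right_field intro!: pos exI[of _ 1])
    moreover have "G (x + 0 *\<^sub>R b) \<bullet> b \<le> 0"
      by (rule tendsto_upperbound[OF cont[of "at_left 0"]])
        (auto simp: tendsto_ident_at eventually_at_left_field intro!: neg exI[of _ "-1"])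
    ultimately show False using Gb by simp
  qed
  show "y \<in> base b" "\<bar>h y\<bar> = height b y"
    using rho_zero_iff[OF b yb hnz] x0 by (auto simp: x_def)
qed

end

section \<open>The Leray integral in different directions\<close>

lemma nn_integral_hyperplane:
  fixes b :: "'a::euclidean_space"
  assumes [measurable]: "f \<in> borel_measurable borel"
  shows "(\<integral>\<^sup>+y. f y \<partial>hyperplane_lborel b)
       = (\<integral>\<^sup>+a. f (\<Sum>i\<in>Basis - {b}. a i *\<^sub>R i) \<partial>(\<Pi>\<^sub>M i\<in>Basis - {b}. lborel))"
  unfolding hyperplane_lborel_def by (subst nn_integral_distr) auto

lemma nn_integral_hyperplane_split:
  fixes b c :: "'a::euclidean_space"
  assumes [measurable]: "f \<in> borel_measurable borel" and c: "c \<in> Basis" "c \<noteq> b"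
  shows "(\<integral>\<^sup>+y. f y \<partial>hyperplane_lborel b)
       = (\<integral>\<^sup>+a. \<integral>\<^sup>+t. f ((\<Sum>i\<in>Basis - {b, c}. a i *\<^sub>R i) + t *\<^sub>R c) \<partial>lborel \<partial>(\<Pi>\<^sub>M i\<in>Basis - {b, c}. lborel))"
proof -
  interpret product_sigma_finite "\<lambda>_::'a. lborel :: real measure" by standard
  have eq: "Basis - {b} = insert c (Basis - {b, c})" using c by auto
  have "(\<integral>\<^sup>+y. f y \<partial>hyperplane_lborel b)
      = (\<integral>\<^sup>+a. f (\<Sum>i\<in>insert c (Basis - {b, c}). a i *\<^sub>R i) \<partial>(\<Pi>\<^sub>M i\<in>insert c (Basis - {b, c}). lborel))"
    by (subst nn_integral_hyperplane) (simp_all flip: eq)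
  also have "\<dots> = (\<integral>\<^sup>+a. \<integral>\<^sup>+t. f (\<Sum>i\<in>insert c (Basis - {b, c}). (a(c := t)) i *\<^sub>R i) \<partial>lborel \<partial>(\<Pi>\<^sub>M i\<in>Basis - {b, c}. lborel))"
    by (rule product_nn_integral_insert) auto
  also have "\<dots> = (\<integral>\<^sup>+a. \<integral>\<^sup>+t. f ((\<Sum>i\<in>Basis - {b, c}. a i *\<^sub>R i) + t *\<^sub>R c) \<partial>lborel \<partial>(\<Pi>\<^sub>M i\<in>Basis - {b, c}. lborel))"
  proof (intro nn_integral_cong arg_cong[where f=f])
    fix a :: "'a \<Rightarrow> real" and t
    have "(\<Sum>i\<in>Basis - {b, c}. (a(c := t)) i *\<^sub>R i) = (\<Sum>i\<in>Basis - {b, c}. a i *\<^sub>R i)"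
      by (intro sum.cong) auto
    then show "(\<Sum>i\<in>insert c (Basis - {b, c}). (a(c := t)) i *\<^sub>R i) = (\<Sum>i\<in>Basis - {b, c}. a i *\<^sub>R i) + t *\<^sub>R c"
      by (subst sum.insert) auto
  qed
  finally show ?thesis .
qed

lemma sum_Basis_inner_zero:
  fixes b :: "'a::euclidean_space"
  assumes "b \<in> Basis" "b \<notin> I" "I \<subseteq> Basis"
  shows "(\<Sum>i\<in>I. a i *\<^sub>R i) \<bullet> b = 0"
  unfolding inner_sum_left
proof (intro sum.neutral ballI)
  fix i assume "i \<in> I"
  then have "i \<in> Basis" "i \<noteq> b" using assms by auto
  then show "(a i *\<^sub>R i) \<bullet> b = 0" using assms(1) by (simp add: inner_Basis)
qed

context unconditional_hypersurface
begin

definition lift :: "real \<Rightarrow> 'a \<Rightarrow> 'a \<Rightarrow> 'a" where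
  "lift s b y = y + (s * height b y) *\<^sub>R b"

definition leray_integrand :: "'a \<Rightarrow> ('a \<Rightarrow> ennreal) \<Rightarrow> 'a \<Rightarrow> ennreal" where
  "leray_integrand b F y =
     indicator (base b) y * (\<Sum>s\<in>{1,-1}. F (lift s b y) * ennreal (1 / \<bar>G (lift s b y) \<bullet> b\<bar>))"

text \<open>Dividing the area element by the length of the gradient gives the Gelfand-Leray form of \<open>\<rho>\<close>. Seen from
direction \<open>b\<close> it is \<open>dy / \<bar>G \<bullet> b\<bar>\<close> on each of the two sheets, with no square root left. Its integrals are what
can be compared between different directions.\<close>

definition leray :: "'a \<Rightarrow> ('a \<Rightarrow> ennreal) \<Rightarrow> ennreal" where
  "leray b F = (\<integral>\<^sup>+y. leray_integrand b F y \<partial>hyperplane_lborel b)"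

lemma base_borel [measurable]: "base b \<in> sets borel"
proof -
  have "open {x. \<rho> x < 0}" using open_Collect_less[OF rho_cont continuous_on_const] by simp
  moreover have "closed {y. y \<bullet> b = 0}" by (intro closed_Collect_eq continuous_intros)
  moreover have "base b = {y. y \<bullet> b = 0} \<inter> {x. \<rho> x < 0}" by (auto simp: base_def)
  ultimately show ?thesis by auto
qed

lemma height_borel [measurable]: "b \<in> Basis \<Longrightarrow> height b \<in> borel_measurable borel"
proof -
  assume b: "b \<in> Basis"
  have "height b = (\<lambda>y. if y \<in> base b then height b y else 0)" by (auto simp: height_def fun_eq_iff)
  also have "\<dots> \<in> borel_measurable borel"
    by (rule borel_measurable_continuous_on_if[OF base_borel height_continuous[OF b]]) auto
  finally show ?thesis .
qed

lemma rho_borel [measurable]: "\<rho> \<in> borel_measurable borel"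
  and G_borel [measurable]: "G \<in> borel_measurable borel"
  using rho_cont grad_cont by (auto intro: borel_measurable_continuous_onI)

lemma lift_borel [measurable]: "b \<in> Basis \<Longrightarrow> lift s b \<in> borel_measurable borel"
proof -
  assume b: "b \<in> Basis"
  note [measurable] = height_borel[OF b]
  show ?thesis unfolding lift_def[abs_def] by measurable
qed

lemma leray_integrand_borel [measurable]:
  assumes b: "b \<in> Basis" and [measurable]: "F \<in> borel_measurable borel"
  shows "leray_integrand b F \<in> borel_measurable borel"
proof -
  note [measurable] = lift_borel[OF b]
  show ?thesis unfolding leray_integrand_def[abs_def] by measurable
qed

text \<open>In the two-plane through \<open>y\<close> spanned by \<open>b\<close> and \<open>c\<close>, the quarter of the surface with signs \<open>s\<close> and \<open>s'\<close> is an arc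
that is a graph over each of the two axes. The transition \<open>\<phi>\<close> from the \<open>c\<close>-coordinate to the
\<open>b\<close>-coordinate has \<open>\<bar>\<phi>'\<bar> = \<bar>G \<bullet> c\<bar> / \<bar>G \<bullet> b\<bar>\<close> by implicit differentiation, and this is exactly the quotient of
the two Leray densities.\<close>

lemma leray_arc_exchange:
  assumes b: "b \<in> Basis" and c: "c \<in> Basis" "b \<noteq> c" and y: "y \<bullet> b = 0" "y \<bullet> c = 0" "\<rho> y < 0"
    and s: "s \<in> {1, -1}" and s': "s' \<in> {1, -1}" and F [measurable]: "F \<in> borel_measurable borel"
  shows "(\<integral>\<^sup>+t. indicator {0<..<height c y} t *
              (F (lift s b (y + (s' * t) *\<^sub>R c)) * ennreal (1 / \<bar>G (lift s b (y + (s' * t) *\<^sub>R c)) \<bullet> b\<bar>)) \<partial>lborel)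
       = (\<integral>\<^sup>+t. indicator {0<..<height b y} t *
              (F (lift s' c (y + (s * t) *\<^sub>R b)) * ennreal (1 / \<bar>G (lift s' c (y + (s * t) *\<^sub>R b)) \<bullet> c\<bar>)) \<partial>lborel)"
proof -
  have bc: "b \<bullet> c = 0" "c \<bullet> b = 0" "b \<bullet> b = 1" "c \<bullet> c = 1" using b c by (auto simp: inner_Basis)
  have s1: "\<bar>s\<bar> = 1" "\<bar>s'\<bar> = 1" "s * s = 1" "s' * s' = 1" "s \<noteq> 0" "s' \<noteq> 0" using s s' by auto
  define T where "T = height c y"
  define T' where "T' = height b y"
  have T'0: "0 \<le> T'" using height_pos[OF b, of y] y by (simp add: T'_def base_def)
  define \<phi> where "\<phi> t = height b (y + (s' * t) *\<^sub>R c)" for t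
  define \<psi> where "\<psi> t = height c (y + (s * t) *\<^sub>R b)" for t
  define x where "x t = lift s b (y + (s' * t) *\<^sub>R c)" for t
  have inb: "y + (s' * t) *\<^sub>R c \<in> base b" if "t \<in> {0<..<T}" for t
    using rho_neg_iff[OF c(1) y(2), of "s' * t"] that y s1 bc by (auto simp: base_def T_def abs_mult inner_simps)
  have inc: "y + (s * t) *\<^sub>R b \<in> base c" if "t \<in> {0<..<T'}" for t
    using rho_neg_iff[OF b y(1), of "s * t"] that y s1 bc by (auto simp: base_def T'_def abs_mult inner_simps)
  have \<phi>: "\<phi> t \<in> {0<..<T'}" "\<psi> (\<phi> t) = t" "lift s' c (y + (s * \<phi> t) *\<^sub>R b) = x t" if t: "t \<in> {0<..<T}" for t
  proof -
    have p: "\<phi> t > 0" unfolding \<phi>_def by (rule height_pos[OF b inb[OF t]])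
    have "\<rho> ((y + (s' * t) *\<^sub>R c) + (s * \<phi> t) *\<^sub>R b) = 0"
      unfolding \<phi>_def by (rule height_signed_root[OF b inb[OF t] s1(1)])
    then have "\<rho> ((y + (s * \<phi> t) *\<^sub>R b) + (s' * t) *\<^sub>R c) = 0" by (simp add: ac_simps)
    then have r: "y + (s * \<phi> t) *\<^sub>R b \<in> base c \<and> \<bar>s' * t\<bar> = \<psi> (\<phi> t)"
      unfolding \<psi>_def using t s1 y bc by (subst (asm) rho_zero_iff[OF c(1)]) (auto simp: inner_simps)
    then show e: "\<psi> (\<phi> t) = t" using t s1 by (auto simp: abs_mult)
    show "\<phi> t \<in> {0<..<T'}"
      using r rho_neg_iff[OF b y(1), of "s * \<phi> t"] p s1 by (auto simp: base_def T'_def abs_mult)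
    show "lift s' c (y + (s * \<phi> t) *\<^sub>R b) = x t"
      using e by (simp add: lift_def x_def \<psi>_def[symmetric]) (simp add: \<phi>_def)
  qed
  have \<psi>: "\<psi> t \<in> {0<..<T}" "\<phi> (\<psi> t) = t" if t: "t \<in> {0<..<T'}" for t
  proof -
    have p: "\<psi> t > 0" unfolding \<psi>_def by (rule height_pos[OF c(1) inc[OF t]])
    have "\<rho> ((y + (s * t) *\<^sub>R b) + (s' * \<psi> t) *\<^sub>R c) = 0"
      unfolding \<psi>_def by (rule height_signed_root[OF c(1) inc[OF t] s1(2)])
    then have "\<rho> ((y + (s' * \<psi> t) *\<^sub>R c) + (s * t) *\<^sub>R b) = 0" by (simp add: ac_simps)
    then have r: "y + (s' * \<psi> t) *\<^sub>R c \<in> base b \<and> \<bar>s * t\<bar> = \<phi> (\<psi> t)"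
      unfolding \<phi>_def using t s1 y bc by (subst (asm) rho_zero_iff[OF b]) (auto simp: inner_simps)
    then show "\<phi> (\<psi> t) = t" using t s1 by (auto simp: abs_mult)
    show "\<psi> t \<in> {0<..<T}"
      using r rho_neg_iff[OF c(1) y(2), of "s' * \<psi> t"] p s1 by (auto simp: base_def T_def abs_mult)
  qed
  have bij: "bij_betw \<phi> {0<..<T} {0<..<T'}"
    by (rule bij_betw_byWitness[where f'=\<psi>]) (use \<phi> \<psi> in auto)
  \<comment> \<open>the derivative of the implicit function along the line in direction \<open>c\<close>\<close>
  define \<phi>' where "\<phi>' t = - (s * s') * (G (x t) \<bullet> c) / (G (x t) \<bullet> b)" for t
  have der: "(\<phi> has_real_derivative \<phi>' t) (at t)" if t: "t \<in> {0<..<T}" for t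
  proof -
    have "((\<lambda>t. s * height b (y + (s' * t) *\<^sub>R c)) has_derivative
            (\<lambda>h. - (G (x t) \<bullet> ((s' * h) *\<^sub>R c)) / (G (x t) \<bullet> b))) (at t within {0<..<T})"
      unfolding x_def lift_def
    proof (rule has_derivative_in_compose2[where f="\<lambda>t. y + (s' * t) *\<^sub>R c" and t="base b" and g="\<lambda>y. s * height b y"
            and g'="\<lambda>y v. - (G (y + (s * height b y) *\<^sub>R b) \<bullet> v) / (G (y + (s * height b y) *\<^sub>R b) \<bullet> b)"])
      fix z assume "z \<in> base b"
      then show "((\<lambda>y. s * height b y) has_derivative (\<lambda>v. - (G (z + (s * height b z) *\<^sub>R b) \<bullet> v) /
          (G (z + (s * height b z) *\<^sub>R b) \<bullet> b))) (at z within base b)"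
        by (rule signed_height_derivative[OF b _ s1(1)])
    qed (use inb t in \<open>auto intro!: derivative_eq_intros\<close>)
    then have "((\<lambda>t. s * (s * height b (y + (s' * t) *\<^sub>R c))) has_derivative
            (\<lambda>h. s * (- (G (x t) \<bullet> ((s' * h) *\<^sub>R c)) / (G (x t) \<bullet> b)))) (at t within {0<..<T})"
      by (rule has_derivative_mult_right)
    also have "(\<lambda>t. s * (s * height b (y + (s' * t) *\<^sub>R c))) = \<phi>"
      using s1 by (simp add: \<phi>_def fun_eq_iff flip: mult.assoc)
    also have "(\<lambda>h. s * (- (G (x t) \<bullet> ((s' * h) *\<^sub>R c)) / (G (x t) \<bullet> b))) = (*) (\<phi>' t)"
      by (simp add: fun_eq_iff \<phi>'_def)
    finally show ?thesis
      using at_within_open[OF t] by (simp add: has_field_derivative_def)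
  qed
  have nzb: "G (x t) \<bullet> b \<noteq> 0" if t: "t \<in> {0<..<T}" for t
    using grad_nz[OF b inb[OF t] s1(1)] by (auto simp: x_def lift_def)
  have nzc: "G (x t) \<bullet> c \<noteq> 0" if t: "t \<in> {0<..<T}" for t
    using grad_nz[OF c(1) inc[OF \<phi>(1)[OF t]] s1(2)] \<phi>(3)[OF t] by (auto simp: lift_def)
  have m': "(\<lambda>t. indicator {0<..<T} t * \<phi>' t) \<in> borel_measurable borel"
  proof -
    have [measurable]: "(\<lambda>t. lift s b (y + (s' * t) *\<^sub>R c)) \<in> borel_measurable borel"
      using lift_borel[OF b] by measurable
    show ?thesis unfolding \<phi>'_def x_def by measurable
  qed
  define f where "f t = F (lift s' c (y + (s * t) *\<^sub>R b)) * ennreal (1 / \<bar>G (lift s' c (y + (s * t) *\<^sub>R b)) \<bullet> c\<bar>)" for t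
  have mf: "f \<in> borel_measurable borel"
  proof -
    have [measurable]: "(\<lambda>t. lift s' c (y + (s * t) *\<^sub>R b)) \<in> borel_measurable borel"
      using lift_borel[OF c(1)] by measurable
    show ?thesis unfolding f_def by measurable
  qed
  have "(\<integral>\<^sup>+t. indicator {0<..<T'} t * f t \<partial>lborel) = (\<integral>\<^sup>+t. indicator {0<..<T} t * (f (\<phi> t) * ennreal \<bar>\<phi>' t\<bar>) \<partial>lborel)"
    by (rule nn_integral_substitution_deriv[OF mf _ bij _ _ der m']) (simp_all add: T'0)
  also have "\<dots> = (\<integral>\<^sup>+t. indicator {0<..<T} t * (F (x t) * ennreal (1 / \<bar>G (x t) \<bullet> b\<bar>)) \<partial>lborel)"
  proof (intro nn_integral_cong)
    fix t
    show "indicator {0<..<T} t * (f (\<phi> t) * ennreal \<bar>\<phi>' t\<bar>) = indicator {0<..<T} t * (F (x t) * ennreal (1 / \<bar>G (x t) \<bullet> b\<bar>))"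
    proof (cases "t \<in> {0<..<T}")
      case True
      have "1 / \<bar>G (x t) \<bullet> c\<bar> * \<bar>\<phi>' t\<bar> = 1 / \<bar>G (x t) \<bullet> b\<bar>"
        using nzb[OF True] nzc[OF True] s1 by (simp add: \<phi>'_def abs_mult)
      then have "ennreal (1 / \<bar>G (x t) \<bullet> c\<bar>) * ennreal \<bar>\<phi>' t\<bar> = ennreal (1 / \<bar>G (x t) \<bullet> b\<bar>)"
        by (simp flip: ennreal_mult)
      then show ?thesis using \<phi>(3)[OF True] by (simp add: f_def mult.assoc)
    qed auto
  qed
  finally show ?thesis by (simp add: f_def x_def T_def T'_def)
qed

lemma leray_line:
  assumes b: "b \<in> Basis" and c: "c \<in> Basis" "b \<noteq> c" and y: "y \<bullet> b = 0" "y \<bullet> c = 0" "\<rho> y < 0"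
    and F [measurable]: "F \<in> borel_measurable borel"
  shows "(\<integral>\<^sup>+t. leray_integrand b F (y + t *\<^sub>R c) \<partial>lborel) = (\<Sum>s\<in>{1,-1}. \<Sum>s'\<in>{1,-1}. \<integral>\<^sup>+t. indicator {0<..<height c y} t *
              (F (lift s b (y + (s' * t) *\<^sub>R c)) * ennreal (1 / \<bar>G (lift s b (y + (s' * t) *\<^sub>R c)) \<bullet> b\<bar>)) \<partial>lborel)"
proof -
  have bc: "b \<bullet> c = 0" "c \<bullet> b = 0" using b c by (auto simp: inner_Basis)
  have iff: "y + t *\<^sub>R c \<in> base b \<longleftrightarrow> \<bar>t\<bar> < height c y" for t
    using rho_neg_iff[OF c(1) y(2), of t] y bc by (auto simp: base_def inner_simps)
  note [measurable] = lift_borel[OF b] leray_integrand_borel[OF b F]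
  have [measurable]: "(\<lambda>t. lift s b (y + (s' * t) *\<^sub>R c)) \<in> borel_measurable borel" for s s' by measurable
  have "(\<integral>\<^sup>+t. leray_integrand b F (y + t *\<^sub>R c) \<partial>lborel)
     = (\<integral>\<^sup>+t. indicator {0<..} t * leray_integrand b F (y + (1 * t) *\<^sub>R c) \<partial>lborel)
     + (\<integral>\<^sup>+t. indicator {0<..} t * leray_integrand b F (y + (- 1 * t) *\<^sub>R c) \<partial>lborel)"
    by (subst nn_integral_fold_positive) auto
  also have "\<dots> = (\<Sum>s'\<in>{1,-1}. \<integral>\<^sup>+t. indicator {0<..} t * leray_integrand b F (y + (s' * t) *\<^sub>R c) \<partial>lborel)"
    by simp
  also have "\<dots> = (\<Sum>s'\<in>{1,-1}. \<Sum>s\<in>{1,-1}. \<integral>\<^sup>+t. indicator {0<..<height c y} t *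
              (F (lift s b (y + (s' * t) *\<^sub>R c)) * ennreal (1 / \<bar>G (lift s b (y + (s' * t) *\<^sub>R c)) \<bullet> b\<bar>)) \<partial>lborel)"
  proof (rule sum.cong[OF refl])
    fix s' :: real assume s': "s' \<in> {1,-1}"
    have "(\<integral>\<^sup>+t. indicator {0<..} t * leray_integrand b F (y + (s' * t) *\<^sub>R c) \<partial>lborel)
      = (\<integral>\<^sup>+t. (\<Sum>s\<in>{1,-1}. indicator {0<..<height c y} t *
              (F (lift s b (y + (s' * t) *\<^sub>R c)) * ennreal (1 / \<bar>G (lift s b (y + (s' * t) *\<^sub>R c)) \<bullet> b\<bar>))) \<partial>lborel)"
    proof (intro nn_integral_cong)
      fix t
      have "indicator {0<..} t * indicator (base b) (y + (s' * t) *\<^sub>R c) = (indicator {0<..<height c y} t :: ennreal)"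
        unfolding indicator_def iff using s' by (auto simp: abs_mult)
      then show "indicator {0<..} t * leray_integrand b F (y + (s' * t) *\<^sub>R c) = (\<Sum>s\<in>{1,-1}. indicator {0<..<height c y} t *
              (F (lift s b (y + (s' * t) *\<^sub>R c)) * ennreal (1 / \<bar>G (lift s b (y + (s' * t) *\<^sub>R c)) \<bullet> b\<bar>)))"
        unfolding leray_integrand_def sum_distrib_left[symmetric] by (simp only: mult.assoc[symmetric])
    qed
    also have "\<dots> = (\<Sum>s\<in>{1,-1}. \<integral>\<^sup>+t. indicator {0<..<height c y} t *
              (F (lift s b (y + (s' * t) *\<^sub>R c)) * ennreal (1 / \<bar>G (lift s b (y + (s' * t) *\<^sub>R c)) \<bullet> b\<bar>)) \<partial>lborel)"
      by (rule nn_integral_sum) measurable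
    finally show "(\<integral>\<^sup>+t. indicator {0<..} t * leray_integrand b F (y + (s' * t) *\<^sub>R c) \<partial>lborel) = \<dots>" .
  qed
  also have "\<dots> = (\<Sum>s\<in>{1,-1}. \<Sum>s'\<in>{1,-1}. \<integral>\<^sup>+t. indicator {0<..<height c y} t *
              (F (lift s b (y + (s' * t) *\<^sub>R c)) * ennreal (1 / \<bar>G (lift s b (y + (s' * t) *\<^sub>R c)) \<bullet> b\<bar>)) \<partial>lborel)"
    by (rule sum.swap)
  finally show ?thesis .
qed

text \<open>Both hyperplanes fibre over the subspace orthogonal to \<open>b\<close> and \<open>c\<close>. On each fibre the surface is the union
of four arcs (up to the axes), on which the exchange lemma applies.\<close>

lemma leray_independent:
  assumes b: "b \<in> Basis" and c: "c \<in> Basis" and F [measurable]: "F \<in> borel_measurable borel"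
  shows "leray b F = leray c F"
proof (cases "b = c")
  case False
  have eq: "Basis - {c, b} = Basis - {b, c}" by auto
  have "leray b F = (\<integral>\<^sup>+a. \<integral>\<^sup>+t. leray_integrand b F ((\<Sum>i\<in>Basis - {b, c}. a i *\<^sub>R i) + t *\<^sub>R c) \<partial>lborel \<partial>(\<Pi>\<^sub>M i\<in>Basis - {b, c}. lborel))"
    unfolding leray_def by (rule nn_integral_hyperplane_split) (use False b c in auto)
  also have "\<dots> = (\<integral>\<^sup>+a. \<integral>\<^sup>+t. leray_integrand c F ((\<Sum>i\<in>Basis - {b, c}. a i *\<^sub>R i) + t *\<^sub>R b) \<partial>lborel \<partial>(\<Pi>\<^sub>M i\<in>Basis - {b, c}. lborel))"
  proof (rule nn_integral_cong)
    fix a :: "'a \<Rightarrow> real"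
    define y where "y = (\<Sum>i\<in>Basis - {b, c}. a i *\<^sub>R i)"
    have y: "y \<bullet> b = 0" "y \<bullet> c = 0" unfolding y_def using b c by (auto intro!: sum_Basis_inner_zero)
    have "(\<integral>\<^sup>+t. leray_integrand b F (y + t *\<^sub>R c) \<partial>lborel) = (\<integral>\<^sup>+t. leray_integrand c F (y + t *\<^sub>R b) \<partial>lborel)"
    proof (cases "\<rho> y < 0")
      case True
      have "(\<integral>\<^sup>+t. leray_integrand b F (y + t *\<^sub>R c) \<partial>lborel) = (\<Sum>s\<in>{1,-1}. \<Sum>s'\<in>{1,-1}. \<integral>\<^sup>+t. indicator {0<..<height b y} t *
              (F (lift s' c (y + (s * t) *\<^sub>R b)) * ennreal (1 / \<bar>G (lift s' c (y + (s * t) *\<^sub>R b)) \<bullet> c\<bar>)) \<partial>lborel)"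
        unfolding leray_line[OF b c False y True F]
        by (intro sum.cong refl leray_arc_exchange b c False y True F) auto
      also have "\<dots> = (\<integral>\<^sup>+t. leray_integrand c F (y + t *\<^sub>R b) \<partial>lborel)"
        unfolding leray_line[OF c b False[symmetric] y(2,1) True F] by (rule sum.swap)
      finally show ?thesis .
    next
      case F: False
      have "y + t *\<^sub>R c \<notin> base b" "y + t *\<^sub>R b \<notin> base c" for t
        using rho_neg_iff[OF c y(2), of t] rho_neg_iff[OF b y(1), of t] F by (auto simp: base_def)
      then show ?thesis by (simp add: leray_integrand_def)
    qed
    then show "(\<integral>\<^sup>+t. leray_integrand b F ((\<Sum>i\<in>Basis - {b, c}. a i *\<^sub>R i) + t *\<^sub>R c) \<partial>lborel)
        = (\<integral>\<^sup>+t. leray_integrand c F ((\<Sum>i\<in>Basis - {b, c}. a i *\<^sub>R i) + t *\<^sub>R b) \<partial>lborel)"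
      unfolding y_def .
  qed
  also have "\<dots> = leray c F"
    unfolding leray_def by (subst nn_integral_hyperplane_split[where b=c and c=b]) (use False b c in \<open>auto simp: eq\<close>)
  finally show ?thesis .
qed simp

end

section \<open>Existence and uniqueness of the hypersurface measure\<close>

text \<open>Used to compare two hypersurface measures: each is prescribed on sets contained in a single patch, so a
general set is cut along finitely many patches.\<close>

lemma measure_eqI_finite_cover:
  assumes I: "finite I" and sets: "sets M = sets N" and P: "\<And>i. i \<in> I \<Longrightarrow> P i \<in> sets M"
    and cover: "space M \<subseteq> (\<Union>i\<in>I. P i)"
    and eq: "\<And>i B. i \<in> I \<Longrightarrow> B \<in> sets M \<Longrightarrow> B \<subseteq> P i \<Longrightarrow> emeasure M B = emeasure N B"
  shows "M = N"
proof (rule measure_eqI[OF sets])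
  have "J \<subseteq> I \<Longrightarrow> \<forall>B\<in>sets M. B \<subseteq> (\<Union>i\<in>J. P i) \<longrightarrow> emeasure M B = emeasure N B" if "finite J" for J
    using that
  proof (induction J)
    case (insert i J)
    show ?case
    proof (intro ballI impI)
      fix B assume B: "B \<in> sets M" "B \<subseteq> (\<Union>j\<in>insert i J. P j)"
      have Pi: "P i \<in> sets M" using P insert by auto
      have "emeasure M B = emeasure M (B \<inter> P i) + emeasure M (B - P i)"
        using B Pi by (subst plus_emeasure) (auto intro: arg_cong[where f="emeasure M"])
      also have "emeasure M (B \<inter> P i) = emeasure N (B \<inter> P i)" using eq[of i "B \<inter> P i"] B Pi insert by auto
      also have "emeasure M (B - P i) = emeasure N (B - P i)"
      proof -
        have "B - P i \<in> sets M" "B - P i \<subseteq> (\<Union>j\<in>J. P j)" using B Pi by auto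
        then show ?thesis using insert.IH insert.prems by blast
      qed
      also have "emeasure N (B \<inter> P i) + emeasure N (B - P i) = emeasure N B"
        using B Pi sets by (subst plus_emeasure) (auto intro: arg_cong[where f="emeasure N"])
      finally show "emeasure M B = emeasure N B" .
    qed
  qed auto
  from this[OF I] show "emeasure M A = emeasure N A" if "A \<in> sets M" for A
    using that cover sets.sets_into_space[OF that] by auto
qed

context unconditional_hypersurface
begin

text \<open>The counting measure on the two signs carries the two sheets over the base. The final restriction only
moves the measure to the \<open>\<sigma>\<close>-algebra of the surface.\<close>

definition graph_measure :: "'a \<Rightarrow> 'a measure" where
  "graph_measure b = restrict_space
     (distr (density (hyperplane_lborel b \<Otimes>\<^sub>M count_space {1, -1})
               (\<lambda>(y, s). indicator (base b) y * (ennreal (norm (G (lift s b y))) * ennreal (1 / \<bar>G (lift s b y) \<bullet> b\<bar>))))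
        borel (\<lambda>(y, s). lift s b y)) {x. \<rho> x = 0}"

lemma sets_hyperplane_lborel [measurable_cong]: "sets (hyperplane_lborel b) = sets borel"
  by (simp add: hyperplane_lborel_def)

lemma surface_borel: "{x. \<rho> x = 0} \<in> sets borel"
proof -
  have "closed {x. \<rho> x = 0}" by (intro closed_Collect_eq rho_cont continuous_intros)
  then show ?thesis by simp
qed

lemma sets_graph_measure: "sets (graph_measure b) = sets (restrict_space borel {x. \<rho> x = 0})"
  unfolding graph_measure_def by (intro sets_restrict_space_cong) simp

lemma lift_on_surface: "b \<in> Basis \<Longrightarrow> y \<in> base b \<Longrightarrow> s \<in> {1,-1} \<Longrightarrow> \<rho> (lift s b y) = 0"
  unfolding lift_def by (rule height_signed_root) auto

lemma nn_integral_graph_measure: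
  assumes b: "b \<in> Basis" and F [measurable]: "F \<in> borel_measurable borel"
  shows "(\<integral>\<^sup>+x. F x \<partial>graph_measure b) = leray b (\<lambda>x. ennreal (norm (G x)) * F x)"
proof -
  interpret C: sigma_finite_measure "count_space {1, - 1 :: real}"
    by (rule sigma_finite_measure_count_space_finite) simp
  note [measurable] = height_borel[OF b]
  have S [measurable]: "{x. \<rho> x = 0} \<in> sets borel" by (rule surface_borel)
  have [measurable]: "(\<lambda>(y, s). s) \<in> borel_measurable (hyperplane_lborel b \<Otimes>\<^sub>M count_space {1, - 1 :: real})"
    unfolding case_prod_unfold by (rule measurable_compose[OF measurable_snd]) simp
  have L [measurable]: "(\<lambda>(y, s). lift s b y) \<in> borel_measurable (hyperplane_lborel b \<Otimes>\<^sub>M count_space {1, - 1 :: real})"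
    unfolding lift_def case_prod_unfold
    by (intro borel_measurable_add borel_measurable_scaleR borel_measurable_times borel_measurable_const
        measurable_compose[OF measurable_fst] measurable_compose[OF measurable_snd]) (simp_all add: height_borel[OF b] measurable_cong_sets[OF sets_hyperplane_lborel refl])
  have L' [measurable]: "(\<lambda>p. lift (snd p) b (fst p)) \<in> borel_measurable (hyperplane_lborel b \<Otimes>\<^sub>M count_space {1, - 1 :: real})"
    using L by (simp add: case_prod_unfold)
  have D [measurable]: "(\<lambda>(y, s). indicator (base b) y * (ennreal (norm (G (lift s b y))) * ennreal (1 / \<bar>G (lift s b y) \<bullet> b\<bar>)))
     \<in> borel_measurable (hyperplane_lborel b \<Otimes>\<^sub>M count_space {1, - 1 :: real})"
    unfolding case_prod_unfold by measurable
  define N where "N = hyperplane_lborel b \<Otimes>\<^sub>M count_space {1, - 1 :: real}"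
  define D where "D = (\<lambda>(y, s). indicator (base b) y * (ennreal (norm (G (lift s b y))) * ennreal (1 / \<bar>G (lift s b y) \<bullet> b\<bar>)))"
  define K where "K = (\<lambda>p. F (case p of (y, s) \<Rightarrow> lift s b y) * indicator {x. \<rho> x = 0} (case p of (y, s) \<Rightarrow> lift s b y))"
  have LN: "(\<lambda>(y, s). lift s b y) \<in> borel_measurable N" unfolding N_def by (rule L)
  have DN: "D \<in> borel_measurable N" unfolding N_def D_def by (rule D)
  have FS: "(\<lambda>x. F x * indicator {x. \<rho> x = 0} x) \<in> borel_measurable borel" by measurable
  have KN: "K \<in> borel_measurable N" unfolding K_def by (rule measurable_compose[OF LN FS])
  have "(\<integral>\<^sup>+x. F x \<partial>graph_measure b)
      = (\<integral>\<^sup>+x. F x * indicator {x. \<rho> x = 0} x \<partial>distr (density N D) borel (\<lambda>(y, s). lift s b y))"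
    unfolding graph_measure_def N_def D_def by (rule nn_integral_restrict_space) (simp add: S)
  also have "\<dots> = (\<integral>\<^sup>+p. K p \<partial>density N D)"
    unfolding K_def by (rule nn_integral_distr) (use LN FS in simp_all)
  also have "\<dots> = (\<integral>\<^sup>+p. D p * K p \<partial>N)" by (rule nn_integral_density[OF DN KN])
  also have "\<dots> = (\<integral>\<^sup>+y. \<integral>\<^sup>+s. D (y, s) * K (y, s) \<partial>count_space {1, - 1} \<partial>hyperplane_lborel b)"
    unfolding N_def
    by (rule C.nn_integral_fst[symmetric]) (use DN KN in \<open>auto simp: N_def\<close>)
  also have "\<dots> = (\<integral>\<^sup>+y. leray_integrand b (\<lambda>x. ennreal (norm (G x)) * F x) y \<partial>hyperplane_lborel b)"
  proof (rule nn_integral_cong)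
    fix y
    have "(\<integral>\<^sup>+s. D (y, s) * K (y, s) \<partial>count_space {1, - 1}) = (\<Sum>s\<in>{1,-1}. D (y, s) * K (y, s))"
      by (rule nn_integral_count_space_finite) simp
    also have "\<dots> = (\<Sum>s\<in>{1,-1}. indicator (base b) y *
        (ennreal (norm (G (lift s b y))) * F (lift s b y) * ennreal (1 / \<bar>G (lift s b y) \<bullet> b\<bar>)))"
    proof (rule sum.cong[OF refl])
      fix s :: real assume s: "s \<in> {1,-1}"
      show "D (y, s) * K (y, s) = indicator (base b) y *
          (ennreal (norm (G (lift s b y))) * F (lift s b y) * ennreal (1 / \<bar>G (lift s b y) \<bullet> b\<bar>))"
        using lift_on_surface[OF b _ s, of y]
        by (cases "y \<in> base b") (simp_all add: D_def K_def mult_ac)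
    qed
    finally show "(\<integral>\<^sup>+s. D (y, s) * K (y, s) \<partial>count_space {1, - 1}) = leray_integrand b (\<lambda>x. ennreal (norm (G x)) * F x) y"
      by (simp only: leray_integrand_def sum_distrib_left)
  qed
  finally show ?thesis unfolding leray_def .
qed

text \<open>Over each \<open>y\<close> at most one of the two sheets meets \<open>B\<close>, because \<open>B\<close> lies in the graph of the single
function \<open>h\<close>; there the area factor is \<open>norm (G x) / \<bar>G x \<bullet> b\<bar>\<close>.\<close>

lemma patch_integrand:
  assumes P: "C1_graph_patch {x. \<rho> x = 0} b U h g" and B: "B \<subseteq> (\<lambda>y. y + h y *\<^sub>R b) ` U" and y: "y \<bullet> b = 0"
  shows "leray_integrand b (\<lambda>x. ennreal (norm (G x)) * indicator B x) y
       = indicator U y * indicator B (y + h y *\<^sub>R b) * ennreal (sqrt (1 + (norm (g y))\<^sup>2))"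
proof -
  have b: "b \<in> Basis" using P by (auto simp: C1_graph_patch_def)
  then have nb: "b \<bullet> b = 1" by simp
  have U0: "u \<bullet> b = 0" if "u \<in> U" for u
    using patch_geometry(2)[OF P that] by (auto simp: base_def)
  have lift_mem: "y \<in> U \<and> h y = s * height b y" if lB: "lift s b y \<in> B" for s
  proof -
    obtain u where u: "u \<in> U" "y + (s * height b y) *\<^sub>R b = u + h u *\<^sub>R b"
      using lB B by (auto simp: lift_def)
    have "s * height b y = h u"
      using arg_cong[OF u(2), of "\<lambda>v. v \<bullet> b"] y U0[OF u(1)] nb by (simp add: inner_simps)
    then show ?thesis using u by auto
  qed
  show ?thesis
  proof (cases "y \<in> U \<and> y + h y *\<^sub>R b \<in> B")
    case True
    then have yU: "y \<in> U" and xB: "y + h y *\<^sub>R b \<in> B" by auto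
    note geo = patch_geometry[OF P yU]
    have hp: "height b y > 0" by (rule height_pos[OF b geo(2)])
    define s0 where "s0 = sgn (h y)"
    have s0: "s0 \<in> {1,-1}" "s0 * height b y = h y" using geo(3) hp by (auto simp: s0_def sgn_if)
    have l0: "lift s0 b y = y + h y *\<^sub>R b" using s0 by (simp add: lift_def)
    have l1: "lift (- s0) b y \<notin> B"
      using lift_mem[of "- s0"] s0 hp by auto
    have "(\<Sum>s\<in>{1,-1}. ennreal (norm (G (lift s b y))) * indicator B (lift s b y) * ennreal (1 / \<bar>G (lift s b y) \<bullet> b\<bar>))
        = (\<Sum>s\<in>{s0,-s0}. ennreal (norm (G (lift s b y))) * indicator B (lift s b y) * ennreal (1 / \<bar>G (lift s b y) \<bullet> b\<bar>))"
      using s0(1) by (intro sum.cong) auto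
    also have "\<dots> = ennreal (norm (G (lift s0 b y))) * ennreal (1 / \<bar>G (lift s0 b y) \<bullet> b\<bar>)"
    proof -
      have "s0 \<noteq> - s0" using s0 by auto
      then show ?thesis using l0 l1 xB by simp
    qed
    also have "\<dots> = ennreal (norm (G (lift s0 b y)) / \<bar>G (lift s0 b y) \<bullet> b\<bar>)"
      by (simp flip: ennreal_mult)
    finally show ?thesis using yU xB geo(2,4) l0 by (simp add: leray_integrand_def)
  next
    case False
    have "lift s b y \<notin> B" if "y \<in> base b" for s
      using lift_mem[of s] False by (auto simp: lift_def)
    then have "leray_integrand b (\<lambda>x. ennreal (norm (G x)) * indicator B x) y = 0"
      by (cases "y \<in> base b") (auto simp: leray_integrand_def)
    then show ?thesis using False by (auto simp: indicator_def)
  qed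
qed

lemma AE_hyperplane: "b \<in> Basis \<Longrightarrow> AE y in hyperplane_lborel b. y \<bullet> b = 0"
  unfolding hyperplane_lborel_def
  by (subst AE_distr_iff) (auto intro!: sum_Basis_inner_zero AE_I2)

lemma emeasure_graph_measure_patch:
  assumes b0: "b0 \<in> Basis" and P: "C1_graph_patch {x. \<rho> x = 0} b U h g"
    and B: "B \<in> sets (graph_measure b0)" "B \<subseteq> (\<lambda>y. y + h y *\<^sub>R b) ` U"
  shows "emeasure (graph_measure b0) B =
    (\<integral>\<^sup>+y. indicator U y * indicator B (y + h y *\<^sub>R b) * ennreal (sqrt (1 + (norm (g y))\<^sup>2)) \<partial>hyperplane_lborel b)"
proof -
  have b: "b \<in> Basis" using P by (auto simp: C1_graph_patch_def)
  have [measurable]: "B \<in> sets borel"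
    using B(1) surface_borel by (auto simp: sets_graph_measure sets_restrict_space_iff)
  have "emeasure (graph_measure b0) B = (\<integral>\<^sup>+x. indicator B x \<partial>graph_measure b0)"
    by (rule nn_integral_indicator[OF B(1), symmetric])
  also have "\<dots> = leray b0 (\<lambda>x. ennreal (norm (G x)) * indicator B x)"
    by (rule nn_integral_graph_measure[OF b0]) simp
  also have "\<dots> = leray b (\<lambda>x. ennreal (norm (G x)) * indicator B x)"
    by (rule leray_independent[OF b0 b]) measurable
  also have "\<dots> = (\<integral>\<^sup>+y. indicator U y * indicator B (y + h y *\<^sub>R b) * ennreal (sqrt (1 + (norm (g y))\<^sup>2)) \<partial>hyperplane_lborel b)"
    unfolding leray_def
    by (rule nn_integral_cong_AE, rule eventually_mono[OF AE_hyperplane[OF b]]) (rule patch_integrand[OF P B(2)])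
  finally show ?thesis .
qed

text \<open>The measure is built from one direction \<open>b0\<close>, while patches may point in any direction \<open>b\<close>. Independence of
the Leray integral of its direction moves one to the other.\<close>

lemma graph_measure_is_hypersurface_measure:
  assumes b0: "b0 \<in> Basis"
  shows "is_hypersurface_measure {x. \<rho> x = 0} (graph_measure b0)"
  unfolding is_hypersurface_measure_def
proof (rule conjI[OF sets_graph_measure], rule allI, rule allI, rule allI, rule allI, rule impI, rule ballI, rule impI)
  fix b U h g B
  assume "C1_graph_patch {x. \<rho> x = 0} b U h g" "B \<in> sets (graph_measure b0)" "B \<subseteq> (\<lambda>y. y + h y *\<^sub>R b) ` U"
  then show "emeasure (graph_measure b0) B =
    (\<integral>\<^sup>+y. indicator U y * indicator B (y + h y *\<^sub>R b) * ennreal (sqrt (1 + (norm (g y))\<^sup>2)) \<partial>hyperplane_lborel b)"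
    by (rule emeasure_graph_measure_patch[OF b0])
qed

definition half :: "'a \<times> real \<Rightarrow> 'a set" where
  "half p = {x. \<rho> x = 0 \<and> 0 < snd p * (x \<bullet> fst p)}"

lemma surface_subset_halves: "{x. \<rho> x = 0} \<subseteq> (\<Union>p\<in>Basis \<times> {1, -1}. half p)"
proof
  fix x assume "x \<in> {x. \<rho> x = 0}"
  then have x: "\<rho> x = 0" by simp
  then have "x \<noteq> 0" using origin by auto
  then obtain b where b: "b \<in> Basis" "x \<bullet> b \<noteq> 0" by (metis euclidean_all_zero_iff)
  then have "(b, sgn (x \<bullet> b)) \<in> Basis \<times> {1, -1}" by (auto simp: sgn_if)
  moreover have "x \<in> half (b, sgn (x \<bullet> b))" using b x by (auto simp: half_def sgn_if)
  ultimately show "x \<in> (\<Union>p\<in>Basis \<times> {1, -1}. half p)" by blast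
qed

lemma half_sets: "half p \<in> sets (restrict_space borel {x. \<rho> x = 0})"
proof -
  have "open {x. 0 < snd p * (x \<bullet> fst p)}" by (intro open_Collect_less continuous_intros)
  moreover have "half p = {x. \<rho> x = 0} \<inter> {x. 0 < snd p * (x \<bullet> fst p)}" by (auto simp: half_def)
  ultimately show ?thesis unfolding sets_restrict_space by (intro image_eqI) auto
qed

lemma hypersurface_measure_on_half:
  assumes \<tau>: "is_hypersurface_measure {x. \<rho> x = 0} \<tau>" and p: "p \<in> Basis \<times> {1, -1}"
    and B: "B \<in> sets \<tau>" "B \<subseteq> half p"
  shows "emeasure \<tau> B = (\<integral>\<^sup>+y. indicator (base (fst p)) y * indicator B (y + (snd p * height (fst p) y) *\<^sub>R fst p) *
          ennreal (sqrt (1 + (norm (height_gradient (snd p) (fst p) y))\<^sup>2)) \<partial>hyperplane_lborel (fst p))"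
proof -
  have b: "fst p \<in> Basis" and s: "snd p \<in> {1,-1}" using p by auto
  note patch = height_patch[OF b s]
  have B': "B \<subseteq> (\<lambda>y. y + (snd p * height (fst p) y) *\<^sub>R fst p) ` base (fst p)"
    using B(2) unfolding patch(2) half_def .
  show ?thesis
    using \<tau>[unfolded is_hypersurface_measure_def, THEN conjunct2, rule_format, OF patch(1) B(1) B'] .
qed

text \<open>Every point of the surface has a nonzero coordinate, as the origin is not on it; hence the halves cover.\<close>

lemma hypersurface_measure_unique:
  assumes \<sigma>: "is_hypersurface_measure {x. \<rho> x = 0} \<sigma>" and \<tau>: "is_hypersurface_measure {x. \<rho> x = 0} \<tau>"
  shows "\<sigma> = \<tau>"
proof (rule measure_eqI_finite_cover)
  have sets\<sigma>: "sets \<sigma> = sets (restrict_space borel {x. \<rho> x = 0})"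
    using \<sigma>[unfolded is_hypersurface_measure_def, THEN conjunct1] .
  have sets\<tau>: "sets \<tau> = sets (restrict_space borel {x. \<rho> x = 0})"
    using \<tau>[unfolded is_hypersurface_measure_def, THEN conjunct1] .
  show eq: "sets \<sigma> = sets \<tau>" by (rule trans[OF sets\<sigma> sets\<tau>[symmetric]])
  show "finite (Basis \<times> {1, -1::real} :: ('a \<times> real) set)" by (intro finite_cartesian_product finite_Basis) simp
  have "space \<sigma> = space (restrict_space borel {x. \<rho> x = 0})" by (rule sets_eq_imp_space_eq[OF sets\<sigma>])
  also have "\<dots> = {x. \<rho> x = 0}" by (simp only: space_restrict_space space_borel Int_UNIV_right)
  finally show "space \<sigma> \<subseteq> (\<Union>p\<in>Basis \<times> {1, -1}. half p)" using surface_subset_halves by (rule ord_eq_le_trans)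
  show "half p \<in> sets \<sigma>" for p unfolding sets\<sigma> by (rule half_sets)
  show "emeasure \<sigma> B = emeasure \<tau> B" if p: "p \<in> Basis \<times> {1, -1}" and B: "B \<in> sets \<sigma>" "B \<subseteq> half p" for p B
    using hypersurface_measure_on_half[OF \<sigma> p B] hypersurface_measure_on_half[OF \<tau> p B(1)[unfolded eq] B(2)]
    by (rule trans[OF _ sym])
qed

lemma hypersurface_measure_eq:
  assumes b0: "b0 \<in> Basis"
  shows "hypersurface_measure {x. \<rho> x = 0} = graph_measure b0"
  unfolding hypersurface_measure_def
proof (rule the_equality[where P = "is_hypersurface_measure {x. \<rho> x = 0}" and a = "graph_measure b0"])
  show *: "is_hypersurface_measure {x. \<rho> x = 0} (graph_measure b0)"
    by (rule graph_measure_is_hypersurface_measure[OF b0])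
  fix \<sigma> assume "is_hypersurface_measure {x. \<rho> x = 0} \<sigma>"
  then show "\<sigma> = graph_measure b0" by (rule hypersurface_measure_unique[OF _ *])
qed

end

section \<open>The bordered Hessian of the egg\<close>

lemma det_only_identity:
  fixes A :: "'a::comm_ring_1 ^ 'n::finite ^ 'n"
  assumes "\<And>p. p permutes UNIV \<Longrightarrow> p \<noteq> id \<Longrightarrow> \<exists>i. A $ i $ p i = 0"
  shows "det A = (\<Prod>i\<in>UNIV. A $ i $ i)"
proof -
  have "det A = (\<Sum>p\<in>{id}. of_int (sign p) * (\<Prod>i\<in>UNIV. A $ i $ p i))"
    unfolding det_def
  proof (rule sum.mono_neutral_right)
    show "\<forall>p\<in>{p. p permutes UNIV} - {id}. of_int (sign p) * (\<Prod>i\<in>UNIV. A $ i $ p i) = 0"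
    proof
      fix p assume "p \<in> {p. p permutes (UNIV :: 'n set)} - {id}"
      then obtain i where "A $ i $ p i = 0" using assms by auto
      then have "(\<Prod>i\<in>UNIV. A $ i $ p i) = 0" by (intro prod_zero) auto
      then show "of_int (sign p) * (\<Prod>i\<in>UNIV. A $ i $ p i) = 0" by simp
    qed
  qed (auto simp: finite_permutations permutes_id)
  then show ?thesis by (simp add: sign_id)
qed

text \<open>Adding multiples of the other rows to the border row clears it except for its first entry, which becomes
the Schur complement. Afterwards every permutation other than the identity meets a zero.\<close>

lemma det_arrow_matrix:
  fixes a c d :: "'n::finite \<Rightarrow> complex"
  assumes d: "\<And>l. d l \<noteq> 0"
  defines "A \<equiv> (\<chi> i j. case i of None \<Rightarrow> (case j of None \<Rightarrow> 0 | Some l \<Rightarrow> a l)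
     | Some k \<Rightarrow> (case j of None \<Rightarrow> c k | Some l \<Rightarrow> (if k = l then d k else 0))) :: complex ^ 'n option ^ 'n option"
  shows "det A = - (\<Sum>l\<in>UNIV. a l * c l / d l) * (\<Prod>l\<in>UNIV. d l)"
proof -
  define x where "x = (\<Sum>l\<in>UNIV. (- a l / d l) *s row (Some l) A)"
  have x: "x \<in> vec.span {row j A |j. j \<noteq> None}"
    unfolding x_def by (intro vec.span_sum vec.span_scale vec.span_base) auto
  define B where "B = (\<chi> k. if k = None then row None A + x else row k A)"
  have "det A = det B" unfolding B_def by (rule det_row_span[OF x, symmetric])
  also have "\<dots> = (\<Prod>i\<in>UNIV. B $ i $ i)"
  proof (rule det_only_identity)
    fix p :: "'n option \<Rightarrow> 'n option" assume p: "p permutes UNIV" "p \<noteq> id"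
    have x_Some: "x $ Some l = - a l" for l
    proof -
      have "x $ Some l = (\<Sum>k\<in>UNIV. (- a k / d k) * (if k = l then d k else 0))"
        unfolding x_def by (simp add: row_def A_def)
      also have "\<dots> = (\<Sum>k\<in>{l}. (- a k / d k) * (if k = l then d k else 0))"
        by (rule sum.mono_neutral_right) auto
      finally show ?thesis using d[of l] by simp
    qed
    show "\<exists>i. B $ i $ p i = 0"
    proof (cases "p None")
      case (Some l)
      then have "B $ None $ p None = 0" by (simp add: B_def row_def A_def x_Some)
      then show ?thesis by blast
    next
      case None
      obtain i where i: "p i \<noteq> i" using p(2) by (auto simp: fun_eq_iff)
      with None obtain k where k: "i = Some k" by (cases i) auto
      have "p i \<noteq> None" using None k permutes_inj[OF p(1)] by (metis injD option.distinct(1))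
      then obtain l where "p i = Some l" by auto
      then have "B $ i $ p i = 0" using i k by (simp add: B_def row_def A_def)
      then show ?thesis by blast
    qed
  qed
  also have "\<dots> = B $ None $ None * (\<Prod>l\<in>UNIV. B $ Some l $ Some l)"
    by (simp add: UNIV_option_conv prod.reindex)
  also have "(\<Prod>l\<in>UNIV. B $ Some l $ Some l) = (\<Prod>l\<in>UNIV. d l)"
    by (simp add: B_def row_def A_def)
  also have "B $ None $ None = - (\<Sum>l\<in>UNIV. a l * c l / d l)"
    by (simp add: B_def row_def A_def x_def sum_negf)
  finally show ?thesis .
qed

definition egg_grad :: "nat \<Rightarrow> (complex ^ 'k::finite) \<times> complex \<Rightarrow> (complex ^ 'k) \<times> complex" where
  "egg_grad m p = (2 *\<^sub>R fst p, (2 * real m * (snd p \<bullet> snd p) ^ (m - 1)) *\<^sub>R snd p)"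

lemma egg_rho_inner: "egg_rho m p = fst p \<bullet> fst p + (snd p \<bullet> snd p) ^ m - 1"
  by (simp add: egg_rho_def power_mult power2_norm_eq_inner)

lemma egg_rho_derivative: "(egg_rho m has_derivative (\<lambda>v. egg_grad m p \<bullet> v)) (at p)"
  unfolding egg_rho_inner[abs_def] egg_grad_def
  by (auto intro!: derivative_eq_intros simp: fun_eq_iff inner_prod_def inner_commute algebra_simps)

lemma frechet_derivative_egg_rho:
  "frechet_derivative (\<lambda>x. of_real (egg_rho m x) :: complex) (at p) v = of_real (egg_grad m p \<bullet> v)"
proof -
  have "((\<lambda>x. of_real (egg_rho m x) :: complex) has_derivative (\<lambda>v. of_real (egg_grad m p \<bullet> v))) (at p)"
    by (intro derivative_intros egg_rho_derivative)
  then show ?thesis by (metis frechet_derivative_at)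
qed

text \<open>The antiholomorphic first derivatives of \<open>egg_rho\<close>.\<close>

definition egg_dbar :: "nat \<Rightarrow> 'k option \<Rightarrow> (complex ^ 'k::finite) \<times> complex \<Rightarrow> complex" where
  "egg_dbar m l p = (case l of Some j \<Rightarrow> fst p $ j | None \<Rightarrow> of_real (real m * (snd p \<bullet> snd p) ^ (m - 1)) * snd p)"

lemma inner_axis_complex: "(z :: complex ^ 'k::finite) \<bullet> axis j c = z $ j \<bullet> c"
  by (simp add: inner_axis)

lemma wirtinger_bar_egg_rho: "wirtinger_bar l (\<lambda>x. of_real (egg_rho m x)) p = egg_dbar m l p"
  by (cases l) (simp_all add: wirtinger_bar_def frechet_derivative_egg_rho egg_grad_def egg_dbar_def coord_dir_def
      inner_prod_def inner_axis_complex inner_complex_def complex_eq_iff)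

lemma wirtinger_egg_rho: "wirtinger l (\<lambda>x. of_real (egg_rho m x)) p = cnj (egg_dbar m l p)"
  by (cases l) (simp_all add: wirtinger_def frechet_derivative_egg_rho egg_grad_def egg_dbar_def coord_dir_def
      inner_prod_def inner_axis_complex inner_complex_def complex_eq_iff)

text \<open>The Levi matrix of \<open>\<bar>z\<bar>\<^sup>2 + \<bar>w\<bar>\<^sup>2\<^sup>m\<close> is diagonal, with entries 1 and \<open>m\<^sup>2 \<bar>w\<bar>\<^sup>2\<^sup>m\<^sup>-\<^sup>2\<close>. For the last one, the two
real partial derivatives combine through \<open>(2 Re w - 2 \<i> Im w) w = 2 \<bar>w\<bar>\<^sup>2\<close>.\<close>

lemma wirtinger_egg_dbar:
  fixes p :: "(complex ^ 'k::finite) \<times> complex"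
  assumes m: "m \<ge> 1"
  shows "wirtinger j (egg_dbar m l) p =
    (if j = l then (case l of Some _ \<Rightarrow> 1 | None \<Rightarrow> of_real ((real m)\<^sup>2 * (snd p \<bullet> snd p) ^ (m - 1))) else 0)"
proof (cases l)
  case (Some i)
  have "((\<lambda>p. fst p $ i) has_derivative (\<lambda>v. fst v $ i)) (at p)"
    by (intro bounded_linear_imp_has_derivative bounded_linear_compose[OF bounded_linear_vec_nth bounded_linear_fst])
  then have "frechet_derivative (egg_dbar m l) (at p) = (\<lambda>v. fst v $ i)"
    unfolding Some egg_dbar_def[abs_def] by (simp add: frechet_derivative_at[symmetric])
  then show ?thesis
    by (cases j) (auto simp: wirtinger_def coord_dir_def Some axis_def)
next
  case None
  have "((\<lambda>p::(complex ^ 'k) \<times> complex. of_real (real m * (snd p \<bullet> snd p) ^ (m - 1)) * snd p) has_derivative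
     (\<lambda>v. of_real (real m * (snd p \<bullet> snd p) ^ (m - 1)) * snd v
        + of_real (real m * (real (m - 1) * (2 * (snd p \<bullet> snd v)) * (snd p \<bullet> snd p) ^ (m - 1 - 1))) * snd p)) (at p)"
    by (auto intro!: derivative_eq_intros simp: fun_eq_iff inner_commute algebra_simps)
  then have fd: "frechet_derivative (egg_dbar m l) (at p) = (\<lambda>v. of_real (real m * (snd p \<bullet> snd p) ^ (m - 1)) * snd v
        + of_real (real m * (real (m - 1) * (2 * (snd p \<bullet> snd v)) * (snd p \<bullet> snd p) ^ (m - 1 - 1))) * snd p)"
    unfolding None egg_dbar_def[abs_def] by (simp add: frechet_derivative_at[symmetric])
  show ?thesis
  proof (cases j)
    case (Some i)
    then show ?thesis by (simp add: wirtinger_def fd[unfolded None] coord_dir_def None)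
  next
    case j: None
    let ?w = "snd p" and ?q = "snd p \<bullet> snd p"
    have w: "(of_real (2 * Re ?w) - \<i> * of_real (2 * Im ?w)) * ?w = of_real (2 * ?q)"
      by (simp add: complex_eq_iff inner_complex_def power2_eq_square algebra_simps)
    have q: "real (m - 1) * (?q ^ (m - 1 - 1) * ?q) = real (m - 1) * ?q ^ (m - 1)"
    proof (cases "m = 1")
      case False
      then have "m - 1 = Suc (m - 1 - 1)" using m by simp
      then show ?thesis by (metis power_Suc2)
    qed simp
    have "2 * wirtinger j (egg_dbar m l) p = 2 * of_real (real m * ?q ^ (m - 1))
       + of_real (real m * (real (m - 1) * ?q ^ (m - 1 - 1))) * ((of_real (2 * Re ?w) - \<i> * of_real (2 * Im ?w)) * ?w)"
    proof -
      let ?A = "complex_of_real (real m * ?q ^ (m - 1))" and ?c = "real m * (real (m - 1) * ?q ^ (m - 1 - 1))"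
      have "frechet_derivative (egg_dbar m l) (at p) (0, 1) = ?A + of_real (?c * (2 * Re ?w)) * ?w"
        unfolding fd by (simp add: mult_ac)
      moreover have "frechet_derivative (egg_dbar m l) (at p) (0, \<i>) = ?A * \<i> + of_real (?c * (2 * Im ?w)) * ?w"
        unfolding fd by (simp add: mult_ac)
      moreover have "(A + of_real (c * r) * w) - \<i> * (A * \<i> + of_real (c * s) * w)
          = 2 * A + of_real c * ((of_real r - \<i> * of_real s) * w)" for A w :: complex and c r s :: real
        by (simp add: algebra_simps)
      ultimately show ?thesis by (simp only: wirtinger_def j coord_dir_def option.case) simp
    qed
    also have "\<dots> = of_real (2 * (real m * ?q ^ (m - 1)) + real m * 2 * (real (m - 1) * (?q ^ (m - 1 - 1) * ?q)))"
      unfolding w by (simp add: algebra_simps)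
    also have "\<dots> = of_real (2 * ((real m)\<^sup>2 * ?q ^ (m - 1)))"
      unfolding q using m by (intro arg_cong[where f=of_real]) (simp add: of_nat_diff algebra_simps power2_eq_square)
    finally have "wirtinger j (egg_dbar m l) p = of_real ((real m)\<^sup>2 * ?q ^ (m - 1))" by simp
    then show ?thesis by (simp add: None j)
  qed
qed

lemma bordered_hessian_egg:
  fixes p :: "(complex ^ 'k::finite) \<times> complex"
  assumes m: "m \<ge> 1"
  shows "bordered_hessian (egg_rho m) p = (\<chi> i j. case i of None \<Rightarrow> (case j of None \<Rightarrow> 0 | Some l \<Rightarrow> egg_dbar m l p)
     | Some k \<Rightarrow> (case j of None \<Rightarrow> cnj (egg_dbar m k p) | Some l \<Rightarrow> (if k = l then
         (case k of Some _ \<Rightarrow> 1 | None \<Rightarrow> of_real ((real m)\<^sup>2 * (snd p \<bullet> snd p) ^ (m - 1))) else 0)))"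
  unfolding bordered_hessian_def wirtinger_bar_egg_rho wirtinger_egg_rho wirtinger_egg_dbar[OF m]
  by (intro arg_cong[where f=vec_lambda] ext) (auto split: option.split)

lemma fefferman_M_egg_off_axis:
  fixes p :: "(complex ^ 'k::finite) \<times> complex"
  assumes m: "m \<ge> 1" and w: "snd p \<noteq> 0"
  shows "fefferman_M (egg_rho m) p = (real m)\<^sup>2 * (snd p \<bullet> snd p) ^ (m - 1) * (egg_rho m p + 1)"
proof -
  define q where "q = snd p \<bullet> snd p"
  define D where "D = (real m)\<^sup>2 * q ^ (m - 1)"
  define d where "d l = (case l of Some _ \<Rightarrow> 1 | None \<Rightarrow> complex_of_real D)" for l :: "'k option"
  have q: "q > 0" using w by (simp add: q_def)
  have D: "D > 0" using q m by (simp add: D_def)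
  have d: "d l \<noteq> 0" for l using D by (simp add: d_def split: option.split)
  have "bordered_hessian (egg_rho m) p = (\<chi> i j. case i of None \<Rightarrow> (case j of None \<Rightarrow> 0 | Some l \<Rightarrow> egg_dbar m l p)
     | Some k \<Rightarrow> (case j of None \<Rightarrow> cnj (egg_dbar m k p) | Some l \<Rightarrow> (if k = l then d k else 0)))"
    unfolding bordered_hessian_egg[OF m] d_def D_def q_def ..
  then have "det (bordered_hessian (egg_rho m) p)
      = - (\<Sum>l\<in>UNIV. egg_dbar m l p * cnj (egg_dbar m l p) / d l) * (\<Prod>l\<in>UNIV. d l)"
    using det_arrow_matrix[OF d] by simp
  also have "(\<Prod>l\<in>UNIV. d l) = of_real D" by (simp add: UNIV_option_conv prod.reindex d_def)
  also have "(\<Sum>l\<in>UNIV. egg_dbar m l p * cnj (egg_dbar m l p) / d l)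
      = of_real ((real m * q ^ (m - 1))\<^sup>2 * q / D) + (\<Sum>j\<in>UNIV. fst p $ j * cnj (fst p $ j))"
  proof -
    have "egg_dbar m None p * cnj (egg_dbar m None p) = of_real ((real m * q ^ (m - 1))\<^sup>2) * (snd p * cnj (snd p))"
      by (simp add: egg_dbar_def q_def power2_eq_square mult_ac)
    also have "snd p * cnj (snd p) = of_real q"
      by (simp add: complex_norm_square[symmetric] q_def dot_square_norm)
    finally have "egg_dbar m None p * cnj (egg_dbar m None p) / d None = of_real ((real m * q ^ (m - 1))\<^sup>2 * q / D)"
      by (simp add: d_def)
    moreover have "egg_dbar m (Some j) p * cnj (egg_dbar m (Some j) p) / d (Some j) = fst p $ j * cnj (fst p $ j)" for j
      by (simp add: d_def egg_dbar_def)
    ultimately show ?thesis by (simp only: UNIV_option_conv sum.reindex[OF inj_Some] o_def sum.insert finite_imageI finite_class.finite_UNIV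
          image_iff option.distinct bex_simps simp_thms not_False_eq_True)
  qed
  also have "(\<Sum>j\<in>UNIV. fst p $ j * cnj (fst p $ j)) = of_real (fst p \<bullet> fst p)"
    by (simp add: inner_vec_def complex_norm_square[symmetric] dot_square_norm)
  finally have "det (bordered_hessian (egg_rho m) p)
     = of_real (- ((real m * q ^ (m - 1))\<^sup>2 * q / D + fst p \<bullet> fst p) * D)" by simp
  then have "fefferman_M (egg_rho m) p = ((real m * q ^ (m - 1))\<^sup>2 * q / D + fst p \<bullet> fst p) * D"
    by (simp only: fefferman_M_def Re_complex_of_real mult_minus_left minus_minus)
  also have "\<dots> = (real m * q ^ (m - 1))\<^sup>2 * q + (fst p \<bullet> fst p) * D"
    using D by (simp add: distrib_right)
  also have "(real m * q ^ (m - 1))\<^sup>2 * q = D * q ^ m"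
  proof -
    have "q ^ m = q ^ (m - 1) * q" using m by (metis Suc_diff_1 Suc_le_eq One_nat_def power_Suc2)
    then show ?thesis by (simp add: D_def power2_eq_square mult_ac)
  qed
  finally show ?thesis by (simp add: egg_rho_inner[of m p] D_def q_def algebra_simps)
qed

text \<open>The determinant formula for arrow matrices divides by the diagonal entries, so the points with \<open>w = 0\<close> are
separate: for \<open>m \<ge> 2\<close> a whole row vanishes there, and for \<open>m = 1\<close> all diagonal entries are 1.\<close>

lemma fefferman_M_egg:
  fixes p :: "(complex ^ 'k::finite) \<times> complex"
  assumes m: "m \<ge> 1"
  shows "fefferman_M (egg_rho m) p = (real m)\<^sup>2 * (snd p \<bullet> snd p) ^ (m - 1) * (egg_rho m p + 1)"
proof (cases "snd p = 0")
  case w: True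
  show ?thesis
  proof (cases "m = 1")
    case True
    define d where "d l = (1 :: complex)" for l :: "'k option"
    have "bordered_hessian (egg_rho m) p = (\<chi> i j. case i of None \<Rightarrow> (case j of None \<Rightarrow> 0 | Some l \<Rightarrow> egg_dbar m l p)
     | Some k \<Rightarrow> (case j of None \<Rightarrow> cnj (egg_dbar m k p) | Some l \<Rightarrow> (if k = l then d k else 0)))"
      unfolding bordered_hessian_egg[OF m] d_def using True
      by (intro arg_cong[where f=vec_lambda] ext) (auto split: option.split)
    then have "det (bordered_hessian (egg_rho m) p) = - (\<Sum>l\<in>UNIV. egg_dbar m l p * cnj (egg_dbar m l p) / d l) * (\<Prod>l\<in>UNIV. d l)"
      using det_arrow_matrix[of d] by (simp add: d_def)
    also have "\<dots> = - (\<Sum>j\<in>UNIV. fst p $ j * cnj (fst p $ j))"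
      by (simp add: d_def UNIV_option_conv sum.reindex egg_dbar_def w)
    also have "(\<Sum>j\<in>UNIV. fst p $ j * cnj (fst p $ j)) = of_real (fst p \<bullet> fst p)"
      by (simp add: inner_vec_def complex_norm_square[symmetric] dot_square_norm)
    finally show ?thesis by (simp add: fefferman_M_def True w egg_rho_inner[of "Suc 0" p])
  next
    case False
    have "row (Some None) (bordered_hessian (egg_rho m) p) = 0"
      unfolding bordered_hessian_egg[OF m] using m False w
      by (auto simp: row_def vec_eq_iff egg_dbar_def split: option.split)
    then have "det (bordered_hessian (egg_rho m) p) = 0" by (rule det_zero_row)
    then show ?thesis using m False w by (simp add: fefferman_M_def)
  qed
qed (rule fefferman_M_egg_off_axis[OF m])

lemma real_gradient_egg: "real_gradient (egg_rho m) p = egg_grad m p"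
proof -
  have "frechet_derivative (egg_rho m) (at p) = (\<lambda>v. egg_grad m p \<bullet> v)"
    by (rule frechet_derivative_at[OF egg_rho_derivative, symmetric])
  then show ?thesis by (simp add: real_gradient_def euclidean_representation)
qed

section \<open>Geometry of the egg\<close>

text \<open>In direction of a real coordinate \<open>b\<close>, the gradient component is a positive multiple of that coordinate.\<close>

lemma egg_unconditional:
  assumes m: "m \<ge> 1"
  shows "unconditional_hypersurface (egg_rho m :: (complex ^ 'k::finite) \<times> complex \<Rightarrow> real) (egg_grad m)"
proof
  show "(egg_rho m has_derivative (\<bullet>) (egg_grad m x)) (at x)" for x :: "(complex ^ 'k) \<times> complex"
    by (rule egg_rho_derivative)
  show "continuous_on UNIV (egg_grad m :: (complex ^ 'k) \<times> complex \<Rightarrow> _)"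
    unfolding egg_grad_def[abs_def] by (intro continuous_intros)
  fix b x :: "(complex ^ 'k) \<times> complex" assume b: "b \<in> Basis"
  then consider i where "i \<in> Basis" "b = (i, 0)" | j where "j \<in> Basis" "b = (0, j)"
    by (auto simp: Basis_prod_def)
  note cases = this
  show "0 < (x \<bullet> b) * (egg_grad m x \<bullet> b)" if nz: "x \<bullet> b \<noteq> 0"
  proof (cases rule: cases)
    case 1
    have "(x \<bullet> b) * (egg_grad m x \<bullet> b) = 2 * (x \<bullet> b)\<^sup>2"
      unfolding 1 by (simp add: egg_grad_def inner_prod_def power2_eq_square)
    then show ?thesis using nz by simp
  next
    case 2
    then have "snd x \<noteq> 0" using nz by (auto simp: inner_prod_def)
    moreover have "(x \<bullet> b) * (egg_grad m x \<bullet> b) = 2 * real m * (snd x \<bullet> snd x) ^ (m - 1) * (x \<bullet> b)\<^sup>2"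
      unfolding 2 by (simp add: egg_grad_def inner_prod_def power2_eq_square)
    ultimately show ?thesis using nz m by simp
  qed
  have refl: "(v - (2 * (v \<bullet> i)) *\<^sub>R i) \<bullet> (v - (2 * (v \<bullet> i)) *\<^sub>R i) = v \<bullet> v"
    if "i \<in> Basis" for v i :: "'c::euclidean_space"
    using that by (simp add: inner_simps inner_commute algebra_simps)
  show "egg_rho m (x - (2 * (x \<bullet> b)) *\<^sub>R b) = egg_rho m x"
    by (cases rule: cases) (simp_all add: egg_rho_inner inner_prod_def refl)
next
  show "egg_rho m (0 :: (complex ^ 'k) \<times> complex) < 0" using m by (simp add: egg_rho_inner power_0_left)
  have "norm p \<le> 2" if p: "egg_rho m p \<le> 0" for p :: "(complex ^ 'k) \<times> complex"
  proof -
    have *: "(norm (fst p))\<^sup>2 + norm (snd p) ^ (2 * m) \<le> 1" using p by (simp add: egg_rho_def)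
    have "(norm (fst p))\<^sup>2 \<le> 1" using * zero_le_power[OF norm_ge_zero, of "snd p" "2 * m"] by linarith
    then have 1: "norm (fst p) \<le> 1" by (simp add: power2_le_iff_abs_le abs_square_le_1)
    have "norm (snd p) ^ (2 * m) \<le> 1" using * zero_le_power2[of "norm (fst p)"] by linarith
    then have 2: "norm (snd p) \<le> 1" using m by (simp add: power_le_one_iff)
    have "norm p \<le> norm (fst p) + norm (snd p)" using norm_Pair_le[of "fst p" "snd p"] by simp
    then show ?thesis using 1 2 by simp
  qed
  then show "bounded {x :: (complex ^ 'k) \<times> complex. egg_rho m x \<le> 0}" by (auto intro!: boundedI)
qed

lemma egg_eq_sublevel: "egg m = {p. egg_rho m p < 0}"
  by (auto simp: egg_def egg_rho_def)

lemma egg_rho_continuous: "continuous_on A (egg_rho m)"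
  unfolding egg_rho_inner[abs_def] by (intro continuous_intros)

lemma open_egg: "open (egg m)"
  unfolding egg_eq_sublevel by (intro open_Collect_less egg_rho_continuous continuous_intros)

lemma scaleR_in_egg:
  assumes m: "m \<ge> 1" and p: "egg_rho m p \<le> 0" and r: "0 \<le> r" "r < 1"
  shows "r *\<^sub>R p \<in> egg m"
proof -
  have *: "(norm (fst p))\<^sup>2 + norm (snd p) ^ (2 * m) \<le> 1" using p by (simp add: egg_rho_def)
  have r2: "r\<^sup>2 < 1" using r by (simp add: power_less_one_iff abs_square_less_1)
  have "r ^ (2 * m) \<le> r\<^sup>2" using r m by (intro power_decreasing) auto
  then have "r ^ (2 * m) * norm (snd p) ^ (2 * m) \<le> r\<^sup>2 * norm (snd p) ^ (2 * m)" by (intro mult_right_mono) auto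
  then have "(norm (fst (r *\<^sub>R p)))\<^sup>2 + norm (snd (r *\<^sub>R p)) ^ (2 * m) \<le> r\<^sup>2 * ((norm (fst p))\<^sup>2 + norm (snd p) ^ (2 * m))"
    using r by (simp add: power_mult_distrib distrib_left)
  also have "\<dots> \<le> r\<^sup>2 * 1" using * by (intro mult_left_mono) auto
  finally show ?thesis using r2 by (simp add: egg_eq_sublevel egg_rho_def)
qed

lemma closure_egg:
  assumes m: "m \<ge> 1"
  shows "closure (egg m) = {p :: (complex ^ 'k::finite) \<times> complex. egg_rho m p \<le> 0}"
proof (intro equalityI subsetI)
  have *: "closed {p :: (complex ^ 'k) \<times> complex. egg_rho m p \<le> 0}"
    by (intro closed_Collect_le egg_rho_continuous continuous_intros)
  show "p \<in> {p. egg_rho m p \<le> 0}" if "p \<in> closure (egg m)" for p :: "(complex ^ 'k) \<times> complex"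
  proof -
    have "egg m \<subseteq> {p :: (complex ^ 'k) \<times> complex. egg_rho m p \<le> 0}" by (auto simp: egg_eq_sublevel)
    from closure_minimal[OF this] show ?thesis using * that by blast
  qed
next
  fix p :: "(complex ^ 'k) \<times> complex" assume "p \<in> {p. egg_rho m p \<le> 0}"
  then have p: "egg_rho m p \<le> 0" by simp
  have "(\<lambda>i. (1 - inverse (real (Suc i))) *\<^sub>R p) \<longlonglongrightarrow> (1 - 0) *\<^sub>R p"
    by (intro tendsto_intros LIMSEQ_inverse_real_of_nat)
  moreover have "(1 - inverse (real (Suc i))) *\<^sub>R p \<in> egg m" for i
    by (rule scaleR_in_egg[OF m p]) (auto simp: field_simps)
  ultimately show "p \<in> closure (egg m)"
    unfolding closure_sequential by (intro exI[of _ "\<lambda>i. (1 - inverse (real (Suc i))) *\<^sub>R p"]) auto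
qed

lemma frontier_egg:
  assumes m: "m \<ge> 1"
  shows "frontier (egg m) = {p :: (complex ^ 'k::finite) \<times> complex. egg_rho m p = 0}"
  unfolding frontier_def closure_egg[OF m] interior_open[OF open_egg] by (auto simp: egg_eq_sublevel)

section \<open>Integrals over coordinate hyperplanes\<close>

text \<open>Thickening the hyperplane to a slab of thickness one replaces the product measure on a set of basis
vectors by Lebesgue measure of the full space, which splits along products of spaces.\<close>

lemma nn_integral_hyperplane_slab:
  fixes b :: "'a::euclidean_space"
  assumes b: "b \<in> Basis" and f [measurable]: "f \<in> borel_measurable borel"
  shows "(\<integral>\<^sup>+y. f y \<partial>hyperplane_lborel b) = (\<integral>\<^sup>+x. indicator {0..1} (x \<bullet> b) * f (x - (x \<bullet> b) *\<^sub>R b) \<partial>lborel)"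
proof -
  interpret product_sigma_finite "\<lambda>_::'a. lborel :: real measure" by standard
  define g where "g x = indicator {0..1} (x \<bullet> b) * f (x - (x \<bullet> b) *\<^sub>R b)" for x
  have [measurable]: "g \<in> borel_measurable borel" unfolding g_def by measurable
  have eq: "insert b (Basis - {b}) = Basis" using b by auto
  have "(\<integral>\<^sup>+x. g x \<partial>lborel) = (\<integral>\<^sup>+a. g (\<Sum>i\<in>Basis. a i *\<^sub>R i) \<partial>(\<Pi>\<^sub>M i\<in>insert b (Basis - {b}). lborel))"
    unfolding insert_absorb[OF b] insert_Diff_single by (subst lborel_eq, subst nn_integral_distr) simp_all
  also have "\<dots> = (\<integral>\<^sup>+a. \<integral>\<^sup>+t. g (\<Sum>i\<in>Basis. (a(b := t)) i *\<^sub>R i) \<partial>lborel \<partial>(\<Pi>\<^sub>M i\<in>Basis - {b}. lborel))"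
    by (rule product_nn_integral_insert) (auto simp: eq)
  also have "\<dots> = (\<integral>\<^sup>+a. f (\<Sum>i\<in>Basis - {b}. a i *\<^sub>R i) \<partial>(\<Pi>\<^sub>M i\<in>Basis - {b}. lborel))"
  proof (rule nn_integral_cong)
    fix a :: "'a \<Rightarrow> real"
    have split: "(\<Sum>i\<in>Basis. (a(b := t)) i *\<^sub>R i) = t *\<^sub>R b + (\<Sum>i\<in>Basis - {b}. a i *\<^sub>R i)" for t
      by (subst sum.remove[OF finite_Basis b]) (auto intro!: sum.cong)
    have 0: "(\<Sum>i\<in>Basis - {b}. a i *\<^sub>R i) \<bullet> b = 0" using b by (intro sum_Basis_inner_zero) auto
    have "(\<integral>\<^sup>+t. g (\<Sum>i\<in>Basis. (a(b := t)) i *\<^sub>R i) \<partial>lborel)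
        = (\<integral>\<^sup>+t. f (\<Sum>i\<in>Basis - {b}. a i *\<^sub>R i) * indicator {0..1::real} t \<partial>lborel)"
      unfolding split g_def using b 0 by (intro nn_integral_cong) (simp add: inner_simps mult.commute)
    also have "\<dots> = f (\<Sum>i\<in>Basis - {b}. a i *\<^sub>R i)" by (subst nn_integral_cmult_indicator) auto
    finally show "(\<integral>\<^sup>+t. g (\<Sum>i\<in>Basis. (a(b := t)) i *\<^sub>R i) \<partial>lborel) = f (\<Sum>i\<in>Basis - {b}. a i *\<^sub>R i)" .
  qed
  also have "\<dots> = (\<integral>\<^sup>+y. f y \<partial>hyperplane_lborel b)" by (rule nn_integral_hyperplane[symmetric]) fact
  finally show ?thesis by (simp add: g_def)
qed

lemma nn_integral_hyperplane_imaginary: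
  fixes f :: "complex \<Rightarrow> ennreal"
  assumes f [measurable]: "f \<in> borel_measurable borel"
  shows "(\<integral>\<^sup>+y. f y \<partial>hyperplane_lborel \<i>) = (\<integral>\<^sup>+u. f (of_real u) \<partial>lborel)"
proof -
  interpret product_sigma_finite "\<lambda>_::complex. lborel :: real measure" by standard
  have eq: "Basis - {\<i>} = {1::complex}" by (auto simp: Basis_complex_def complex_eq_iff)
  have "(\<integral>\<^sup>+y. f y \<partial>hyperplane_lborel \<i>) = (\<integral>\<^sup>+a. (\<lambda>u. f (of_real u)) (a 1) \<partial>(\<Pi>\<^sub>M i\<in>{1::complex}. lborel))"
    unfolding nn_integral_hyperplane[OF f] eq by (simp add: scaleR_conv_of_real)
  also have "\<dots> = (\<integral>\<^sup>+u. f (of_real u) \<partial>lborel)"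
    by (rule product_nn_integral_singleton) measurable
  finally show ?thesis .
qed

text \<open>The hyperplane orthogonal to \<open>(0, \<i>)\<close> consists of the points \<open>(z, u)\<close> with real \<open>u\<close>.\<close>

lemma nn_integral_hyperplane_last_imaginary:
  fixes f :: "(complex ^ 'k::finite) \<times> complex \<Rightarrow> ennreal"
  assumes f [measurable]: "f \<in> borel_measurable borel"
  shows "(\<integral>\<^sup>+y. f y \<partial>hyperplane_lborel (0, \<i>)) = (\<integral>\<^sup>+z. \<integral>\<^sup>+u. f (z, of_real u) \<partial>lborel \<partial>lborel)"
proof -
  have b: "(0, \<i>) \<in> (Basis :: ((complex ^ 'k) \<times> complex) set)" by (auto simp: Basis_prod_def Basis_complex_def)
  have i: "\<i> \<in> (Basis :: complex set)" by (simp add: Basis_complex_def)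
  have fp [measurable]: "f \<in> borel_measurable (borel \<Otimes>\<^sub>M borel)" using f by (simp add: borel_prod)
  have "(\<integral>\<^sup>+y. f y \<partial>hyperplane_lborel (0, \<i>))
      = (\<integral>\<^sup>+x. indicator {0..1} (snd x \<bullet> \<i>) * f (fst x, snd x - (snd x \<bullet> \<i>) *\<^sub>R \<i>) \<partial>(lborel \<Otimes>\<^sub>M lborel))"
    by (subst nn_integral_hyperplane_slab[OF b f], subst lborel_prod)
      (auto intro!: nn_integral_cong arg_cong2[where f="(*)"] arg_cong[where f=f] simp: inner_prod_def prod_eq_iff)
  also have "\<dots> = (\<integral>\<^sup>+z. \<integral>\<^sup>+w. indicator {0..1} (w \<bullet> \<i>) * f (z, w - (w \<bullet> \<i>) *\<^sub>R \<i>) \<partial>lborel \<partial>lborel)"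
  proof -
    have "(\<lambda>x. (fst x, snd x - (snd x \<bullet> \<i>) *\<^sub>R \<i>)) \<in> measurable (lborel \<Otimes>\<^sub>M lborel) (borel \<Otimes>\<^sub>M borel :: ((complex ^ 'k) \<times> complex) measure)"
      by measurable
    then have [measurable]: "(\<lambda>x. f (fst x, snd x - (snd x \<bullet> \<i>) *\<^sub>R \<i>)) \<in> borel_measurable (lborel \<Otimes>\<^sub>M lborel)"
      by (rule measurable_compose[OF _ fp])
    have "(\<lambda>x. indicator {0..1} (snd x \<bullet> \<i>) * f (fst x, snd x - (snd x \<bullet> \<i>) *\<^sub>R \<i>)) \<in> borel_measurable (lborel \<Otimes>\<^sub>M lborel)"
      by measurable
    from lborel.nn_integral_fst[OF this, symmetric] show ?thesis by simp
  qed
  also have "\<dots> = (\<integral>\<^sup>+z. \<integral>\<^sup>+u. f (z, of_real u) \<partial>lborel \<partial>lborel)"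
  proof (rule nn_integral_cong)
    fix z :: "complex ^ 'k"
    have [measurable]: "(\<lambda>w. f (z, w)) \<in> borel_measurable borel" by measurable
    show "(\<integral>\<^sup>+w. indicator {0..1} (w \<bullet> \<i>) * f (z, w - (w \<bullet> \<i>) *\<^sub>R \<i>) \<partial>lborel) = (\<integral>\<^sup>+u. f (z, of_real u) \<partial>lborel)"
      by (subst nn_integral_hyperplane_slab[OF i, symmetric], simp, subst nn_integral_hyperplane_imaginary) simp_all
  qed
  finally show ?thesis .
qed

section \<open>The circle as two graphs\<close>

text \<open>The unit circle with period 1, so that \<open>{0<..<1}\<close> with Lebesgue measure is normalised arc length.\<close>

definition ecirc :: "real \<Rightarrow> complex" where "ecirc t = cis (2 * pi * t)"

lemma norm_ecirc [simp]: "norm (ecirc t) = 1" by (simp add: ecirc_def)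

lemma ecirc_nonzero [simp]: "ecirc t \<noteq> 0" using norm_ecirc[of t] by force

lemma continuous_ecirc [continuous_intros]:
  "continuous_on A f \<Longrightarrow> continuous_on A (\<lambda>x. ecirc (f x))"
  unfolding ecirc_def cis_conv_exp by (intro continuous_intros)

lemma ecirc_borel [measurable]: "ecirc \<in> borel_measurable borel"
  by (intro borel_measurable_continuous_onI continuous_intros)

lemma nn_integral_semicircle:
  fixes f :: "real \<Rightarrow> ennreal"
  assumes [measurable]: "f \<in> borel_measurable borel" and r: "r > 0"
  shows "(\<integral>\<^sup>+u. indicator {-r<..<r} u * f u \<partial>lborel)
       = (\<integral>\<^sup>+t. indicator {0<..<1/2} t * (f (r * cos (2 * pi * t)) * ennreal (2 * pi * r * sin (2 * pi * t))) \<partial>lborel)"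
proof -
  define \<phi> where "\<phi> t = r * cos (2 * pi * t)" for t
  define \<phi>' where "\<phi>' t = - (2 * pi * r * sin (2 * pi * t))" for t
  have bij: "bij_betw \<phi> {0<..<1/2} {-r<..<r}"
  proof (rule bij_betw_byWitness[where f' = "\<lambda>u. arccos (u / r) / (2 * pi)"])
    show "\<forall>t\<in>{0<..<1/2}. arccos (\<phi> t / r) / (2 * pi) = t"
      using r by (auto simp: \<phi>_def arccos_cos)
    have *: "-1 < u / r" "u / r < 1" if "u \<in> {-r<..<r}" for u using that r by (auto simp: field_simps)
    then show "\<forall>u\<in>{-r<..<r}. \<phi> (arccos (u / r) / (2 * pi)) = u"
      using r by (auto simp: \<phi>_def cos_arccos less_imp_le)
    show "\<phi> ` {0<..<1/2} \<subseteq> {-r<..<r}"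
    proof (intro image_subsetI)
      fix t :: real assume t: "t \<in> {0<..<1/2}"
      have "cos (2 * pi * t) < cos 0" "cos pi < cos (2 * pi * t)"
        using t by (intro cos_monotone_0_pi; simp)+
      then have "r * cos (2 * pi * t) < r * 1" "r * (- 1) < r * cos (2 * pi * t)"
        using r by (intro mult_strict_left_mono; simp)+
      then show "\<phi> t \<in> {-r<..<r}" by (simp add: \<phi>_def)
    qed
    show "(\<lambda>u. arccos (u / r) / (2 * pi)) ` {-r<..<r} \<subseteq> {0<..<1/2}"
    proof (intro image_subsetI)
      fix u assume "u \<in> {-r<..<r}"
      from *[OF this] have "0 < arccos (u / r)" "arccos (u / r) < pi" using arccos_lt_bounded by auto
      then show "arccos (u / r) / (2 * pi) \<in> {0<..<1/2}" by (simp add: field_simps)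
    qed
  qed
  have "(\<integral>\<^sup>+u. indicator {-r<..<r} u * f u \<partial>lborel) = (\<integral>\<^sup>+t. indicator {0<..<1/2} t * (f (\<phi> t) * ennreal \<bar>\<phi>' t\<bar>) \<partial>lborel)"
  proof (rule nn_integral_substitution_deriv[OF _ _ bij])
    show "(\<phi> has_real_derivative \<phi>' t) (at t)" for t
      unfolding \<phi>_def \<phi>'_def by (auto intro!: derivative_eq_intros)
    show "(\<lambda>x. indicator {0<..<1/2} x * \<phi>' x) \<in> borel_measurable borel" unfolding \<phi>'_def by measurable
  qed (use r in auto)
  also have "\<dots> = (\<integral>\<^sup>+t. indicator {0<..<1/2} t * (f (r * cos (2 * pi * t)) * ennreal (2 * pi * r * sin (2 * pi * t))) \<partial>lborel)"
  proof (intro nn_integral_cong)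
    fix t :: real
    show "indicator {0<..<1/2} t * (f (\<phi> t) * ennreal \<bar>\<phi>' t\<bar>) =
        indicator {0<..<1/2} t * (f (r * cos (2 * pi * t)) * ennreal (2 * pi * r * sin (2 * pi * t)))"
    proof (cases "t \<in> {0<..<1/2}")
      case True
      then have "sin (2 * pi * t) > 0" by (intro sin_gt_zero) auto
      then show ?thesis using r by (simp add: \<phi>_def \<phi>'_def abs_mult)
    qed auto
  qed
  finally show ?thesis .
qed

text \<open>The circle of radius \<open>r\<close> as two graphs over \<open>{-r<..<r}\<close>. The substitution \<open>u = r cos (2 \<pi> t)\<close> turns
\<open>du / sqrt (r\<^sup>2 - u\<^sup>2)\<close> into \<open>2 \<pi> dt\<close>; the lower half circle is the upper one run backwards.\<close>

lemma nn_integral_circle_graphs: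
  fixes f :: "complex \<Rightarrow> ennreal"
  assumes [measurable]: "f \<in> borel_measurable borel" and r: "r > 0" and c: "c \<ge> 0"
  shows "(\<integral>\<^sup>+u. indicator {-r<..<r} u * (\<Sum>s\<in>{1,-1}. f (Complex u (s * sqrt (r\<^sup>2 - u\<^sup>2))) *
            ennreal (c / sqrt (r\<^sup>2 - u\<^sup>2))) \<partial>lborel)
       = ennreal (2 * pi * c) * (\<integral>\<^sup>+t. indicator {0<..<1} t * f (of_real r * ecirc t) \<partial>lborel)"
proof -
  define g where "g t = f (of_real r * ecirc t)" for t
  have gm [measurable]: "g \<in> borel_measurable borel" unfolding g_def by measurable
  have cm [measurable]: "(\<lambda>u. Complex u (s * sqrt (r\<^sup>2 - u\<^sup>2))) \<in> borel_measurable borel" for s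
    unfolding Complex_eq by measurable
  have half: "(\<integral>\<^sup>+u. indicator {-r<..<r} u * (f (Complex u (s * sqrt (r\<^sup>2 - u\<^sup>2))) * ennreal (c / sqrt (r\<^sup>2 - u\<^sup>2))) \<partial>lborel)
      = ennreal (2 * pi * c) * (\<integral>\<^sup>+t. indicator {0<..<1/2} t * f (of_real r * Complex (cos (2 * pi * t)) (s * sin (2 * pi * t))) \<partial>lborel)" for s
  proof -
    have "(\<integral>\<^sup>+u. indicator {-r<..<r} u * (f (Complex u (s * sqrt (r\<^sup>2 - u\<^sup>2))) * ennreal (c / sqrt (r\<^sup>2 - u\<^sup>2))) \<partial>lborel)
      = (\<integral>\<^sup>+t. ennreal (2 * pi * c) * (indicator {0<..<1/2} t * f (of_real r * Complex (cos (2 * pi * t)) (s * sin (2 * pi * t)))) \<partial>lborel)"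
    proof (subst nn_integral_semicircle[OF _ r], measurable, intro nn_integral_cong)
      fix t :: real
      show "indicator {0<..<1/2} t * (f (Complex (r * cos (2 * pi * t)) (s * sqrt (r\<^sup>2 - (r * cos (2 * pi * t))\<^sup>2))) *
           ennreal (c / sqrt (r\<^sup>2 - (r * cos (2 * pi * t))\<^sup>2)) * ennreal (2 * pi * r * sin (2 * pi * t)))
         = ennreal (2 * pi * c) * (indicator {0<..<1/2} t * f (of_real r * Complex (cos (2 * pi * t)) (s * sin (2 * pi * t))))"
      proof (cases "t \<in> {0<..<1/2}")
        case True
        then have sp: "sin (2 * pi * t) > 0" by (intro sin_gt_zero) auto
        have "r\<^sup>2 - (r * cos (2 * pi * t))\<^sup>2 = (r * sin (2 * pi * t))\<^sup>2"
          by (simp add: power_mult_distrib sin_squared_eq algebra_simps)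
        then have sq: "sqrt (r\<^sup>2 - (r * cos (2 * pi * t))\<^sup>2) = r * sin (2 * pi * t)" using sp r by simp
        have "c / (r * sin (2 * pi * t)) * (2 * pi * r * sin (2 * pi * t)) = 2 * pi * c" using sp r by simp
        then have e: "ennreal (c / (r * sin (2 * pi * t))) * ennreal (2 * pi * r * sin (2 * pi * t)) = ennreal (2 * pi * c)"
          using sp r c by (simp flip: ennreal_mult)
        have ceq: "Complex (r * cos (2 * pi * t)) (s * (r * sin (2 * pi * t))) = of_real r * Complex (cos (2 * pi * t)) (s * sin (2 * pi * t))"
          by (simp add: complex_eq_iff)
        show ?thesis by (simp only: sq ceq mult.assoc[of "f _"] e) (simp add: mult_ac)
      qed auto
    qed
    also have "\<dots> = ennreal (2 * pi * c) * (\<integral>\<^sup>+t. indicator {0<..<1/2} t * f (of_real r * Complex (cos (2 * pi * t)) (s * sin (2 * pi * t))) \<partial>lborel)"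
    proof (rule nn_integral_cmult)
      have [measurable]: "(\<lambda>t. complex_of_real r * Complex (cos (2 * pi * t)) (s * sin (2 * pi * t))) \<in> borel_measurable borel"
        unfolding Complex_eq by measurable
      show "(\<lambda>t. indicator {0<..<1/2} t * f (of_real r * Complex (cos (2 * pi * t)) (s * sin (2 * pi * t)))) \<in> borel_measurable lborel"
        by measurable
    qed
    finally show ?thesis .
  qed
  have up: "f (of_real r * Complex (cos (2 * pi * t)) (1 * sin (2 * pi * t))) = g t" for t
    by (simp add: g_def ecirc_def cis.ctr complex_eq_iff)
  have down: "f (of_real r * Complex (cos (2 * pi * t)) (- 1 * sin (2 * pi * t))) = g (1 - t)" for t
  proof -
    have "cos (2 * pi * (1 - t)) = cos (2 * pi * t)" "sin (2 * pi * (1 - t)) = - sin (2 * pi * t)"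
      by (simp_all add: right_diff_distrib cos_diff sin_diff)
    then have "ecirc (1 - t) = Complex (cos (2 * pi * t)) (- 1 * sin (2 * pi * t))" by (simp add: ecirc_def complex_eq_iff)
    then show ?thesis by (simp add: g_def)
  qed
  have "(\<integral>\<^sup>+t. indicator {0<..<1} t * g t \<partial>lborel) = (\<integral>\<^sup>+t. indicator {0<..<1/2} t * g t + indicator {1/2<..<1} t * g t \<partial>lborel)"
    by (rule nn_integral_cong_AE, rule eventually_mono[OF AE_lborel_singleton[of "1/2"]]) (auto simp: indicator_def)
  also have "\<dots> = (\<integral>\<^sup>+t. indicator {0<..<1/2} t * g t \<partial>lborel) + (\<integral>\<^sup>+t. indicator {1/2<..<1} t * g t \<partial>lborel)"
    by (rule nn_integral_add) measurable
  also have "(\<integral>\<^sup>+t. indicator {1/2<..<1} t * g t \<partial>lborel) = (\<integral>\<^sup>+t. indicator {0<..<1/2} t * g (1 - t) \<partial>lborel)"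
    by (subst nn_integral_real_affine[where c="-1" and t=1], measurable, simp)
      (auto simp: indicator_def intro!: nn_integral_cong)
  finally have full: "(\<integral>\<^sup>+t. indicator {0<..<1} t * g t \<partial>lborel)
      = (\<integral>\<^sup>+t. indicator {0<..<1/2} t * g t \<partial>lborel) + (\<integral>\<^sup>+t. indicator {0<..<1/2} t * g (1 - t) \<partial>lborel)" .
  have "(\<integral>\<^sup>+u. indicator {-r<..<r} u * (\<Sum>s\<in>{1,-1}. f (Complex u (s * sqrt (r\<^sup>2 - u\<^sup>2))) *
            ennreal (c / sqrt (r\<^sup>2 - u\<^sup>2))) \<partial>lborel)
     = (\<integral>\<^sup>+u. (\<Sum>s\<in>{1,-1}. indicator {-r<..<r} u * (f (Complex u (s * sqrt (r\<^sup>2 - u\<^sup>2))) *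
            ennreal (c / sqrt (r\<^sup>2 - u\<^sup>2)))) \<partial>lborel)"
    by (simp only: sum_distrib_left)
  also have "\<dots> = (\<Sum>s\<in>{1,-1}. \<integral>\<^sup>+u. indicator {-r<..<r} u * (f (Complex u (s * sqrt (r\<^sup>2 - u\<^sup>2))) *
            ennreal (c / sqrt (r\<^sup>2 - u\<^sup>2))) \<partial>lborel)"
    by (rule nn_integral_sum) measurable
  also have "\<dots> = ennreal (2 * pi * c) * ((\<integral>\<^sup>+t. indicator {0<..<1/2} t * g t \<partial>lborel) + (\<integral>\<^sup>+t. indicator {0<..<1/2} t * g (1 - t) \<partial>lborel))"
    unfolding half using up down by (simp add: distrib_left)
  finally show ?thesis unfolding full[symmetric] by (simp add: g_def)
qed

section \<open>The Fefferman measure in polar coordinates\<close>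

definition egg_radius :: "nat \<Rightarrow> complex ^ 'k::finite \<Rightarrow> real" where
  "egg_radius m z = (1 - (norm z)\<^sup>2) powr (1 / (2 * real m))"

text \<open>Polar coordinates in \<open>w\<close> on the boundary. Outside the ball the value is an arbitrary boundary point, so that
the map takes all its values in the boundary.\<close>

definition egg_param :: "nat \<Rightarrow> (complex ^ 'k::finite) \<times> real \<Rightarrow> (complex ^ 'k) \<times> complex" where
  "egg_param m p = (if norm (fst p) < 1 then (fst p, of_real (egg_radius m (fst p)) * ecirc (snd p)) else (0, 1))"

text \<open>The density over the ball of the Fefferman measure in these coordinates; its constant includes the factor
\<open>2 \<pi>\<close> from the circle.\<close>

definition egg_weight :: "nat \<Rightarrow> complex ^ 'k::finite \<Rightarrow> real" where
  "egg_weight m z = indicator (ball 0 1) z * (pi * real m powr (2 / (real CARD('k) + 2) - 1)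
     * (1 - (norm z)\<^sup>2) powr (egg_mu (CARD('k) + 1) m - 1))"

lemma norm_sq_less_1: "norm z < 1 \<Longrightarrow> (norm z)\<^sup>2 < 1" for z :: "'a::real_normed_vector"
  by (simp add: abs_square_less_1)

lemma egg_radius_pos: "norm z < 1 \<Longrightarrow> 0 < egg_radius m z"
  using norm_sq_less_1[of z] by (simp add: egg_radius_def)

lemma egg_radius_power:
  assumes "m \<ge> 1" "norm z < 1"
  shows "egg_radius m z ^ (2 * m) = 1 - (norm z)\<^sup>2"
proof -
  have "egg_radius m z ^ (2 * m) = egg_radius m z powr real (2 * m)"
    by (rule powr_realpow[symmetric]) (rule egg_radius_pos[OF assms(2)])
  also have "\<dots> = (1 - (norm z)\<^sup>2) powr 1" using assms(1) by (simp add: egg_radius_def powr_powr)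
  finally show ?thesis using norm_sq_less_1[OF assms(2)] by simp
qed

lemma egg_rho_le_iff:
  assumes "m \<ge> 1" "norm z < 1"
  shows "egg_rho m (z, w) < 0 \<longleftrightarrow> norm w < egg_radius m z" "egg_rho m (z, w) \<le> 0 \<longleftrightarrow> norm w \<le> egg_radius m z"
    "egg_rho m (z, w) = 0 \<longleftrightarrow> norm w = egg_radius m z"
proof -
  have e: "egg_rho m (z, w) = norm w ^ (2 * m) - egg_radius m z ^ (2 * m)"
    unfolding egg_radius_power[OF assms] by (simp add: egg_rho_def)
  have r: "egg_radius m z \<ge> 0" using egg_radius_pos[OF assms(2)] by (rule less_imp_le)
  have le: "norm w ^ (2 * m) \<le> egg_radius m z ^ (2 * m) \<longleftrightarrow> norm w \<le> egg_radius m z"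
    and ge: "egg_radius m z ^ (2 * m) \<le> norm w ^ (2 * m) \<longleftrightarrow> egg_radius m z \<le> norm w"
    using r assms(1) by (intro power_mono_iff; simp)+
  show "egg_rho m (z, w) < 0 \<longleftrightarrow> norm w < egg_radius m z" unfolding e using ge by linarith
  show "egg_rho m (z, w) \<le> 0 \<longleftrightarrow> norm w \<le> egg_radius m z" unfolding e using le by linarith
  show "egg_rho m (z, w) = 0 \<longleftrightarrow> norm w = egg_radius m z" unfolding e using le ge by linarith
qed

lemma egg_rho_egg_param:
  assumes "m \<ge> 1" shows "egg_rho m (egg_param m p) = 0"
proof (cases "norm (fst p) < 1")
  case True
  then show ?thesis
    using egg_radius_pos[OF True, of m]
    by (simp add: egg_param_def egg_rho_le_iff[OF assms True] norm_mult)
next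
  case False
  then show ?thesis by (simp add: egg_param_def egg_rho_def)
qed

lemma egg_param_borel [measurable]: "egg_param m \<in> borel_measurable (borel :: ((complex ^ 'k::finite) \<times> real) measure)"
proof -
  have "continuous_on {p :: (complex ^ 'k) \<times> real. norm (fst p) < 1} (\<lambda>p. (fst p, of_real (egg_radius m (fst p)) * ecirc (snd p)))"
    unfolding egg_radius_def using norm_sq_less_1 by (fastforce intro!: continuous_intros)
  moreover have "open {p :: (complex ^ 'k) \<times> real. norm (fst p) < 1}"
    by (intro open_Collect_less continuous_intros)
  ultimately show ?thesis
    unfolding egg_param_def[abs_def]
    using borel_measurable_continuous_on_if[of "{p :: (complex ^ 'k) \<times> real. norm (fst p) < 1}"
        "\<lambda>p. (fst p, complex_of_real (egg_radius m (fst p)) * ecirc (snd p))" "\<lambda>_. (0, 1)"] by simp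
qed

text \<open>Up to constants, everything is a power of \<open>Q = 1 - \<bar>z\<bar>\<^sup>2\<close>: \<open>r\<^sup>2\<^sup>m\<^sup>-\<^sup>2\<close> has exponent \<open>(m - 1) / m\<close>, so the quotient has
exponent \<open>(m - 1) / m * (1 / (n + 1) - 1)\<close>, and this equals \<open>egg_mu n m - 1\<close>.\<close>

lemma fefferman_exponent:
  assumes m: "m \<ge> 1" and z: "norm (z :: complex ^ 'k::finite) < 1"
  defines "r \<equiv> egg_radius m z"
  shows "2 * pi * (((real m)\<^sup>2 * (r\<^sup>2) ^ (m - 1)) powr (1 / (real CARD('k option) + 1)) / (2 * real m * (r\<^sup>2) ^ (m - 1)))
       = egg_weight m z"
proof -
  define k where "k = real CARD('k)"
  have k: "k > 0" by (simp add: k_def)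
  define Q where "Q = 1 - (norm z)\<^sup>2"
  have Q: "Q > 0" using norm_sq_less_1[OF z] by (simp add: Q_def)
  have mm: "real m > 0" using m by simp
  have rp: "(r\<^sup>2) ^ (m - 1) = Q powr ((real m - 1) / real m)"
  proof -
    have "(r\<^sup>2) ^ (m - 1) = r powr real (2 * (m - 1))"
      using egg_radius_pos[OF z, of m] by (subst powr_realpow) (simp_all add: r_def power_mult)
    also have "\<dots> = Q powr ((1 / (2 * real m)) * real (2 * (m - 1)))"
      unfolding r_def egg_radius_def Q_def[symmetric] by (simp add: powr_powr)
    also have "(1 / (2 * real m)) * real (2 * (m - 1)) = (real m - 1) / real m" using m by (simp add: of_nat_diff field_simps)
    finally show ?thesis .
  qed
  have mu: "egg_mu (CARD('k) + 1) m - 1 = (real m - 1) / real m * (1 / (k + 2) - 1)"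
    using mm k by (simp add: egg_mu_def k_def[symmetric] divide_simps) (simp add: algebra_simps)
  have "((real m)\<^sup>2 * (r\<^sup>2) ^ (m - 1)) powr (1 / (k + 2)) = real m powr (2 / (k + 2)) * Q powr ((real m - 1) / real m * (1 / (k + 2)))"
    unfolding rp using mm Q by (simp add: powr_mult powr_powr flip: powr_numeral)
  then have "((real m)\<^sup>2 * (r\<^sup>2) ^ (m - 1)) powr (1 / (k + 2)) / (2 * real m * (r\<^sup>2) ^ (m - 1))
     = (1/2) * (real m powr (2 / (k + 2)) / real m powr 1) * (Q powr ((real m - 1) / real m * (1 / (k + 2))) / Q powr ((real m - 1) / real m))"
    unfolding rp using mm by simp
  also have "\<dots> = (1/2) * (real m powr (2 / (k + 2) - 1)) * (Q powr (egg_mu (CARD('k) + 1) m - 1))"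
    unfolding mu by (simp only: powr_diff[symmetric] right_diff_distrib mult_1_right)
  finally have X: "((real m)\<^sup>2 * (r\<^sup>2) ^ (m - 1)) powr (1 / (k + 2)) / (2 * real m * (r\<^sup>2) ^ (m - 1))
    = (1/2) * (real m powr (2 / (k + 2) - 1)) * (Q powr (egg_mu (CARD('k) + 1) m - 1))" .
  have "real CARD('k option) + 1 = k + 2" by (simp add: k_def)
  moreover have "egg_weight m z = pi * real m powr (2 / (k + 2) - 1) * Q powr (egg_mu (CARD('k) + 1) m - 1)"
    using z by (simp add: egg_weight_def Q_def k_def)
  ultimately show ?thesis by (simp only: X)
qed

text \<open>The boundary is viewed as a graph in the direction \<open>(0, \<i>)\<close>. The gradient length in the area factor cancels
against that in the Fefferman density, leaving \<open>M powr (1 / (n + 1))\<close> over its component in that direction.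
For fixed \<open>z\<close> this is a constant multiple of the arc length density of the circle \<open>\<bar>w\<bar> = egg_radius m z\<close>.\<close>

lemma nn_integral_fefferman_egg:
  fixes F :: "(complex ^ 'k::finite) \<times> complex \<Rightarrow> ennreal"
  assumes m: "m \<ge> 1" and F [measurable]: "F \<in> borel_measurable borel"
  shows "(\<integral>\<^sup>+p. F p \<partial>fefferman_measure (egg m) (egg_rho m))
       = (\<integral>\<^sup>+z. ennreal (egg_weight m z) * (\<integral>\<^sup>+t. indicator {0<..<1} t * F (egg_param m (z, t)) \<partial>lborel) \<partial>lborel)"
proof -
  interpret E: unconditional_hypersurface "egg_rho m" "egg_grad m :: (complex ^ 'k) \<times> complex \<Rightarrow> _"
    by (rule egg_unconditional[OF m])
  define b where "b = ((0, \<i>) :: (complex ^ 'k) \<times> complex)"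
  have b: "b \<in> Basis" by (auto simp: b_def Basis_prod_def Basis_complex_def)
  define a where "a = 1 / (real CARD('k option) + 1)"
  define M where "M p = (real m)\<^sup>2 * (snd p \<bullet> snd p) ^ (m - 1) * (egg_rho m p + 1)" for p :: "(complex ^ 'k) \<times> complex"
  define W where "W p = ennreal (M p powr a / norm (egg_grad m p))" for p
  have [measurable]: "(egg_rho m :: (complex ^ 'k) \<times> complex \<Rightarrow> real) \<in> borel_measurable borel"
    "(egg_grad m :: (complex ^ 'k) \<times> complex \<Rightarrow> _) \<in> borel_measurable borel"
    by (rule E.rho_borel, rule E.G_borel)
  have [measurable]: "(snd :: (complex ^ 'k) \<times> complex \<Rightarrow> complex) \<in> borel_measurable borel"
    by (intro borel_measurable_continuous_onI continuous_intros)
  have W [measurable]: "W \<in> borel_measurable borel" unfolding W_def M_def by measurable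
  have mg: "f \<in> borel_measurable borel \<Longrightarrow> f \<in> borel_measurable (E.graph_measure b)" for f :: "_ \<Rightarrow> ennreal"
    by (subst measurable_cong_sets[OF E.sets_graph_measure refl]) (rule measurable_restrict_space1)
  have "fefferman_measure (egg m) (egg_rho m) = density (E.graph_measure b) W"
    unfolding fefferman_measure_def frontier_egg[OF m] E.hypersurface_measure_eq[OF b] fefferman_M_egg[OF m] real_gradient_egg
      W_def M_def a_def ..
  then have "(\<integral>\<^sup>+p. F p \<partial>fefferman_measure (egg m) (egg_rho m)) = (\<integral>\<^sup>+p. W p * F p \<partial>E.graph_measure b)"
    by (simp add: nn_integral_density mg)
  also have "\<dots> = E.leray b (\<lambda>x. ennreal (norm (egg_grad m x)) * (W x * F x))"
    by (rule E.nn_integral_graph_measure[OF b]) measurable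
  also have "\<dots> = (\<integral>\<^sup>+z. \<integral>\<^sup>+u. E.leray_integrand b (\<lambda>x. ennreal (norm (egg_grad m x)) * (W x * F x)) (z, of_real u) \<partial>lborel \<partial>lborel)"
    unfolding E.leray_def b_def by (intro nn_integral_hyperplane_last_imaginary E.leray_integrand_borel b[unfolded b_def]) measurable
  also have "\<dots> = (\<integral>\<^sup>+z. ennreal (egg_weight m z) * (\<integral>\<^sup>+t. indicator {0<..<1} t * F (egg_param m (z, t)) \<partial>lborel) \<partial>lborel)"
  proof (rule nn_integral_cong)
    fix z :: "complex ^ 'k"
    show "(\<integral>\<^sup>+u. E.leray_integrand b (\<lambda>x. ennreal (norm (egg_grad m x)) * (W x * F x)) (z, of_real u) \<partial>lborel)
       = ennreal (egg_weight m z) * (\<integral>\<^sup>+t. indicator {0<..<1} t * F (egg_param m (z, t)) \<partial>lborel)"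
    proof (cases "norm z < 1")
      case False
      then have "1 \<le> (norm z)\<^sup>2" by simp
      moreover have "0 \<le> \<bar>u\<bar> ^ (2 * m)" for u :: real by simp
      ultimately have "\<not> egg_rho m (z, of_real u) < 0" for u
        by (smt (verit) egg_rho_def fst_conv snd_conv norm_of_real)
      then have "(z, of_real u) \<notin> E.base b" for u by (simp add: E.base_def)
      then show ?thesis using False by (simp add: E.leray_integrand_def egg_weight_def)
    next
      case z: True
      define r where "r = egg_radius m z"
      have r: "r > 0" using egg_radius_pos[OF z] by (simp add: r_def)
      \<comment> \<open>the density \<open>M powr a / \<bar>G \<bullet> b\<bar>\<close> is \<open>c / h\<close> at height \<open>h\<close>\<close>
      define c where "c = ((real m)\<^sup>2 * (r\<^sup>2) ^ (m - 1)) powr a / (2 * real m * (r\<^sup>2) ^ (m - 1))"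
      have c: "c \<ge> 0" using r by (simp add: c_def)
      have yb: "(z, complex_of_real u) \<bullet> b = 0" for u by (simp add: b_def inner_prod_def inner_complex_def)
      have base: "(z, of_real u) \<in> E.base b \<longleftrightarrow> u \<in> {-r<..<r}" for u
        unfolding E.base_def using yb egg_rho_le_iff(1)[OF m z] by (auto simp: r_def abs_less_iff)
      have [measurable]: "(\<lambda>w. F (z, w)) \<in> borel_measurable borel"
        by (rule measurable_compose[OF borel_measurable_continuous_onI F]) (intro continuous_intros)
      have "(\<integral>\<^sup>+u. E.leray_integrand b (\<lambda>x. ennreal (norm (egg_grad m x)) * (W x * F x)) (z, of_real u) \<partial>lborel)
        = (\<integral>\<^sup>+u. indicator {-r<..<r} u * (\<Sum>s\<in>{1,-1}. (\<lambda>w. F (z, w)) (Complex u (s * sqrt (r\<^sup>2 - u\<^sup>2))) *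
            ennreal (c / sqrt (r\<^sup>2 - u\<^sup>2))) \<partial>lborel)"
      proof (rule nn_integral_cong)
        fix u :: real
        show "E.leray_integrand b (\<lambda>x. ennreal (norm (egg_grad m x)) * (W x * F x)) (z, of_real u)
          = indicator {-r<..<r} u * (\<Sum>s\<in>{1,-1}. (\<lambda>w. F (z, w)) (Complex u (s * sqrt (r\<^sup>2 - u\<^sup>2))) *
            ennreal (c / sqrt (r\<^sup>2 - u\<^sup>2)))"
        proof (cases "u \<in> {-r<..<r}")
          case True
          define h where "h = sqrt (r\<^sup>2 - u\<^sup>2)"
          have "\<bar>u\<bar> < \<bar>r\<bar>" using True r by auto
          then have "u\<^sup>2 < r\<^sup>2" using power_strict_mono[of "\<bar>u\<bar>" "\<bar>r\<bar>" 2] by simp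
          then have h: "h > 0" and h2: "h\<^sup>2 = r\<^sup>2 - u\<^sup>2" by (simp_all add: h_def)
          have ww: "Complex u (s * h) \<bullet> Complex u (s * h) = r\<^sup>2" if "s \<in> {1,-1}" for s
            using that h2 by (auto simp: inner_complex_def power2_eq_square)
          have nw: "norm (Complex u (s * h)) = r" if "s \<in> {1,-1}" for s
            using ww[OF that] r by (simp add: norm_eq_sqrt_inner)
          have pt: "(z, of_real u) + (s * h) *\<^sub>R b = (z, Complex u (s * h))" for s
            by (simp add: b_def complex_eq_iff)
          have "egg_rho m ((z, of_real u) + (1 * h) *\<^sub>R b) = 0"
            unfolding pt using nw[of 1] egg_rho_le_iff(3)[OF m z] by (simp add: r_def)
          then have hh: "E.height b (z, of_real u) = h"
            using E.rho_zero_iff[OF b yb, of h u] h by simp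
          have lift: "E.lift s b (z, of_real u) = (z, Complex u (s * h))" for s
            unfolding E.lift_def hh pt ..
          have "(\<Sum>s\<in>{1,-1}. ennreal (norm (egg_grad m (E.lift s b (z, of_real u)))) *
              (W (E.lift s b (z, of_real u)) * F (E.lift s b (z, of_real u))) * ennreal (1 / \<bar>egg_grad m (E.lift s b (z, of_real u)) \<bullet> b\<bar>))
            = (\<Sum>s\<in>{1,-1}. F (z, Complex u (s * h)) * ennreal (c / h))"
          proof (rule sum.cong[OF refl])
            fix s :: real assume s: "s \<in> {1,-1}"
            let ?p = "(z, Complex u (s * h))"
            have r0: "egg_rho m ?p = 0" using nw[OF s] egg_rho_le_iff(3)[OF m z] by (simp add: r_def)
            have gb: "egg_grad m ?p \<bullet> b = 2 * real m * (r\<^sup>2) ^ (m - 1) * (s * h)"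
            proof -
              have "egg_grad m ?p \<bullet> b = 2 * real m * (Complex u (s * h) \<bullet> Complex u (s * h)) ^ (m - 1) * (Complex u (s * h) \<bullet> \<i>)"
                by (simp only: egg_grad_def b_def inner_prod_def fst_conv snd_conv inner_scaleR_left inner_zero_right add_0)
              moreover have "Complex u (s * h) \<bullet> \<i> = s * h" by (simp add: inner_complex_def)
              ultimately show ?thesis by (simp only: ww[OF s])
            qed
            have gb': "\<bar>egg_grad m ?p \<bullet> b\<bar> = 2 * real m * (r\<^sup>2) ^ (m - 1) * h"
              unfolding gb using s h by (auto simp: abs_mult)
            have "\<bar>egg_grad m ?p \<bullet> b\<bar> > 0" unfolding gb' using r h m by simp
            then have gp: "norm (egg_grad m ?p) > 0" by auto
            have Mp: "M ?p = (real m)\<^sup>2 * (r\<^sup>2) ^ (m - 1)" by (simp add: M_def r0 ww[OF s])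
            have "norm (egg_grad m ?p) * (M ?p powr a / norm (egg_grad m ?p)) * (1 / \<bar>egg_grad m ?p \<bullet> b\<bar>) = c / h"
              unfolding gb' using gp by (simp add: Mp c_def)
            then have "ennreal (norm (egg_grad m ?p)) * ennreal (M ?p powr a / norm (egg_grad m ?p)) * ennreal (1 / \<bar>egg_grad m ?p \<bullet> b\<bar>) = ennreal (c / h)"
              by (simp flip: ennreal_mult)
            moreover have comm: "x * (y * v) * w = v * (x * y * w)" for x y v w :: ennreal by (simp only: ac_simps)
            ultimately show "ennreal (norm (egg_grad m (E.lift s b (z, of_real u)))) *
              (W (E.lift s b (z, of_real u)) * F (E.lift s b (z, of_real u))) * ennreal (1 / \<bar>egg_grad m (E.lift s b (z, of_real u)) \<bullet> b\<bar>)
              = F ?p * ennreal (c / h)"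
              unfolding lift W_def comm[of "ennreal (norm (egg_grad m ?p))"] by (simp only:)
          qed
          then show ?thesis using True base[of u] by (simp only: E.leray_integrand_def h_def indicator_simps if_True mult_1)
        next
          case False
          then have "(z, of_real u) \<notin> E.base b" using base by blast
          then show ?thesis using False by (simp add: E.leray_integrand_def del: greaterThanLessThan_iff)
        qed
      qed
      also have "\<dots> = ennreal (2 * pi * c) * (\<integral>\<^sup>+t. indicator {0<..<1} t * F (z, of_real r * ecirc t) \<partial>lborel)"
        by (rule nn_integral_circle_graphs[OF \<open>(\<lambda>w. F (z, w)) \<in> borel_measurable borel\<close> r c])
      also have "2 * pi * c = egg_weight m z"
        using fefferman_exponent[OF m z] by (simp only: c_def a_def r_def)
      finally show ?thesis using z by (simp add: egg_param_def r_def)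
    qed
  qed
  finally show ?thesis .
qed

lemma egg_weight_nonneg: "egg_weight m z \<ge> 0"
  by (simp add: egg_weight_def)

lemma egg_weight_borel [measurable]: "egg_weight m \<in> borel_measurable (borel :: (complex ^ 'k::finite) measure)"
proof -
  have [measurable]: "ball (0 :: complex ^ 'k) 1 \<in> sets borel" by simp
  show ?thesis unfolding egg_weight_def[abs_def] by measurable
qed

definition egg_param_measure :: "nat \<Rightarrow> ((complex ^ 'k::finite) \<times> real) measure" where
  "egg_param_measure m = density (lborel \<Otimes>\<^sub>M lborel) (\<lambda>(z, t). ennreal (egg_weight m z * indicator {0<..<1} t))"

lemma fefferman_measure_egg:
  assumes m: "m \<ge> 1"
  shows "fefferman_measure (egg m) (egg_rho m :: (complex ^ 'k::finite) \<times> complex \<Rightarrow> real)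
       = distr (egg_param_measure m) (restrict_space borel {p. egg_rho m p = 0}) (egg_param m)"
    (is "?\<mu> = ?\<nu>")
proof (rule measure_eqI)
  interpret E: unconditional_hypersurface "egg_rho m" "egg_grad m :: (complex ^ 'k) \<times> complex \<Rightarrow> _"
    by (rule egg_unconditional[OF m])
  have b: "((0, \<i>) :: (complex ^ 'k) \<times> complex) \<in> Basis" by (auto simp: Basis_prod_def Basis_complex_def)
  show sets: "sets ?\<mu> = sets ?\<nu>"
    by (simp add: fefferman_measure_def frontier_egg[OF m] E.hypersurface_measure_eq[OF b] E.sets_graph_measure)
  fix A assume A: "A \<in> sets ?\<mu>"
  then have A': "A \<in> sets (restrict_space borel {p. egg_rho m p = 0})" using sets by simp
  then have AB [measurable]: "A \<in> sets borel" using E.surface_borel by (auto simp: sets_restrict_space_iff)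
  have pm: "egg_param m \<in> measurable (egg_param_measure m) (restrict_space borel {p :: (complex ^ 'k) \<times> complex. egg_rho m p = 0})"
    by (intro measurable_restrict_space2)
      (auto simp: egg_rho_egg_param[OF m] egg_param_measure_def lborel_prod)
  have dm: "(\<lambda>(z :: complex ^ 'k, t). ennreal (egg_weight m z * indicator {0<..<1::real} t)) \<in> borel_measurable (lborel \<Otimes>\<^sub>M lborel)"
    by measurable
  have im: "(\<lambda>p :: (complex ^ 'k) \<times> real. indicator A (egg_param m p) :: ennreal) \<in> borel_measurable (lborel \<Otimes>\<^sub>M lborel)"
    unfolding lborel_prod by measurable
  have "emeasure ?\<nu> A = (\<integral>\<^sup>+x. indicator A x \<partial>?\<nu>)" using A' by simp
  also have "\<dots> = (\<integral>\<^sup>+p. indicator A (egg_param m p) \<partial>egg_param_measure m)"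
    by (rule nn_integral_distr[OF pm]) (use A' in measurable)
  also have "\<dots> = (\<integral>\<^sup>+p. (case p of (z, t) \<Rightarrow> ennreal (egg_weight m z * indicator {0<..<1} t)) * indicator A (egg_param m p) \<partial>(lborel \<Otimes>\<^sub>M lborel))"
    unfolding egg_param_measure_def by (rule nn_integral_density[OF dm im])
  also have "\<dots> = (\<integral>\<^sup>+z. \<integral>\<^sup>+t. ennreal (egg_weight m z * indicator {0<..<1} t) * indicator A (egg_param m (z, t)) \<partial>lborel \<partial>lborel)"
    by (subst lborel.nn_integral_fst[symmetric, OF borel_measurable_times_ennreal[OF dm im]]) simp
  also have "\<dots> = (\<integral>\<^sup>+z. ennreal (egg_weight m z) * (\<integral>\<^sup>+t. indicator {0<..<1} t * indicator A (egg_param m (z, t)) \<partial>lborel) \<partial>lborel)"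
  proof (rule nn_integral_cong)
    fix z :: "complex ^ 'k"
    have pz: "(\<lambda>t. egg_param m (z, t)) \<in> borel_measurable borel"
      by (rule measurable_compose[OF borel_measurable_continuous_onI egg_param_borel]) (intro continuous_intros)
    have "(\<lambda>t. indicator {0<..<1} t * indicator A (egg_param m (z, t)) :: ennreal) \<in> borel_measurable lborel"
      using pz by measurable
    then have "ennreal (egg_weight m z) * (\<integral>\<^sup>+t. indicator {0<..<1} t * indicator A (egg_param m (z, t)) \<partial>lborel)
      = (\<integral>\<^sup>+t. ennreal (egg_weight m z) * (indicator {0<..<1} t * indicator A (egg_param m (z, t))) \<partial>lborel)"
      by (rule nn_integral_cmult[symmetric])
    also have "\<dots> = (\<integral>\<^sup>+t. ennreal (egg_weight m z * indicator {0<..<1} t) * indicator A (egg_param m (z, t)) \<partial>lborel)"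
      by (intro nn_integral_cong) (auto simp: indicator_def)
    finally show "(\<integral>\<^sup>+t. ennreal (egg_weight m z * indicator {0<..<1} t) * indicator A (egg_param m (z, t)) \<partial>lborel)
      = ennreal (egg_weight m z) * (\<integral>\<^sup>+t. indicator {0<..<1} t * indicator A (egg_param m (z, t)) \<partial>lborel)" by simp
  qed
  also have "\<dots> = (\<integral>\<^sup>+x. indicator A x \<partial>?\<mu>)" by (rule nn_integral_fefferman_egg[OF m, symmetric]) simp
  also have "\<dots> = emeasure ?\<mu> A" using A by simp
  finally show "emeasure ?\<mu> A = emeasure ?\<nu> A" ..
qed

section \<open>Gaussian integrals and integrals over the ball\<close>

lemma nn_integral_lborel_translate:
  fixes f :: "'a::euclidean_space \<Rightarrow> ennreal"
  assumes [measurable]: "f \<in> borel_measurable borel"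
  shows "(\<integral>\<^sup>+x. f (c + x) \<partial>lborel) = (\<integral>\<^sup>+x. f x \<partial>lborel)"
proof -
  have "(\<integral>\<^sup>+x. f x \<partial>lborel) = (\<integral>\<^sup>+x. f x \<partial>distr lborel borel ((+) c))" by (simp add: lborel_distr_plus)
  also have "\<dots> = (\<integral>\<^sup>+x. f (c + x) \<partial>lborel)" by (subst nn_integral_distr) auto
  finally show ?thesis ..
qed

text \<open>Let \<open>U\<close> be the unit ball, and integrate \<open>indicator A (T x) * indicator U (y - T x)\<close> over \<open>x\<close> and \<open>y\<close>. Integrating
over \<open>y\<close> first gives the image measure of \<open>A\<close> times the volume of \<open>U\<close>. Replacing \<open>x\<close> by \<open>S y + x\<close> first, and using
that \<open>U\<close> is invariant under \<open>x \<mapsto> - T x\<close>, gives the volume of \<open>A\<close> times that of \<open>U\<close>.\<close>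

lemma lborel_linear_isometry:
  fixes T S :: "'a::euclidean_space \<Rightarrow> 'a"
  assumes T: "linear T" and iso: "\<And>x. norm (T x) = norm x" and inv: "\<And>x. T (S x) = x"
  shows "distr lborel borel T = lborel"
proof (rule measure_eqI)
  fix A assume "A \<in> sets (distr lborel borel T)"
  then have A [measurable]: "A \<in> sets borel" by simp
  have Tc: "continuous_on UNIV T" using T by (simp add: linear_continuous_on linear_conv_bounded_linear)
  then have [measurable]: "T \<in> borel_measurable borel" by (rule borel_measurable_continuous_onI)
  define U where "U = ball (0 :: 'a) 1"
  have [measurable]: "U \<in> sets borel" by (simp add: U_def)
  have add: "T (S y + x) = y + T x" for x y using T inv by (simp add: linear_add)
  have U: "indicator U (- T x) = (indicator U x :: ennreal)" for x by (simp add: U_def iso indicator_def)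
  have e1: "emeasure (distr lborel borel T) A = (\<integral>\<^sup>+x. indicator A (T x) \<partial>lborel)"
    by (subst nn_integral_indicator[symmetric], simp, subst nn_integral_distr) auto
  have "emeasure (distr lborel borel T) A * emeasure lborel U = (\<integral>\<^sup>+x. indicator A (T x) * emeasure lborel U \<partial>lborel)"
    unfolding e1 by (rule nn_integral_multc[symmetric]) measurable
  also have "\<dots> = (\<integral>\<^sup>+x. \<integral>\<^sup>+y. indicator A (T x) * indicator U (y - T x) \<partial>lborel \<partial>lborel)"
  proof (rule nn_integral_cong)
    fix x
    have "(\<integral>\<^sup>+y. indicator A (T x) * indicator U (y - T x) \<partial>lborel) = indicator A (T x) * (\<integral>\<^sup>+y. indicator U (y - T x) \<partial>lborel)"
      by (rule nn_integral_cmult) measurable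
    also have "(\<integral>\<^sup>+y. indicator U (y - T x) \<partial>lborel) = (\<integral>\<^sup>+y. indicator U y \<partial>lborel)"
      using nn_integral_lborel_translate[of "indicator U" "- T x"] by (simp add: add.commute)
    finally show "indicator A (T x) * emeasure lborel U = (\<integral>\<^sup>+y. indicator A (T x) * indicator U (y - T x) \<partial>lborel)"
      by simp
  qed
  also have "\<dots> = (\<integral>\<^sup>+y. \<integral>\<^sup>+x. indicator A (T x) * indicator U (y - T x) \<partial>lborel \<partial>lborel)"
    by (rule lborel_pair.Fubini'[symmetric]) measurable
  also have "\<dots> = (\<integral>\<^sup>+y. \<integral>\<^sup>+x. indicator A (y + T x) * indicator U x \<partial>lborel \<partial>lborel)"
  proof (rule nn_integral_cong)
    fix y
    have "(\<integral>\<^sup>+x. indicator A (T x) * indicator U (y - T x) \<partial>lborel) = (\<integral>\<^sup>+x. indicator A (T (S y + x)) * indicator U (y - T (S y + x)) \<partial>lborel)"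
      by (rule nn_integral_lborel_translate[symmetric]) measurable
    then show "(\<integral>\<^sup>+x. indicator A (T x) * indicator U (y - T x) \<partial>lborel) = (\<integral>\<^sup>+x. indicator A (y + T x) * indicator U x \<partial>lborel)"
      by (simp add: add U)
  qed
  also have "\<dots> = (\<integral>\<^sup>+x. \<integral>\<^sup>+y. indicator A (y + T x) * indicator U x \<partial>lborel \<partial>lborel)"
    by (rule lborel_pair.Fubini') measurable
  also have "\<dots> = (\<integral>\<^sup>+x. emeasure lborel A * indicator U x \<partial>lborel)"
  proof (rule nn_integral_cong)
    fix x
    have "(\<integral>\<^sup>+y. indicator A (y + T x) * indicator U x \<partial>lborel) = (\<integral>\<^sup>+y. indicator A (y + T x) \<partial>lborel) * indicator U x"
      by (rule nn_integral_multc) measurable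
    also have "(\<integral>\<^sup>+y. indicator A (y + T x) \<partial>lborel) = (\<integral>\<^sup>+y. indicator A y \<partial>lborel)"
      using nn_integral_lborel_translate[of "indicator A" "T x"] by (simp add: add.commute)
    finally show "(\<integral>\<^sup>+y. indicator A (y + T x) * indicator U x \<partial>lborel) = emeasure lborel A * indicator U x" by simp
  qed
  also have "\<dots> = emeasure lborel A * emeasure lborel U" by (simp add: nn_integral_cmult_indicator)
  finally have eq: "emeasure (distr lborel borel T) A * emeasure lborel U = emeasure lborel A * emeasure lborel U" .
  have fin: "emeasure lborel U < top" unfolding U_def by (rule emeasure_lborel_ball_finite[unfolded infinity_ennreal_def])
  have "emeasure lborel U \<noteq> 0"
    unfolding U_def using emeasure_lborel_ball_finite[of "0::'a" 1] content_ball_pos[of 1 "0::'a"]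
    by (metis measure_def enn2real_0 measure_completion order_less_irrefl zero_less_one emeasure_eq_measure2)
  with eq fin show "emeasure (distr lborel borel T) A = emeasure lborel A"
    by (metis mult_divide_eq_ennreal less_irrefl)
qed simp

lemma nn_integral_lborel_scale:
  fixes f :: "'a::euclidean_space \<Rightarrow> ennreal"
  assumes [measurable]: "f \<in> borel_measurable borel" and c: "c > 0"
  shows "(\<integral>\<^sup>+x. f x \<partial>lborel) = ennreal (c ^ DIM('a)) * (\<integral>\<^sup>+x. f (c *\<^sub>R x) \<partial>lborel)"
proof -
  have "(\<integral>\<^sup>+x. f x \<partial>lborel) = (\<integral>\<^sup>+x. f x \<partial>density (distr lborel borel (\<lambda>x. 0 + c *\<^sub>R x)) (\<lambda>_. ennreal (\<bar>c\<bar> ^ DIM('a))))"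
    using lborel_affine[of c "0::'a"] c by simp
  also have "\<dots> = (\<integral>\<^sup>+x. ennreal (\<bar>c\<bar> ^ DIM('a)) * f (c *\<^sub>R x) \<partial>lborel)"
    by (subst nn_integral_density, simp, simp, subst nn_integral_distr) auto
  also have "\<dots> = ennreal (c ^ DIM('a)) * (\<integral>\<^sup>+x. f (c *\<^sub>R x) \<partial>lborel)"
    using c by (subst nn_integral_cmult) auto
  finally show ?thesis .
qed

lemma nn_integral_Gamma:
  assumes "\<nu> > 0"
  shows "(\<integral>\<^sup>+t. ennreal (indicator {0<..} t * (t powr (\<nu> - 1) * exp (- t))) \<partial>lborel) = ennreal (Gamma \<nu>)"
proof -
  have "(\<integral>\<^sup>+t. ennreal (indicator {0<..} t * (t powr (\<nu> - 1) * exp (- t))) \<partial>lborel)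
     = (\<integral>\<^sup>+t. ennreal (indicator {0..} t * t powr (\<nu> - 1) / exp t) \<partial>lborel)"
    by (intro nn_integral_cong) (auto simp: indicator_def exp_minus divide_inverse)
  then show ?thesis using Gamma_conv_nn_integral_real[OF assms] by simp
qed

text \<open>Both sides are iterated integrals of \<open>\<phi> z * (T - \<bar>z\<bar>\<^sup>2) powr (\<nu> - 1) * exp (- T)\<close> over \<open>\<bar>z\<bar>\<^sup>2 < T\<close>. With \<open>T = \<bar>z\<bar>\<^sup>2 + t\<close> the
inner integral over \<open>t\<close> is a Gamma integral and leaves the Gaussian. For fixed \<open>T\<close>, rescaling \<open>z\<close> by \<open>sqrt T\<close>
leaves the weighted integral over the unit ball times a power of \<open>T\<close>, and the integral over \<open>T\<close> is the
other Gamma factor. For homogeneous functions, weighted Bergman integrals over the ball are thus Gaussian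
integrals.\<close>

lemma gaussian_ball_nn_integral:
  fixes \<phi> :: "'a::euclidean_space \<Rightarrow> ennreal"
  assumes [measurable]: "\<phi> \<in> borel_measurable borel" and \<nu>: "\<nu> > 0" and a: "a \<ge> 0"
    and hom: "\<And>T z. T > 0 \<Longrightarrow> \<phi> (sqrt T *\<^sub>R z) = ennreal (T powr a) * \<phi> z"
  shows "ennreal (Gamma \<nu>) * (\<integral>\<^sup>+z. \<phi> z * ennreal (exp (- (norm z)\<^sup>2)) \<partial>lborel)
       = ennreal (Gamma (a + real DIM('a) / 2 + \<nu>)) *
           (\<integral>\<^sup>+z. \<phi> z * ennreal (indicator (ball 0 1) z * (1 - (norm z)\<^sup>2) powr (\<nu> - 1)) \<partial>lborel)"
proof -
  have [measurable]: "ball (0 :: 'a) 1 \<in> sets borel" by simp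
  define K where "K z T = \<phi> z * ennreal (indicator {0<..} (T - (norm z)\<^sup>2) * ((T - (norm z)\<^sup>2) powr (\<nu> - 1) * exp (- T)))" for z :: 'a and T :: real
  have [measurable]: "(\<lambda>(z, T). K z T) \<in> borel_measurable (lborel \<Otimes>\<^sub>M lborel)" unfolding K_def by measurable
  define I where "I = (\<integral>\<^sup>+z. \<phi> z * ennreal (indicator (ball 0 1) z * (1 - (norm z)\<^sup>2) powr (\<nu> - 1)) \<partial>lborel)"
  have "(\<integral>\<^sup>+z. \<integral>\<^sup>+T. K z T \<partial>lborel \<partial>lborel) = (\<integral>\<^sup>+z. \<phi> z * ennreal (exp (- (norm z)\<^sup>2)) * ennreal (Gamma \<nu>) \<partial>lborel)"
  proof (rule nn_integral_cong)
    fix z :: 'a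
    have "(\<integral>\<^sup>+T. K z T \<partial>lborel) = (\<integral>\<^sup>+t. K z ((norm z)\<^sup>2 + t) \<partial>lborel)"
      by (rule nn_integral_lborel_translate[symmetric]) (unfold K_def, measurable)
    also have "\<dots> = (\<integral>\<^sup>+t. (\<phi> z * ennreal (exp (- (norm z)\<^sup>2))) * ennreal (indicator {0<..} t * (t powr (\<nu> - 1) * exp (- t))) \<partial>lborel)"
    proof (rule nn_integral_cong)
      fix t :: real
      have "exp (- ((norm z)\<^sup>2 + t)) = exp (- (norm z)\<^sup>2) * exp (- t)" by (simp add: exp_add[symmetric])
      then have "indicator {0<..} t * (t powr (\<nu> - 1) * exp (- ((norm z)\<^sup>2 + t)))
         = exp (- (norm z)\<^sup>2) * (indicator {0<..} t * (t powr (\<nu> - 1) * exp (- t)))" by (simp only: ac_simps)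
      then show "K z ((norm z)\<^sup>2 + t) = (\<phi> z * ennreal (exp (- (norm z)\<^sup>2))) * ennreal (indicator {0<..} t * (t powr (\<nu> - 1) * exp (- t)))"
        by (simp only: K_def add_diff_cancel_left') (subst ennreal_mult, simp_all add: mult.assoc)
    qed
    also have "\<dots> = (\<phi> z * ennreal (exp (- (norm z)\<^sup>2))) * ennreal (Gamma \<nu>)"
      by (subst nn_integral_cmult) (auto simp: nn_integral_Gamma[OF \<nu>])
    finally show "(\<integral>\<^sup>+T. K z T \<partial>lborel) = (\<phi> z * ennreal (exp (- (norm z)\<^sup>2))) * ennreal (Gamma \<nu>)" .
  qed
  also have "\<dots> = ennreal (Gamma \<nu>) * (\<integral>\<^sup>+z. \<phi> z * ennreal (exp (- (norm z)\<^sup>2)) \<partial>lborel)"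
    by (subst nn_integral_multc) (auto simp: mult.commute)
  finally have 1: "(\<integral>\<^sup>+z. \<integral>\<^sup>+T. K z T \<partial>lborel \<partial>lborel) = \<dots>" .
  have "(\<integral>\<^sup>+z. \<integral>\<^sup>+T. K z T \<partial>lborel \<partial>lborel) = (\<integral>\<^sup>+T. \<integral>\<^sup>+z. K z T \<partial>lborel \<partial>lborel)"
    by (rule lborel_pair.Fubini'[symmetric]) measurable
  also have "\<dots> = (\<integral>\<^sup>+T. ennreal (indicator {0<..} T * (T powr (a + real DIM('a) / 2 + \<nu> - 1) * exp (- T))) * I \<partial>lborel)"
  proof (rule nn_integral_cong)
    fix T :: real
    show "(\<integral>\<^sup>+z. K z T \<partial>lborel) = ennreal (indicator {0<..} T * (T powr (a + real DIM('a) / 2 + \<nu> - 1) * exp (- T))) * I"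
    proof (cases "T > 0")
      case False
      have "T - (norm z)\<^sup>2 \<le> 0" for z :: 'a using False zero_le_power2[of "norm z"] by linarith
      then have "K z T = 0" for z by (simp add: K_def not_less)
      then show ?thesis using False by simp
    next
      case T: True
      define C where "C = exp (- T) * T powr (\<nu> - 1) * T powr a"
      have C: "C \<ge> 0" by (simp add: C_def)
      have "(\<integral>\<^sup>+z. K z T \<partial>lborel) = ennreal (sqrt T ^ DIM('a)) * (\<integral>\<^sup>+z. K (sqrt T *\<^sub>R z) T \<partial>lborel)"
        by (rule nn_integral_lborel_scale) (use T in \<open>simp_all add: K_def\<close>)
      also have "(\<integral>\<^sup>+z. K (sqrt T *\<^sub>R z) T \<partial>lborel)
          = (\<integral>\<^sup>+z. ennreal C * (\<phi> z * ennreal (indicator (ball 0 1) z * (1 - (norm z)\<^sup>2) powr (\<nu> - 1))) \<partial>lborel)"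
      proof (rule nn_integral_cong)
        fix z :: 'a
        have e: "T - (norm (sqrt T *\<^sub>R z))\<^sup>2 = T * (1 - (norm z)\<^sup>2)"
          using T by (simp add: power_mult_distrib right_diff_distrib)
        have ind: "indicator {0<..} (T * (1 - (norm z)\<^sup>2)) = (indicator (ball 0 1) z :: real)"
          using T abs_square_less_1[of "norm z"] by (auto simp: indicator_def zero_less_mult_iff)
        have i: "indicator {0<..} (T * (1 - (norm z)\<^sup>2)) * ((T * (1 - (norm z)\<^sup>2)) powr (\<nu> - 1) * exp (- T))
           = exp (- T) * T powr (\<nu> - 1) * (indicator (ball 0 1) z * (1 - (norm z)\<^sup>2) powr (\<nu> - 1))"
        proof (cases "z \<in> ball 0 1")
          case True
          have "(T * (1 - (norm z)\<^sup>2)) powr (\<nu> - 1) = T powr (\<nu> - 1) * (1 - (norm z)\<^sup>2) powr (\<nu> - 1)"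
            by (rule powr_mult)
          then show ?thesis unfolding ind by (simp only: ac_simps)
        qed (simp add: ind)
        show "K (sqrt T *\<^sub>R z) T = ennreal C * (\<phi> z * ennreal (indicator (ball 0 1) z * (1 - (norm z)\<^sup>2) powr (\<nu> - 1)))"
          unfolding K_def e i hom[OF T] C_def by (simp add: ennreal_mult ac_simps)
      qed
      also have "\<dots> = ennreal C * I" unfolding I_def by (rule nn_integral_cmult) measurable
      also have "ennreal (sqrt T ^ DIM('a)) * (ennreal C * I) = ennreal (sqrt T ^ DIM('a) * C) * I"
        using T C by (simp add: ennreal_mult mult.assoc)
      also have "sqrt T ^ DIM('a) = T powr (real DIM('a) / 2)"
        using T by (simp add: powr_half_sqrt[symmetric] powr_realpow[symmetric] powr_powr)
      also have "T powr (real DIM('a) / 2) * C = T powr (a + real DIM('a) / 2 + \<nu> - 1) * exp (- T)"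
      proof -
        have e: "a + real DIM('a) / 2 + \<nu> - 1 = real DIM('a) / 2 + (\<nu> - 1) + a" by simp
        show ?thesis unfolding C_def e powr_add by (simp only: ac_simps)
      qed
      finally show ?thesis using T by simp
    qed
  qed
  also have "\<dots> = ennreal (Gamma (a + real DIM('a) / 2 + \<nu>)) * I"
    using \<nu> a by (subst nn_integral_multc) (auto simp: nn_integral_Gamma)
  finally show ?thesis unfolding 1 I_def .
qed

text \<open>The previous identity for \<open>\<phi> = 1\<close> and \<open>\<nu> = 1\<close>, where the ball integral is the volume of the ball.\<close>

lemma nn_integral_gaussian:
  "(\<integral>\<^sup>+z. ennreal (exp (- (norm (z :: 'a::euclidean_space))\<^sup>2)) \<partial>lborel) = ennreal (pi powr (real DIM('a) / 2))"
proof -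
  have "Gamma (real DIM('a) / 2 + 1) > 0" by (intro Gamma_real_pos) (simp add: add_nonneg_pos)
  then have G: "Gamma (real DIM('a) / 2 + 1) \<noteq> 0" "0 \<le> Gamma (real DIM('a) / 2 + 1)" by (simp_all only: less_imp_le less_imp_neq[symmetric] not_False_eq_True)
  have "(\<integral>\<^sup>+z. ennreal (exp (- (norm (z :: 'a))\<^sup>2)) \<partial>lborel)
      = ennreal (Gamma (real DIM('a) / 2 + 1)) * (\<integral>\<^sup>+z. ennreal (indicator (ball (0::'a) 1) z * (1 - (norm z)\<^sup>2) powr 0) \<partial>lborel)"
    using gaussian_ball_nn_integral[of "\<lambda>_::'a. 1" 1 0] by simp
  also have "(\<integral>\<^sup>+z. ennreal (indicator (ball (0::'a) 1) z * (1 - (norm z)\<^sup>2) powr 0) \<partial>lborel) = (\<integral>\<^sup>+z. indicator (ball (0::'a) 1) z \<partial>lborel)"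
    by (intro nn_integral_cong) (auto simp: indicator_def abs_square_eq_1)
  also have "\<dots> = ennreal (unit_ball_vol (real DIM('a)))"
    by (simp add: emeasure_ball)
  also have "ennreal (Gamma (real DIM('a) / 2 + 1)) * ennreal (unit_ball_vol (real DIM('a))) = ennreal (pi powr (real DIM('a) / 2))"
    by (subst ennreal_mult[symmetric, OF G(2)])
      (simp, simp only: unit_ball_vol_def times_divide_eq_right nonzero_mult_div_cancel_left[OF G(1)])
  finally show ?thesis .
qed

lemma gaussian_ball_integrable:
  fixes \<phi> :: "'a::euclidean_space \<Rightarrow> 'b::{banach, second_countable_topology}"
  assumes \<phi> [measurable]: "\<phi> \<in> borel_measurable borel" and \<nu>: "\<nu> > 0" and a: "a \<ge> 0"
    and hom: "\<And>T z. T > 0 \<Longrightarrow> \<phi> (sqrt T *\<^sub>R z) = (T powr a) *\<^sub>R \<phi> z"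
    and int: "integrable lborel (\<lambda>z. exp (- (norm z)\<^sup>2) *\<^sub>R \<phi> z)"
  shows "integrable lborel (\<lambda>z. (indicator (ball 0 1) z * (1 - (norm z)\<^sup>2) powr (\<nu> - 1)) *\<^sub>R \<phi> z)"
proof (rule integrableI_bounded)
  have [measurable]: "ball (0 :: 'a) 1 \<in> sets borel" by simp
  show "(\<lambda>z. (indicator (ball 0 1) z * (1 - (norm z)\<^sup>2) powr (\<nu> - 1)) *\<^sub>R \<phi> z) \<in> borel_measurable lborel" by measurable
  have pos: "Gamma \<nu> > 0" "Gamma (a + real DIM('a) / 2 + \<nu>) > 0"
    using \<nu> a by (auto intro!: Gamma_real_pos add_nonneg_pos)
  define X where "X = (\<integral>\<^sup>+z. ennreal (norm (\<phi> z)) * ennreal (indicator (ball 0 1) z * (1 - (norm z)\<^sup>2) powr (\<nu> - 1)) \<partial>lborel)"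
  have "ennreal (Gamma \<nu>) * (\<integral>\<^sup>+z. ennreal (norm (\<phi> z)) * ennreal (exp (- (norm z)\<^sup>2)) \<partial>lborel)
      = ennreal (Gamma (a + real DIM('a) / 2 + \<nu>)) * X"
    unfolding X_def by (rule gaussian_ball_nn_integral[OF _ \<nu> a]) (simp_all add: hom ennreal_mult)
  moreover have "(\<integral>\<^sup>+z. ennreal (norm (\<phi> z)) * ennreal (exp (- (norm z)\<^sup>2)) \<partial>lborel) = (\<integral>\<^sup>+z. ennreal (norm (exp (- (norm z)\<^sup>2) *\<^sub>R \<phi> z)) \<partial>lborel)"
    by (intro nn_integral_cong) (simp add: ennreal_mult mult.commute)
  moreover have "\<dots> < \<infinity>" using int by (simp add: integrable_iff_bounded)
  ultimately have "ennreal (Gamma (a + real DIM('a) / 2 + \<nu>)) * X < \<infinity>"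
    by (metis ennreal_less_top ennreal_mult_less_top infinity_ennreal_def)
  then have "X < \<infinity>" using pos by (auto simp: ennreal_mult_less_top)
  moreover have "(\<integral>\<^sup>+z. ennreal (norm ((indicator (ball 0 1) z * (1 - (norm z)\<^sup>2) powr (\<nu> - 1)) *\<^sub>R \<phi> z)) \<partial>lborel) = X"
    unfolding X_def by (intro nn_integral_cong) (simp add: ennreal_mult mult.commute abs_mult)
  ultimately show "(\<integral>\<^sup>+z. ennreal (norm ((indicator (ball 0 1) z * (1 - (norm z)\<^sup>2) powr (\<nu> - 1)) *\<^sub>R \<phi> z)) \<partial>lborel) < \<infinity>" by simp
qed

lemma gaussian_ball_integral_real:
  fixes \<phi> :: "'a::euclidean_space \<Rightarrow> real"
  assumes \<phi> [measurable]: "\<phi> \<in> borel_measurable borel" and \<nu>: "\<nu> > 0" and a: "a \<ge> 0"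
    and hom: "\<And>T z. T > 0 \<Longrightarrow> \<phi> (sqrt T *\<^sub>R z) = T powr a * \<phi> z"
    and int: "integrable lborel (\<lambda>z. exp (- (norm z)\<^sup>2) * \<phi> z)"
  shows "Gamma \<nu> * (\<integral>z. exp (- (norm z)\<^sup>2) * \<phi> z \<partial>lborel)
       = Gamma (a + real DIM('a) / 2 + \<nu>) * (\<integral>z. indicator (ball 0 1) z * (1 - (norm z)\<^sup>2) powr (\<nu> - 1) * \<phi> z \<partial>lborel)"
proof -
  have pos: "Gamma \<nu> > 0" "Gamma (a + real DIM('a) / 2 + \<nu>) > 0"
    using \<nu> a by (auto intro!: Gamma_real_pos add_nonneg_pos)
  have int2: "integrable lborel (\<lambda>z. indicator (ball 0 1) z * (1 - (norm z)\<^sup>2) powr (\<nu> - 1) * \<phi> z)"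
    using gaussian_ball_integrable[of \<phi> \<nu> a] assms by simp
  have key: "Gamma \<nu> * enn2real (\<integral>\<^sup>+z. ennreal (exp (- (norm z)\<^sup>2) * \<psi> z) \<partial>lborel) = Gamma (a + real DIM('a) / 2 + \<nu>) *
     enn2real (\<integral>\<^sup>+z. ennreal (indicator (ball 0 1) z * (1 - (norm z)\<^sup>2) powr (\<nu> - 1) * \<psi> z) \<partial>lborel)"
    if [measurable]: "\<psi> \<in> borel_measurable borel" and h: "\<And>T z. T > 0 \<Longrightarrow> \<psi> (sqrt T *\<^sub>R z) = T powr a * \<psi> z" for \<psi> :: "'a \<Rightarrow> real"
  proof -
    have "ennreal (Gamma \<nu>) * (\<integral>\<^sup>+z. ennreal (\<psi> z) * ennreal (exp (- (norm z)\<^sup>2)) \<partial>lborel)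
      = ennreal (Gamma (a + real DIM('a) / 2 + \<nu>)) *
        (\<integral>\<^sup>+z. ennreal (\<psi> z) * ennreal (indicator (ball 0 1) z * (1 - (norm z)\<^sup>2) powr (\<nu> - 1)) \<partial>lborel)"
      by (rule gaussian_ball_nn_integral[OF _ \<nu> a]) (simp_all add: h ennreal_mult')
    then have "enn2real (ennreal (Gamma \<nu>) * (\<integral>\<^sup>+z. ennreal (exp (- (norm z)\<^sup>2) * \<psi> z) \<partial>lborel))
      = enn2real (ennreal (Gamma (a + real DIM('a) / 2 + \<nu>)) *
        (\<integral>\<^sup>+z. ennreal (indicator (ball 0 1) z * (1 - (norm z)\<^sup>2) powr (\<nu> - 1) * \<psi> z) \<partial>lborel))"
      by (simp add: ennreal_mult' mult.commute[of "ennreal (\<psi> _)"])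
    then show ?thesis using pos by (simp add: enn2real_mult less_imp_le)
  qed
  have hom': "- \<phi> (sqrt T *\<^sub>R z) = T powr a * - \<phi> z" if "T > 0" for T z using hom[OF that] by simp
  show ?thesis
    unfolding real_lebesgue_integral_def[OF int] real_lebesgue_integral_def[OF int2]
    using key[OF \<phi> hom] key[of "\<lambda>z. - \<phi> z", OF _ hom'] by (simp add: right_diff_distrib)
qed

lemma gaussian_ball_integral:
  fixes \<phi> :: "'a::euclidean_space \<Rightarrow> complex"
  assumes \<phi> [measurable]: "\<phi> \<in> borel_measurable borel" and \<nu>: "\<nu> > 0" and a: "a \<ge> 0"
    and hom: "\<And>T z. T > 0 \<Longrightarrow> \<phi> (sqrt T *\<^sub>R z) = (T powr a) *\<^sub>R \<phi> z"
    and int: "integrable lborel (\<lambda>z. exp (- (norm z)\<^sup>2) *\<^sub>R \<phi> z)"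
  shows "Gamma \<nu> *\<^sub>R (\<integral>z. exp (- (norm z)\<^sup>2) *\<^sub>R \<phi> z \<partial>lborel)
       = Gamma (a + real DIM('a) / 2 + \<nu>) *\<^sub>R
          (\<integral>z. (indicator (ball 0 1) z * (1 - (norm z)\<^sup>2) powr (\<nu> - 1)) *\<^sub>R \<phi> z \<partial>lborel)"
proof -
  have int2: "integrable lborel (\<lambda>z. (indicator (ball 0 1) z * (1 - (norm z)\<^sup>2) powr (\<nu> - 1)) *\<^sub>R \<phi> z)"
    by (rule gaussian_ball_integrable[OF \<phi> \<nu> a hom int])
  have part: "Gamma \<nu> * L (\<integral>z. exp (- (norm z)\<^sup>2) *\<^sub>R \<phi> z \<partial>lborel)
       = Gamma (a + real DIM('a) / 2 + \<nu>) *
          L (\<integral>z. (indicator (ball 0 1) z * (1 - (norm z)\<^sup>2) powr (\<nu> - 1)) *\<^sub>R \<phi> z \<partial>lborel)"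
    if L: "bounded_linear L" for L :: "complex \<Rightarrow> real"
  proof -
    interpret L: bounded_linear L by (rule L)
    have [measurable]: "L \<in> borel_measurable borel"
      by (intro borel_measurable_continuous_onI L.continuous_on continuous_on_id)
    have m: "(\<lambda>z. L (\<phi> z)) \<in> borel_measurable borel" by measurable
    have h: "L (\<phi> (sqrt T *\<^sub>R z)) = T powr a * L (\<phi> z)" if "T > 0" for T z
      using hom[OF that] by (simp add: L.scaleR)
    have i: "integrable lborel (\<lambda>z. exp (- (norm z)\<^sup>2) * L (\<phi> z))"
      using integrable_bounded_linear[OF L int] by (simp add: L.scaleR)
    show ?thesis
      using gaussian_ball_integral_real[OF m \<nu> a h i]
      unfolding integral_bounded_linear[OF L int, symmetric] integral_bounded_linear[OF L int2, symmetric]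
      by (simp add: L.scaleR)
  qed
  show ?thesis
    using part[OF bounded_linear_Re] part[OF bounded_linear_Im] by (simp add: complex_eq_iff)
qed

section \<open>Averages over circles\<close>

lemma norm_vector_scale: "norm (c *s z) = norm c * norm z" for c :: complex and z :: "complex ^ 'k::finite"
proof -
  have "(\<Sum>i\<in>UNIV. (norm ((c *s z) $ i))\<^sup>2) = (norm c)\<^sup>2 * (\<Sum>i\<in>UNIV. (norm (z $ i))\<^sup>2)"
    by (simp add: norm_mult power_mult_distrib sum_distrib_left)
  then show ?thesis by (simp add: norm_vec_def L2_set_def real_sqrt_mult)
qed

lemma continuous_on_vector_scale [continuous_intros]:
  fixes f :: "'a::topological_space \<Rightarrow> complex" and g :: "'a \<Rightarrow> complex ^ 'k::finite"
  assumes "continuous_on A f" "continuous_on A g"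
  shows "continuous_on A (\<lambda>x. f x *s g x)"
  unfolding vector_scalar_mult_def using assms by (intro continuous_intros)

lemma lborel_unit_scalar:
  fixes c :: complex
  assumes "norm c = 1"
  shows "distr lborel borel (\<lambda>z :: complex ^ 'k::finite. c *s z) = lborel"
proof (rule lborel_linear_isometry)
  show "linear (\<lambda>z :: complex ^ 'k. c *s z)"
    by (rule linearI) (simp_all add: vec_eq_iff algebra_simps)
  have "c \<noteq> 0" using assms by auto
  then show "c *s ((1 / c) *s z) = z" for z :: "complex ^ 'k" by (simp add: vec_eq_iff)
qed (simp add: norm_vector_scale assms)

definition unit_arc :: "real measure" where
  "unit_arc = density lborel (indicator {0<..<1})"

lemma sets_unit_arc [measurable_cong]: "sets unit_arc = sets borel"
  by (simp add: unit_arc_def)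

lemma emeasure_unit_arc: "emeasure unit_arc (space unit_arc) = 1"
  by (simp add: unit_arc_def emeasure_density)

lemma measure_unit_arc [simp]: "measure unit_arc (space unit_arc) = 1"
  by (simp add: measure_def emeasure_unit_arc)

lemma finite_measure_unit_arc: "finite_measure unit_arc"
  by (rule finite_measureI) (simp add: emeasure_unit_arc)

lemma unit_arc_integral:
  fixes F :: "real \<Rightarrow> complex"
  assumes F: "continuous_on UNIV F"
  shows "integrable unit_arc F" "integral\<^sup>L unit_arc F = integral {0..1} F"
proof -
  have [measurable]: "F \<in> borel_measurable borel" using F by (rule borel_measurable_continuous_onI)
  have si: "set_integrable lborel {0..1} F"
    unfolding set_integrable_def by (rule borel_integrable_compact) (auto intro: continuous_on_subset[OF F])
  have dens: "unit_arc = density lborel (\<lambda>x. ennreal (indicator {0<..<1} x))"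
    unfolding unit_arc_def by (simp add: ennreal_indicator)
  have si': "set_integrable lborel {0<..<1} F" by (rule set_integrable_subset[OF si]) auto
  then show "integrable unit_arc F"
    unfolding dens by (subst integrable_density) (auto simp: set_integrable_def)
  have "integral\<^sup>L unit_arc F = (LINT t:{0<..<1}|lborel. F t)"
    unfolding dens set_lebesgue_integral_def by (subst integral_density) auto
  also have "\<dots> = integral {0<..<1} F" by (rule set_borel_integral_eq_integral[OF si'])
  also have "\<dots> = integral {0..1} F" using integral_open_interval_real[of 0 1 F] by simp
  finally show "integral\<^sup>L unit_arc F = integral {0..1} F" .
qed

text \<open>Lebesgue measure is invariant under multiplication by unimodular scalars, so an integrand may be replaced
by its average over circles. Mean values and Fourier coefficients on circles are the only way in which
holomorphy enters the integral formulas below.\<close>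

lemma integral_circle_average:
  fixes f :: "complex ^ 'k::finite \<Rightarrow> complex"
  assumes f: "integrable lborel f"
  shows "(\<integral>z. f z \<partial>lborel) = (\<integral>z. (\<integral>t. f (ecirc t *s z) \<partial>unit_arc) \<partial>lborel)"
proof -
  interpret P: finite_measure unit_arc by (rule finite_measure_unit_arc)
  interpret PL: pair_sigma_finite unit_arc "lborel :: (complex ^ 'k) measure" ..
  have [measurable]: "f \<in> borel_measurable borel" using f by simp
  have cont: "continuous_on UNIV (\<lambda>p :: real \<times> (complex ^ 'k). ecirc (fst p) *s snd p)" by (intro continuous_intros)
  have bm: "(\<lambda>p :: real \<times> (complex ^ 'k). ecirc (fst p) *s snd p) \<in> borel_measurable borel"
    by (rule borel_measurable_continuous_onI[OF cont])
  then have fm: "(\<lambda>(t, z). f (ecirc t *s z)) \<in> borel_measurable (unit_arc \<Otimes>\<^sub>M lborel)"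
    using measurable_compose[OF bm \<open>f \<in> borel_measurable borel\<close>]
    by (simp add: case_prod_unfold measurable_cong_sets[OF sets_pair_measure_cong[OF sets_unit_arc sets_lborel] refl] borel_prod)
  have inv: "integrable lborel (\<lambda>z. g (ecirc t *s z)) = integrable lborel g"
    "(\<integral>z. g (ecirc t *s z) \<partial>lborel) = (\<integral>z. g z \<partial>lborel)" if [measurable]: "g \<in> borel_measurable borel"
    for t and g :: "complex ^ 'k \<Rightarrow> 'b::{banach, second_countable_topology}"
  proof -
    have [measurable]: "(\<lambda>z :: complex ^ 'k. ecirc t *s z) \<in> borel_measurable borel"
      by (intro borel_measurable_continuous_onI continuous_intros)
    have d: "distr lborel borel (\<lambda>z :: complex ^ 'k. ecirc t *s z) = lborel" by (rule lborel_unit_scalar) simp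
    show "integrable lborel (\<lambda>z. g (ecirc t *s z)) = integrable lborel g"
      by (subst (2) d[symmetric], subst integrable_distr_eq) auto
    show "(\<integral>z. g (ecirc t *s z) \<partial>lborel) = (\<integral>z. g z \<partial>lborel)"
      by (subst (2) d[symmetric], subst integral_distr) auto
  qed
  have int: "integrable (unit_arc \<Otimes>\<^sub>M lborel) (\<lambda>(t, z). f (ecirc t *s z))"
  proof (rule PL.Fubini_integrable[OF fm])
    show "integrable unit_arc (\<lambda>t. \<integral>z. norm (case (t, z) of (t, z) \<Rightarrow> f (ecirc t *s z)) \<partial>lborel)"
      using inv(2)[of "\<lambda>z. norm (f z)"] by simp
    show "AE t in unit_arc. integrable lborel (\<lambda>z. case (t, z) of (t, z) \<Rightarrow> f (ecirc t *s z))"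
      using inv(1)[of f] f by simp
  qed
  have "(\<integral>z. (\<integral>t. f (ecirc t *s z) \<partial>unit_arc) \<partial>lborel) = (\<integral>t. (\<integral>z. f (ecirc t *s z) \<partial>lborel) \<partial>unit_arc)"
    by (rule PL.Fubini_integral[OF int])
  also have "\<dots> = (\<integral>z. f z \<partial>lborel)" using inv(2)[of f] by simp
  finally show ?thesis ..
qed

lemma circlepath_ecirc: "circlepath 0 r t = of_real r * ecirc t"
  by (simp add: circlepath ecirc_def cis_conv_exp mult_ac)

definition taylor_coeff :: "nat \<Rightarrow> (complex \<Rightarrow> complex) \<Rightarrow> complex" where
  "taylor_coeff d F = (deriv ^^ d) F 0 / fact d"

text \<open>Cauchy's formula, for functions that are only continuous up to the circle.\<close>

lemma taylor_coeff_circle: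
  assumes cont: "continuous_on (cball 0 r) F" and hol: "F holomorphic_on ball 0 r" and r: "r > 0"
  shows "(\<integral>t. F (of_real r * ecirc t) / ecirc t ^ d \<partial>unit_arc) = of_real r ^ d * taylor_coeff d F"
proof -
  have cF: "continuous_on UNIV (\<lambda>t. F (of_real r * ecirc t) / ecirc t ^ d)"
    by (intro continuous_intros continuous_on_compose2[OF cont]) (use r in \<open>auto simp: norm_mult\<close>)
  have "((\<lambda>u. F u / (u - 0) ^ Suc d) has_contour_integral 2 * pi * \<i> / fact d * (deriv ^^ d) F 0) (circlepath 0 r)"
    by (rule Cauchy_has_contour_integral_higher_derivative_circlepath) (use assms in auto)
  then have "((\<lambda>t. F (circlepath 0 r t) / circlepath 0 r t ^ Suc d * vector_derivative (circlepath 0 r) (at t within {0..1}))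
      has_integral 2 * pi * \<i> / fact d * (deriv ^^ d) F 0) {0..1}"
    by (simp add: has_contour_integral_def)
  then have "((\<lambda>t. (2 * pi * \<i> / of_real r ^ d) * (F (of_real r * ecirc t) / ecirc t ^ d)) has_integral 2 * pi * \<i> / fact d * (deriv ^^ d) F 0) {0..1}"
  proof (rule has_integral_eq[rotated])
    fix t :: real assume t: "t \<in> {0..1}"
    have vd: "vector_derivative (circlepath 0 r) (at t within {0..1}) = 2 * pi * \<i> * (of_real r * ecirc t)"
      using t by (subst vector_derivative_circlepath01) (auto simp: ecirc_def cis_conv_exp mult_ac)
    show "F (circlepath 0 r t) / circlepath 0 r t ^ Suc d * vector_derivative (circlepath 0 r) (at t within {0..1})
      = (2 * pi * \<i> / of_real r ^ d) * (F (of_real r * ecirc t) / ecirc t ^ d)"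
      unfolding vd circlepath_ecirc using r by (simp add: power_mult_distrib field_simps)
  qed
  then have "integral {0..1} (\<lambda>t. (2 * pi * \<i> / of_real r ^ d) * (F (of_real r * ecirc t) / ecirc t ^ d))
      = 2 * pi * \<i> / fact d * (deriv ^^ d) F 0"
    by (rule integral_unique)
  then have "(2 * pi * \<i> / of_real r ^ d) * (\<integral>t. F (of_real r * ecirc t) / ecirc t ^ d \<partial>unit_arc) = 2 * pi * \<i> / fact d * (deriv ^^ d) F 0"
    unfolding unit_arc_integral(2)[OF cF] by (simp only: Henstock_Kurzweil_Integration.integral_mult_right)
  then show ?thesis using r by (simp add: taylor_coeff_def field_simps)
qed

lemma circle_mean_value:
  assumes "continuous_on (cball 0 r) F" "F holomorphic_on ball 0 r" "r > 0"
  shows "(\<integral>t. F (of_real r * ecirc t) \<partial>unit_arc) = F 0"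
  using taylor_coeff_circle[OF assms, of 0] by (simp add: taylor_coeff_def)

lemma taylor_coeff_sums:
  assumes "F holomorphic_on ball 0 r" "norm s < r"
  shows "(\<lambda>d. taylor_coeff d F * s ^ d) sums F s"
  using holomorphic_power_series[OF assms(1), of s] assms(2) by (simp add: taylor_coeff_def)

section \<open>The reproducing formula of the Fock space\<close>

lemma herm_scale_left: "herm (c *s z) \<zeta> = c * herm z \<zeta>"
  by (simp add: herm_def sum_distrib_left mult.assoc)

lemma herm_scale_right: "herm z (c *s \<zeta>) = cnj c * herm z \<zeta>"
  by (simp add: herm_def sum_distrib_left mult_ac)

lemma herm_scaleR_left: "herm (r *\<^sub>R z) \<zeta> = of_real r * herm z \<zeta>"
  by (simp add: herm_def sum_distrib_left scaleR_conv_of_real[symmetric])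

lemma herm_scaleR_right: "herm z (r *\<^sub>R \<zeta>) = of_real r * herm z \<zeta>"
  by (simp add: herm_def sum_distrib_left scaleR_conv_of_real[symmetric])

lemma herm_add_left: "herm (z + w) \<zeta> = herm z \<zeta> + herm w \<zeta>"
  by (simp add: herm_def sum.distrib distrib_right)

lemma herm_add_right: "herm z (\<zeta> + \<eta>) = herm z \<zeta> + herm z \<eta>"
  by (simp add: herm_def sum.distrib distrib_left)

lemma cnj_herm: "cnj (herm z \<zeta>) = herm \<zeta> z"
  by (simp add: herm_def mult.commute)

lemma herm_self: "herm z z = of_real ((norm z)\<^sup>2)"
  by (simp add: herm_def norm_vec_def L2_set_def complex_norm_square[symmetric] sum_nonneg)

lemma norm_herm_le: "norm (herm z \<zeta>) \<le> norm z * norm \<zeta>"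
proof -
  have "norm (herm z \<zeta>) \<le> (\<Sum>j\<in>UNIV. norm (z $ j * cnj (\<zeta> $ j)))" unfolding herm_def by (rule norm_sum)
  also have "\<dots> = (\<Sum>j\<in>UNIV. \<bar>norm (z $ j)\<bar> * \<bar>norm (\<zeta> $ j)\<bar>)" by (simp add: norm_mult)
  also have "\<dots> \<le> norm z * norm \<zeta>" unfolding norm_vec_def by (rule L2_set_mult_ineq)
  finally show ?thesis .
qed

lemma continuous_on_herm [continuous_intros]:
  fixes f g :: "'a::topological_space \<Rightarrow> complex ^ 'k::finite"
  assumes "continuous_on A f" "continuous_on A g"
  shows "continuous_on A (\<lambda>x. herm (f x) (g x))"
  unfolding herm_def using assms by (intro continuous_intros)

text \<open>Holomorphy along complex lines. Together with continuity this is the form of holomorphy that passes to Taylor coefficients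
and supports integration over circles in complex lines.\<close>

definition slice_holomorphic :: "(complex ^ 'k::finite \<Rightarrow> complex) \<Rightarrow> (complex ^ 'k) set \<Rightarrow> bool" where
  "slice_holomorphic g A \<longleftrightarrow> (\<forall>a u. (\<lambda>s. g (a + s *s u)) holomorphic_on {s. a + s *s u \<in> A})"

lemma integrable_gaussian: "integrable lborel (\<lambda>z :: 'a::euclidean_space. exp (- (norm z)\<^sup>2))"
  by (rule integrableI_bounded) (simp_all add: nn_integral_gaussian)

lemma integral_gaussian: "(\<integral>z. exp (- (norm (z :: 'a::euclidean_space))\<^sup>2) \<partial>lborel) = pi powr (real DIM('a) / 2)"
  by (rule integral_eq_nn_integral[THEN trans]) (simp_all add: nn_integral_gaussian)

lemma integrable_gaussian_half: "integrable lborel (\<lambda>z :: 'a::euclidean_space. exp (- (norm z)\<^sup>2 / 2))"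
proof (rule integrableI_bounded)
  have "(\<integral>\<^sup>+z. ennreal (exp (- (norm (z :: 'a))\<^sup>2 / 2)) \<partial>lborel)
     = ennreal (sqrt 2 ^ DIM('a)) * (\<integral>\<^sup>+z. ennreal (exp (- (norm (sqrt 2 *\<^sub>R z :: 'a))\<^sup>2 / 2)) \<partial>lborel)"
    by (rule nn_integral_lborel_scale) simp_all
  also have "\<dots> = ennreal (sqrt 2 ^ DIM('a)) * ennreal (pi powr (real DIM('a) / 2))"
    by (simp add: power_mult_distrib nn_integral_gaussian)
  also have "\<dots> < \<infinity>" by (simp add: ennreal_mult_less_top)
  finally show "(\<integral>\<^sup>+z. ennreal (norm (exp (- (norm (z :: 'a))\<^sup>2 / 2))) \<partial>lborel) < \<infinity>" by simp
qed simp

lemma power_le_fact_exp: "t \<ge> 0 \<Longrightarrow> t ^ d \<le> fact d * exp (t :: real)"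
proof -
  assume t: "t \<ge> 0"
  have "(\<Sum>n\<in>{d}. t ^ n /\<^sub>R fact n) \<le> (\<Sum>n. t ^ n /\<^sub>R fact n)"
    by (rule sum_le_suminf[OF summable_exp_generic]) (use t in auto)
  then show ?thesis by (simp add: exp_def field_simps)
qed

text \<open>Completing the square: \<open>- t\<^sup>2 + (B + 1) t \<le> (B + 1)\<^sup>2 / 2 - t\<^sup>2 / 2\<close>; one extra \<open>exp t\<close> absorbs the power \<open>t ^ d\<close>.\<close>

lemma poly_exp_gaussian_bound:
  fixes t B :: real
  assumes "t \<ge> 0"
  shows "exp (- t\<^sup>2) * (t ^ d * exp (B * t)) \<le> fact d * exp ((B + 1)\<^sup>2 / 2) * exp (- t\<^sup>2 / 2)"
proof -
  have "0 \<le> (t - (B + 1))\<^sup>2" by simp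
  then have "- t\<^sup>2 + t + B * t \<le> (B + 1)\<^sup>2 / 2 + - t\<^sup>2 / 2" by (simp add: power2_eq_square algebra_simps)
  then have e: "exp (- t\<^sup>2) * (exp t * exp (B * t)) \<le> exp ((B + 1)\<^sup>2 / 2) * exp (- t\<^sup>2 / 2)"
    by (simp add: exp_add[symmetric] add.assoc)
  have "exp (- t\<^sup>2) * (t ^ d * exp (B * t)) \<le> exp (- t\<^sup>2) * ((fact d * exp t) * exp (B * t))"
    by (intro mult_left_mono mult_right_mono power_le_fact_exp assms) auto
  also have "\<dots> = fact d * (exp (- t\<^sup>2) * (exp t * exp (B * t)))" by simp
  also have "\<dots> \<le> fact d * (exp ((B + 1)\<^sup>2 / 2) * exp (- t\<^sup>2 / 2))" by (intro mult_left_mono e) auto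
  finally show ?thesis by (simp add: mult_ac)
qed

lemma DIM_complex_vec: "real DIM(complex ^ 'k::finite) / 2 = real CARD('k)"
  by simp

text \<open>The exponent is \<open>\<langle>\<zeta>, \<zeta> + u\<rangle> - \<bar>\<zeta> + u\<bar>\<^sup>2 = - \<langle>u, \<zeta> + u\<rangle>\<close>: after the shift, apart from the radial factor, only a
factor holomorphic in \<open>u\<close> remains.\<close>

lemma fock_exponent:
  "of_real (exp (- (norm (\<zeta> + u))\<^sup>2)) * exp (herm \<zeta> (\<zeta> + u)) = of_real (exp (- (norm u)\<^sup>2)) * exp (- herm u (\<zeta> :: complex ^ 'k::finite))"
proof -
  have "complex_of_real (- (norm (\<zeta> + u))\<^sup>2) + herm \<zeta> (\<zeta> + u) = of_real (- (norm u)\<^sup>2) + - herm u \<zeta>"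
    unfolding of_real_minus herm_self[symmetric] by (simp add: herm_add_left herm_add_right)
  then show ?thesis by (simp only: exp_of_real[symmetric] exp_add[symmetric])
qed

lemma fock_integrable:
  fixes g :: "complex ^ 'k::finite \<Rightarrow> complex"
  assumes g: "continuous_on UNIV g" and bound: "\<And>z. norm (g z) \<le> A * norm z ^ d" and A: "A \<ge> 0"
  shows "integrable lborel (\<lambda>z. exp (- (norm z)\<^sup>2) *\<^sub>R (g z * exp (herm \<zeta> z)))"
proof (rule Bochner_Integration.integrable_bound)
  show "integrable lborel (\<lambda>z :: complex ^ 'k. (A * fact d * exp ((norm \<zeta> + 1)\<^sup>2 / 2)) * exp (- (norm z)\<^sup>2 / 2))"
    by (intro integrable_mult_right integrable_gaussian_half)
  show "(\<lambda>z. exp (- (norm z)\<^sup>2) *\<^sub>R (g z * exp (herm \<zeta> z))) \<in> borel_measurable lborel"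
    using g by (auto intro!: borel_measurable_continuous_onI continuous_intros)
  show "AE z in lborel. norm (exp (- (norm z)\<^sup>2) *\<^sub>R (g z * exp (herm \<zeta> z)))
      \<le> norm ((A * fact d * exp ((norm \<zeta> + 1)\<^sup>2 / 2)) * exp (- (norm z)\<^sup>2 / 2))"
  proof (rule AE_I2)
    fix z :: "complex ^ 'k"
    have "Re (herm \<zeta> z) \<le> norm \<zeta> * norm z"
      using complex_Re_le_cmod[of "herm \<zeta> z"] norm_herm_le[of \<zeta> z] by linarith
    then have "exp (- (norm z)\<^sup>2) * (norm (g z) * exp (Re (herm \<zeta> z))) \<le> exp (- (norm z)\<^sup>2) * ((A * norm z ^ d) * exp (norm \<zeta> * norm z))"
      by (intro mult_left_mono mult_mono bound) (auto simp: A)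
    then have "norm (exp (- (norm z)\<^sup>2) *\<^sub>R (g z * exp (herm \<zeta> z))) \<le> exp (- (norm z)\<^sup>2) * ((A * norm z ^ d) * exp (norm \<zeta> * norm z))"
      by (simp add: norm_mult)
    also have "\<dots> = A * (exp (- (norm z)\<^sup>2) * (norm z ^ d * exp (norm \<zeta> * norm z)))" by simp
    also have "\<dots> \<le> A * (fact d * exp ((norm \<zeta> + 1)\<^sup>2 / 2) * exp (- (norm z)\<^sup>2 / 2))"
      by (intro mult_left_mono poly_exp_gaussian_bound A) simp
    finally show "norm (exp (- (norm z)\<^sup>2) *\<^sub>R (g z * exp (herm \<zeta> z)))
      \<le> norm ((A * fact d * exp ((norm \<zeta> + 1)\<^sup>2 / 2)) * exp (- (norm z)\<^sup>2 / 2))"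
      using A by (simp add: mult.assoc abs_mult)
  qed
qed

text \<open>After the translation \<open>z = \<zeta> + u\<close> the integrand is a radial Gaussian times the function
\<open>g (\<zeta> + u) * exp (- \<langle>u, \<zeta>\<rangle>)\<close>, holomorphic along lines. Averaging over the circle through \<open>u\<close> replaces that
function by its value \<open>g \<zeta>\<close> at \<open>u = 0\<close>.\<close>

lemma fock_reproducing:
  fixes g :: "complex ^ 'k::finite \<Rightarrow> complex"
  assumes g: "continuous_on UNIV g" and sl: "slice_holomorphic g UNIV"
    and bound: "\<And>z. norm (g z) \<le> A * norm z ^ d" and A: "A \<ge> 0"
  shows "(\<integral>z. exp (- (norm z)\<^sup>2) *\<^sub>R (g z * exp (herm \<zeta> z)) \<partial>lborel) = of_real (pi ^ CARD('k)) * g \<zeta>"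
proof -
  define f where "f z = exp (- (norm z)\<^sup>2) *\<^sub>R (g z * exp (herm \<zeta> z))" for z
  have fi: "integrable lborel f" unfolding f_def by (rule fock_integrable[OF g bound A])
  then have [measurable]: "f \<in> borel_measurable borel" by simp
  have shift: "distr lborel borel ((+) \<zeta>) = (lborel :: (complex ^ 'k) measure)" by (rule lborel_distr_plus)
  have fi': "integrable lborel (\<lambda>u. f (\<zeta> + u))"
    by (subst integrable_distr_eq[symmetric, where N = borel]) (auto simp: shift fi)
  have "(\<integral>z. f z \<partial>lborel) = (\<integral>u. f (\<zeta> + u) \<partial>lborel)"
    by (subst shift[symmetric], subst integral_distr) auto
  also have "\<dots> = (\<integral>u. (\<integral>t. f (\<zeta> + ecirc t *s u) \<partial>unit_arc) \<partial>lborel)"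
    by (rule integral_circle_average[OF fi'])
  also have "\<dots> = (\<integral>u. of_real (exp (- (norm u)\<^sup>2)) * g \<zeta> \<partial>(lborel :: (complex ^ 'k) measure))"
  proof (rule Bochner_Integration.integral_cong[OF refl])
    fix u :: "complex ^ 'k"
    define F where "F s = g (\<zeta> + s *s u) * exp (- (s * herm u \<zeta>))" for s
    have "f (\<zeta> + ecirc t *s u) = of_real (exp (- (norm u)\<^sup>2)) * F (of_real 1 * ecirc t)" for t
    proof -
      have "f (\<zeta> + ecirc t *s u) = g (\<zeta> + ecirc t *s u) * (of_real (exp (- (norm (\<zeta> + ecirc t *s u))\<^sup>2)) * exp (herm \<zeta> (\<zeta> + ecirc t *s u)))"
        by (simp add: f_def scaleR_conv_of_real)
      then show ?thesis unfolding fock_exponent by (simp add: F_def norm_vector_scale herm_scale_left)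
    qed
    moreover have "(\<integral>t. F (of_real 1 * ecirc t) \<partial>unit_arc) = F 0"
    proof (rule circle_mean_value)
      have h: "F holomorphic_on UNIV"
        unfolding F_def using sl by (auto intro!: holomorphic_intros simp: slice_holomorphic_def)
      then show "F holomorphic_on ball 0 1" by (rule holomorphic_on_subset) simp
      show "continuous_on (cball 0 1) F"
        by (rule continuous_on_subset[OF holomorphic_on_imp_continuous_on[OF h]]) simp
    qed simp
    ultimately show "(\<integral>t. f (\<zeta> + ecirc t *s u) \<partial>unit_arc) = of_real (exp (- (norm u)\<^sup>2)) * g \<zeta>"
      by (simp add: F_def)
  qed
  also have "\<dots> = (\<integral>u. complex_of_real (exp (- (norm u)\<^sup>2)) \<partial>(lborel :: (complex ^ 'k) measure)) * g \<zeta>"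
    by (rule integral_mult_left_zero)
  also have "(\<integral>u. complex_of_real (exp (- (norm u)\<^sup>2)) \<partial>(lborel :: (complex ^ 'k) measure)) = of_real (pi ^ CARD('k))"
    by (simp only: integral_complex_of_real integral_gaussian DIM_complex_vec) (simp add: powr_realpow)
  finally show ?thesis by (simp add: f_def)
qed

lemma taylor_coeff_exp: "taylor_coeff d (\<lambda>s. exp (s * y)) = y ^ d / fact d"
proof -
  have "(deriv ^^ d) (\<lambda>s. exp (s * y)) = (\<lambda>s. y ^ d * exp (s * y))"
  proof (induction d)
    case (Suc d)
    have "deriv (\<lambda>s. y ^ d * exp (s * y)) s = y ^ Suc d * exp (s * y)" for s
      by (rule DERIV_imp_deriv) (auto intro!: derivative_eq_intros)
    then show ?case by (simp only: funpow.simps o_apply Suc.IH)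
  qed simp
  then show ?thesis by (simp add: taylor_coeff_def)
qed

definition homogeneous :: "nat \<Rightarrow> (complex ^ 'k \<Rightarrow> complex) \<Rightarrow> bool" where
  "homogeneous d g \<longleftrightarrow> (\<forall>c z. g (c *s z) = c ^ d * g z)"

lemma homogeneous_bound:
  fixes g :: "complex ^ 'k::finite \<Rightarrow> complex"
  assumes g: "continuous_on UNIV g" and hom: "homogeneous d g"
  obtains A where "A \<ge> 0" "\<And>z. norm (g z) \<le> A * norm z ^ d"
proof -
  have "bounded (g ` sphere 0 1)"
    by (intro compact_imp_bounded compact_continuous_image continuous_on_subset[OF g]) auto
  then obtain B where "\<forall>x\<in>g ` sphere 0 1. norm x \<le> B" unfolding bounded_iff by blast
  then have B: "\<And>z. norm z = 1 \<Longrightarrow> norm (g z) \<le> B" by simp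
  \<comment> \<open>the value \<open>g 0\<close> is needed at \<open>z = 0\<close> when \<open>d = 0\<close>\<close>
  have "norm (g z) \<le> max (max B (norm (g 0))) 0 * norm z ^ d" for z
  proof (cases "z = 0")
    case True
    have "g 0 = 0 ^ d * g 0" using hom unfolding homogeneous_def by (metis vector_space_over_itself.scale_zero_left vec.scale_zero_left)
    then show ?thesis using True by (auto simp: power_0_left split: if_splits)
  next
    case False
    define v where "v = of_real (1 / norm z) *s z"
    have v: "norm v = 1" using False by (simp add: v_def norm_vector_scale norm_divide)
    have "z = of_real (norm z) *s v" using False by (simp add: v_def vec_eq_iff)
    then have "g z = of_real (norm z) ^ d * g v" using hom unfolding homogeneous_def by metis
    then have "norm (g z) = norm (g v) * norm z ^ d" by (simp add: norm_mult norm_power)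
    also have "\<dots> \<le> max (max B (norm (g 0))) 0 * norm z ^ d"
      using B[OF v] by (intro mult_right_mono) auto
    finally show ?thesis .
  qed
  then show ?thesis by (intro that[of "max (max B (norm (g 0))) 0"]) auto
qed

text \<open>Apply the Fock reproducing formula at \<open>ecirc t *s \<zeta>\<close> and divide by \<open>ecirc t ^ d\<close>. Homogeneity makes the right
hand side independent of \<open>t\<close>, while averaging the left hand side over \<open>t\<close> extracts the term of degree \<open>d\<close> of
the exponential series.\<close>

lemma fock_homogeneous:
  fixes g :: "complex ^ 'k::finite \<Rightarrow> complex"
  assumes g: "continuous_on UNIV g" and sl: "slice_holomorphic g UNIV" and hom: "homogeneous d g"
  shows "(\<integral>z. exp (- (norm z)\<^sup>2) *\<^sub>R (g z * herm \<zeta> z ^ d) \<partial>lborel) = of_real (fact d * pi ^ CARD('k)) * g \<zeta>"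
proof -
  interpret P: finite_measure unit_arc by (rule finite_measure_unit_arc)
  interpret PL: pair_sigma_finite unit_arc "lborel :: (complex ^ 'k) measure" ..
  obtain A where A: "A \<ge> 0" "\<And>z. norm (g z) \<le> A * norm z ^ d" using homogeneous_bound[OF g hom] by blast
  define f where "f t z = exp (- (norm z)\<^sup>2) *\<^sub>R (g z * exp (ecirc t * herm \<zeta> z)) / ecirc t ^ d" for t and z :: "complex ^ 'k"
  have fz: "integrable lborel (f t)" "(\<integral>z. f t z \<partial>lborel) = of_real (pi ^ CARD('k)) * g \<zeta>" for t
  proof -
    have f_eq: "f t = (\<lambda>z. exp (- (norm z)\<^sup>2) *\<^sub>R (g z * exp (herm (ecirc t *s \<zeta>) z)) / ecirc t ^ d)"
      by (simp add: f_def herm_scale_left fun_eq_iff)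
    show "integrable lborel (f t)"
      unfolding f_eq by (intro integrable_divide_zero fock_integrable[OF g A(2) A(1)])
    have "(\<integral>z. f t z \<partial>lborel) = of_real (pi ^ CARD('k)) * g (ecirc t *s \<zeta>) / ecirc t ^ d"
      unfolding f_eq using fock_reproducing[OF g sl A(2) A(1), of "ecirc t *s \<zeta>"] by simp
    then show "(\<integral>z. f t z \<partial>lborel) = of_real (pi ^ CARD('k)) * g \<zeta>"
      using hom by (simp add: homogeneous_def)
  qed
  have cont: "continuous_on UNIV (\<lambda>p. f (fst p) (snd p))"
    unfolding f_def by (intro continuous_intros continuous_on_compose2[OF g]) auto
  have fm: "(\<lambda>(t, z). f t z) \<in> borel_measurable (unit_arc \<Otimes>\<^sub>M lborel)"
    using borel_measurable_continuous_onI[OF cont]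
    by (simp add: case_prod_unfold measurable_cong_sets[OF sets_pair_measure_cong[OF sets_unit_arc sets_lborel] refl] borel_prod)
  define B where "B = (\<integral>z. A * fact d * exp ((norm \<zeta> + 1)\<^sup>2 / 2) * exp (- (norm (z :: complex ^ 'k))\<^sup>2 / 2) \<partial>lborel)"
  have nb: "norm (f t z) \<le> A * fact d * exp ((norm \<zeta> + 1)\<^sup>2 / 2) * exp (- (norm z)\<^sup>2 / 2)" for t z
  proof -
    have "Re (ecirc t * herm \<zeta> z) \<le> norm \<zeta> * norm z"
      using complex_Re_le_cmod[of "ecirc t * herm \<zeta> z"] norm_herm_le[of \<zeta> z] by (simp add: norm_mult)
    then have "exp (- (norm z)\<^sup>2) * (norm (g z) * exp (Re (ecirc t * herm \<zeta> z))) \<le> exp (- (norm z)\<^sup>2) * ((A * norm z ^ d) * exp (norm \<zeta> * norm z))"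
      by (intro mult_left_mono mult_mono A) (auto simp: A)
    moreover have "norm (f t z) = exp (- (norm z)\<^sup>2) * (norm (g z) * exp (Re (ecirc t * herm \<zeta> z)))"
      by (simp only: f_def norm_divide norm_scaleR norm_mult norm_power norm_ecirc norm_exp_eq_Re power_one div_by_1 abs_exp_cancel)
    ultimately have "norm (f t z) \<le> exp (- (norm z)\<^sup>2) * ((A * norm z ^ d) * exp (norm \<zeta> * norm z))" by simp
    also have "\<dots> = A * (exp (- (norm z)\<^sup>2) * (norm z ^ d * exp (norm \<zeta> * norm z)))" by simp
    also have "\<dots> \<le> A * (fact d * exp ((norm \<zeta> + 1)\<^sup>2 / 2) * exp (- (norm z)\<^sup>2 / 2))"
      by (intro mult_left_mono poly_exp_gaussian_bound A) simp
    finally show ?thesis by (simp add: mult.assoc)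
  qed
  have int: "integrable (unit_arc \<Otimes>\<^sub>M lborel) (\<lambda>(t, z). f t z)"
  proof (rule PL.Fubini_integrable[OF fm])
    have m: "(\<lambda>t. \<integral>z. norm (f t z) \<partial>lborel) \<in> borel_measurable unit_arc"
      by (rule lborel.borel_measurable_lebesgue_integral) (use fm in measurable)
    have "norm (\<integral>z. norm (f t z) \<partial>lborel) \<le> B" for t
    proof -
      have "(\<integral>z. norm (f t z) \<partial>lborel) \<le> B" unfolding B_def
        by (rule integral_mono[OF integrable_norm[OF fz(1)] integrable_mult_right[OF integrable_gaussian_half] nb])
      then show ?thesis by (simp add: integral_nonneg_AE)
    qed
    then show "integrable unit_arc (\<lambda>t. \<integral>z. norm (case (t, z) of (t, z) \<Rightarrow> f t z) \<partial>lborel)"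
      using P.integrable_const_bound[OF _ m, of B] by simp
    show "AE t in unit_arc. integrable lborel (\<lambda>z. case (t, z) of (t, z) \<Rightarrow> f t z)" using fz(1) by simp
  qed
  have "of_real (pi ^ CARD('k)) * g \<zeta> = (\<integral>t. (\<integral>z. f t z \<partial>lborel) \<partial>unit_arc)" unfolding fz(2) by simp
  also have "\<dots> = (\<integral>z. (\<integral>t. f t z \<partial>unit_arc) \<partial>lborel)" by (rule PL.Fubini_integral[OF int, symmetric])
  also have "\<dots> = (\<integral>z. exp (- (norm z)\<^sup>2) *\<^sub>R (g z * herm \<zeta> z ^ d) / fact d \<partial>lborel)"
  proof (rule Bochner_Integration.integral_cong[OF refl])
    fix z :: "complex ^ 'k"
    have "(\<integral>t. (\<lambda>s. exp (s * herm \<zeta> z)) (of_real 1 * ecirc t) / ecirc t ^ d \<partial>unit_arc) = of_real 1 ^ d * taylor_coeff d (\<lambda>s. exp (s * herm \<zeta> z))"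
      by (rule taylor_coeff_circle) (auto intro!: continuous_intros holomorphic_intros)
    then have "(\<integral>t. exp (ecirc t * herm \<zeta> z) / ecirc t ^ d \<partial>unit_arc) = herm \<zeta> z ^ d / fact d" by (simp add: taylor_coeff_exp)
    moreover have "(\<lambda>t. f t z) = (\<lambda>t. (exp (- (norm z)\<^sup>2) *\<^sub>R g z) * (exp (ecirc t * herm \<zeta> z) / ecirc t ^ d))" by (simp add: f_def)
    ultimately have "(\<integral>t. f t z \<partial>unit_arc) = (exp (- (norm z)\<^sup>2) *\<^sub>R g z) * (herm \<zeta> z ^ d / fact d)"
      by (simp only: integral_mult_right_zero)
    then show "(\<integral>t. f t z \<partial>unit_arc) = exp (- (norm z)\<^sup>2) *\<^sub>R (g z * herm \<zeta> z ^ d) / fact d" by simp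
  qed
  also have "\<dots> = (\<integral>z. exp (- (norm z)\<^sup>2) *\<^sub>R (g z * herm \<zeta> z ^ d) \<partial>lborel) / fact d" by (rule integral_divide_zero)
  finally show ?thesis by (simp add: field_simps)
qed

text \<open>The integrand \<open>g z * \<langle>\<zeta>, z\<rangle> ^ d\<close> scales with the power \<open>2 d\<close> of a real factor, that is with \<open>T powr d\<close> under
scaling by \<open>sqrt T\<close>, so the Gaussian formula transfers to the ball.\<close>

lemma bergman_homogeneous:
  fixes g :: "complex ^ 'k::finite \<Rightarrow> complex"
  assumes g: "continuous_on UNIV g" and sl: "slice_holomorphic g UNIV" and hom: "homogeneous d g" and \<nu>: "\<nu> > 0"
  shows "of_real (Gamma (real d + real CARD('k) + \<nu>)) *
      (\<integral>z. (indicator (ball 0 1) z * (1 - (norm z)\<^sup>2) powr (\<nu> - 1)) *\<^sub>R (g z * herm \<zeta> z ^ d) \<partial>lborel)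
    = of_real (Gamma \<nu> * fact d * pi ^ CARD('k)) * g \<zeta>"
proof -
  obtain A where A: "A \<ge> 0" "\<And>z. norm (g z) \<le> A * norm z ^ d" using homogeneous_bound[OF g hom] by blast
  have int: "integrable lborel (\<lambda>z. exp (- (norm z)\<^sup>2) *\<^sub>R (g z * herm \<zeta> z ^ d))"
  proof -
    have "continuous_on UNIV (\<lambda>z. g z * herm \<zeta> z ^ d)" by (intro continuous_intros g)
    moreover have "norm (g z * herm \<zeta> z ^ d) \<le> (A * norm \<zeta> ^ d) * norm z ^ (2 * d)" for z
    proof -
      have "norm (g z * herm \<zeta> z ^ d) \<le> (A * norm z ^ d) * (norm \<zeta> * norm z) ^ d"
        unfolding norm_mult norm_power by (intro mult_mono A power_mono norm_herm_le) (auto simp: A)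
      moreover have "norm z ^ (2 * d) = norm z ^ d * norm z ^ d" by (simp add: mult_2 power_add)
      ultimately show ?thesis by (simp add: power_mult_distrib mult_ac)
    qed
    ultimately show ?thesis
      using fock_integrable[of "\<lambda>z. g z * herm \<zeta> z ^ d" "A * norm \<zeta> ^ d" "2 * d" 0] A(1) by (simp add: herm_def)
  qed
  have m: "(\<lambda>z. g z * herm \<zeta> z ^ d) \<in> borel_measurable borel"
    by (intro borel_measurable_continuous_onI continuous_intros g)
  have h: "g (sqrt T *\<^sub>R z) * herm \<zeta> (sqrt T *\<^sub>R z) ^ d = (T powr real d) *\<^sub>R (g z * herm \<zeta> z ^ d)" if T: "T > 0" for T and z :: "complex ^ 'k"
  proof -
    \<comment> \<open>the two factors \<open>g\<close> and \<open>\<langle>\<zeta>, z\<rangle> ^ d\<close> contribute \<open>sqrt T ^ d\<close> each\<close>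
    have s: "sqrt T *\<^sub>R z = of_real (sqrt T) *s z" by (simp add: vec_eq_iff) (simp add: scaleR_conv_of_real)
    have 1: "g (sqrt T *\<^sub>R z) = of_real (sqrt T) ^ d * g z" using hom unfolding s homogeneous_def by blast
    have 2: "complex_of_real (sqrt T) ^ d * of_real (sqrt T) ^ d = of_real (T powr real d)"
      using T by (simp add: powr_realpow of_real_power[symmetric] of_real_mult[symmetric] power_mult_distrib[symmetric] del: of_real_power of_real_mult)
    have "g (sqrt T *\<^sub>R z) * herm \<zeta> (sqrt T *\<^sub>R z) ^ d = (of_real (sqrt T) ^ d * g z) * (of_real (sqrt T) * herm \<zeta> z) ^ d"
      by (simp only: 1 herm_scaleR_right)
    also have "\<dots> = (of_real (sqrt T) ^ d * of_real (sqrt T) ^ d) * (g z * herm \<zeta> z ^ d)"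
      by (simp add: power_mult_distrib)
    finally show ?thesis by (simp only: 2 scaleR_conv_of_real[where 'a = complex])
  qed
  show ?thesis
    using gaussian_ball_integral[OF m \<nu> _ h int] unfolding fock_homogeneous[OF g sl hom] DIM_complex_vec
    by (simp add: scaleR_conv_of_real mult_ac)
qed

section \<open>Homogeneous expansion\<close>

lemma continuous_on_unit_arc_integral:
  fixes f :: "'a::metric_space \<Rightarrow> real \<Rightarrow> complex"
  assumes "continuous_on (U \<times> UNIV) (\<lambda>p. f (fst p) (snd p))"
  shows "continuous_on U (\<lambda>x. \<integral>t. f x t \<partial>unit_arc)"
proof -
  have "(\<integral>t. f x t \<partial>unit_arc) = integral (cbox 0 1) (f x)" if "x \<in> U" for x
  proof -
    have "continuous_on UNIV (f x)"
      by (rule continuous_on_compose2[OF assms, of UNIV "\<lambda>t. (x, t)", simplified]) (use that in \<open>auto intro!: continuous_intros\<close>)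
    then show ?thesis by (simp add: unit_arc_integral)
  qed
  moreover have "continuous_on (U \<times> cbox 0 1) (\<lambda>(x, t). f x t)"
    using continuous_on_subset[OF assms, of "U \<times> cbox 0 1"] by (auto simp: case_prod_unfold)
  then have "continuous_on U (\<lambda>x. integral (cbox 0 1) (f x))" by (rule integral_continuous_on_param)
  ultimately show ?thesis by (simp cong: continuous_on_cong)
qed

text \<open>Differentiation under the integral needs a jointly continuous derivative. Cauchy's formula for the
derivative on a small circle of fixed radius provides it.\<close>

lemma holomorphic_on_unit_arc_integral:
  fixes f :: "complex \<Rightarrow> real \<Rightarrow> complex"
  assumes U: "open U" and cont: "continuous_on (U \<times> UNIV) (\<lambda>p. f (fst p) (snd p))"
    and hol: "\<And>t. (\<lambda>s. f s t) holomorphic_on U"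
  shows "(\<lambda>s. \<integral>t. f s t \<partial>unit_arc) holomorphic_on U"
proof -
  have "(\<lambda>s. \<integral>t. f s t \<partial>unit_arc) field_differentiable (at s0)" if s0: "s0 \<in> U" for s0
  proof -
    obtain R where R: "R > 0" "cball s0 R \<subseteq> U" using U s0 open_contains_cball by blast
    define r where "r = R / 2"
    have r: "r > 0" using R by (simp add: r_def)
    have sub: "s + h \<in> U" if "s \<in> ball s0 r" "h \<in> cball 0 r" for s h
    proof -
      have "dist s0 (s + h) \<le> dist s0 s + norm h" using norm_triangle_ineq[of "s0 - s" "- h"] by (simp add: dist_norm algebra_simps)
      then show ?thesis using that R(2) by (auto simp: r_def dist_norm)
    qed
    \<comment> \<open>Cauchy's formula for the derivative of \<open>f\<close> in its first argument\<close>
    define D where "D s t = (\<integral>\<tau>. f (s + of_real r * ecirc \<tau>) t / ecirc \<tau> ^ 1 \<partial>unit_arc) / of_real r" for s t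
    have der: "((\<lambda>s. f s t) has_field_derivative D s t) (at s within ball s0 r)" if s: "s \<in> ball s0 r" for s t
    proof -
      have "((\<lambda>s. f s t) \<circ> (\<lambda>h. s + h)) holomorphic_on cball 0 r"
        by (rule holomorphic_on_compose_gen[OF _ hol], intro holomorphic_intros) (use sub[OF s] in blast)
      then have h: "(\<lambda>h. f (s + h) t) holomorphic_on cball 0 r" by (simp add: o_def)
      have "(\<integral>\<tau>. (\<lambda>h. f (s + h) t) (of_real r * ecirc \<tau>) / ecirc \<tau> ^ 1 \<partial>unit_arc) = of_real r ^ 1 * taylor_coeff 1 (\<lambda>h. f (s + h) t)"
        by (rule taylor_coeff_circle) (use h r in \<open>auto intro: holomorphic_on_imp_continuous_on holomorphic_on_subset\<close>)
      then have D: "D s t = deriv (\<lambda>h. f (s + h) t) 0" using r by (simp add: D_def taylor_coeff_def)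
      have sU: "s \<in> U" using sub[OF s, of 0] r by simp
      have d1: "((\<lambda>s. f s t) has_field_derivative deriv (\<lambda>s. f s t) s) (at s)"
        by (rule holomorphic_derivI[OF hol U sU])
      then have "((\<lambda>h. f (s + h) t) has_field_derivative deriv (\<lambda>s. f s t) s) (at 0)"
        using DERIV_shift[of "\<lambda>s. f s t" "deriv (\<lambda>s. f s t) s" 0 s] by (simp add: add.commute)
      then have "deriv (\<lambda>h. f (s + h) t) 0 = deriv (\<lambda>s. f s t) s" by (rule DERIV_imp_deriv)
      then show ?thesis using d1 D by (auto intro: has_field_derivative_at_within)
    qed
    have cD: "continuous_on (ball s0 r \<times> UNIV) (\<lambda>p. D (fst p) (snd p))"
    proof -
      have "continuous_on ((ball s0 r \<times> UNIV) \<times> UNIV)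
          (\<lambda>x. (\<lambda>p. f (fst p) (snd p)) (fst (fst x) + of_real r * ecirc (snd x), snd (fst x)))"
        by (rule continuous_on_compose2[OF cont]) (use r sub in \<open>auto simp: norm_mult intro!: continuous_intros\<close>)
      then have "continuous_on ((ball s0 r \<times> UNIV) \<times> UNIV)
          (\<lambda>x. f (fst (fst x) + of_real r * ecirc (snd x)) (snd (fst x)) / ecirc (snd x) ^ 1)"
        by (intro continuous_intros) auto
      then have "continuous_on (ball s0 r \<times> UNIV) (\<lambda>p. \<integral>\<tau>. f (fst p + of_real r * ecirc \<tau>) (snd p) / ecirc \<tau> ^ 1 \<partial>unit_arc)"
        by (rule continuous_on_unit_arc_integral)
      then show ?thesis
        unfolding D_def by (rule continuous_on_divide[OF _ continuous_on_const]) (use r in auto)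
    qed
    have ball: "ball s0 r \<subseteq> U" using sub[of _ 0] r by force
    have ct: "continuous_on UNIV (f s)" if "s \<in> U" for s
      by (rule continuous_on_compose2[OF cont, of UNIV "\<lambda>t. (s, t)", simplified]) (use that in \<open>auto intro!: continuous_intros\<close>)
    have "(\<lambda>s. integral (cbox 0 1) (f s)) holomorphic_on ball s0 r"
    proof (rule leibniz_rule_holomorphic[OF der])
      show "f s integrable_on cbox 0 1" if "s \<in> ball s0 r" for s
        by (rule integrable_continuous) (rule continuous_on_subset[OF ct], use that ball in auto)
      show "continuous_on (ball s0 r \<times> cbox 0 1) (\<lambda>(s, t). D s t)"
        using continuous_on_subset[OF cD, of "ball s0 r \<times> cbox 0 1"] by (auto simp: case_prod_unfold)
    qed auto
    then have "(\<lambda>s. \<integral>t. f s t \<partial>unit_arc) holomorphic_on ball s0 r"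
      by (rule holomorphic_transform) (use ball ct in \<open>auto simp: unit_arc_integral\<close>)
    then show ?thesis
      using r by (auto simp: holomorphic_on_def intro!: field_differentiable_within_open[of s0 "ball s0 r", THEN iffD1])
  qed
  then show ?thesis by (auto simp: holomorphic_on_def intro: field_differentiable_at_within)
qed

text \<open>The component of degree \<open>d\<close> of the expansion of \<open>g\<close> at 0. A Taylor coefficient at 0 only depends on the germ,
so this is defined for all \<open>z\<close> even when \<open>g\<close> lives on the ball.\<close>

definition homogeneous_part :: "nat \<Rightarrow> (complex ^ 'k \<Rightarrow> complex) \<Rightarrow> complex ^ 'k \<Rightarrow> complex" where
  "homogeneous_part d g z = taylor_coeff d (\<lambda>s. g (s *s z))"

lemma slice_holomorphic_radial:
  fixes z :: "complex ^ 'k::finite"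
  assumes sl: "slice_holomorphic g (ball 0 1)" and r: "r * norm z \<le> 1"
  shows "(\<lambda>s. g (s *s z)) holomorphic_on ball 0 r"
proof (cases "z = 0")
  case True
  then show ?thesis by simp
next
  case False
  have "(\<lambda>s. g (0 + s *s z)) holomorphic_on {s. 0 + s *s z \<in> ball 0 1}"
    using sl unfolding slice_holomorphic_def by blast
  moreover have "norm s * norm z < 1" if "norm s < r" for s
  proof -
    have "norm s * norm z < r * norm z" using that False by (intro mult_strict_right_mono) auto
    then show ?thesis using r by linarith
  qed
  ultimately show ?thesis by (auto simp: norm_vector_scale elim!: holomorphic_on_subset)
qed

lemma homogeneous_part_homogeneous:
  fixes g :: "complex ^ 'k::finite \<Rightarrow> complex"
  assumes sl: "slice_holomorphic g (ball 0 1)"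
  shows "homogeneous d (homogeneous_part d g)"
  unfolding homogeneous_def
proof (intro allI)
  fix c :: complex and z :: "complex ^ 'k"
  \<comment> \<open>the summand 1 covers \<open>z = 0\<close>\<close>
  define r where "r = 1 / (norm z + 1)"
  have rp: "r > 0" by (simp add: r_def add_nonneg_pos)
  have F: "(\<lambda>s. g (s *s z)) holomorphic_on ball 0 r"
    by (rule slice_holomorphic_radial[OF sl]) (simp add: r_def divide_simps add_nonneg_pos)
  define r' where "r' = r / (norm c + 1)"
  have r': "r' > 0" using rp by (simp add: r'_def add_nonneg_pos)
  have "(deriv ^^ d) (\<lambda>s. (\<lambda>s. g (s *s z)) (c * s)) 0 = c ^ d * (deriv ^^ d) (\<lambda>s. g (s *s z)) (c * 0)"
  proof (rule higher_deriv_compose_linear[OF F, of "ball 0 r'"])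
    fix w assume "w \<in> ball (0::complex) r'"
    then have "norm w < r'" by simp
    then have "(norm c + 1) * norm w < (norm c + 1) * r'" by (intro mult_strict_left_mono) (auto simp: add_nonneg_pos)
    also have "\<dots> = r" by (simp add: r'_def add_nonneg_eq_0_iff)
    finally have "norm c * norm w + norm w < r" by (simp add: distrib_right)
    then have "norm c * norm w < r" using norm_ge_zero[of w] by linarith
    then show "c * w \<in> ball 0 r" by (simp add: norm_mult)
  qed (use r' in auto)
  then show "homogeneous_part d g (c *s z) = c ^ d * homogeneous_part d g z"
    by (simp add: homogeneous_part_def taylor_coeff_def vector_smult_assoc mult.commute)
qed

lemma homogeneous_part_circle:
  fixes z :: "complex ^ 'k::finite"
  assumes sl: "slice_holomorphic g (ball 0 1)" and r: "r > 0" "r * norm z < 1"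
  shows "(\<integral>t. g ((of_real r * ecirc t) *s z) / ecirc t ^ d \<partial>unit_arc) = of_real r ^ d * homogeneous_part d g z"
  unfolding homogeneous_part_def
proof (rule taylor_coeff_circle[OF _ _ r(1)])
  obtain R where R: "r < R" "R * norm z \<le> 1"
  proof (cases "z = 0")
    case False
    then show ?thesis using r that[of "1 / norm z"] by (simp add: field_simps)
  qed (use that[of "r + 1"] in auto)
  have h: "(\<lambda>s. g (s *s z)) holomorphic_on ball 0 R" by (rule slice_holomorphic_radial[OF sl R(2)])
  then show "(\<lambda>s. g (s *s z)) holomorphic_on ball 0 r" by (rule holomorphic_on_subset) (use R in auto)
  show "continuous_on (cball 0 r) (\<lambda>s. g (s *s z))"
    by (rule continuous_on_subset[OF holomorphic_on_imp_continuous_on[OF h]]) (use R in auto)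
qed

text \<open>Near a given \<open>z\<close>, one radius \<open>r\<close> serves for all neighbouring points, and the Cauchy integral over the circle of
that radius depends continuously, and along lines holomorphically, on the point.\<close>

lemma homogeneous_part_regular:
  fixes g :: "complex ^ 'k::finite \<Rightarrow> complex"
  assumes g: "continuous_on (ball 0 1) g" and sl: "slice_holomorphic g (ball 0 1)"
  shows "continuous_on UNIV (homogeneous_part d g)" "slice_holomorphic (homogeneous_part d g) UNIV"
proof -
  define f where "f r z t = g ((of_real r * ecirc t) *s z) / ecirc t ^ d" for r t and z :: "complex ^ 'k"
  have eq: "homogeneous_part d g z = (\<integral>t. f r z t \<partial>unit_arc) / of_real r ^ d" if "r > 0" "r * norm z < 1" for r z
    unfolding f_def homogeneous_part_circle[OF sl that] using that by simp
  have rad: "\<exists>r>0. r * R < 1" for R :: real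
    by (rule exI[of _ "1 / (\<bar>R\<bar> + 1)"]) (auto simp: divide_simps add_nonneg_pos)
  have cf: "continuous_on ({z. r * norm z < 1} \<times> UNIV) (\<lambda>p. f r (fst p) (snd p))" if "r > 0" for r
    unfolding f_def by (intro continuous_intros continuous_on_compose2[OF g]) (use that in \<open>auto simp: norm_vector_scale norm_mult\<close>)
  have op: "open {z :: complex ^ 'k. r * norm z < 1}" for r by (intro open_Collect_less continuous_intros)
  show "continuous_on UNIV (homogeneous_part d g)"
  proof (rule continuous_at_imp_continuous_on, rule ballI)
    fix z :: "complex ^ 'k"
    obtain r where r: "r > 0" "r * norm z < 1" using rad by blast
    have "continuous_on {z. r * norm z < 1} (\<lambda>z. (\<integral>t. f r z t \<partial>unit_arc) / of_real r ^ d)"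
      by (intro continuous_intros continuous_on_unit_arc_integral cf r) (use r in auto)
    then have "continuous_on {z. r * norm z < 1} (homogeneous_part d g)"
      by (rule continuous_on_eq) (use eq r in auto)
    then show "isCont (homogeneous_part d g) z"
      using op r(2) by (simp add: continuous_on_eq_continuous_at)
  qed
  show "slice_holomorphic (homogeneous_part d g) UNIV"
    unfolding slice_holomorphic_def
  proof (intro allI)
    fix a u :: "complex ^ 'k"
    have "(\<lambda>s. homogeneous_part d g (a + s *s u)) field_differentiable (at s0)" for s0
    proof -
      obtain r where r: "r > 0" "r * norm (a + s0 *s u) < 1" using rad by blast
      define U where "U = {s. r * norm (a + s *s u) < 1}"
      have U: "open U" unfolding U_def by (intro open_Collect_less continuous_intros)
      have s0: "s0 \<in> U" using r by (simp add: U_def)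
      have "(\<lambda>s. \<integral>t. f r (a + s *s u) t \<partial>unit_arc) holomorphic_on U"
      proof (rule holomorphic_on_unit_arc_integral[OF U])
        show "continuous_on (U \<times> UNIV) (\<lambda>p. f r (a + fst p *s u) (snd p))"
          by (rule continuous_on_compose2[OF cf[OF r(1)], of _ "\<lambda>p. (a + fst p *s u, snd p)", simplified])
            (auto simp: U_def intro!: continuous_intros)
        fix t
        define c where "c = of_real r * ecirc t"
        have "(\<lambda>s. g (c *s a + s *s (c *s u))) holomorphic_on {s. c *s a + s *s (c *s u) \<in> ball 0 1}"
          using sl unfolding slice_holomorphic_def by blast
        moreover have lin: "c *s a + s *s (c *s u) = c *s (a + s *s u)" for s
          by (simp add: vec_eq_iff algebra_simps)
        moreover have "norm (c *s v) = r * norm v" for v :: "complex ^ 'k"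
          unfolding norm_vector_scale using r(1) by (simp add: c_def norm_mult)
        then have "U \<subseteq> {s. c *s (a + s *s u) \<in> ball 0 1}" by (simp only: U_def mem_ball_0 order_refl)
        ultimately have "(\<lambda>s. g (c *s (a + s *s u))) holomorphic_on U"
          unfolding lin by (blast intro: holomorphic_on_subset)
        then show "(\<lambda>s. f r (a + s *s u) t) holomorphic_on U"
          unfolding f_def c_def by (intro holomorphic_intros) auto
      qed
      then have "(\<lambda>s. (\<integral>t. f r (a + s *s u) t \<partial>unit_arc) / of_real r ^ d) holomorphic_on U"
        by (intro holomorphic_intros) (use r in auto)
      then have "(\<lambda>s. homogeneous_part d g (a + s *s u)) holomorphic_on U"
        by (rule holomorphic_transform) (use eq r in \<open>auto simp: U_def\<close>)
      then show ?thesis using U s0 holomorphic_on_imp_differentiable_at by blast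
    qed
    then show "(\<lambda>s. homogeneous_part d g (a + s *s u)) holomorphic_on {s. a + s *s u \<in> UNIV}"
      by (auto simp: holomorphic_on_def intro: field_differentiable_at_within)
  qed
qed

lemma homogeneous_part_sums:
  fixes z :: "complex ^ 'k::finite"
  assumes sl: "slice_holomorphic g (ball 0 1)" and z: "norm z < 1"
  shows "(\<lambda>d. homogeneous_part d g z) sums g z"
proof -
  obtain R where R: "1 < R" "R * norm z \<le> 1"
  proof (cases "z = 0")
    case False
    then show ?thesis using z that[of "1 / norm z"] by (simp add: field_simps)
  qed (use that[of 2] in auto)
  have "(\<lambda>s. g (s *s z)) holomorphic_on ball 0 R" by (rule slice_holomorphic_radial[OF sl R(2)])
  from taylor_coeff_sums[OF this, of 1] R show ?thesis by (simp add: homogeneous_part_def)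
qed

section \<open>Weighted Bergman spaces of the ball\<close>

definition ball_weight :: "real \<Rightarrow> complex ^ 'k::finite \<Rightarrow> real" where
  "ball_weight \<nu> z = indicator (ball 0 1) z * (1 - (norm z)\<^sup>2) powr (\<nu> - 1)"

lemma ball_weight_scale: "norm c = 1 \<Longrightarrow> ball_weight \<nu> (c *s z) = ball_weight \<nu> z"
  by (simp add: ball_weight_def norm_vector_scale indicator_def)

text \<open>Replacing \<open>z\<close> by \<open>ecirc t *s z\<close> multiplies \<open>\<langle>\<zeta>, z\<rangle> ^ d\<close> by \<open>ecirc t ^ (- d)\<close>. Hence averaging over the circle projects
\<open>g\<close> to its homogeneous part of degree \<open>d\<close>, to which the homogeneous case applies.\<close>

lemma bergman_power:
  fixes g :: "complex ^ 'k::finite \<Rightarrow> complex"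
  assumes g: "continuous_on (ball 0 1) g" and sl: "slice_holomorphic g (ball 0 1)" and \<nu>: "\<nu> > 0"
    and int: "integrable lborel (\<lambda>z. ball_weight \<nu> z *\<^sub>R g z)"
  shows "integrable lborel (\<lambda>z. ball_weight \<nu> z *\<^sub>R (g z * herm \<zeta> z ^ d))"
    and "of_real (Gamma (real d + real CARD('k) + \<nu>)) * (\<integral>z. ball_weight \<nu> z *\<^sub>R (g z * herm \<zeta> z ^ d) \<partial>lborel)
       = of_real (Gamma \<nu> * fact d * pi ^ CARD('k)) * homogeneous_part d g \<zeta>"
proof -
  define f where "f z = ball_weight \<nu> z *\<^sub>R (g z * herm \<zeta> z ^ d)" for z
  have f_eq: "f z = (ball_weight \<nu> z *\<^sub>R g z) * herm \<zeta> z ^ d" for z by (simp add: f_def)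
  have hm: "(\<lambda>z :: complex ^ 'k. herm \<zeta> z ^ d) \<in> borel_measurable borel"
    by (intro borel_measurable_continuous_onI continuous_intros)
  show fi: "integrable lborel f"
  proof (rule Bochner_Integration.integrable_bound)
    show "integrable lborel (\<lambda>z. (norm \<zeta> ^ d) * norm (ball_weight \<nu> z *\<^sub>R g z))"
      using int by (intro integrable_mult_right integrable_norm)
    show "f \<in> borel_measurable lborel"
      unfolding f_eq[abs_def] using int hm by (intro borel_measurable_times) auto
    show "AE z in lborel. norm (f z) \<le> norm (norm \<zeta> ^ d * norm (ball_weight \<nu> z *\<^sub>R g z))"
    proof (rule AE_I2)
      fix z :: "complex ^ 'k"
      show "norm (f z) \<le> norm (norm \<zeta> ^ d * norm (ball_weight \<nu> z *\<^sub>R g z))"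
      proof (cases "norm z < 1")
        case True
        have "norm (herm \<zeta> z) \<le> norm \<zeta> * 1"
          by (rule order_trans[OF norm_herm_le mult_left_mono]) (use True in auto)
        then have "norm (herm \<zeta> z) ^ d \<le> norm \<zeta> ^ d" by (intro power_mono) auto
        then have "norm (ball_weight \<nu> z *\<^sub>R g z) * norm (herm \<zeta> z) ^ d \<le> norm (ball_weight \<nu> z *\<^sub>R g z) * norm \<zeta> ^ d"
          by (intro mult_left_mono) auto
        moreover have "norm (f z) = norm (ball_weight \<nu> z *\<^sub>R g z) * norm (herm \<zeta> z) ^ d"
          by (simp only: f_eq norm_mult norm_power)
        moreover have "norm (norm \<zeta> ^ d * norm (ball_weight \<nu> z *\<^sub>R g z)) = norm (ball_weight \<nu> z *\<^sub>R g z) * norm \<zeta> ^ d"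
          by (subst real_norm_def, subst abs_of_nonneg) (simp_all add: mult.commute)
        ultimately show ?thesis by (simp only:)
      qed (simp add: f_def ball_weight_def)
    qed
  qed
  have "(\<integral>z. f z \<partial>lborel) = (\<integral>z. (\<integral>t. f (ecirc t *s z) \<partial>unit_arc) \<partial>lborel)"
    by (rule integral_circle_average[OF fi])
  also have "\<dots> = (\<integral>z. ball_weight \<nu> z *\<^sub>R (homogeneous_part d g z * herm \<zeta> z ^ d) \<partial>lborel)"
  proof (rule Bochner_Integration.integral_cong[OF refl])
    fix z :: "complex ^ 'k"
    show "(\<integral>t. f (ecirc t *s z) \<partial>unit_arc) = ball_weight \<nu> z *\<^sub>R (homogeneous_part d g z * herm \<zeta> z ^ d)"
    proof (cases "norm z < 1")
      case True
      have ce: "cnj (ecirc t) = 1 / ecirc t" for t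
        using complex_norm_square[of "ecirc t"] by (simp add: field_simps)
      have "(\<lambda>t. f (ecirc t *s z)) = (\<lambda>t. (ball_weight \<nu> z *\<^sub>R herm \<zeta> z ^ d) * (g ((of_real 1 * ecirc t) *s z) / ecirc t ^ d))"
        by (simp add: f_def ball_weight_scale herm_scale_right ce power_divide power_mult_distrib fun_eq_iff mult_ac scaleR_conv_of_real)
      then have "(\<integral>t. f (ecirc t *s z) \<partial>unit_arc) = (ball_weight \<nu> z *\<^sub>R herm \<zeta> z ^ d) * (of_real 1 ^ d * homogeneous_part d g z)"
        using homogeneous_part_circle[OF sl, of 1 z d] True by (simp only: integral_mult_right_zero)
      then show ?thesis by (simp add: mult_ac)
    next
      case False
      then show ?thesis by (simp add: f_def ball_weight_scale) (simp add: ball_weight_def)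
    qed
  qed
  finally show "of_real (Gamma (real d + real CARD('k) + \<nu>)) * (\<integral>z. f z \<partial>lborel)
       = of_real (Gamma \<nu> * fact d * pi ^ CARD('k)) * homogeneous_part d g \<zeta>"
    using bergman_homogeneous[OF homogeneous_part_regular[OF g sl] homogeneous_part_homogeneous[OF sl] \<nu>, of d \<zeta>]
    by (simp add: ball_weight_def)
qed

lemma negative_binomial_sums:
  fixes y :: complex and s :: real
  assumes "norm y < 1"
  shows "(\<lambda>d. of_real (pochhammer s d / fact d) * y ^ d) sums (1 - y) powr of_real (- s)"
proof -
  have "(\<lambda>d. (of_real (- s) gchoose d) * (- y) ^ d) sums (1 + - y) powr of_real (- s)"
    by (rule gen_binomial_complex) (use assms in auto)
  moreover have "(of_real (- s) gchoose d) * (- y) ^ d = of_real (pochhammer s d / fact d) * y ^ d" for d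
  proof -
    have "(complex_of_real (- s) gchoose d) = (- 1) ^ d * (of_real (pochhammer s d) / fact d)"
      unfolding gbinomial_pochhammer pochhammer_of_real[symmetric] by simp
    moreover have "(- 1) ^ d * (- 1) ^ d = (1 :: complex)" by (simp flip: power_mult_distrib)
    ultimately show ?thesis unfolding power_minus[of y] by (simp add: mult_ac)
  qed
  ultimately show ?thesis by simp
qed

text \<open>The weighted Bergman kernel of the ball. Expand \<open>(1 - \<langle>\<zeta>, z\<rangle>) powr (- s)\<close> in its binomial series and integrate
term by term. The coefficient \<open>\<Gamma>(s + d) / (\<Gamma>(s) d!)\<close> of the series cancels the factors that depend
on \<open>d\<close> in \<open>bergman_power\<close>, so the terms add up to a constant times the sum of the homogeneous parts of \<open>g\<close>.\<close>

theorem weighted_bergman_reproducing: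
  fixes g :: "complex ^ 'k::finite \<Rightarrow> complex"
  assumes g: "continuous_on (ball 0 1) g" and sl: "slice_holomorphic g (ball 0 1)" and \<nu>: "\<nu> > 0"
    and int: "integrable lborel (\<lambda>z. ball_weight \<nu> z *\<^sub>R g z)" and \<zeta>: "norm \<zeta> < 1"
  defines "s \<equiv> real CARD('k) + \<nu>"
  shows "(\<integral>z. ball_weight \<nu> z *\<^sub>R (g z * (1 - herm \<zeta> z) powr of_real (- s)) \<partial>lborel)
       = of_real (pi ^ CARD('k) * Gamma \<nu> / Gamma s) * g \<zeta>"
proof -
  have s: "s > 0" using \<nu> by (simp add: s_def)
  define c where "c d = pochhammer s d / fact d" for d
  have c: "c d \<ge> 0" for d unfolding c_def using s by (intro divide_nonneg_nonneg pochhammer_nonneg) auto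
  define f where "f d z = complex_of_real (c d) * (ball_weight \<nu> z *\<^sub>R (g z * herm \<zeta> z ^ d))" for d z
  note bp = bergman_power[OF g sl \<nu> int, where \<zeta> = \<zeta>]
  have hb: "norm (herm \<zeta> z) \<le> norm \<zeta>" "norm (herm \<zeta> z) < 1" if "norm z < 1" for z
  proof -
    show "norm (herm \<zeta> z) \<le> norm \<zeta>" using norm_herm_le[of \<zeta> z] mult_left_mono[of "norm z" 1 "norm \<zeta>"] that by simp
    then show "norm (herm \<zeta> z) < 1" using \<zeta> by simp
  qed
  have csum: "summable (\<lambda>d. c d * norm \<zeta> ^ d)"
  proof -
    have ab: "summable (\<lambda>d. norm (complex_of_real (c d) * of_real (norm \<zeta>) ^ d))"
    proof -
      obtain r where r: "norm \<zeta> < r" "r < 1" using \<zeta> dense by blast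
      have "summable (\<lambda>d. complex_of_real (c d) * of_real r ^ d)"
        using negative_binomial_sums[of "of_real r" s] r norm_ge_zero[of \<zeta>] by (auto simp: c_def sums_iff)
      then show ?thesis by (rule powser_insidea) (use r norm_ge_zero[of \<zeta>] in auto)
    qed
    have "norm (complex_of_real (c d) * of_real (norm \<zeta>) ^ d) = c d * norm \<zeta> ^ d" for d
      using c by (simp add: norm_mult norm_power)
    with ab show ?thesis by simp
  qed
  have fi: "integrable lborel (f d)" for d
    unfolding f_def by (intro integrable_mult_right bp)
  have nf: "norm (f d z) \<le> (c d * norm \<zeta> ^ d) * norm (ball_weight \<nu> z *\<^sub>R g z)" for d z
  proof (cases "norm z < 1")
    case True
    have "norm (f d z) = c d * norm (herm \<zeta> z) ^ d * norm (ball_weight \<nu> z *\<^sub>R g z)"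
      using c by (simp add: f_def norm_mult norm_power)
    also have "\<dots> \<le> (c d * norm \<zeta> ^ d) * norm (ball_weight \<nu> z *\<^sub>R g z)"
      using c hb[OF True] by (intro mult_right_mono mult_left_mono power_mono) auto
    finally show ?thesis .
  qed (simp add: f_def ball_weight_def)
  have "(\<lambda>d. \<integral>z. f d z \<partial>lborel) sums (\<integral>z. (\<Sum>d. f d z) \<partial>lborel)"
  proof (rule sums_integral[OF fi])
    show "AE z in lborel. summable (\<lambda>d. norm (f d z))"
      by (rule AE_I2, rule summable_comparison_test'[OF summable_mult2[OF csum]]) (use nf in auto)
    show "summable (\<lambda>d. \<integral>z. norm (f d z) \<partial>lborel)"
    proof (rule summable_comparison_test'[OF summable_mult2[OF csum]])
      fix d
      have "(\<integral>z. norm (f d z) \<partial>lborel) \<le> (\<integral>z. (c d * norm \<zeta> ^ d) * norm (ball_weight \<nu> z *\<^sub>R g z) \<partial>lborel)"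
        by (rule integral_mono[OF integrable_norm[OF fi] integrable_mult_right[OF integrable_norm[OF int]] nf])
      then show "norm (\<integral>z. norm (f d z) \<partial>lborel) \<le> c d * norm \<zeta> ^ d * (\<integral>z. norm (ball_weight \<nu> z *\<^sub>R g z) \<partial>lborel)"
        by simp
    qed
  qed
  also have "(\<integral>z. (\<Sum>d. f d z) \<partial>lborel) = (\<integral>z. ball_weight \<nu> z *\<^sub>R (g z * (1 - herm \<zeta> z) powr of_real (- s)) \<partial>lborel)"
  proof (rule Bochner_Integration.integral_cong[OF refl])
    fix z :: "complex ^ 'k"
    show "(\<Sum>d. f d z) = ball_weight \<nu> z *\<^sub>R (g z * (1 - herm \<zeta> z) powr of_real (- s))"
    proof (cases "norm z < 1")
      case True
      have "(\<lambda>d. (ball_weight \<nu> z *\<^sub>R g z) * (of_real (c d) * herm \<zeta> z ^ d)) sums ((ball_weight \<nu> z *\<^sub>R g z) * (1 - herm \<zeta> z) powr of_real (- s))"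
        unfolding c_def by (intro sums_mult negative_binomial_sums hb True)
      moreover have "(ball_weight \<nu> z *\<^sub>R g z) * (of_real (c d) * herm \<zeta> z ^ d) = f d z" for d by (simp add: f_def mult_ac)
      ultimately show ?thesis by (simp add: sums_iff)
    qed (simp add: f_def ball_weight_def)
  qed
  finally have "(\<lambda>d. \<integral>z. f d z \<partial>lborel) sums (\<integral>z. ball_weight \<nu> z *\<^sub>R (g z * (1 - herm \<zeta> z) powr of_real (- s)) \<partial>lborel)" .
  moreover have "(\<integral>z. f d z \<partial>lborel) = of_real (pi ^ CARD('k) * Gamma \<nu> / Gamma s) * homogeneous_part d g \<zeta>" for d
  proof -
    have Gs: "Gamma s > 0" using s by (rule Gamma_real_pos)
    have Gd: "Gamma (s + real d) > 0" using s by (intro Gamma_real_pos) auto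
    have "pochhammer s d = Gamma (s + real d) / Gamma s" using s by (intro pochhammer_Gamma) (auto dest: nonpos_Ints_nonpos)
    then have cd: "c d * (Gamma \<nu> * fact d * pi ^ CARD('k)) = Gamma (s + real d) * (pi ^ CARD('k) * Gamma \<nu> / Gamma s)"
      by (simp add: c_def)
    have "of_real (Gamma (s + real d)) * (\<integral>z. f d z \<partial>lborel)
        = of_real (c d) * (of_real (Gamma (real d + real CARD('k) + \<nu>)) * (\<integral>z. ball_weight \<nu> z *\<^sub>R (g z * herm \<zeta> z ^ d) \<partial>lborel))"
      unfolding f_def integral_mult_right_zero by (simp add: s_def add_ac mult_ac)
    also have "\<dots> = of_real (c d * (Gamma \<nu> * fact d * pi ^ CARD('k))) * homogeneous_part d g \<zeta>"
      unfolding bp(2) by simp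
    also have "\<dots> = of_real (Gamma (s + real d)) * (of_real (pi ^ CARD('k) * Gamma \<nu> / Gamma s) * homogeneous_part d g \<zeta>)"
      unfolding cd by simp
    finally show ?thesis using Gd by (simp only: mult_cancel_left of_real_eq_0_iff) auto
  qed
  ultimately have "(\<lambda>d. of_real (pi ^ CARD('k) * Gamma \<nu> / Gamma s) * homogeneous_part d g \<zeta>) sums
      (\<integral>z. ball_weight \<nu> z *\<^sub>R (g z * (1 - herm \<zeta> z) powr of_real (- s)) \<partial>lborel)" by simp
  moreover have "(\<lambda>d. of_real (pi ^ CARD('k) * Gamma \<nu> / Gamma s) * homogeneous_part d g \<zeta>) sums
      (of_real (pi ^ CARD('k) * Gamma \<nu> / Gamma s) * g \<zeta>)"
    by (intro sums_mult homogeneous_part_sums[OF sl \<zeta>])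
  ultimately show ?thesis by (rule sums_unique2)
qed

section \<open>Complex differentiability in several variables\<close>

text \<open>Complex differentiability at a point, the pointwise condition in \<open>holomorphic_near\<close>.\<close>

definition cdifferentiable :: "((complex ^ 'k::finite) \<times> complex \<Rightarrow> complex) \<Rightarrow> (complex ^ 'k) \<times> complex \<Rightarrow> bool" where
  "cdifferentiable f p \<longleftrightarrow> (\<exists>f'. (f has_derivative f') (at p) \<and> (\<forall>c v. f' (cscale c v) = c * f' v))"

lemma holomorphic_near_iff:
  "holomorphic_near f K \<longleftrightarrow> (\<exists>U. open U \<and> K \<subseteq> U \<and> (\<forall>p\<in>U. cdifferentiable f p))"
  by (simp add: holomorphic_near_def cdifferentiable_def)

lemma cdifferentiable_const: "cdifferentiable (\<lambda>_. c) p"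
  unfolding cdifferentiable_def by (rule exI[of _ "\<lambda>_. 0"]) simp

lemma cdifferentiable_snd: "cdifferentiable snd p"
  unfolding cdifferentiable_def
  by (rule exI[of _ snd]) (auto simp: cscale_def intro: bounded_linear_imp_has_derivative bounded_linear_snd)

lemma bounded_linear_herm: "bounded_linear (\<lambda>z :: complex ^ 'k::finite. herm z \<zeta>)"
proof (rule bounded_linear_intro[where K = "norm \<zeta>"])
  show "herm (r *\<^sub>R x) \<zeta> = r *\<^sub>R herm x \<zeta>" for r and x :: "complex ^ 'k"
    by (simp only: herm_scaleR_left scaleR_conv_of_real[where 'a = complex])
qed (simp_all add: herm_add_left norm_herm_le)

lemma cdifferentiable_herm: "cdifferentiable (\<lambda>p. herm (fst p) \<zeta>) (p :: (complex ^ 'k::finite) \<times> complex)"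
  unfolding cdifferentiable_def
  by (rule exI[of _ "\<lambda>p. herm (fst p) \<zeta>"])
    (auto simp: cscale_def herm_scale_left intro: bounded_linear_imp_has_derivative bounded_linear_compose[OF bounded_linear_herm bounded_linear_fst])

lemma cdifferentiable_mult:
  assumes "cdifferentiable f p" "cdifferentiable g p"
  shows "cdifferentiable (\<lambda>x. f x * g x) p"
proof -
  from assms obtain f' g' where "(f has_derivative f') (at p)" "\<And>c v. f' (cscale c v) = c * f' v"
    "(g has_derivative g') (at p)" "\<And>c v. g' (cscale c v) = c * g' v"
    unfolding cdifferentiable_def by blast
  then show ?thesis unfolding cdifferentiable_def
    by (intro exI[of _ "\<lambda>h. f p * g' h + f' h * g p"]) (auto intro!: has_derivative_mult simp: algebra_simps)
qed

lemma cdifferentiable_compose: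
  assumes f: "cdifferentiable f p" and G: "G field_differentiable (at (f p))"
  shows "cdifferentiable (\<lambda>x. G (f x)) p"
proof -
  from f obtain f' where f': "(f has_derivative f') (at p)" "\<And>c v. f' (cscale c v) = c * f' v"
    unfolding cdifferentiable_def by blast
  from G obtain D where D: "(G has_field_derivative D) (at (f p))" by (auto simp: field_differentiable_def)
  have "((\<lambda>x. G (f x)) has_derivative (\<lambda>v. D * f' v)) (at p)"
    by (rule has_derivative_compose[OF f'(1)]) (use D in \<open>simp add: has_field_derivative_def\<close>)
  then show ?thesis unfolding cdifferentiable_def using f'(2) by (intro exI[of _ "\<lambda>v. D * f' v"]) auto
qed

lemma cdifferentiable_line:
  assumes f: "cdifferentiable f (p + cscale s v)"
  shows "(\<lambda>s. f (p + cscale s v)) field_differentiable (at s)"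
proof -
  from f obtain f' where f': "(f has_derivative f') (at (p + cscale s v))" "\<And>c v. f' (cscale c v) = c * f' v"
    unfolding cdifferentiable_def by blast
  have bl: "bounded_linear (\<lambda>s. cscale s v)"
  proof (rule bounded_linear_intro[where K = "norm v"])
    show "cscale (r *\<^sub>R x) v = r *\<^sub>R cscale x v" for r x
      by (simp add: cscale_def vec_eq_iff)
    show "cscale (x + y) v = cscale x v + cscale y v" for x y
      by (simp add: cscale_def vec_eq_iff algebra_simps)
    show "norm (cscale x v) \<le> norm x * norm v" for x
      by (simp add: cscale_def norm_prod_def norm_vector_scale norm_mult power_mult_distrib real_sqrt_mult flip: distrib_left)
  qed
  have "((\<lambda>s. f (p + cscale s v)) has_derivative (\<lambda>\<sigma>. f' (cscale \<sigma> v))) (at s)"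
  proof (rule has_derivative_compose[where f = "\<lambda>s. p + cscale s v" and g = f])
    show "(f has_derivative f') (at (p + cscale s v))" by (rule f'(1))
    have "((\<lambda>s. p + cscale s v) has_derivative (\<lambda>\<sigma>. 0 + cscale \<sigma> v)) (at s)"
      by (intro has_derivative_add has_derivative_const bounded_linear_imp_has_derivative[OF bl])
    then show "((\<lambda>s. p + cscale s v) has_derivative (\<lambda>\<sigma>. cscale \<sigma> v)) (at s)" by simp
  qed
  then have "((\<lambda>s. f (p + cscale s v)) has_field_derivative f' v) (at s)"
    unfolding has_field_derivative_def f'(2) by (simp only: mult.commute[of _ "f' v"])
  then show ?thesis by (auto simp: field_differentiable_def)
qed

lemma cdifferentiable_imp_continuous: "cdifferentiable f p \<Longrightarrow> isCont f p"
  unfolding cdifferentiable_def by (auto intro: has_derivative_continuous)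

section \<open>The kernel of the egg\<close>

definition egg_coeff :: "nat \<Rightarrow> nat \<Rightarrow> nat \<Rightarrow> real" where
  "egg_coeff k m \<beta> = Gamma (real k + egg_lambda (k + 1) m \<beta>) / Gamma (egg_lambda (k + 1) m \<beta>)"

lemma egg_mu_pos: "m \<ge> 1 \<Longrightarrow> egg_mu n m > 0"
  unfolding egg_mu_def by (intro divide_pos_pos mult_pos_pos add_nonneg_pos) auto

lemma egg_lambda_pos: "m \<ge> 1 \<Longrightarrow> egg_lambda n m \<beta> > 0"
  unfolding egg_lambda_def using egg_mu_pos[of m n] by (intro add_nonneg_pos) auto

lemma egg_coeff_pochhammer: "m \<ge> 1 \<Longrightarrow> egg_coeff k m \<beta> = pochhammer (egg_lambda (k + 1) m \<beta>) k"
  unfolding egg_coeff_def using egg_lambda_pos[of m "k + 1" \<beta>]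
  by (subst pochhammer_Gamma) (auto dest: nonpos_Ints_nonpos simp: add.commute)

lemma egg_coeff_nonneg: "m \<ge> 1 \<Longrightarrow> egg_coeff k m \<beta> \<ge> 0"
  unfolding egg_coeff_pochhammer using egg_lambda_pos[of m "k + 1" \<beta>] by (intro pochhammer_nonneg) auto

lemma pochhammer_mono:
  assumes "0 \<le> x" "x \<le> (y :: real)"
  shows "pochhammer x k \<le> pochhammer y k"
  unfolding pochhammer_prod using assms by (intro prod_mono) auto

text \<open>Both sides are \<open>(k + b)! / b!\<close>. The right hand side exhibits the polynomially growing coefficients as
binomial coefficients of \<open>(1 - r) powr (- (k + 1))\<close>, whose series converges for \<open>r < 1\<close>.\<close>

lemma pochhammer_Suc_swap: "pochhammer (real b + 1) k = fact k * (pochhammer (real k + 1) b / fact b)"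
proof -
  have "pochhammer (1 :: real) (b + k) = pochhammer 1 b * pochhammer (1 + real b) k"
    and "pochhammer (1 :: real) (k + b) = pochhammer 1 k * pochhammer (1 + real k) b"
    by (simp_all add: pochhammer_product')
  then have "fact b * pochhammer (real b + 1) k = fact k * pochhammer (real k + 1) b"
    by (simp add: pochhammer_fact[symmetric] add.commute)
  then show ?thesis by (simp add: field_simps)
qed

lemma summable_egg_coeff:
  assumes m: "m \<ge> 1" and r: "0 \<le> r" "r < 1"
  shows "summable (\<lambda>\<beta>. egg_coeff k m \<beta> * r ^ \<beta>)"
proof -
  obtain R where R: "r < R" "R < 1" using r(2) dense by blast
  have R0: "R > 0" using R r by simp
  \<comment> \<open>shifting the index by \<open>D\<close> dominates \<open>egg_lambda\<close> by an integer\<close>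
  define D where "D = nat \<lceil>egg_mu (k + 1) m\<rceil>"
  define a where "a b = pochhammer (real k + 1) b / fact b" for b
  have a0: "a b \<ge> 0" for b unfolding a_def by (intro divide_nonneg_nonneg pochhammer_nonneg) auto
  have "(\<lambda>b. complex_of_real (a b) * of_real R ^ b) sums ((1 - of_real R) powr of_real (- (real k + 1)))"
    unfolding a_def by (rule negative_binomial_sums) (use R R0 in auto)
  then have "summable (\<lambda>b. complex_of_real (a b * R ^ b))" by (simp add: sums_iff)
  then have "summable (\<lambda>b. a b * R ^ b)" by (simp only: summable_complex_of_real)
  then have "summable (\<lambda>\<beta>. a (\<beta> + D) * R ^ (\<beta> + D))" by (rule summable_ignore_initial_segment)
  then have "summable (\<lambda>\<beta>. a (\<beta> + D) * R ^ (\<beta> + D) * (fact k / R ^ D))" by (rule summable_mult2)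
  then show ?thesis
  proof (rule summable_comparison_test')
    fix \<beta>
    have "egg_lambda (k + 1) m \<beta> \<le> real (\<beta> + D) + 1"
    proof -
      have "real \<beta> / real m \<le> real \<beta>" using m by (simp add: divide_le_eq mult_le_cancel_left1)
      moreover have "egg_mu (k + 1) m \<le> real D" unfolding D_def by linarith
      ultimately show ?thesis by (simp add: egg_lambda_def)
    qed
    then have "egg_coeff k m \<beta> \<le> pochhammer (real (\<beta> + D) + 1) k"
      unfolding egg_coeff_pochhammer[OF m] using egg_lambda_pos[OF m, of "k + 1" \<beta>] by (intro pochhammer_mono) auto
    also have "\<dots> = fact k * a (\<beta> + D)" unfolding a_def by (rule pochhammer_Suc_swap)
    finally have "egg_coeff k m \<beta> * r ^ \<beta> \<le> (fact k * a (\<beta> + D)) * R ^ \<beta>"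
      using egg_coeff_nonneg[OF m, of k \<beta>] r R a0 by (intro mult_mono power_mono) auto
    also have "\<dots> = a (\<beta> + D) * R ^ (\<beta> + D) * (fact k / R ^ D)" using R0 by (simp add: power_add)
    finally show "norm (egg_coeff k m \<beta> * r ^ \<beta>) \<le> a (\<beta> + D) * R ^ (\<beta> + D) * (fact k / R ^ D)"
      using egg_coeff_nonneg[OF m, of k \<beta>] r by simp
  qed
qed

text \<open>All terms of the kernel have the form \<open>c\<^sub>\<beta> (w \<eta>\<^sup>*)\<^sup>\<beta> (1 - y)\<^sup>-\<^sup>s\<close> with \<open>\<eta>\<^sup>*\<close> the conjugate of \<open>\<eta>\<close>, \<open>y = \<langle>z, \<zeta>\<rangle>\<close> and
\<open>s = k + \<mu> + \<beta> / m\<close>. The kernel is therefore a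
power series of radius of convergence 1 in the single variable \<open>u = w \<eta>\<^sup>* (1 - y) powr (- 1 / m)\<close>, times a fixed
power of \<open>1 - y\<close>. Convergence, holomorphy and continuity all reduce to this power series.\<close>

definition egg_series :: "nat \<Rightarrow> nat \<Rightarrow> complex \<Rightarrow> complex" where
  "egg_series k m u = (\<Sum>\<beta>. of_real (egg_coeff k m \<beta>) * u ^ \<beta>)"

lemma egg_series_norm_summable:
  fixes u :: complex
  assumes m: "m \<ge> 1" and u: "norm u < 1"
  shows "summable (\<lambda>\<beta>. norm (of_real (egg_coeff k m \<beta>) * u ^ \<beta>))"
  using summable_egg_coeff[OF m norm_ge_zero u] egg_coeff_nonneg[OF m] by (simp add: norm_mult norm_power)

lemma egg_series_sums:
  assumes m: "m \<ge> 1" and u: "norm u < 1"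
  shows "(\<lambda>\<beta>. of_real (egg_coeff k m \<beta>) * u ^ \<beta>) sums egg_series k m u"
  unfolding egg_series_def by (rule summable_sums[OF summable_norm_cancel[OF egg_series_norm_summable[OF m u]]])

lemma egg_series_holomorphic: "m \<ge> 1 \<Longrightarrow> egg_series k m holomorphic_on ball 0 1"
  by (rule power_series_holomorphic[where a = "\<lambda>\<beta>. of_real (egg_coeff k m \<beta>)"]) (use egg_series_sums in auto)

definition egg_u :: "nat \<Rightarrow> (complex ^ 'k::finite) \<times> complex \<Rightarrow> (complex ^ 'k) \<times> complex \<Rightarrow> complex" where
  "egg_u m p q = snd p * cnj (snd q) * (1 - herm (fst p) (fst q)) powr of_real (- (1 / real m))"

definition egg_prefactor :: "nat \<Rightarrow> (complex ^ 'k::finite) \<times> complex \<Rightarrow> (complex ^ 'k) \<times> complex \<Rightarrow> complex" where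
  "egg_prefactor m p q = (1 - herm (fst p) (fst q)) powr of_real (- (real CARD('k) + egg_mu (CARD('k) + 1) m))"

definition egg_kernel :: "nat \<Rightarrow> (complex ^ 'k::finite) \<times> complex \<Rightarrow> (complex ^ 'k) \<times> complex \<Rightarrow> complex" where
  "egg_kernel m p q = egg_prefactor m p q * egg_series CARD('k) m (egg_u m p q)"

text \<open>The set where both the principal power of \<open>1 - \<langle>z, \<zeta>\<rangle>\<close> and the power series in \<open>egg_u\<close> make sense. It is open and
contains the pairs of a point of the closed egg and one of the open egg, so that the kernel is holomorphic
near the closure in its first variable.\<close>

definition egg_domain :: "nat \<Rightarrow> (((complex ^ 'k::finite) \<times> complex) \<times> ((complex ^ 'k) \<times> complex)) set" where
  "egg_domain m = {(p, q). norm (herm (fst p) (fst q)) < 1 \<and> norm (egg_u m p q) < 1}"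

lemma one_minus_not_nonpos: "norm y < 1 \<Longrightarrow> 1 - y \<notin> \<real>\<^sub>\<le>\<^sub>0" for y :: complex
  using complex_Re_le_cmod[of y] by (auto simp: complex_nonpos_Reals_iff)

lemma Re_le_one: "norm y < 1 \<Longrightarrow> Re y \<le> 1" for y :: complex
  using complex_Re_le_cmod[of y] by simp

lemma one_minus_nonzero: "norm y < 1 \<Longrightarrow> 1 - y \<noteq> 0" for y :: complex
  by auto

text \<open>All powers are exponentials of multiples of one and the same logarithm, so real exponents may be added and
the \<open>\<beta>\<close>-th power may be taken outside.\<close>

lemma egg_term_eq:
  fixes p q :: "(complex ^ 'k::finite) \<times> complex"
  assumes y: "norm (herm (fst p) (fst q)) < 1" and n: "n = CARD('k) + 1"
  shows "egg_term n m \<beta> p q = egg_prefactor m p q * (of_real (egg_coeff CARD('k) m \<beta>) * egg_u m p q ^ \<beta>)"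
proof -
  define L where "L = ln (1 - herm (fst p) (fst q))"
  define s0 where "s0 = real CARD('k) + egg_mu (CARD('k) + 1) m"
  have pw: "(1 - herm (fst p) (fst q)) powr a = exp (a * L)" for a
    using one_minus_nonzero[OF y] by (simp add: powr_def L_def)
  have s: "real (n - 1) + egg_lambda n m \<beta> = s0 + real \<beta> * (1 / real m)"
    by (simp add: n egg_lambda_def s0_def)
  have g: "real CARD('k) + egg_lambda (CARD('k) + 1) m \<beta> = s0 + real \<beta> * (1 / real m)"
    by (simp add: egg_lambda_def s0_def)
  have "- (complex_of_real (s0 + real \<beta> * (1 / real m)) * L) = of_real (- s0) * L + of_nat \<beta> * (of_real (- (1 / real m)) * L)"
    by (simp add: algebra_simps)
  then have "1 / exp (complex_of_real (s0 + real \<beta> * (1 / real m)) * L) = exp (of_real (- s0) * L) * exp (of_real (- (1 / real m)) * L) ^ \<beta>"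
    unfolding exp_of_nat_mult[symmetric] exp_add[symmetric] by (simp only: exp_minus[symmetric] inverse_eq_divide[symmetric])
  then have key: "x / exp (complex_of_real (s0 + real \<beta> * (1 / real m)) * L) = x * (exp (of_real (- s0) * L) * exp (of_real (- (1 / real m)) * L) ^ \<beta>)" for x
    by (simp only: divide_inverse[of x] inverse_eq_divide)
  show ?thesis
    unfolding egg_term_def Let_def egg_prefactor_def egg_u_def egg_coeff_def pw s g key s0_def[symmetric]
    by (simp only: n power_mult_distrib ac_simps)
qed

lemma egg_kernel_sums:
  fixes p q :: "(complex ^ 'k::finite) \<times> complex"
  assumes m: "m \<ge> 1" and d: "(p, q) \<in> egg_domain m" and n: "n = CARD('k) + 1"
  shows "summable (\<lambda>\<beta>. norm (egg_term n m \<beta> p q))" "(\<lambda>\<beta>. egg_term n m \<beta> p q) sums egg_kernel m p q"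
proof -
  have y: "norm (herm (fst p) (fst q)) < 1" and u: "norm (egg_u m p q) < 1" using d by (auto simp: egg_domain_def)
  show "summable (\<lambda>\<beta>. norm (egg_term n m \<beta> p q))"
    unfolding egg_term_eq[OF y n] norm_mult[of "egg_prefactor m p q"]
    by (intro summable_mult egg_series_norm_summable m u)
  show "(\<lambda>\<beta>. egg_term n m \<beta> p q) sums egg_kernel m p q"
    unfolding egg_term_eq[OF y n] egg_kernel_def by (intro sums_mult egg_series_sums m u)
qed

text \<open>Let \<open>a = \<bar>z\<bar>\<close>, \<open>b = \<bar>\<zeta>\<bar>\<close>, \<open>v = \<bar>w\<bar> ^ m\<close>, and let the local \<open>w\<close> be \<open>\<bar>\<eta>\<bar> ^ m\<close>. Then \<open>v\<^sup>2 \<le> 1 - a\<^sup>2\<close> and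
\<open>w\<^sup>2 < 1 - b\<^sup>2\<close>, and \<open>(1 - a\<^sup>2) (1 - b\<^sup>2) = (1 - a b)\<^sup>2 - (a - b)\<^sup>2\<close> gives \<open>v w < 1 - a b\<close>. The right hand side is
at most \<open>\<bar>1 - \<langle>z, \<zeta>\<rangle>\<bar>\<close>.\<close>

lemma egg_pair_in_domain:
  fixes p q :: "(complex ^ 'k::finite) \<times> complex"
  assumes m: "m \<ge> 1" and p: "egg_rho m p \<le> 0" and q: "egg_rho m q < 0"
  shows "(p, q) \<in> egg_domain m"
proof -
  define a where "a = norm (fst p)"
  define b where "b = norm (fst q)"
  define v where "v = norm (snd p) ^ m"
  define w where "w = norm (snd q) ^ m"
  define y where "y = herm (fst p) (fst q)"
  have nn: "0 \<le> a" "0 \<le> b" "0 \<le> v" "0 \<le> w" by (simp_all add: a_def b_def v_def w_def)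
  have v2: "v\<^sup>2 \<le> 1 - a\<^sup>2" and w2: "w\<^sup>2 < 1 - b\<^sup>2"
    using p q by (simp_all add: egg_rho_def v_def w_def a_def b_def power_mult[symmetric] mult.commute)
  have sq: "a\<^sup>2 \<le> 1" "b\<^sup>2 < 1" using v2 w2 zero_le_power2[of v] zero_le_power2[of w] by linarith+
  then have a1: "a \<le> 1" and b1: "b < 1" using nn by (simp_all add: abs_square_le_1 abs_square_less_1)
  have "a * b \<le> 1 * b" using a1 nn by (intro mult_right_mono)
  then have ab: "a * b < 1" using b1 by simp
  have ny: "norm y \<le> a * b" unfolding y_def a_def b_def by (rule norm_herm_le)
  have vw: "v * w < 1 - a * b"
  proof (cases "v = 0")
    case False
    then have "v\<^sup>2 * w\<^sup>2 < v\<^sup>2 * (1 - b\<^sup>2)" using w2 by (intro mult_strict_left_mono) auto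
    also have "\<dots> \<le> (1 - a\<^sup>2) * (1 - b\<^sup>2)" using v2 sq(2) by (intro mult_right_mono) auto
    also have "\<dots> \<le> (1 - a * b)\<^sup>2"
    proof -
      have "(1 - a * b)\<^sup>2 - (1 - a\<^sup>2) * (1 - b\<^sup>2) = (a - b)\<^sup>2" by (simp add: power2_eq_square algebra_simps)
      then show ?thesis using zero_le_power2[of "a - b"] by linarith
    qed
    finally have "(v * w)\<^sup>2 < (1 - a * b)\<^sup>2" by (simp add: power_mult_distrib)
    then show ?thesis by (rule power2_less_imp_less) (use ab in simp)
  qed (use ab in simp)
  have y1: "norm y < 1" using ny ab by simp
  have "1 - a * b \<le> norm (1 - y)" using ny norm_triangle_ineq2[of 1 y] by simp
  then have x: "(norm (snd p) * norm (snd q)) ^ m < norm (1 - y)" using vw by (simp add: v_def w_def power_mult_distrib)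
  have n0: "norm (1 - y) > 0" using one_minus_nonzero[OF y1] by simp
  have "norm (egg_u m p q) ^ m = (norm (snd p) * norm (snd q)) ^ m * (norm (1 - y) powr (- (1 / real m))) ^ m"
  proof -
    have "norm ((1 - y) powr of_real c) = norm (1 - y) powr c" for c by (simp add: norm_powr_real_powr')
    then show ?thesis by (simp only: egg_u_def y_def[symmetric] norm_mult power_mult_distrib complex_mod_cnj)
  qed
  also have "(norm (1 - y) powr (- (1 / real m))) ^ m = 1 / norm (1 - y)"
  proof -
    have "(norm (1 - y) powr (- (1 / real m))) ^ m = norm (1 - y) powr (- (1 / real m) * real m)"
      using n0 by (subst powr_realpow[symmetric]) (auto simp: powr_powr)
    also have "- (1 / real m) * real m = - 1" using m by simp
    finally show ?thesis using n0 by (simp add: powr_neg_one)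
  qed
  finally have "norm (egg_u m p q) ^ m < 1" using x n0 by (simp add: divide_less_eq)
  then have "norm (egg_u m p q) < 1" using m by (simp add: power_less_one_iff)
  with y1 show ?thesis by (simp add: egg_domain_def y_def)
qed

lemma open_herm_domain: "open {x :: ((complex ^ 'k::finite) \<times> complex) \<times> ((complex ^ 'k) \<times> complex). norm (herm (fst (fst x)) (fst (snd x))) < 1}"
  by (intro open_Collect_less continuous_intros)

lemma continuous_on_egg_u:
  "continuous_on {x :: ((complex ^ 'k::finite) \<times> complex) \<times> ((complex ^ 'k) \<times> complex). norm (herm (fst (fst x)) (fst (snd x))) < 1}
     (\<lambda>x. egg_u m (fst x) (snd x))"
  unfolding egg_u_def by (intro continuous_intros) (auto dest: Re_le_one simp: complex_nonpos_Reals_iff)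

lemma continuous_on_egg_prefactor:
  "continuous_on {x :: ((complex ^ 'k::finite) \<times> complex) \<times> ((complex ^ 'k) \<times> complex). norm (herm (fst (fst x)) (fst (snd x))) < 1}
     (\<lambda>x. egg_prefactor m (fst x) (snd x))"
  unfolding egg_prefactor_def by (intro continuous_intros) (auto dest: Re_le_one simp: complex_nonpos_Reals_iff)

lemma open_egg_domain: "open (egg_domain m :: (((complex ^ 'k::finite) \<times> complex) \<times> ((complex ^ 'k) \<times> complex)) set)"
proof -
  have "open ((\<lambda>x. egg_u m (fst x) (snd x)) -` ball 0 1 \<inter>
     {x :: ((complex ^ 'k) \<times> complex) \<times> ((complex ^ 'k) \<times> complex). norm (herm (fst (fst x)) (fst (snd x))) < 1})"
    using continuous_on_open_vimage[OF open_herm_domain] continuous_on_egg_u open_ball by blast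
  moreover have "egg_domain m = (\<lambda>x. egg_u m (fst x) (snd x)) -` ball 0 1 \<inter>
     {x :: ((complex ^ 'k) \<times> complex) \<times> ((complex ^ 'k) \<times> complex). norm (herm (fst (fst x)) (fst (snd x))) < 1}"
    by (auto simp: egg_domain_def)
  ultimately show ?thesis by simp
qed

lemma continuous_on_egg_kernel:
  assumes m: "m \<ge> 1"
  shows "continuous_on (egg_domain m) (\<lambda>x :: ((complex ^ 'k::finite) \<times> complex) \<times> ((complex ^ 'k) \<times> complex). egg_kernel m (fst x) (snd x))"
proof -
  have sub: "egg_domain m \<subseteq> {x :: ((complex ^ 'k) \<times> complex) \<times> ((complex ^ 'k) \<times> complex). norm (herm (fst (fst x)) (fst (snd x))) < 1}"
    by (auto simp: egg_domain_def)
  show ?thesis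
    unfolding egg_kernel_def
    by (intro continuous_on_mult continuous_on_subset[OF continuous_on_egg_prefactor sub]
        continuous_on_compose2[OF holomorphic_on_imp_continuous_on[OF egg_series_holomorphic[OF m]] continuous_on_subset[OF continuous_on_egg_u sub]])
      (auto simp: egg_domain_def)
qed

lemma cdifferentiable_egg_kernel:
  fixes p q :: "(complex ^ 'k::finite) \<times> complex"
  assumes m: "m \<ge> 1" and d: "(p, q) \<in> egg_domain m"
  shows "cdifferentiable (\<lambda>p. egg_kernel m p q) p"
proof -
  have y: "norm (herm (fst p) (fst q)) < 1" and u: "norm (egg_u m p q) < 1" using d by (auto simp: egg_domain_def)
  have pw: "cdifferentiable (\<lambda>p. (1 - herm (fst p) (fst q)) powr a) p" for a
  proof (rule cdifferentiable_compose[OF cdifferentiable_herm])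
    show "(\<lambda>y. (1 - y) powr a) field_differentiable at (herm (fst p) (fst q))"
    proof -
      have "((\<lambda>y. (1 - y) powr a) has_field_derivative (a * (1 - herm (fst p) (fst q)) powr (a - 1) * (- 1))) (at (herm (fst p) (fst q)))"
        by (rule DERIV_chain2[where f = "\<lambda>z. z powr a" and g = "\<lambda>y. 1 - y", OF has_field_derivative_powr[OF one_minus_not_nonpos[OF y]]])
          (auto intro!: derivative_eq_intros)
      then show ?thesis by (auto simp: field_differentiable_def)
    qed
  qed
  have cu: "cdifferentiable (\<lambda>p. egg_u m p q) p"
    unfolding egg_u_def by (intro cdifferentiable_mult cdifferentiable_snd cdifferentiable_const pw)
  have "egg_series CARD('k) m field_differentiable (at (egg_u m p q))"
    using holomorphic_on_imp_differentiable_at[OF egg_series_holomorphic[OF m] open_ball] u by simp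
  from cdifferentiable_compose[OF cu this] pw show ?thesis
    unfolding egg_kernel_def egg_prefactor_def by (rule cdifferentiable_mult[rotated])
qed

lemma egg_kernel_holomorphic_near:
  fixes q :: "(complex ^ 'k::finite) \<times> complex"
  assumes m: "m \<ge> 1" and q: "egg_rho m q < 0"
  shows "holomorphic_near (\<lambda>p. egg_kernel m p q) (closure (egg m))"
  unfolding holomorphic_near_iff
proof (intro exI conjI ballI)
  show "open ((\<lambda>p. (p, q)) -` egg_domain m)" by (intro open_vimage open_egg_domain continuous_intros)
  show "closure (egg m) \<subseteq> (\<lambda>p. (p, q)) -` egg_domain m"
    using egg_pair_in_domain[OF m _ q] by (auto simp: closure_egg[OF m])
  fix p assume "p \<in> (\<lambda>p. (p, q)) -` egg_domain m"
  then show "cdifferentiable (\<lambda>p. egg_kernel m p q) p" by (intro cdifferentiable_egg_kernel[OF m]) simp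
qed

lemma cnj_one_minus_powr: "norm y < 1 \<Longrightarrow> cnj ((1 - y) powr of_real a) = (1 - cnj y) powr of_real a" for y :: complex
  using cnj_powr[of "1 - y" "of_real a"] one_minus_not_nonpos[of y] complex_Re_le_cmod[of y] by (auto simp: complex_nonpos_Reals_iff)

lemma cnj_egg_kernel:
  fixes p q :: "(complex ^ 'k::finite) \<times> complex"
  assumes m: "m \<ge> 1" and d: "(p, q) \<in> egg_domain m"
  shows "cnj (egg_kernel m p q) = egg_kernel m q p"
proof -
  have y: "norm (herm (fst p) (fst q)) < 1" and u: "norm (egg_u m p q) < 1" using d by (auto simp: egg_domain_def)
  have cu: "cnj (egg_u m p q) = egg_u m q p"
    unfolding egg_u_def by (simp add: cnj_one_minus_powr[OF y] cnj_herm mult_ac del: of_real_minus)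
  have "(\<lambda>\<beta>. cnj (of_real (egg_coeff CARD('k) m \<beta>) * egg_u m p q ^ \<beta>)) sums cnj (egg_series CARD('k) m (egg_u m p q))"
    by (rule sums_cnj[THEN iffD2]) (rule egg_series_sums[OF m u])
  moreover have "(\<lambda>\<beta>. of_real (egg_coeff CARD('k) m \<beta>) * egg_u m q p ^ \<beta>) sums egg_series CARD('k) m (egg_u m q p)"
    by (rule egg_series_sums[OF m]) (use u in \<open>simp flip: cu\<close>)
  ultimately have "cnj (egg_series CARD('k) m (egg_u m p q)) = egg_series CARD('k) m (egg_u m q p)"
    by (simp add: cu sums_unique2)
  then show ?thesis
    unfolding egg_kernel_def egg_prefactor_def by (simp only: complex_cnj_mult cnj_one_minus_powr[OF y] cnj_herm)
qed

lemma egg_kernel_scaleR: "egg_kernel m (r *\<^sub>R p) q = egg_kernel m p (r *\<^sub>R q)"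
  by (simp add: egg_kernel_def egg_prefactor_def egg_u_def herm_scaleR_left herm_scaleR_right scaleR_conv_of_real[where 'a = complex] mult_ac)

lemma egg_series_uniform:
  assumes m: "m \<ge> 1" and r: "r < 1"
  shows "uniform_limit (cball 0 r) (\<lambda>N u. \<Sum>\<beta><N. of_real (egg_coeff k m \<beta>) * u ^ \<beta>) (egg_series k m) sequentially"
proof (cases "0 \<le> r")
  case True
  show ?thesis
    unfolding egg_series_def[abs_def]
  proof (rule Weierstrass_m_test[OF _ summable_egg_coeff[OF m True r]])
    fix \<beta> and u :: complex assume "u \<in> cball 0 r"
    then show "norm (of_real (egg_coeff k m \<beta>) * u ^ \<beta>) \<le> egg_coeff k m \<beta> * r ^ \<beta>"
      using egg_coeff_nonneg[OF m, of k \<beta>] by (auto simp: norm_mult norm_power intro!: mult_left_mono power_mono)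
  qed
qed simp

text \<open>Near a point of the domain \<open>\<bar>u\<bar>\<close> stays below some \<open>r < 1\<close> and the prefactor stays bounded, so the Weierstrass
test for the power series on the disc of radius \<open>r\<close> suffices.\<close>

lemma egg_kernel_locally_uniform:
  fixes x0 :: "((complex ^ 'k::finite) \<times> complex) \<times> ((complex ^ 'k) \<times> complex)"
  assumes m: "m \<ge> 1" and x0: "x0 \<in> egg_domain m" and n: "n = CARD('k) + 1"
  obtains U where "open U" "x0 \<in> U" "U \<subseteq> egg_domain m"
    "uniform_limit U (\<lambda>N (p, q). \<Sum>\<beta><N. egg_term n m \<beta> p q) (\<lambda>(p, q). egg_kernel m p q) sequentially"
proof -
  define r where "r = (norm (egg_u m (fst x0) (snd x0)) + 1) / 2"
  have r: "norm (egg_u m (fst x0) (snd x0)) < r" "r < 1" using x0 by (auto simp: egg_domain_def r_def)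
  have sub: "egg_domain m \<subseteq> {x :: ((complex ^ 'k) \<times> complex) \<times> ((complex ^ 'k) \<times> complex). norm (herm (fst (fst x)) (fst (snd x))) < 1}"
    by (auto simp: egg_domain_def)
  define B where "B = norm (egg_prefactor m (fst x0) (snd x0)) + 1"
  define U where "U = (\<lambda>x :: ((complex ^ 'k) \<times> complex) \<times> ((complex ^ 'k) \<times> complex). (norm (egg_u m (fst x) (snd x)), norm (egg_prefactor m (fst x) (snd x)))) -` ({..<r} \<times> {..<B}) \<inter> egg_domain m"
  have U: "open U"
  proof -
    have c: "continuous_on (egg_domain m) (\<lambda>x :: ((complex ^ 'k) \<times> complex) \<times> ((complex ^ 'k) \<times> complex). (norm (egg_u m (fst x) (snd x)), norm (egg_prefactor m (fst x) (snd x))))"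
      by (intro continuous_on_Pair continuous_on_norm continuous_on_subset[OF continuous_on_egg_prefactor sub] continuous_on_subset[OF continuous_on_egg_u sub])
    have "open ({..<r} \<times> {..<B})" by (intro open_Times open_lessThan)
    then show ?thesis unfolding U_def Int_commute[of "_ -` _"]
      by (rule continuous_open_preimage[OF c open_egg_domain])
  qed
  have "uniform_limit U (\<lambda>N x. \<Sum>\<beta><N. of_real (egg_coeff CARD('k) m \<beta>) * egg_u m (fst x) (snd x) ^ \<beta>)
      (\<lambda>x. egg_series CARD('k) m (egg_u m (fst x) (snd x))) sequentially"
    by (rule uniform_limit_compose'[OF egg_series_uniform[OF m r(2)]]) (auto simp: U_def)
  then have lim: "uniform_limit U (\<lambda>N x. egg_prefactor m (fst x) (snd x) * (\<Sum>\<beta><N. of_real (egg_coeff CARD('k) m \<beta>) * egg_u m (fst x) (snd x) ^ \<beta>))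
      (\<lambda>x. egg_prefactor m (fst x) (snd x) * egg_series CARD('k) m (egg_u m (fst x) (snd x))) sequentially"
  proof (rule uniform_lim_mult[OF uniform_limit_const])
    show "bounded ((\<lambda>x. egg_prefactor m (fst x) (snd x)) ` U)"
      unfolding bounded_iff by (intro exI[of _ B]) (auto simp: U_def)
    have "compact (egg_series CARD('k) m ` cball 0 r)"
      by (intro compact_continuous_image continuous_on_subset[OF holomorphic_on_imp_continuous_on[OF egg_series_holomorphic[OF m]]]) (use r in auto)
    then show "bounded ((\<lambda>x. egg_series CARD('k) m (egg_u m (fst x) (snd x))) ` U)"
      by (rule bounded_subset[OF compact_imp_bounded]) (auto simp: U_def)
  qed
  have eq: "egg_prefactor m (fst x) (snd x) * (\<Sum>\<beta><N. of_real (egg_coeff CARD('k) m \<beta>) * egg_u m (fst x) (snd x) ^ \<beta>)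
      = (case x of (p, q) \<Rightarrow> \<Sum>\<beta><N. egg_term n m \<beta> p q)" if "x \<in> U" for x N
  proof -
    have "norm (herm (fst (fst x)) (fst (snd x))) < 1" using that sub by (auto simp: U_def)
    then show ?thesis by (simp add: case_prod_unfold egg_term_eq[OF _ n] sum_distrib_left)
  qed
  have "uniform_limit U (\<lambda>N (p, q). \<Sum>\<beta><N. egg_term n m \<beta> p q) (\<lambda>(p, q). egg_kernel m p q) sequentially"
    using uniform_limit_cong'[of U, THEN iffD1, OF _ _ lim] eq by (simp add: case_prod_unfold egg_kernel_def)
  moreover have "x0 \<in> U" using x0 r by (simp add: U_def B_def)
  moreover have "U \<subseteq> egg_domain m" by (auto simp: U_def)
  ultimately show ?thesis using U that by blast
qed

section \<open>The reproducing formula of the egg\<close>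

lemma integrable_ball_weight: "\<nu> > 0 \<Longrightarrow> integrable lborel (ball_weight \<nu> :: complex ^ 'k::finite \<Rightarrow> real)"
  using gaussian_ball_integrable[of "\<lambda>_ :: complex ^ 'k. 1 :: real" \<nu> 0] integrable_gaussian
  by (simp add: ball_weight_def[abs_def])

lemma egg_weight_eq:
  "egg_weight m (z :: complex ^ 'k::finite) = pi * real m powr (2 / (real CARD('k) + 2) - 1) * ball_weight (egg_mu (CARD('k) + 1) m) z"
  by (simp add: egg_weight_def ball_weight_def)

lemma finite_measure_egg_param:
  assumes m: "m \<ge> 1"
  shows "finite_measure (egg_param_measure m :: ((complex ^ 'k::finite) \<times> real) measure)"
proof (rule finite_measureI)
  have dm: "(\<lambda>(z :: complex ^ 'k, t). ennreal (egg_weight m z * indicator {0<..<1::real} t)) \<in> borel_measurable (lborel \<Otimes>\<^sub>M lborel)"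
    by measurable
  have i: "integrable lborel (egg_weight m :: complex ^ 'k \<Rightarrow> real)"
    unfolding egg_weight_eq[abs_def] by (intro integrable_mult_right integrable_ball_weight egg_mu_pos m)
  have "emeasure (egg_param_measure m) (space (egg_param_measure m :: ((complex ^ 'k) \<times> real) measure))
      = (\<integral>\<^sup>+p. (\<lambda>(z :: complex ^ 'k, t). ennreal (egg_weight m z * indicator {0<..<1::real} t)) p \<partial>(lborel \<Otimes>\<^sub>M lborel))"
    unfolding egg_param_measure_def
    by (subst space_density, subst emeasure_density[OF dm sets.top]) (auto intro!: nn_integral_cong)
  also have "\<dots> = (\<integral>\<^sup>+z. \<integral>\<^sup>+t. ennreal (egg_weight m (z :: complex ^ 'k)) * indicator {0<..<1::real} t \<partial>lborel \<partial>lborel)"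
    by (subst lborel.nn_integral_fst[OF dm, symmetric]) (auto intro!: nn_integral_cong simp: indicator_def)
  also have "\<dots> = (\<integral>\<^sup>+z. ennreal (egg_weight m (z :: complex ^ 'k)) \<partial>lborel)"
    by (intro nn_integral_cong) (simp add: nn_integral_cmult_indicator)
  also have "\<dots> < \<infinity>" using i by (simp add: integrable_iff_bounded abs_of_nonneg[OF egg_weight_nonneg])
  finally show "emeasure (egg_param_measure m) (space (egg_param_measure m :: ((complex ^ 'k) \<times> real) measure)) \<noteq> \<infinity>" by simp
qed

lemma egg_param_measurable:
  assumes m: "m \<ge> 1"
  shows "egg_param m \<in> measurable (egg_param_measure m) (restrict_space borel {p :: (complex ^ 'k::finite) \<times> complex. egg_rho m p = 0})"
  by (intro measurable_restrict_space2)
    (auto simp: egg_rho_egg_param[OF m] egg_param_measure_def lborel_prod)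

text \<open>Fubini in polar coordinates, for bounded functions on the boundary.\<close>

lemma fefferman_integral:
  fixes \<phi> :: "(complex ^ 'k::finite) \<times> complex \<Rightarrow> complex"
  assumes m: "m \<ge> 1" and \<phi>: "\<phi> \<in> borel_measurable (restrict_space borel {p. egg_rho m p = 0})"
    and bd: "\<And>p. egg_rho m p = 0 \<Longrightarrow> norm (\<phi> p) \<le> B"
  shows "integrable (fefferman_measure (egg m) (egg_rho m)) \<phi>"
    "(\<integral>p. \<phi> p \<partial>fefferman_measure (egg m) (egg_rho m))
      = (\<integral>z. egg_weight m z *\<^sub>R (\<integral>t. \<phi> (egg_param m (z, t)) \<partial>unit_arc) \<partial>lborel)"
proof -
  interpret P: finite_measure "egg_param_measure m :: ((complex ^ 'k) \<times> real) measure" by (rule finite_measure_egg_param[OF m])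
  note pm = egg_param_measurable[OF m, where 'k = 'k]
  interpret F: finite_measure "fefferman_measure (egg m) (egg_rho m :: (complex ^ 'k) \<times> complex \<Rightarrow> real)"
    unfolding fefferman_measure_egg[OF m] by (rule P.finite_measure_distr[OF pm])
  have \<phi>\<mu>: "\<phi> \<in> borel_measurable (fefferman_measure (egg m) (egg_rho m))"
    unfolding fefferman_measure_egg[OF m] using \<phi> by simp
  show "integrable (fefferman_measure (egg m) (egg_rho m)) \<phi>"
    by (rule F.integrable_const_bound[OF _ \<phi>\<mu>, of B])
      (auto intro!: AE_I2 bd simp: fefferman_measure_egg[OF m] space_restrict_space)
  have cm: "(\<lambda>p. \<phi> (egg_param m p)) \<in> borel_measurable (egg_param_measure m)" by (rule measurable_compose[OF pm \<phi>])
  then have cm': "(\<lambda>p. \<phi> (egg_param m p)) \<in> borel_measurable (lborel \<Otimes>\<^sub>M lborel)" by (simp add: egg_param_measure_def)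
  have ci: "integrable (egg_param_measure m) (\<lambda>p. \<phi> (egg_param m p))"
    by (rule P.integrable_const_bound[OF _ cm, of B]) (auto intro!: AE_I2 bd egg_rho_egg_param[OF m])
  define w where "w p = egg_weight m (fst p) * indicator {0<..<1::real} (snd p)" for p :: "(complex ^ 'k) \<times> real"
  have w: "w \<in> borel_measurable (lborel \<Otimes>\<^sub>M lborel)" unfolding w_def by measurable
  have w0: "w p \<ge> 0" for p by (simp add: w_def egg_weight_nonneg)
  have Pw: "egg_param_measure m = density (lborel \<Otimes>\<^sub>M lborel) (\<lambda>p. ennreal (w p))"
    by (simp add: egg_param_measure_def w_def case_prod_unfold)
  have wi: "integrable (lborel \<Otimes>\<^sub>M lborel) (\<lambda>p. w p *\<^sub>R \<phi> (egg_param m p))"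
    using ci unfolding Pw by (subst (asm) integrable_density) (auto simp: cm' w w0)
  have "(\<integral>p. \<phi> p \<partial>fefferman_measure (egg m) (egg_rho m)) = (\<integral>p. \<phi> (egg_param m p) \<partial>egg_param_measure m)"
    unfolding fefferman_measure_egg[OF m] by (rule integral_distr[OF pm \<phi>])
  also have "\<dots> = (\<integral>p. w p *\<^sub>R \<phi> (egg_param m p) \<partial>(lborel \<Otimes>\<^sub>M lborel))"
    unfolding Pw by (rule integral_density) (auto simp: cm' w w0)
  also have "\<dots> = (\<integral>z. \<integral>t. w (z, t) *\<^sub>R \<phi> (egg_param m (z, t)) \<partial>lborel \<partial>lborel)"
    by (rule lborel_pair.integral_fst'[OF wi, symmetric])
  also have "\<dots> = (\<integral>z. egg_weight m z *\<^sub>R (\<integral>t. \<phi> (egg_param m (z, t)) \<partial>unit_arc) \<partial>lborel)"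
  proof (rule Bochner_Integration.integral_cong[OF refl])
    fix z :: "complex ^ 'k"
    have mz: "(\<lambda>t. \<phi> (egg_param m (z, t))) \<in> borel_measurable lborel"
      using measurable_compose[OF measurable_Pair1' cm', of z] by (simp add: space_pair_measure)
    have "(\<integral>t. \<phi> (egg_param m (z, t)) \<partial>unit_arc) = (\<integral>t. \<phi> (egg_param m (z, t)) \<partial>density lborel (\<lambda>t. ennreal (indicator {0<..<1} t)))"
      by (simp add: unit_arc_def ennreal_indicator)
    also have "\<dots> = (\<integral>t. indicator {0<..<1} t *\<^sub>R \<phi> (egg_param m (z, t)) \<partial>lborel)"
      by (rule integral_density) (use mz in auto)
    finally show "(\<integral>t. w (z, t) *\<^sub>R \<phi> (egg_param m (z, t)) \<partial>lborel) = egg_weight m z *\<^sub>R (\<integral>t. \<phi> (egg_param m (z, t)) \<partial>unit_arc)"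
      by (simp add: w_def flip: scaleR_scaleR integral_scaleR_right)
  qed
  finally show "(\<integral>p. \<phi> p \<partial>fefferman_measure (egg m) (egg_rho m))
      = (\<integral>z. egg_weight m z *\<^sub>R (\<integral>t. \<phi> (egg_param m (z, t)) \<partial>unit_arc) \<partial>lborel)" .
qed

lemma compact_closure_egg:
  assumes m: "m \<ge> 1"
  shows "compact {p :: (complex ^ 'k::finite) \<times> complex. egg_rho m p \<le> 0}"
    "compact {p :: (complex ^ 'k::finite) \<times> complex. egg_rho m p = 0}"
proof -
  interpret E: unconditional_hypersurface "egg_rho m" "egg_grad m :: (complex ^ 'k) \<times> complex \<Rightarrow> _"
    by (rule egg_unconditional[OF m])
  show c: "compact {p :: (complex ^ 'k) \<times> complex. egg_rho m p \<le> 0}"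
    unfolding compact_eq_bounded_closed using E.bdd by (auto intro!: closed_Collect_le egg_rho_continuous continuous_intros)
  have "closed {p :: (complex ^ 'k) \<times> complex. egg_rho m p = 0}"
    by (intro closed_Collect_eq egg_rho_continuous continuous_intros)
  then have "compact ({p :: (complex ^ 'k) \<times> complex. egg_rho m p \<le> 0} \<inter> {p. egg_rho m p = 0})" by (rule compact_Int_closed[OF c])
  moreover have "{p :: (complex ^ 'k) \<times> complex. egg_rho m p \<le> 0} \<inter> {p. egg_rho m p = 0} = {p. egg_rho m p = 0}" by auto
  ultimately show "compact {p :: (complex ^ 'k) \<times> complex. egg_rho m p = 0}" by simp
qed

lemma egg_rho_neg_norm: "egg_rho m p < 0 \<Longrightarrow> norm (fst p) < 1"
proof -
  assume "egg_rho m p < 0"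
  then have "(norm (fst p))\<^sup>2 < 1"
    using zero_le_power[OF norm_ge_zero, of "snd p" "2 * m"] unfolding egg_rho_def by linarith
  then show ?thesis by (simp add: abs_square_less_1)
qed

text \<open>The coefficient of \<open>w ^ \<beta>\<close> in the expansion of \<open>f\<close> in its last variable at \<open>w = 0\<close>, as a function of \<open>z\<close>.\<close>

definition last_coeff :: "nat \<Rightarrow> ((complex ^ 'k) \<times> complex \<Rightarrow> complex) \<Rightarrow> complex ^ 'k \<Rightarrow> complex" where
  "last_coeff \<beta> f z = taylor_coeff \<beta> (\<lambda>t. f (z, t))"

text \<open>A function on an open neighbourhood \<open>U\<close> of the closed egg, as in \<open>holomorphic_near\<close>.\<close>

locale holomorphic_on_egg =
  fixes m :: nat and f :: "(complex ^ 'k::finite) \<times> complex \<Rightarrow> complex" and U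
  assumes m: "m \<ge> 1" and U: "open U" and sub: "{p. egg_rho m p \<le> 0} \<subseteq> U"
    and diff: "\<And>p. p \<in> U \<Longrightarrow> cdifferentiable f p"
begin

lemma f_cont: "continuous_on U f"
  using diff by (intro continuous_at_imp_continuous_on) (auto intro: cdifferentiable_imp_continuous)

lemma hol_last: "(\<lambda>t. f (z, t)) holomorphic_on {t. (z, t) \<in> U}"
proof -
  have "(\<lambda>t. f (z, t)) field_differentiable at t" if "(z, t) \<in> U" for t
    using cdifferentiable_line[of f "(z, 0)" t "(0, 1)"] diff[OF that] by (simp add: cscale_def)
  then show ?thesis by (auto simp: holomorphic_on_def intro: field_differentiable_at_within)
qed

lemma hol_first: "(\<lambda>s. f (a + s *s u, w)) holomorphic_on {s. (a + s *s u, w) \<in> U}"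
proof -
  have "(\<lambda>s. f (a + s *s u, w)) field_differentiable at s" if "(a + s *s u, w) \<in> U" for s
    using cdifferentiable_line[of f "(a, w)" s "(u, 0)"] diff[OF that] by (simp add: cscale_def)
  then show ?thesis by (auto simp: holomorphic_on_def intro: field_differentiable_at_within)
qed

lemma in_U: "norm z < 1 \<Longrightarrow> norm w \<le> egg_radius m z \<Longrightarrow> (z, w) \<in> U"
  using egg_rho_le_iff(2)[OF m, of z w] sub by auto

text \<open>The boundary circle \<open>r = egg_radius m z\<close> is included, since \<open>f\<close> is holomorphic beyond it.\<close>

lemma last_coeff_circle:
  assumes z: "norm z < 1" and r: "0 < r" "r \<le> egg_radius m z"
  shows "(\<integral>t. f (z, of_real r * ecirc t) / ecirc t ^ \<beta> \<partial>unit_arc) = of_real r ^ \<beta> * last_coeff \<beta> f z"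
  unfolding last_coeff_def
proof (rule taylor_coeff_circle[OF _ _ r(1)])
  have h: "(\<lambda>t. f (z, t)) holomorphic_on cball 0 r"
    by (rule holomorphic_on_subset[OF hol_last]) (use in_U[OF z] r in auto)
  then show "continuous_on (cball 0 r) (\<lambda>t. f (z, t))" by (rule holomorphic_on_imp_continuous_on)
  show "(\<lambda>t. f (z, t)) holomorphic_on ball 0 r" by (rule holomorphic_on_subset[OF h]) auto
qed

lemma last_coeff_sums:
  assumes q: "egg_rho m q < 0"
  shows "(\<lambda>\<beta>. last_coeff \<beta> f (fst q) * snd q ^ \<beta>) sums f q"
proof -
  have z: "norm (fst q) < 1" by (rule egg_rho_neg_norm[OF q])
  have "(\<lambda>t. f (fst q, t)) holomorphic_on ball 0 (egg_radius m (fst q))"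
    by (rule holomorphic_on_subset[OF hol_last]) (use in_U[OF z] in auto)
  moreover have "norm (snd q) < egg_radius m (fst q)" using egg_rho_le_iff(1)[OF m z, of "snd q"] q by simp
  ultimately show ?thesis using taylor_coeff_sums[of "\<lambda>t. f (fst q, t)" "egg_radius m (fst q)" "snd q"] by (simp add: last_coeff_def)
qed

text \<open>The radius of the circle over \<open>z\<close> shrinks as \<open>z\<close> approaches the sphere. Locally in \<open>z\<close> a fixed smaller radius
\<open>r\<close> can be used, namely on the open set \<open>V r\<close> of points over which the circle of radius \<open>r\<close> is interior to the egg.\<close>

lemma last_coeff_regular:
  "continuous_on (ball 0 1) (last_coeff \<beta> f)" "slice_holomorphic (last_coeff \<beta> f) (ball 0 1)"
proof -
  define F where "F r z t = f (z, of_real r * ecirc t) / ecirc t ^ \<beta>" for r z t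
  define V where "V r = {z :: complex ^ 'k. egg_rho m (z, of_real r) < 0}" for r
  have V1: "norm z < 1" if "z \<in> V r" for r z
    using egg_rho_neg_norm[of m "(z, of_real r)"] that by (simp add: V_def)
  have Vr: "r < egg_radius m z" if "z \<in> V r" "r > 0" for r z
    using that egg_rho_le_iff(1)[OF m V1[OF that(1)], of "of_real r"] by (simp add: V_def)
  have VU: "(z, of_real r * ecirc t) \<in> U" if "z \<in> V r" "r > 0" for z r t
    using Vr[OF that] that by (intro in_U V1[OF that(1)]) (simp add: norm_mult)
  have op: "open (V r)" for r
    unfolding V_def by (intro open_Collect_less continuous_on_compose2[OF egg_rho_continuous] continuous_intros) auto
  have ex: "\<exists>r>0. z \<in> V r" if "norm z < 1" for z
  proof -
    have "egg_rho m (z, of_real (egg_radius m z / 2)) < 0"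
      using egg_rho_le_iff(1)[OF m that, of "of_real (egg_radius m z / 2)"] egg_radius_pos[OF that, of m] by simp
    then show ?thesis using egg_radius_pos[OF that, of m] by (intro exI[of _ "egg_radius m z / 2"]) (simp add: V_def)
  qed
  have eq: "last_coeff \<beta> f z = (\<integral>t. F r z t \<partial>unit_arc) / of_real r ^ \<beta>" if "r > 0" "z \<in> V r" for r z
    unfolding F_def using last_coeff_circle[OF V1[OF that(2)] that(1)] Vr[OF that(2,1)] that by simp
  have cF: "continuous_on (V r \<times> UNIV) (\<lambda>p. F r (fst p) (snd p))" if "r > 0" for r
    unfolding F_def by (intro continuous_intros continuous_on_compose2[OF f_cont]) (use that VU in auto)
  show "continuous_on (ball 0 1) (last_coeff \<beta> f)"
  proof (rule continuous_at_imp_continuous_on, rule ballI)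
    fix z :: "complex ^ 'k" assume "z \<in> ball 0 1"
    then obtain r where r: "r > 0" "z \<in> V r" using ex by auto
    have "continuous_on (V r) (\<lambda>z. (\<integral>t. F r z t \<partial>unit_arc) / of_real r ^ \<beta>)"
      using r by (intro continuous_on_divide[OF continuous_on_unit_arc_integral continuous_on_const] cF) auto
    then have "continuous_on (V r) (last_coeff \<beta> f)" by (rule continuous_on_eq) (use eq r in auto)
    then show "isCont (last_coeff \<beta> f) z" using op r(2) by (simp add: continuous_on_eq_continuous_at)
  qed
  show "slice_holomorphic (last_coeff \<beta> f) (ball 0 1)"
    unfolding slice_holomorphic_def
  proof (intro allI)
    fix a u :: "complex ^ 'k"
    have "(\<lambda>s. last_coeff \<beta> f (a + s *s u)) field_differentiable (at s0)" if s0: "norm (a + s0 *s u) < 1" for s0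
    proof -
      obtain r where r: "r > 0" "a + s0 *s u \<in> V r" using ex[OF s0] by auto
      define S where "S = (\<lambda>s. a + s *s u) -` V r"
      have S: "open S" unfolding S_def by (intro open_vimage op continuous_intros)
      have "(\<lambda>s. \<integral>t. F r (a + s *s u) t \<partial>unit_arc) holomorphic_on S"
      proof (rule holomorphic_on_unit_arc_integral[OF S])
        show "continuous_on (S \<times> UNIV) (\<lambda>p. F r (a + fst p *s u) (snd p))"
          by (rule continuous_on_compose2[OF cF[OF r(1)], of _ "\<lambda>p. (a + fst p *s u, snd p)", simplified])
            (auto simp: S_def intro!: continuous_intros)
        show "(\<lambda>s. F r (a + s *s u) t) holomorphic_on S" for t
          unfolding F_def
          by (intro holomorphic_on_divide holomorphic_on_const holomorphic_on_subset[OF hol_first]) (use VU r in \<open>auto simp: S_def\<close>)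
      qed
      then have "(\<lambda>s. (\<integral>t. F r (a + s *s u) t \<partial>unit_arc) / of_real r ^ \<beta>) holomorphic_on S"
        by (intro holomorphic_intros) (use r in auto)
      then have "(\<lambda>s. last_coeff \<beta> f (a + s *s u)) holomorphic_on S"
        by (rule holomorphic_transform) (use eq r in \<open>auto simp: S_def\<close>)
      moreover have "s0 \<in> S" using r by (simp add: S_def)
      ultimately show ?thesis using S holomorphic_on_imp_differentiable_at by blast
    qed
    then show "(\<lambda>s. last_coeff \<beta> f (a + s *s u)) holomorphic_on {s. a + s *s u \<in> ball 0 1}"
      by (auto simp: holomorphic_on_def intro: field_differentiable_at_within)
  qed
qed

lemma f_bounded: obtains A where "A \<ge> 0" "\<And>p. egg_rho m p \<le> 0 \<Longrightarrow> norm (f p) \<le> A"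
proof -
  have "compact (f ` {p. egg_rho m p \<le> 0})"
    by (intro compact_continuous_image continuous_on_subset[OF f_cont sub] compact_closure_egg m)
  then obtain A where A: "\<forall>x\<in>f ` {p. egg_rho m p \<le> 0}. norm x \<le> A" using compact_imp_bounded bounded_iff by metis
  show ?thesis by (rule that[of "max A 0"]) (use A in \<open>auto simp: le_max_iff_disj\<close>)
qed

lemma last_coeff_bound:
  assumes A: "\<And>p. egg_rho m p \<le> 0 \<Longrightarrow> norm (f p) \<le> A" and z: "norm z < 1"
  shows "egg_radius m z ^ \<beta> * norm (last_coeff \<beta> f z) \<le> A"
proof -
  define r where "r = egg_radius m z"
  have r: "r > 0" using egg_radius_pos[OF z] by (simp add: r_def)
  interpret P: finite_measure unit_arc by (rule finite_measure_unit_arc)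
  have c: "continuous_on UNIV (\<lambda>t. f (z, of_real r * ecirc t) / ecirc t ^ \<beta>)"
    by (intro continuous_intros continuous_on_compose2[OF f_cont]) (use in_U[OF z] r in \<open>auto simp: norm_mult r_def\<close>)
  have "norm (\<integral>t. f (z, of_real r * ecirc t) / ecirc t ^ \<beta> \<partial>unit_arc) \<le> (\<integral>t. norm (f (z, of_real r * ecirc t) / ecirc t ^ \<beta>) \<partial>unit_arc)"
    by (rule integral_norm_bound)
  also have "\<dots> \<le> (\<integral>t. A \<partial>unit_arc)"
  proof (rule integral_mono)
    show "integrable unit_arc (\<lambda>t. norm (f (z, of_real r * ecirc t) / ecirc t ^ \<beta>))"
      by (intro integrable_norm unit_arc_integral c)
    show "norm (f (z, of_real r * ecirc t) / ecirc t ^ \<beta>) \<le> A" for t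
      using A[of "(z, of_real r * ecirc t)"] egg_rho_le_iff(2)[OF m z, of "of_real r * ecirc t"] r
      by (simp add: norm_divide norm_power norm_mult r_def)
  qed simp
  finally show ?thesis using last_coeff_circle[OF z r, of \<beta>] r by (simp add: r_def norm_mult norm_power)
qed

text \<open>The Cauchy estimate bounds the coefficient by \<open>A * (1 - \<bar>z\<bar>\<^sup>2) powr (- b)\<close> with \<open>b = \<beta> / (2 m)\<close>, which costs only
half of the amount \<open>\<beta> / m\<close> by which the weight exponent \<open>egg_lambda\<close> exceeds \<open>egg_mu\<close>.\<close>

lemma last_coeff_integrable:
  defines "n \<equiv> CARD('k) + 1"
  shows "integrable lborel (\<lambda>z. ball_weight (egg_lambda n m \<beta>) z *\<^sub>R last_coeff \<beta> f z)"
proof -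
  obtain A where A: "A \<ge> 0" "\<And>p. egg_rho m p \<le> 0 \<Longrightarrow> norm (f p) \<le> A" using f_bounded by blast
  define b where "b = real \<beta> / (2 * real m)"
  have lb: "egg_lambda n m \<beta> - b = egg_mu n m + b" using m by (simp add: egg_lambda_def b_def field_simps)
  show ?thesis
  proof (rule Bochner_Integration.integrable_bound)
    show "integrable lborel (\<lambda>z :: complex ^ 'k. A * ball_weight (egg_lambda n m \<beta> - b) z)"
      unfolding lb using egg_mu_pos[OF m, of n] by (intro integrable_mult_right integrable_ball_weight add_pos_nonneg) (auto simp: b_def)
    have "(\<lambda>z. indicator (ball 0 1) z *\<^sub>R last_coeff \<beta> f z) \<in> borel_measurable borel"
      by (rule borel_measurable_continuous_on_indicator) (auto simp: last_coeff_regular)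
    moreover have bw: "(\<lambda>z :: complex ^ 'k. (1 - (norm z)\<^sup>2) powr (egg_lambda n m \<beta> - 1)) \<in> borel_measurable borel" by measurable
    ultimately have "(\<lambda>z. (1 - (norm z)\<^sup>2) powr (egg_lambda n m \<beta> - 1) *\<^sub>R (indicator (ball 0 1) z *\<^sub>R last_coeff \<beta> f z)) \<in> borel_measurable borel"
      by (rule borel_measurable_scaleR[rotated])
    then show "(\<lambda>z. ball_weight (egg_lambda n m \<beta>) z *\<^sub>R last_coeff \<beta> f z) \<in> borel_measurable lborel"
      by (simp add: ball_weight_def mult.commute)
    show "AE z in lborel. norm (ball_weight (egg_lambda n m \<beta>) z *\<^sub>R last_coeff \<beta> f z) \<le> norm (A * ball_weight (egg_lambda n m \<beta> - b) z)"
    proof (rule AE_I2)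
      fix z :: "complex ^ 'k"
      show "norm (ball_weight (egg_lambda n m \<beta>) z *\<^sub>R last_coeff \<beta> f z) \<le> norm (A * ball_weight (egg_lambda n m \<beta> - b) z)"
      proof (cases "norm z < 1")
        case True
        define Q where "Q = 1 - (norm z)\<^sup>2"
        have Q: "Q > 0" using norm_sq_less_1[OF True] by (simp add: Q_def)
        have rb: "egg_radius m z ^ \<beta> = Q powr b"
        proof -
          have "egg_radius m z ^ \<beta> = egg_radius m z powr real \<beta>" using egg_radius_pos[OF True] by (simp add: powr_realpow)
          then show ?thesis by (simp add: egg_radius_def Q_def powr_powr b_def)
        qed
        have "Q powr b * norm (last_coeff \<beta> f z) \<le> A" using last_coeff_bound[OF A(2) True, of \<beta>] by (simp add: rb)
        then have "Q powr (egg_lambda n m \<beta> - b - 1) * (Q powr b * norm (last_coeff \<beta> f z)) \<le> Q powr (egg_lambda n m \<beta> - b - 1) * A"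
          by (intro mult_left_mono) auto
        moreover have "Q powr (egg_lambda n m \<beta> - b - 1) * Q powr b = Q powr (egg_lambda n m \<beta> - 1)" by (simp add: powr_add[symmetric])
        ultimately have "Q powr (egg_lambda n m \<beta> - 1) * norm (last_coeff \<beta> f z) \<le> A * Q powr (egg_lambda n m \<beta> - b - 1)"
          by (simp only: mult.assoc[symmetric] mult.commute[of A])
        then show ?thesis using True A(1) by (simp add: ball_weight_def Q_def abs_mult)
      qed (simp add: ball_weight_def)
    qed
  qed
qed

end

text \<open>On the boundary circle over \<open>z\<close>, the conjugated term depends on the angle only through \<open>ecirc t ^ (- \<beta>)\<close>, so
integrating it against \<open>f\<close> produces the Taylor coefficient of degree \<open>\<beta>\<close> in \<open>w\<close>.\<close>

lemma egg_term_param: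
  fixes z :: "complex ^ 'k::finite"
  assumes m: "m \<ge> 1" and z: "norm z < 1" and q: "egg_rho m q < 0" and n: "n = CARD('k) + 1"
  shows "cnj (egg_term n m \<beta> (z, of_real r * ecirc t) q)
     = of_real (egg_coeff CARD('k) m \<beta>) * snd q ^ \<beta> * of_real r ^ \<beta> *
        (1 - herm (fst q) z) powr of_real (- (real CARD('k) + egg_lambda n m \<beta>)) / ecirc t ^ \<beta>"
proof -
  have nq: "norm (fst q) < 1" by (rule egg_rho_neg_norm[OF q])
  have y: "norm (herm z (fst q)) < 1"
    using norm_herm_le[of z "fst q"] mult_left_le[of "norm z" "norm (fst q)"] z nq by (simp add: mult.commute)
  have ce: "cnj (ecirc t) = 1 / ecirc t"
    using complex_norm_square[of "ecirc t"] by (simp add: field_simps)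
  define s where "s = real CARD('k) + egg_lambda n m \<beta>"
  define c where "c = egg_coeff CARD('k) m \<beta>"
  define Y where "Y = (1 - herm (fst q) z) powr of_real s"
  have cY: "cnj ((1 - herm z (fst q)) powr of_real s) = Y"
    unfolding Y_def using cnj_one_minus_powr[OF y] by (simp add: cnj_herm)
  have "egg_term n m \<beta> (z, of_real r * ecirc t) q
      = of_real c * (of_real r * ecirc t * cnj (snd q)) ^ \<beta> / (1 - herm z (fst q)) powr of_real s"
    unfolding egg_term_def Let_def c_def egg_coeff_def s_def by (simp only: n add_diff_cancel_right' fst_conv snd_conv)
  then have "cnj (egg_term n m \<beta> (z, of_real r * ecirc t) q) = of_real c * (of_real r * (1 / ecirc t) * snd q) ^ \<beta> / Y"
    by (simp only: complex_cnj_divide complex_cnj_mult complex_cnj_power complex_cnj_complex_of_real complex_cnj_cnj ce cY)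
  also have "\<dots> = of_real c * snd q ^ \<beta> * of_real r ^ \<beta> * inverse Y / ecirc t ^ \<beta>"
    by (simp add: power_mult_distrib power_divide divide_inverse mult_ac power_inverse)
  also have "inverse Y = (1 - herm (fst q) z) powr of_real (- s)" unfolding Y_def by (simp only: of_real_minus powr_minus)
  finally show ?thesis unfolding c_def s_def .
qed

lemma continuous_on_kernel_factors:
  fixes q :: "(complex ^ 'k::finite) \<times> complex"
  assumes m: "m \<ge> 1" and q: "egg_rho m q < 0"
  shows "continuous_on {p. egg_rho m p = 0} (\<lambda>p. egg_u m p q)"
    and "continuous_on {p. egg_rho m p = 0} (\<lambda>p. egg_prefactor m p q)"
proof -
  let ?S = "{p :: (complex ^ 'k) \<times> complex. egg_rho m p = 0}"
  have sub: "(\<lambda>p. (p, q)) ` ?S \<subseteq> {x. norm (herm (fst (fst x)) (fst (snd x))) < 1}"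
  proof (rule image_subsetI)
    fix p assume "p \<in> ?S"
    then have "(p, q) \<in> egg_domain m" by (intro egg_pair_in_domain[OF m _ q]) simp
    then show "(p, q) \<in> {x. norm (herm (fst (fst x)) (fst (snd x))) < 1}" by (simp add: egg_domain_def)
  qed
  have c: "continuous_on ?S (\<lambda>p. (p, q))" by (intro continuous_intros)
  show "continuous_on ?S (\<lambda>p. egg_u m p q)"
    using continuous_on_compose2[OF continuous_on_egg_u c sub] by simp
  show "continuous_on ?S (\<lambda>p. egg_prefactor m p q)"
    using continuous_on_compose2[OF continuous_on_egg_prefactor c sub] by simp
qed

lemma egg_term_uniform_bound:
  fixes q :: "(complex ^ 'k::finite) \<times> complex"
  assumes m: "m \<ge> 1" and q: "egg_rho m q < 0" and n: "n = CARD('k) + 1"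
  obtains M where "summable M" "\<And>\<beta> p. egg_rho m p = 0 \<Longrightarrow> norm (egg_term n m \<beta> p q) \<le> M \<beta>"
proof -
  let ?S = "{p :: (complex ^ 'k) \<times> complex. egg_rho m p = 0}"
  have dom: "(p, q) \<in> egg_domain m" if "p \<in> ?S" for p using egg_pair_in_domain[OF m _ q, of p] that by simp
  then have y: "norm (herm (fst p) (fst q)) < 1" if "p \<in> ?S" for p using that by (auto simp: egg_domain_def)
  note c1 = continuous_on_kernel_factors(1)[OF m q] and c2 = continuous_on_kernel_factors(2)[OF m q]
  have ne: "(0, 1) \<in> ?S" by (simp add: egg_rho_def)
  obtain p0 where p0: "p0 \<in> ?S" "\<And>p. p \<in> ?S \<Longrightarrow> norm (egg_u m p q) \<le> norm (egg_u m p0 q)"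
    using continuous_attains_sup[OF compact_closure_egg(2)[OF m] _ continuous_on_norm[OF c1]] ne by blast
  obtain p1 where p1: "\<And>p. p \<in> ?S \<Longrightarrow> norm (egg_prefactor m p q) \<le> norm (egg_prefactor m p1 q)"
    using continuous_attains_sup[OF compact_closure_egg(2)[OF m] _ continuous_on_norm[OF c2]] ne by blast
  define r where "r = norm (egg_u m p0 q)"
  have r: "0 \<le> r" "r < 1" using dom[OF p0(1)] by (auto simp: r_def egg_domain_def)
  define M where "M \<beta> = norm (egg_prefactor m p1 q) * (egg_coeff CARD('k) m \<beta> * r ^ \<beta>)" for \<beta>
  show ?thesis
  proof (rule that[of M])
    show "summable M" unfolding M_def by (intro summable_mult summable_egg_coeff m r)
    fix \<beta> and p :: "(complex ^ 'k) \<times> complex" assume "egg_rho m p = 0"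
    then have p: "p \<in> ?S" by simp
    have "norm (egg_term n m \<beta> p q) = norm (egg_prefactor m p q) * (egg_coeff CARD('k) m \<beta> * norm (egg_u m p q) ^ \<beta>)"
      using egg_coeff_nonneg[OF m] by (simp add: egg_term_eq[OF y[OF p] n] norm_mult norm_power)
    also have "\<dots> \<le> M \<beta>"
      unfolding M_def r_def using egg_coeff_nonneg[OF m] by (intro mult_mono p1 p mult_left_mono power_mono p0) auto
    finally show "norm (egg_term n m \<beta> p q) \<le> M \<beta>" .
  qed
qed

text \<open>The integral over the circle contributes \<open>egg_radius m z ^ \<beta>\<close> twice, once from the Taylor coefficient of \<open>f\<close>
and once from the kernel. This raises the exponent of the weight by \<open>\<beta> / m\<close>, from \<open>egg_mu - 1\<close> to
\<open>egg_lambda - 1\<close>. What remains is the weighted Bergman integral of the Taylor coefficient with parameter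
\<open>\<nu> = egg_lambda n m \<beta>\<close>, whose Gamma factors are inverse to those of \<open>egg_coeff\<close>.\<close>

lemma (in holomorphic_on_egg) term_integral:
  assumes q: "egg_rho m q < 0" and n: "n = CARD('k) + 1"
  shows "(\<integral>p. f p * cnj (egg_term n m \<beta> p q) \<partial>fefferman_measure (egg m) (egg_rho m))
      = of_real (pi * real m powr (2 / (real n + 1) - 1) * pi ^ CARD('k)) * (last_coeff \<beta> f (fst q) * snd q ^ \<beta>)"
    and "integrable (fefferman_measure (egg m) (egg_rho m)) (\<lambda>p. f p * cnj (egg_term n m \<beta> p q))"
proof -
  let ?S = "{p :: (complex ^ 'k) \<times> complex. egg_rho m p = 0}"
  define k where "k = CARD('k)"
  define \<nu> where "\<nu> = egg_lambda n m \<beta>"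
  define s where "s = real k + \<nu>"
  define c where "c = egg_coeff k m \<beta>"
  define c1 where "c1 = pi * real m powr (2 / (real n + 1) - 1)"
  have l: "\<nu> > 0" unfolding \<nu>_def by (rule egg_lambda_pos[OF m])
  have nq: "norm (fst q) < 1" by (rule egg_rho_neg_norm[OF q])
  have dom: "norm (herm (fst p) (fst q)) < 1" if "p \<in> ?S" for p using egg_pair_in_domain[OF m _ q, of p] that by (simp add: egg_domain_def)
  have cS: "continuous_on ?S (\<lambda>p. f p * cnj (egg_term n m \<beta> p q))"
  proof -
    have "continuous_on ?S f" by (rule continuous_on_subset[OF f_cont]) (use sub in auto)
    moreover have "continuous_on ?S (\<lambda>p. egg_prefactor m p q * (of_real (egg_coeff CARD('k) m \<beta>) * egg_u m p q ^ \<beta>))"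
      by (intro continuous_intros continuous_on_kernel_factors m q)
    then have "continuous_on ?S (\<lambda>p. egg_term n m \<beta> p q)"
      by (rule continuous_on_eq) (simp add: egg_term_eq[OF dom n])
    ultimately show ?thesis by (intro continuous_intros)
  qed
  have mS: "(\<lambda>p. f p * cnj (egg_term n m \<beta> p q)) \<in> borel_measurable (restrict_space borel ?S)"
    by (rule borel_measurable_continuous_on_restrict[OF cS])
  obtain B where B: "\<And>p. p \<in> ?S \<Longrightarrow> norm (f p * cnj (egg_term n m \<beta> p q)) \<le> B"
  proof -
    have "bounded ((\<lambda>p. f p * cnj (egg_term n m \<beta> p q)) ` ?S)"
      by (intro compact_imp_bounded compact_continuous_image cS compact_closure_egg m)
    then obtain B where "\<forall>x\<in>(\<lambda>p. f p * cnj (egg_term n m \<beta> p q)) ` ?S. norm x \<le> B" unfolding bounded_iff by blast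
    then show ?thesis by (intro that[of B]) blast
  qed
  note fi = fefferman_integral[OF m mS, of B]
  show "integrable (fefferman_measure (egg m) (egg_rho m)) (\<lambda>p. f p * cnj (egg_term n m \<beta> p q))"
    using fi(1) B by simp
  have "(\<integral>p. f p * cnj (egg_term n m \<beta> p q) \<partial>fefferman_measure (egg m) (egg_rho m))
      = (\<integral>z. egg_weight m z *\<^sub>R (\<integral>t. f (egg_param m (z, t)) * cnj (egg_term n m \<beta> (egg_param m (z, t)) q) \<partial>unit_arc) \<partial>lborel)"
    using fi(2) B by simp
  also have "\<dots> = (\<integral>z. (of_real (c1 * c) * snd q ^ \<beta>) * (ball_weight \<nu> z *\<^sub>R (last_coeff \<beta> f z * (1 - herm (fst q) z) powr of_real (- s))) \<partial>lborel)"
  proof (rule Bochner_Integration.integral_cong[OF refl])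
    fix z :: "complex ^ 'k"
    show "egg_weight m z *\<^sub>R (\<integral>t. f (egg_param m (z, t)) * cnj (egg_term n m \<beta> (egg_param m (z, t)) q) \<partial>unit_arc)
      = (of_real (c1 * c) * snd q ^ \<beta>) * (ball_weight \<nu> z *\<^sub>R (last_coeff \<beta> f z * (1 - herm (fst q) z) powr of_real (- s)))"
    proof (cases "norm z < 1")
      case False
      then show ?thesis by (simp add: egg_weight_def ball_weight_def)
    next
      case z: True
      define r where "r = egg_radius m z"
      have r: "r > 0" using egg_radius_pos[OF z] by (simp add: r_def)
      define P where "P = (1 - herm (fst q) z) powr of_real (- s)"
      have "f (egg_param m (z, t)) * cnj (egg_term n m \<beta> (egg_param m (z, t)) q)
         = (of_real c * snd q ^ \<beta> * of_real r ^ \<beta> * P) * (f (z, of_real r * ecirc t) / ecirc t ^ \<beta>)" for t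
        using z egg_term_param[OF m z q n, of \<beta> r t] by (simp add: egg_param_def r_def P_def s_def \<nu>_def c_def k_def)
      then have "(\<integral>t. f (egg_param m (z, t)) * cnj (egg_term n m \<beta> (egg_param m (z, t)) q) \<partial>unit_arc)
         = (of_real c * snd q ^ \<beta> * of_real r ^ \<beta> * P) * (of_real r ^ \<beta> * last_coeff \<beta> f z)"
        using last_coeff_circle[OF z r, of \<beta>] by (simp only: integral_mult_right_zero) (simp add: r_def)
      also have "\<dots> = (of_real c * snd q ^ \<beta>) * of_real (r ^ \<beta> * r ^ \<beta>) * (last_coeff \<beta> f z * P)"
        by (simp add: mult_ac)
      finally have I: "(\<integral>t. f (egg_param m (z, t)) * cnj (egg_term n m \<beta> (egg_param m (z, t)) q) \<partial>unit_arc) = \<dots>" .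
      have w: "egg_weight m z * (r ^ \<beta> * r ^ \<beta>) = c1 * ball_weight \<nu> z"
      proof -
        define Q where "Q = 1 - (norm z)\<^sup>2"
        have "r ^ \<beta> * r ^ \<beta> = r powr real (2 * \<beta>)" using r by (simp only: powr_realpow power_add[symmetric] mult_2)
        also have "\<dots> = Q powr (real \<beta> / real m)" using m by (simp add: r_def egg_radius_def powr_powr Q_def)
        finally have "ball_weight (egg_mu n m) z * (r ^ \<beta> * r ^ \<beta>) = ball_weight \<nu> z"
          using z by (simp add: ball_weight_def \<nu>_def egg_lambda_def Q_def powr_add[symmetric] algebra_simps)
        moreover have "real n + 1 = real CARD('k) + 2" by (simp add: n)
        ultimately show ?thesis unfolding egg_weight_eq c1_def n[symmetric] by (simp only: mult.assoc)
      qed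
      have "egg_weight m z *\<^sub>R ((of_real c * snd q ^ \<beta>) * of_real (r ^ \<beta> * r ^ \<beta>) * (last_coeff \<beta> f z * P))
        = (of_real c * snd q ^ \<beta>) * of_real (egg_weight m z * (r ^ \<beta> * r ^ \<beta>)) * (last_coeff \<beta> f z * P)"
        unfolding scaleR_conv_of_real of_real_mult[of "egg_weight m z"] by (simp only: ac_simps)
      also have "\<dots> = (of_real (c1 * c) * snd q ^ \<beta>) * (ball_weight \<nu> z *\<^sub>R (last_coeff \<beta> f z * P))"
        unfolding w scaleR_conv_of_real of_real_mult by (simp only: ac_simps)
      finally show ?thesis unfolding I P_def .
    qed
  qed
  also have "\<dots> = (of_real (c1 * c) * snd q ^ \<beta>) * (\<integral>z. ball_weight \<nu> z *\<^sub>R (last_coeff \<beta> f z * (1 - herm (fst q) z) powr of_real (- s)) \<partial>lborel)"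
    by (rule integral_mult_right_zero)
  also have "(\<integral>z. ball_weight \<nu> z *\<^sub>R (last_coeff \<beta> f z * (1 - herm (fst q) z) powr of_real (- s)) \<partial>lborel)
      = of_real (pi ^ CARD('k) * Gamma \<nu> / Gamma s) * last_coeff \<beta> f (fst q)"
    unfolding s_def k_def
    by (rule weighted_bergman_reproducing[OF last_coeff_regular l _ nq]) (use last_coeff_integrable[of \<beta>] in \<open>simp add: \<nu>_def n\<close>)
  also have "(of_real (c1 * c) * snd q ^ \<beta>) * (of_real (pi ^ CARD('k) * Gamma \<nu> / Gamma s) * last_coeff \<beta> f (fst q))
      = of_real (c1 * (c * Gamma \<nu> / Gamma s) * pi ^ CARD('k)) * (last_coeff \<beta> f (fst q) * snd q ^ \<beta>)"
    by (simp add: mult_ac)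
  also have "c * Gamma \<nu> / Gamma s = 1"
  proof -
    have "Gamma \<nu> > 0" "Gamma s > 0" using l by (auto simp: s_def intro!: Gamma_real_pos add_nonneg_pos)
    then show ?thesis by (simp add: c_def egg_coeff_def s_def \<nu>_def n k_def)
  qed
  finally show "(\<integral>p. f p * cnj (egg_term n m \<beta> p q) \<partial>fefferman_measure (egg m) (egg_rho m))
      = of_real (pi * real m powr (2 / (real n + 1) - 1) * pi ^ CARD('k)) * (last_coeff \<beta> f (fst q) * snd q ^ \<beta>)"
    by (simp add: c1_def)
qed

text \<open>On the compact boundary the terms are dominated by a convergent series, so the integral may be taken term by
term; the result is the Taylor series of \<open>f\<close> in \<open>w\<close>, times a constant inverse to \<open>egg_const\<close>.\<close>

theorem egg_kernel_reproducing:
  fixes f :: "(complex ^ 'k::finite) \<times> complex \<Rightarrow> complex"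
  assumes m: "m \<ge> 1" and f: "holomorphic_near f (closure (egg m))" and q: "q \<in> egg m" and n: "n = CARD('k) + 1"
  shows "L2_inner (fefferman_measure (egg m) (egg_rho m)) f (\<lambda>p. of_real (egg_const n m) * egg_kernel m p q) = f q"
proof -
  let ?\<mu> = "fefferman_measure (egg m) (egg_rho m :: (complex ^ 'k) \<times> complex \<Rightarrow> real)"
  let ?S = "{p :: (complex ^ 'k) \<times> complex. egg_rho m p = 0}"
  obtain U where U: "open U" "closure (egg m) \<subseteq> U" "\<And>p. p \<in> U \<Longrightarrow> cdifferentiable f p"
    using f unfolding holomorphic_near_iff by blast
  interpret H: holomorphic_on_egg m f U
    by standard (use m U in \<open>auto simp: closure_egg[OF m]\<close>)
  have q0: "egg_rho m q < 0" using q by (simp add: egg_eq_sublevel)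
  have space: "space ?\<mu> = ?S" by (simp add: fefferman_measure_egg[OF m] space_restrict_space)
  obtain M where M: "summable M" "\<And>\<beta> p. egg_rho m p = 0 \<Longrightarrow> norm (egg_term n m \<beta> p q) \<le> M \<beta>"
    using egg_term_uniform_bound[OF m q0 n] by blast
  obtain A where A: "A \<ge> 0" "\<And>p. egg_rho m p \<le> 0 \<Longrightarrow> norm (f p) \<le> A" using H.f_bounded by blast
  define C where "C = pi * real m powr (2 / (real n + 1) - 1) * pi ^ CARD('k)"
  interpret F: finite_measure ?\<mu>
    unfolding fefferman_measure_egg[OF m]
    by (rule finite_measure.finite_measure_distr[OF finite_measure_egg_param[OF m] egg_param_measurable[OF m]])
  have bound: "norm (f p * cnj (egg_term n m \<beta> p q)) \<le> A * M \<beta>" if "p \<in> ?S" for p \<beta>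
    unfolding norm_mult complex_mod_cnj using that A M(2)[of p \<beta>] by (intro mult_mono) auto
  have "(\<lambda>\<beta>. \<integral>p. f p * cnj (egg_term n m \<beta> p q) \<partial>?\<mu>) sums (\<integral>p. (\<Sum>\<beta>. f p * cnj (egg_term n m \<beta> p q)) \<partial>?\<mu>)"
  proof (rule sums_integral[OF H.term_integral(2)[OF q0 n]])
    show "AE p in ?\<mu>. summable (\<lambda>\<beta>. norm (f p * cnj (egg_term n m \<beta> p q)))"
      by (rule AE_I2, rule summable_comparison_test'[OF summable_mult[OF M(1)]]) (use bound space in auto)
    show "summable (\<lambda>\<beta>. \<integral>p. norm (f p * cnj (egg_term n m \<beta> p q)) \<partial>?\<mu>)"
    proof (rule summable_comparison_test'[OF summable_mult2[OF summable_mult[OF M(1)]]])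
      fix \<beta>
      have "(\<integral>p. norm (f p * cnj (egg_term n m \<beta> p q)) \<partial>?\<mu>) \<le> (\<integral>p. A * M \<beta> \<partial>?\<mu>)"
        by (rule integral_mono[OF integrable_norm[OF H.term_integral(2)[OF q0 n]]]) (use bound space in auto)
      also have "\<dots> = A * M \<beta> * measure ?\<mu> (space ?\<mu>)" by simp
      finally show "norm (\<integral>p. norm (f p * cnj (egg_term n m \<beta> p q)) \<partial>?\<mu>) \<le> A * M \<beta> * measure ?\<mu> (space ?\<mu>)" by simp
    qed
  qed
  moreover have "(\<integral>p. (\<Sum>\<beta>. f p * cnj (egg_term n m \<beta> p q)) \<partial>?\<mu>) = (\<integral>p. f p * cnj (egg_kernel m p q) \<partial>?\<mu>)"
  proof (rule Bochner_Integration.integral_cong[OF refl])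
    fix p assume "p \<in> space ?\<mu>"
    then have "(p, q) \<in> egg_domain m" using space by (intro egg_pair_in_domain[OF m _ q0]) simp
    from egg_kernel_sums(2)[OF m this n] have "(\<lambda>\<beta>. cnj (egg_term n m \<beta> p q)) sums cnj (egg_kernel m p q)" by (simp only: sums_cnj)
    then have "(\<lambda>\<beta>. f p * cnj (egg_term n m \<beta> p q)) sums (f p * cnj (egg_kernel m p q))" by (rule sums_mult)
    then show "(\<Sum>\<beta>. f p * cnj (egg_term n m \<beta> p q)) = f p * cnj (egg_kernel m p q)" by (simp add: sums_iff)
  qed
  ultimately have "(\<lambda>\<beta>. of_real C * (last_coeff \<beta> f (fst q) * snd q ^ \<beta>)) sums (\<integral>p. f p * cnj (egg_kernel m p q) \<partial>?\<mu>)"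
    unfolding H.term_integral(1)[OF q0 n] C_def by simp
  moreover have "(\<lambda>\<beta>. of_real C * (last_coeff \<beta> f (fst q) * snd q ^ \<beta>)) sums (of_real C * f q)"
    by (intro sums_mult H.last_coeff_sums q0)
  ultimately have eq: "(\<integral>p. f p * cnj (egg_kernel m p q) \<partial>?\<mu>) = of_real C * f q" by (rule sums_unique2)
  \<comment> \<open>of the \<open>n\<close> factors \<open>\<pi>\<close>, one comes from the circle and the others from the ball\<close>
  have "egg_const n m * C = 1"
  proof -
    have "real m powr (1 - 2 / (real n + 1)) * real m powr (2 / (real n + 1) - 1) = 1"
      using m by (simp add: powr_add[symmetric])
    moreover have "pi ^ n = pi * pi ^ CARD('k)" by (simp add: n)
    ultimately show ?thesis by (simp add: egg_const_def C_def)
  qed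
  then have CC: "complex_of_real (egg_const n m) * of_real C = 1" by (metis of_real_1 of_real_mult)
  have "L2_inner ?\<mu> f (\<lambda>p. of_real (egg_const n m) * egg_kernel m p q) = (\<integral>p. of_real (egg_const n m) * (f p * cnj (egg_kernel m p q)) \<partial>?\<mu>)"
    by (simp add: L2_inner_def mult_ac)
  also have "\<dots> = of_real (egg_const n m) * (of_real C * f q)" by (simp only: integral_mult_right_zero eq)
  also have "\<dots> = f q" using CC by (simp only: mult.assoc[symmetric] mult_1_left)
  finally show ?thesis .
qed

section \<open>Square integrable functions\<close>

lemma measurable_cnj: "f \<in> borel_measurable M \<Longrightarrow> (\<lambda>x. cnj (f x)) \<in> borel_measurable M"
  by (rule measurable_compose[OF _ borel_measurable_continuous_onI]) (auto intro!: continuous_intros)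

lemma L2_mult_integrable:
  assumes f: "f \<in> L2_fun \<mu>" and g: "g \<in> L2_fun \<mu>"
  shows "integrable \<mu> (\<lambda>x. f x * cnj (g x))"
proof (rule Bochner_Integration.integrable_bound)
  show "integrable \<mu> (\<lambda>x. (norm (f x))\<^sup>2 + (norm (g x))\<^sup>2)"
    using f g by (intro Bochner_Integration.integrable_add) (auto simp: L2_fun_def)
  show "(\<lambda>x. f x * cnj (g x)) \<in> borel_measurable \<mu>"
    using f g by (auto simp: L2_fun_def intro!: borel_measurable_times measurable_cnj)
  show "AE x in \<mu>. norm (f x * cnj (g x)) \<le> norm ((norm (f x))\<^sup>2 + (norm (g x))\<^sup>2)"
  proof (rule AE_I2)
    fix x
    have "2 * (norm (f x) * norm (g x)) \<le> (norm (f x))\<^sup>2 + (norm (g x))\<^sup>2"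
      using sum_squares_bound[of "norm (f x)" "norm (g x)"] by simp
    moreover have "0 \<le> norm (f x) * norm (g x)" by simp
    ultimately have "norm (f x) * norm (g x) \<le> (norm (f x))\<^sup>2 + (norm (g x))\<^sup>2" by linarith
    then show "norm (f x * cnj (g x)) \<le> norm ((norm (f x))\<^sup>2 + (norm (g x))\<^sup>2)"
      unfolding norm_mult complex_mod_cnj by simp
  qed
qed

text \<open>The best choice is \<open>t = sqrt (B / A)\<close>. If one of \<open>A\<close>, \<open>B\<close> vanishes, letting \<open>t\<close> tend to infinity or to 0 gives
\<open>x \<le> 0\<close>.\<close>

lemma le_sqrt_of_AM:
  fixes x A B :: real
  assumes A: "A \<ge> 0" and B: "B \<ge> 0" and le: "\<And>t. t > 0 \<Longrightarrow> 2 * x \<le> t * A + B / t"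
  shows "x \<le> sqrt A * sqrt B"
proof (cases "A = 0 \<or> B = 0")
  case True
  have "x \<le> e" if e: "e > 0" for e
  proof -
    define M where "M = A + B + 1"
    have M: "M > 0" using A B by (simp add: M_def)
    show ?thesis
    proof (cases "A = 0")
      case True
      have "2 * x \<le> B / (M / e)" using le[of "M / e"] True M e by simp
      also have "\<dots> = (B / M) * e" by simp
      also have "\<dots> \<le> 1 * e" using e M A by (intro mult_right_mono) (auto simp: M_def)
      finally show ?thesis using e by simp
    next
      case False
      then have "B = 0" using \<open>A = 0 \<or> B = 0\<close> by simp
      then have "2 * x \<le> e / M * A" using le[of "e / M"] M e by simp
      also have "\<dots> = (A / M) * e" by simp
      also have "\<dots> \<le> 1 * e" using e M B by (intro mult_right_mono) (auto simp: M_def)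
      finally show ?thesis using e by simp
    qed
  qed
  then have "x \<le> 0" by (rule dense_ge)
  then show ?thesis using True A B by auto
next
  case False
  then have p: "sqrt A > 0" "sqrt B > 0" using A B by auto
  have "2 * x \<le> (sqrt B / sqrt A) * A + B / (sqrt B / sqrt A)" using p by (intro le) simp
  also have "(sqrt B / sqrt A) * A = sqrt A * sqrt B"
    using p A by (simp add: field_simps real_sqrt_mult_self flip: power2_eq_square)
  also have "B / (sqrt B / sqrt A) = sqrt A * sqrt B"
    using p B by (simp add: field_simps flip: power2_eq_square)
  finally show ?thesis by simp
qed

lemma L2_Cauchy_Schwarz:
  assumes f: "f \<in> L2_fun \<mu>" and g: "g \<in> L2_fun \<mu>"
  shows "norm (L2_inner \<mu> f g) \<le> L2_norm \<mu> f * L2_norm \<mu> g"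
  unfolding L2_norm_def
proof (rule le_sqrt_of_AM)
  have fi: "integrable \<mu> (\<lambda>x. (norm (f x))\<^sup>2)" "integrable \<mu> (\<lambda>x. (norm (g x))\<^sup>2)" using f g by (auto simp: L2_fun_def)
  fix t :: real assume t: "t > 0"
  have "norm (L2_inner \<mu> f g) \<le> (\<integral>x. norm (f x * cnj (g x)) \<partial>\<mu>)" unfolding L2_inner_def by (rule integral_norm_bound)
  also have "\<dots> \<le> (\<integral>x. (t * (norm (f x))\<^sup>2 + (norm (g x))\<^sup>2 / t) / 2 \<partial>\<mu>)"
  proof (rule integral_mono)
    show "integrable \<mu> (\<lambda>x. norm (f x * cnj (g x)))" by (rule integrable_norm[OF L2_mult_integrable[OF f g]])
    show "integrable \<mu> (\<lambda>x. (t * (norm (f x))\<^sup>2 + (norm (g x))\<^sup>2 / t) / 2)"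
      using fi by (intro integrable_divide_zero Bochner_Integration.integrable_add integrable_mult_right) auto
    fix x
    have "0 \<le> (t * norm (f x) - norm (g x))\<^sup>2 / t" using t by simp
    also have "(t * norm (f x) - norm (g x))\<^sup>2 / t = t * (norm (f x))\<^sup>2 + (norm (g x))\<^sup>2 / t - 2 * (norm (f x) * norm (g x))"
      using t by (simp add: power2_eq_square field_simps)
    finally show "norm (f x * cnj (g x)) \<le> (t * (norm (f x))\<^sup>2 + (norm (g x))\<^sup>2 / t) / 2"
      by (simp add: norm_mult)
  qed
  also have "\<dots> = (t * (\<integral>x. (norm (f x))\<^sup>2 \<partial>\<mu>) + (\<integral>x. (norm (g x))\<^sup>2 \<partial>\<mu>) / t) / 2"
    using fi by (simp add: Bochner_Integration.integral_add)
  finally show "2 * norm (L2_inner \<mu> f g) \<le> t * (\<integral>x. (norm (f x))\<^sup>2 \<partial>\<mu>) + (\<integral>x. (norm (g x))\<^sup>2 \<partial>\<mu>) / t" by simp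
qed (auto intro!: integral_nonneg_AE)

lemma L2_fun_diff:
  assumes f: "f \<in> L2_fun \<mu>" and g: "g \<in> L2_fun \<mu>"
  shows "(\<lambda>x. f x - g x) \<in> L2_fun \<mu>"
proof -
  have m: "(\<lambda>x. f x - g x) \<in> borel_measurable \<mu>" using f g by (auto simp: L2_fun_def)
  moreover have "integrable \<mu> (\<lambda>x. (norm (f x - g x))\<^sup>2)"
  proof (rule Bochner_Integration.integrable_bound)
    show "integrable \<mu> (\<lambda>x. 2 * (norm (f x))\<^sup>2 + 2 * (norm (g x))\<^sup>2)"
      using f g by (intro Bochner_Integration.integrable_add integrable_mult_right) (auto simp: L2_fun_def)
    show "(\<lambda>x. (norm (f x - g x))\<^sup>2) \<in> borel_measurable \<mu>" using m by measurable
    show "AE x in \<mu>. norm ((norm (f x - g x))\<^sup>2) \<le> norm (2 * (norm (f x))\<^sup>2 + 2 * (norm (g x))\<^sup>2)"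
    proof (rule AE_I2)
      fix x
      have "(norm (f x - g x))\<^sup>2 \<le> (norm (f x) + norm (g x))\<^sup>2" by (intro power_mono norm_triangle_ineq4) auto
      also have "\<dots> \<le> 2 * (norm (f x))\<^sup>2 + 2 * (norm (g x))\<^sup>2"
        using sum_squares_bound[of "norm (f x)" "norm (g x)"] by (simp add: power2_sum)
      finally show "norm ((norm (f x - g x))\<^sup>2) \<le> norm (2 * (norm (f x))\<^sup>2 + 2 * (norm (g x))\<^sup>2)" by simp
    qed
  qed
  ultimately show ?thesis by (simp add: L2_fun_def)
qed

lemma L2_inner_diff:
  assumes "f \<in> L2_fun \<mu>" "g \<in> L2_fun \<mu>" "h \<in> L2_fun \<mu>"
  shows "L2_inner \<mu> (\<lambda>x. f x - g x) h = L2_inner \<mu> f h - L2_inner \<mu> g h"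
  unfolding L2_inner_def left_diff_distrib using assms by (intro Bochner_Integration.integral_diff L2_mult_integrable)

lemma L2_inner_cnj: "cnj (L2_inner \<mu> f g) = L2_inner \<mu> g f"
proof -
  have "cnj (L2_inner \<mu> f g) = (\<integral>x. cnj (f x * cnj (g x)) \<partial>\<mu>)"
    unfolding L2_inner_def by (rule Bochner_Integration.integral_cnj[symmetric])
  then show ?thesis by (simp only: L2_inner_def complex_cnj_mult complex_cnj_cnj mult.commute)
qed

lemma L2_inner_tendsto:
  assumes f: "f \<in> L2_fun \<mu>" and g: "\<And>i. g i \<in> L2_fun \<mu>" and h: "h \<in> L2_fun \<mu>"
    and lim: "(\<lambda>i. L2_norm \<mu> (\<lambda>x. f x - g i x)) \<longlonglongrightarrow> 0"
  shows "(\<lambda>i. L2_inner \<mu> (g i) h) \<longlonglongrightarrow> L2_inner \<mu> f h"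
proof (rule LIM_zero_cancel, rule Lim_null_comparison)
  show "\<forall>\<^sub>F i in sequentially. norm (L2_inner \<mu> (g i) h - L2_inner \<mu> f h) \<le> L2_norm \<mu> (\<lambda>x. f x - g i x) * L2_norm \<mu> h"
  proof (rule always_eventually, rule allI)
    fix i
    have "norm (L2_inner \<mu> (g i) h - L2_inner \<mu> f h) = norm (L2_inner \<mu> (\<lambda>x. f x - g i x) h)"
      unfolding L2_inner_diff[OF f g h] by (rule norm_minus_commute)
    also have "\<dots> \<le> L2_norm \<mu> (\<lambda>x. f x - g i x) * L2_norm \<mu> h" by (intro L2_Cauchy_Schwarz L2_fun_diff f g h)
    finally show "norm (L2_inner \<mu> (g i) h - L2_inner \<mu> f h) \<le> L2_norm \<mu> (\<lambda>x. f x - g i x) * L2_norm \<mu> h" .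
  qed
  show "(\<lambda>i. L2_norm \<mu> (\<lambda>x. f x - g i x) * L2_norm \<mu> h) \<longlonglongrightarrow> 0"
    using tendsto_mult_right[OF lim, of "L2_norm \<mu> h"] by simp
qed

lemma hardy_space_approx:
  assumes "f \<in> hardy_space D \<mu>"
  obtains g where "\<And>i::nat. holomorphic_near (g i) (closure D)" "(\<lambda>i. L2_norm \<mu> (\<lambda>x. f x - g i x)) \<longlonglongrightarrow> 0"
proof -
  have "\<exists>g. holomorphic_near g (closure D) \<and> L2_norm \<mu> (\<lambda>x. f x - g x) < inverse (real (Suc i))" for i
    using assms unfolding hardy_space_def by auto
  then obtain g where g: "\<And>i. holomorphic_near (g i) (closure D)" "\<And>i. L2_norm \<mu> (\<lambda>x. f x - g i x) < inverse (real (Suc i))"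
    by metis
  have "(\<lambda>i. L2_norm \<mu> (\<lambda>x. f x - g i x)) \<longlonglongrightarrow> 0"
  proof (rule Lim_null_comparison[OF _ LIMSEQ_inverse_real_of_nat])
    show "\<forall>\<^sub>F i in sequentially. norm (L2_norm \<mu> (\<lambda>x. f x - g i x)) \<le> inverse (real (Suc i))"
      using g(2) by (intro always_eventually allI) (auto simp: L2_norm_def intro!: less_imp_le integral_nonneg_AE)
  qed
  with g(1) that show ?thesis by blast
qed

section \<open>Hardy spaces with a reproducing kernel\<close>

text \<open>The facts about a kernel \<open>K\<close> from which the Hardy space theory follows: \<open>K\<close> reproduces functions holomorphic
near the closure, and dilations move from one variable to the other. Contracting dilations map the closure
into \<open>D\<close>, and this allows functions near the closure to be approximated by combinations of kernels.\<close>

locale hardy_reproducing =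
  fixes D :: "((complex ^ 'k::finite) \<times> complex) set" and \<mu> :: "((complex ^ 'k) \<times> complex) measure"
    and K :: "(complex ^ 'k) \<times> complex \<Rightarrow> (complex ^ 'k) \<times> complex \<Rightarrow> complex"
  assumes fin: "finite_measure \<mu>" and sets: "sets \<mu> = sets (restrict_space borel (frontier D))"
    and compact: "compact (closure D)"
    and shrink: "\<And>p r. p \<in> closure D \<Longrightarrow> 0 \<le> r \<Longrightarrow> r < 1 \<Longrightarrow> r *\<^sub>R p \<in> D"
    and K_hol: "\<And>q. q \<in> D \<Longrightarrow> holomorphic_near (\<lambda>p. K p q) (closure D)"
    and K_cont: "continuous_on (closure D \<times> D) (\<lambda>x. K (fst x) (snd x))"
    and K_cnj: "\<And>p q. p \<in> closure D \<Longrightarrow> q \<in> D \<Longrightarrow> cnj (K p q) = K q p"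
    and K_scale: "\<And>p q r. K (r *\<^sub>R p) q = K p (r *\<^sub>R q)"
    and reproducing: "\<And>f q. holomorphic_near f (closure D) \<Longrightarrow> q \<in> D \<Longrightarrow> L2_inner \<mu> f (\<lambda>p. K p q) = f q"
begin

lemma space: "space \<mu> = frontier D"
  using sets_eq_imp_space_eq[OF sets] by (simp add: space_restrict_space)

lemma frontier_closure: "frontier D \<subseteq> closure D" by (simp add: frontier_def)

lemma near_continuous: "holomorphic_near f (closure D) \<Longrightarrow> continuous_on (closure D) f"
  unfolding holomorphic_near_iff
  by (intro continuous_at_imp_continuous_on) (auto intro: cdifferentiable_imp_continuous)

lemma near_bounded:
  assumes "continuous_on (closure D) f"
  obtains A where "A \<ge> 0" "\<And>p. p \<in> closure D \<Longrightarrow> norm (f p) \<le> A"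
proof -
  have "bounded (f ` closure D)" by (intro compact_imp_bounded compact_continuous_image assms compact)
  then obtain A where A: "\<forall>x\<in>f ` closure D. norm x \<le> A" unfolding bounded_iff by blast
  show ?thesis by (rule that[of "max A 0"]) (use A in \<open>auto simp: le_max_iff_disj\<close>)
qed

lemma cont_measurable: "continuous_on (closure D) f \<Longrightarrow> f \<in> borel_measurable \<mu>"
  unfolding measurable_cong_sets[OF sets refl]
  by (rule borel_measurable_continuous_on_restrict) (rule continuous_on_subset[OF _ frontier_closure])

lemma cont_L2: "continuous_on (closure D) f \<Longrightarrow> f \<in> L2_fun \<mu>"
proof -
  assume f: "continuous_on (closure D) f"
  interpret finite_measure \<mu> by (rule fin)
  obtain A where A: "A \<ge> 0" "\<And>p. p \<in> closure D \<Longrightarrow> norm (f p) \<le> A" using near_bounded[OF f] by blast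
  have "integrable \<mu> (\<lambda>x. (norm (f x))\<^sup>2)"
    by (rule integrable_const_bound[of _ "A\<^sup>2"])
      (use A frontier_closure space cont_measurable[OF f] in \<open>auto intro!: AE_I2 power_mono\<close>)
  then show ?thesis using cont_measurable[OF f] by (simp add: L2_fun_def)
qed

lemma near_L2: "holomorphic_near f (closure D) \<Longrightarrow> f \<in> L2_fun \<mu>"
  by (intro cont_L2 near_continuous)

lemma near_hardy: "holomorphic_near f (closure D) \<Longrightarrow> f \<in> hardy_space D \<mu>"
  unfolding hardy_space_def by (auto simp: near_L2 L2_norm_def intro!: exI[of _ f])

text \<open>For functions holomorphic near the closure the reproducing formula expresses evaluation as an \<open>L\<^sup>2\<close> inner
product, which is continuous. That some approximating sequence exists makes the limit unique.\<close>

lemma hardy_eval_eq: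
  assumes f: "f \<in> hardy_space D \<mu>" and p: "p \<in> D"
  shows "hardy_eval D \<mu> f p = L2_inner \<mu> f (\<lambda>x. K x p)"
  unfolding hardy_eval_def
proof (rule the_equality)
  have fL: "f \<in> L2_fun \<mu>" using f by (simp add: hardy_space_def)
  show *: "\<forall>g. (\<forall>i::nat. holomorphic_near (g i) (closure D)) \<longrightarrow>
          (\<lambda>i. L2_norm \<mu> (\<lambda>x. f x - g i x)) \<longlonglongrightarrow> 0 \<longrightarrow> (\<lambda>i. g i p) \<longlonglongrightarrow> L2_inner \<mu> f (\<lambda>x. K x p)"
  proof (intro allI impI)
    fix g :: "nat \<Rightarrow> _"
    assume g: "\<forall>i. holomorphic_near (g i) (closure D)" "(\<lambda>i. L2_norm \<mu> (\<lambda>x. f x - g i x)) \<longlonglongrightarrow> 0"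
    have "(\<lambda>i. L2_inner \<mu> (g i) (\<lambda>x. K x p)) \<longlonglongrightarrow> L2_inner \<mu> f (\<lambda>x. K x p)"
      by (rule L2_inner_tendsto[OF fL near_L2 near_L2[OF K_hol[OF p]] g(2)]) (use g in auto)
    then show "(\<lambda>i. g i p) \<longlonglongrightarrow> L2_inner \<mu> f (\<lambda>x. K x p)" using g(1) by (simp add: reproducing[OF _ p])
  qed
  obtain g where g: "\<And>i::nat. holomorphic_near (g i) (closure D)" "(\<lambda>i. L2_norm \<mu> (\<lambda>x. f x - g i x)) \<longlonglongrightarrow> 0"
    using hardy_space_approx[OF f] by blast
  fix c assume "\<forall>g. (\<forall>i::nat. holomorphic_near (g i) (closure D)) \<longrightarrow>
          (\<lambda>i. L2_norm \<mu> (\<lambda>x. f x - g i x)) \<longlonglongrightarrow> 0 \<longrightarrow> (\<lambda>i. g i p) \<longlonglongrightarrow> c"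
  then have "(\<lambda>i. g i p) \<longlonglongrightarrow> c" using g by blast
  moreover have "(\<lambda>i. g i p) \<longlonglongrightarrow> L2_inner \<mu> f (\<lambda>x. K x p)" using * g by blast
  ultimately show "c = L2_inner \<mu> f (\<lambda>x. K x p)" by (rule LIMSEQ_unique)
qed

text \<open>Reproducing \<open>g\<close> at \<open>r *\<^sub>R p\<close> and moving the dilation to the other variable writes \<open>g (r *\<^sub>R p)\<close> as the integral of
\<open>g x * K p (r *\<^sub>R x)\<close> over boundary points \<open>x\<close>. In the variable \<open>p\<close> this is a superposition of kernels at the points
\<open>r *\<^sub>R x\<close> inside \<open>D\<close>, to each of which \<open>h\<close> is orthogonal.\<close>

lemma dilate_orthogonal:
  assumes h: "h \<in> L2_fun \<mu>" and orth: "\<And>p. p \<in> D \<Longrightarrow> L2_inner \<mu> h (\<lambda>x. K x p) = 0"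
    and g: "holomorphic_near g (closure D)" and r: "0 \<le> r" "r < 1"
  shows "L2_inner \<mu> h (\<lambda>p. g (r *\<^sub>R p)) = 0"
proof -
  interpret finite_measure \<mu> by (rule fin)
  interpret PP: pair_sigma_finite \<mu> \<mu> ..
  let ?S = "frontier D"
  have gc: "continuous_on (closure D) g" by (rule near_continuous[OF g])
  define \<Phi> where "\<Phi> p x = h p * (cnj (g x) * cnj (K p (r *\<^sub>R x)))" for p x
  have hm: "h \<in> borel_measurable \<mu>" using h by (simp add: L2_fun_def)
  have kc: "continuous_on (?S \<times> ?S) (\<lambda>y. cnj (g (snd y)) * cnj (K (fst y) (r *\<^sub>R snd y)))"
  proof -
    have "(\<lambda>y. (fst y, r *\<^sub>R snd y)) ` (?S \<times> ?S) \<subseteq> closure D \<times> D"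
      using frontier_closure shrink[OF _ r] by auto
    moreover have "continuous_on (?S \<times> ?S) (\<lambda>y. (fst y, r *\<^sub>R snd y))" by (intro continuous_intros)
    ultimately have "continuous_on (?S \<times> ?S) (\<lambda>y. K (fst y) (r *\<^sub>R snd y))"
      using continuous_on_compose2[OF K_cont] by fastforce
    moreover have "continuous_on (?S \<times> ?S) (\<lambda>y. g (snd y))"
      by (rule continuous_on_compose2[OF gc]) (use frontier_closure in \<open>auto intro!: continuous_intros\<close>)
    ultimately show ?thesis by (intro continuous_intros)
  qed
  have idm: "(\<lambda>y. y) \<in> measurable (\<mu> \<Otimes>\<^sub>M \<mu>) (restrict_space borel (?S \<times> ?S))"
  proof (rule measurable_restrict_space2)
    have "fst \<in> measurable (\<mu> \<Otimes>\<^sub>M \<mu>) borel" "snd \<in> measurable (\<mu> \<Otimes>\<^sub>M \<mu>) borel"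
    proof -
      have "(\<lambda>x. x) \<in> measurable \<mu> borel"
        unfolding measurable_cong_sets[OF sets refl] by (intro measurable_restrict_space1) simp
      then show "fst \<in> measurable (\<mu> \<Otimes>\<^sub>M \<mu>) borel" "snd \<in> measurable (\<mu> \<Otimes>\<^sub>M \<mu>) borel"
        using measurable_compose[OF measurable_fst, of "\<lambda>x. x" \<mu> borel \<mu>] measurable_compose[OF measurable_snd, of "\<lambda>x. x" \<mu> borel \<mu>] by simp_all
    qed
    then have "(\<lambda>y. (fst y, snd y)) \<in> measurable (\<mu> \<Otimes>\<^sub>M \<mu>) (borel \<Otimes>\<^sub>M borel)" by (rule measurable_Pair)
    then show "(\<lambda>y. y) \<in> measurable (\<mu> \<Otimes>\<^sub>M \<mu>) borel" by (simp add: borel_prod)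
  qed (auto simp: space_pair_measure space)
  have km: "(\<lambda>y. cnj (g (snd y)) * cnj (K (fst y) (r *\<^sub>R snd y))) \<in> borel_measurable (\<mu> \<Otimes>\<^sub>M \<mu>)"
    by (rule measurable_compose[OF idm borel_measurable_continuous_on_restrict[OF kc]])
  have \<Phi>m: "(\<lambda>(p, x). \<Phi> p x) \<in> borel_measurable (\<mu> \<Otimes>\<^sub>M \<mu>)"
    unfolding \<Phi>_def case_prod_unfold by (intro borel_measurable_times km measurable_compose[OF measurable_fst hm])
  obtain B where B: "\<And>p x. p \<in> ?S \<Longrightarrow> x \<in> ?S \<Longrightarrow> norm (cnj (g x) * cnj (K p (r *\<^sub>R x))) \<le> B"
  proof -
    have "compact ?S" by (rule compact_frontier_bounded) (rule bounded_subset[OF compact_imp_bounded[OF compact] closure_subset])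
    then have "bounded ((\<lambda>y. cnj (g (snd y)) * cnj (K (fst y) (r *\<^sub>R snd y))) ` (?S \<times> ?S))"
      by (intro compact_imp_bounded compact_continuous_image kc compact_Times)
    then obtain B where "\<forall>v\<in>(\<lambda>y. cnj (g (snd y)) * cnj (K (fst y) (r *\<^sub>R snd y))) ` (?S \<times> ?S). norm v \<le> B" unfolding bounded_iff by blast
    then show ?thesis by (intro that[of B]) force
  qed
  have hi: "integrable \<mu> h"
  proof (rule Bochner_Integration.integrable_bound)
    show "integrable \<mu> (\<lambda>x. 1 + (norm (h x))\<^sup>2)" using h by (simp add: L2_fun_def)
    show "AE x in \<mu>. norm (h x) \<le> norm (1 + (norm (h x))\<^sup>2)"
    proof (rule AE_I2)
      fix x
      have "0 \<le> (norm (h x) - 1)\<^sup>2" by simp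
      then have "2 * norm (h x) \<le> 1 + (norm (h x))\<^sup>2" by (simp add: power2_eq_square algebra_simps)
      then have "norm (h x) \<le> 1 + (norm (h x))\<^sup>2" using norm_ge_zero[of "h x"] by linarith
      then show "norm (h x) \<le> norm (1 + (norm (h x))\<^sup>2)" by simp
    qed
  qed (rule hm)
  have \<Phi>i: "integrable (\<mu> \<Otimes>\<^sub>M \<mu>) (\<lambda>(p, x). \<Phi> p x)"
  proof (rule PP.Fubini_integrable[OF \<Phi>m])
    have mx: "(\<lambda>x. \<Phi> p x) \<in> borel_measurable \<mu>" if "p \<in> space \<mu>" for p
      using measurable_compose[OF measurable_Pair1'[OF that] \<Phi>m] by simp
    have nb: "norm (\<Phi> p x) \<le> norm (h p) * B" if "p \<in> space \<mu>" "x \<in> space \<mu>" for p x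
      unfolding \<Phi>_def norm_mult[of "h p"] using B[of p x] that by (intro mult_left_mono) (auto simp: space)
    have ix: "integrable \<mu> (\<lambda>x. \<Phi> p x)" if "p \<in> space \<mu>" for p
      by (rule integrable_const_bound[OF _ mx[OF that], of "norm (h p) * B"]) (use nb that in auto)
    then show "AE p in \<mu>. integrable \<mu> (\<lambda>x. case (p, x) of (p, x) \<Rightarrow> \<Phi> p x)" by (auto intro: AE_I2)
    show "integrable \<mu> (\<lambda>p. \<integral>x. norm (case (p, x) of (p, x) \<Rightarrow> \<Phi> p x) \<partial>\<mu>)"
    proof (rule Bochner_Integration.integrable_bound)
      show "integrable \<mu> (\<lambda>p. norm (h p) * (B * measure \<mu> (space \<mu>)))" using hi by (intro integrable_mult_left integrable_norm)
      show "(\<lambda>p. \<integral>x. norm (case (p, x) of (p, x) \<Rightarrow> \<Phi> p x) \<partial>\<mu>) \<in> borel_measurable \<mu>"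
        by (rule borel_measurable_lebesgue_integral) (use \<Phi>m in measurable)
      show "AE p in \<mu>. norm (\<integral>x. norm (case (p, x) of (p, x) \<Rightarrow> \<Phi> p x) \<partial>\<mu>) \<le> norm (norm (h p) * (B * measure \<mu> (space \<mu>)))"
      proof (rule AE_I2)
        fix p assume p: "p \<in> space \<mu>"
        have "(\<integral>x. norm (\<Phi> p x) \<partial>\<mu>) \<le> (\<integral>x. norm (h p) * B \<partial>\<mu>)"
          by (rule integral_mono[OF integrable_norm[OF ix[OF p]]]) (use nb p in auto)
        then have "(\<integral>x. norm (\<Phi> p x) \<partial>\<mu>) \<le> norm (h p) * (B * measure \<mu> (space \<mu>))" by (simp add: mult_ac)
        moreover have "0 \<le> (\<integral>x. norm (\<Phi> p x) \<partial>\<mu>)" by (simp add: integral_nonneg_AE)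
        ultimately show "norm (\<integral>x. norm (case (p, x) of (p, x) \<Rightarrow> \<Phi> p x) \<partial>\<mu>) \<le> norm (norm (h p) * (B * measure \<mu> (space \<mu>)))" by simp
      qed
    qed
  qed
  \<comment> \<open>symmetry of \<open>K\<close> and the dilation rule interchange the roles of \<open>p\<close> and \<open>x\<close>\<close>
  have gr: "cnj (g (r *\<^sub>R p)) = (\<integral>x. cnj (g x) * cnj (K p (r *\<^sub>R x)) \<partial>\<mu>)" if p: "p \<in> space \<mu>" for p
  proof -
    have pc: "p \<in> closure D" using p frontier_closure space by auto
    have rD: "r *\<^sub>R p \<in> D" by (rule shrink[OF pc r])
    have "cnj (g (r *\<^sub>R p)) = cnj (L2_inner \<mu> g (\<lambda>x. K x (r *\<^sub>R p)))" by (simp add: reproducing[OF g rD])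
    also have "\<dots> = (\<integral>x. cnj (g x * cnj (K x (r *\<^sub>R p))) \<partial>\<mu>)" unfolding L2_inner_def by (rule Bochner_Integration.integral_cnj[symmetric])
    also have "\<dots> = (\<integral>x. cnj (g x) * cnj (K p (r *\<^sub>R x)) \<partial>\<mu>)"
    proof (rule Bochner_Integration.integral_cong[OF refl])
      fix x assume "x \<in> space \<mu>"
      then have "x \<in> closure D" using frontier_closure space by auto
      then have "cnj (K x (r *\<^sub>R p)) = K p (r *\<^sub>R x)" using K_cnj[OF _ rD] K_scale by simp
      then show "cnj (g x * cnj (K x (r *\<^sub>R p))) = cnj (g x) * cnj (K p (r *\<^sub>R x))" by simp
    qed
    finally show ?thesis .
  qed
  have "L2_inner \<mu> h (\<lambda>p. g (r *\<^sub>R p)) = (\<integral>p. (\<integral>x. \<Phi> p x \<partial>\<mu>) \<partial>\<mu>)"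
    unfolding L2_inner_def
  proof (rule Bochner_Integration.integral_cong[OF refl])
    fix p assume "p \<in> space \<mu>"
    then show "h p * cnj (g (r *\<^sub>R p)) = (\<integral>x. \<Phi> p x \<partial>\<mu>)" unfolding \<Phi>_def by (simp only: gr integral_mult_right_zero)
  qed
  also have "\<dots> = (\<integral>x. (\<integral>p. \<Phi> p x \<partial>\<mu>) \<partial>\<mu>)" by (rule PP.Fubini_integral[OF \<Phi>i, symmetric])
  also have "\<dots> = (\<integral>x. 0 \<partial>\<mu>)"
  proof (rule Bochner_Integration.integral_cong[OF refl])
    fix x assume "x \<in> space \<mu>"
    then have "x \<in> closure D" using frontier_closure space by blast
    then have rx: "r *\<^sub>R x \<in> D" by (rule shrink[OF _ r])
    have "(\<integral>p. \<Phi> p x \<partial>\<mu>) = (\<integral>p. cnj (g x) * (h p * cnj (K p (r *\<^sub>R x))) \<partial>\<mu>)"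
      by (intro Bochner_Integration.integral_cong[OF refl]) (simp add: \<Phi>_def)
    also have "\<dots> = cnj (g x) * L2_inner \<mu> h (\<lambda>p. K p (r *\<^sub>R x))" by (simp only: integral_mult_right_zero L2_inner_def)
    finally show "(\<integral>p. \<Phi> p x \<partial>\<mu>) = 0" by (simp add: orth[OF rx])
  qed
  finally show ?thesis by simp
qed

text \<open>The dilates of \<open>g\<close> converge to \<open>g\<close> uniformly on the boundary as \<open>r\<close> tends to 1.\<close>

lemma orthogonal_to_holomorphic:
  assumes h: "h \<in> L2_fun \<mu>" and orth: "\<And>p. p \<in> D \<Longrightarrow> L2_inner \<mu> h (\<lambda>x. K x p) = 0"
    and g: "holomorphic_near g (closure D)"
  shows "L2_inner \<mu> h g = 0"
proof -
  interpret finite_measure \<mu> by (rule fin)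
  define r where "r i = 1 - inverse (real (Suc i))" for i
  have r: "0 \<le> r i" "r i < 1" for i by (auto simp: r_def field_simps)
  have rl: "r \<longlonglongrightarrow> 1"
    unfolding r_def using tendsto_diff[OF tendsto_const LIMSEQ_inverse_real_of_nat, of 1] by simp
  have gc: "continuous_on (closure D) g" by (rule near_continuous[OF g])
  obtain A where A: "A \<ge> 0" "\<And>p. p \<in> closure D \<Longrightarrow> norm (g p) \<le> A" using near_bounded[OF gc] by blast
  have sp: "r i *\<^sub>R p \<in> closure D" if "p \<in> closure D" for i p
    using shrink[OF that r] closure_subset by blast
  have gcr: "continuous_on (closure D) (\<lambda>p. g (r i *\<^sub>R p))" for i
    by (rule continuous_on_compose2[OF gc]) (use sp in \<open>auto intro!: continuous_intros\<close>)
  have hm: "h \<in> borel_measurable \<mu>" using h by (simp add: L2_fun_def)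
  have hi: "integrable \<mu> (\<lambda>x. h x * cnj (1::complex))"
    by (rule L2_mult_integrable[OF h cont_L2]) (rule continuous_on_const)
  have "(\<lambda>i. \<integral>p. h p * cnj (g (r i *\<^sub>R p)) \<partial>\<mu>) \<longlonglongrightarrow> (\<integral>p. h p * cnj (g p) \<partial>\<mu>)"
  proof (rule integral_dominated_convergence[where w = "\<lambda>p. norm (h p) * A"])
    show "integrable \<mu> (\<lambda>p. norm (h p) * A)" using hi by (intro integrable_mult_left integrable_norm) simp
    show "(\<lambda>p. h p * cnj (g p)) \<in> borel_measurable \<mu>" "(\<lambda>p. h p * cnj (g (r i *\<^sub>R p))) \<in> borel_measurable \<mu>" for i
      by (intro borel_measurable_times hm measurable_cnj cont_measurable gc gcr)+
    show "AE p in \<mu>. (\<lambda>i. h p * cnj (g (r i *\<^sub>R p))) \<longlonglongrightarrow> h p * cnj (g p)"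
    proof (rule AE_I2)
      fix p assume "p \<in> space \<mu>"
      then have p: "p \<in> closure D" using frontier_closure space by auto
      have "(\<lambda>i. r i *\<^sub>R p) \<longlonglongrightarrow> 1 *\<^sub>R p" by (intro tendsto_intros rl)
      then have "(\<lambda>i. g (r i *\<^sub>R p)) \<longlonglongrightarrow> g p"
        using continuous_on_tendsto_compose[OF gc, of "\<lambda>i. r i *\<^sub>R p" p sequentially] p sp by simp
      then show "(\<lambda>i. h p * cnj (g (r i *\<^sub>R p))) \<longlonglongrightarrow> h p * cnj (g p)" by (intro tendsto_intros)
    qed
    show "AE p in \<mu>. norm (h p * cnj (g (r i *\<^sub>R p))) \<le> norm (h p) * A" for i
      using frontier_closure space A(2) sp by (intro AE_I2) (auto simp: norm_mult intro!: mult_left_mono)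
  qed
  moreover have "(\<integral>p. h p * cnj (g (r i *\<^sub>R p)) \<partial>\<mu>) = 0" for i
    using dilate_orthogonal[OF h orth g r] by (simp add: L2_inner_def)
  ultimately have "(\<lambda>i::nat. 0) \<longlonglongrightarrow> (\<integral>p. h p * cnj (g p) \<partial>\<mu>)" by simp
  then show ?thesis by (simp add: LIMSEQ_const_iff L2_inner_def)
qed

lemma orthogonal_to_hardy:
  assumes h: "h \<in> L2_fun \<mu>" and orth: "\<And>p. p \<in> D \<Longrightarrow> L2_inner \<mu> h (\<lambda>x. K x p) = 0"
    and f: "f \<in> hardy_space D \<mu>"
  shows "L2_inner \<mu> f h = 0"
proof -
  have fL: "f \<in> L2_fun \<mu>" using f by (simp add: hardy_space_def)
  obtain g where g: "\<And>i::nat. holomorphic_near (g i) (closure D)" "(\<lambda>i. L2_norm \<mu> (\<lambda>x. f x - g i x)) \<longlonglongrightarrow> 0"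
    using hardy_space_approx[OF f] by blast
  have "L2_inner \<mu> (g i) h = 0" for i
    using orthogonal_to_holomorphic[OF h orth g(1)[of i]] L2_inner_cnj[of \<mu> h "g i"] by simp
  then have "(\<lambda>i::nat. 0) \<longlonglongrightarrow> L2_inner \<mu> f h" using L2_inner_tendsto[OF fL near_L2[OF g(1)] h g(2)] by simp
  then show ?thesis by (simp add: LIMSEQ_const_iff)
qed

text \<open>Evaluations are bounded by the Cauchy-Schwarz inequality. If all evaluations of \<open>f\<close> and \<open>g\<close> agree, then their
difference \<open>h\<close> is orthogonal to all kernels, hence to the whole Hardy space and in particular to \<open>f - g = h\<close>.\<close>

theorem is_RKHS: "hardy_is_RKHS D \<mu>"
  unfolding hardy_is_RKHS_def
proof (intro conjI ballI impI)
  fix p assume p: "p \<in> D"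
  show "\<exists>C. \<forall>f. holomorphic_near f (closure D) \<longrightarrow> norm (f p) \<le> C * L2_norm \<mu> f"
  proof (intro exI allI impI)
    fix f assume f: "holomorphic_near f (closure D)"
    show "norm (f p) \<le> L2_norm \<mu> (\<lambda>x. K x p) * L2_norm \<mu> f"
      using L2_Cauchy_Schwarz[OF near_L2[OF f] near_L2[OF K_hol[OF p]]] by (simp add: reproducing[OF f p] mult.commute)
  qed
next
  fix f g assume f: "f \<in> hardy_space D \<mu>" and g: "g \<in> hardy_space D \<mu>"
    and eq: "\<forall>p\<in>D. hardy_eval D \<mu> f p = hardy_eval D \<mu> g p"
  define h where "h x = f x - g x" for x
  have fL: "f \<in> L2_fun \<mu>" "g \<in> L2_fun \<mu>" using f g by (auto simp: hardy_space_def)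
  have h: "h \<in> L2_fun \<mu>" unfolding h_def by (rule L2_fun_diff[OF fL])
  have orth: "L2_inner \<mu> h (\<lambda>x. K x p) = 0" if "p \<in> D" for p
    unfolding h_def L2_inner_diff[OF fL near_L2[OF K_hol[OF that]]] using eq that by (simp add: hardy_eval_eq f g)
  have "L2_inner \<mu> h h = L2_inner \<mu> f h - L2_inner \<mu> g h"
    using L2_inner_diff[OF fL h] by (simp add: h_def[abs_def])
  then have "L2_inner \<mu> h h = 0" by (simp add: orthogonal_to_hardy[OF h orth] f g)
  moreover have "L2_inner \<mu> h h = of_real (\<integral>x. (norm (h x))\<^sup>2 \<partial>\<mu>)"
    unfolding L2_inner_def integral_complex_of_real[symmetric] by (simp only: complex_norm_square)
  ultimately have "(\<integral>x. (norm (h x))\<^sup>2 \<partial>\<mu>) = 0" by simp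
  moreover have "integrable \<mu> (\<lambda>x. (norm (h x))\<^sup>2)" using h by (simp add: L2_fun_def)
  ultimately have "AE x in \<mu>. (norm (h x))\<^sup>2 = 0" by (subst (asm) integral_nonneg_eq_0_iff_AE) auto
  then show "AE x in \<mu>. f x = g x" by eventually_elim (simp add: h_def)
qed

text \<open>Uniqueness is the usual symmetry argument: evaluate the representing function \<open>F\<close> of \<open>S\<close> at \<open>p\<close> through \<open>K\<close>, and
the kernel at \<open>p\<close> through \<open>F\<close>.\<close>

theorem hardy_kernel_iff: "is_hardy_kernel D \<mu> S \<longleftrightarrow> (\<forall>p\<in>D. \<forall>q\<in>D. S p q = K p q)"
proof
  assume S: "is_hardy_kernel D \<mu> S"
  show "\<forall>p\<in>D. \<forall>q\<in>D. S p q = K p q"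
  proof (intro ballI)
    fix p q assume p: "p \<in> D" and q: "q \<in> D"
    obtain F where F: "F \<in> hardy_space D \<mu>" "hardy_eval D \<mu> F p = S p q"
      "\<And>f. f \<in> hardy_space D \<mu> \<Longrightarrow> hardy_eval D \<mu> f q = L2_inner \<mu> f F"
      using S p q unfolding is_hardy_kernel_def by blast
    have Kp: "holomorphic_near (\<lambda>x. K x p) (closure D)" by (rule K_hol[OF p])
    have "S p q = L2_inner \<mu> F (\<lambda>x. K x p)" using F(2) hardy_eval_eq[OF F(1) p] by simp
    also have "\<dots> = cnj (L2_inner \<mu> (\<lambda>x. K x p) F)" by (simp add: L2_inner_cnj)
    also have "L2_inner \<mu> (\<lambda>x. K x p) F = L2_inner \<mu> (\<lambda>x. K x p) (\<lambda>x. K x q)"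
      using F(3)[OF near_hardy[OF Kp]] hardy_eval_eq[OF near_hardy[OF Kp] q] by simp
    also have "\<dots> = K q p" by (rule reproducing[OF Kp q])
    also have "cnj (K q p) = K p q" using K_cnj[of q p] p q closure_subset by blast
    finally show "S p q = K p q" .
  qed
next
  assume S: "\<forall>p\<in>D. \<forall>q\<in>D. S p q = K p q"
  show "is_hardy_kernel D \<mu> S"
    unfolding is_hardy_kernel_def
  proof (intro ballI bexI conjI)
    fix q assume q: "q \<in> D"
    show Kq: "(\<lambda>x. K x q) \<in> hardy_space D \<mu>" by (rule near_hardy[OF K_hol[OF q]])
    show "hardy_eval D \<mu> (\<lambda>x. K x q) p = S p q" if p: "p \<in> D" for p
      using hardy_eval_eq[OF Kq p] reproducing[OF K_hol[OF q] p] S p q by simp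
    show "hardy_eval D \<mu> f q = L2_inner \<mu> f (\<lambda>x. K x q)" if "f \<in> hardy_space D \<mu>" for f
      by (rule hardy_eval_eq[OF that q])
  qed
qed

end

section \<open>The Hardy space of the egg\<close>

lemma egg_hardy_reproducing:
  assumes m: "m \<ge> 1" and n: "n = CARD('k::finite) + 1"
  shows "hardy_reproducing (egg m) (fefferman_measure (egg m) (egg_rho m :: (complex ^ 'k) \<times> complex \<Rightarrow> real))
    (\<lambda>p q. of_real (egg_const n m) * egg_kernel m p q)"
proof (rule hardy_reproducing.intro)
  let ?\<mu> = "fefferman_measure (egg m) (egg_rho m :: (complex ^ 'k) \<times> complex \<Rightarrow> real)"
  show "finite_measure ?\<mu>"
    unfolding fefferman_measure_egg[OF m]
    by (rule finite_measure.finite_measure_distr[OF finite_measure_egg_param[OF m] egg_param_measurable[OF m]])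
  show "sets ?\<mu> = sets (restrict_space borel (frontier (egg m)))"
    by (simp add: fefferman_measure_egg[OF m] frontier_egg[OF m])
  show "compact (closure (egg m) :: ((complex ^ 'k) \<times> complex) set)"
    by (simp add: closure_egg[OF m] compact_closure_egg[OF m])
  show "r *\<^sub>R p \<in> egg m" if "p \<in> closure (egg m)" "0 \<le> r" "r < 1" for p :: "(complex ^ 'k) \<times> complex" and r
    using scaleR_in_egg[OF m _ that(2,3)] that(1) by (simp add: closure_egg[OF m])
  have dom: "(p, q) \<in> egg_domain m" if "p \<in> closure (egg m)" "q \<in> egg m" for p q :: "(complex ^ 'k) \<times> complex"
  proof (rule egg_pair_in_domain[OF m])
    show "egg_rho m p \<le> 0" using that(1) unfolding closure_egg[OF m] by simp
    show "egg_rho m q < 0" using that(2) unfolding egg_eq_sublevel by simp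
  qed
  show "holomorphic_near (\<lambda>p. of_real (egg_const n m) * egg_kernel m p q) (closure (egg m))" if "q \<in> egg m" for q :: "(complex ^ 'k) \<times> complex"
    using egg_kernel_holomorphic_near[OF m, of q] that cdifferentiable_mult[OF cdifferentiable_const]
    unfolding holomorphic_near_iff egg_eq_sublevel by blast
  show "continuous_on (closure (egg m) \<times> egg m) (\<lambda>x :: ((complex ^ 'k) \<times> complex) \<times> _. of_real (egg_const n m) * egg_kernel m (fst x) (snd x))"
    by (intro continuous_intros continuous_on_subset[OF continuous_on_egg_kernel[OF m]]) (use dom in auto)
  show "cnj (of_real (egg_const n m) * egg_kernel m p q) = of_real (egg_const n m) * egg_kernel m q p"
    if "p \<in> closure (egg m)" "q \<in> egg m" for p q :: "(complex ^ 'k) \<times> complex"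
    using cnj_egg_kernel[OF m dom[OF that]] by simp
  show "of_real (egg_const n m) * egg_kernel m (r *\<^sub>R p) q = of_real (egg_const n m) * egg_kernel m p (r *\<^sub>R q)"
    for p q :: "(complex ^ 'k) \<times> complex" and r by (simp only: egg_kernel_scaleR)
  show "L2_inner ?\<mu> f (\<lambda>p. of_real (egg_const n m) * egg_kernel m p q) = f q"
    if "holomorphic_near f (closure (egg m))" "q \<in> egg m" for f and q :: "(complex ^ 'k) \<times> complex"
    by (rule egg_kernel_reproducing[OF m that n])
qed

theorem theorem3p2:
  fixes n m :: nat
    and E :: "((complex ^ 'k::finite) \<times> complex) set"
    and \<mu> :: "((complex ^ 'k) \<times> complex) measure"
  assumes "n \<ge> 2" and "m \<ge> 1" and "CARD('k) = n - 1"
    and "E = egg m"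
    and "\<mu> = fefferman_measure E (egg_rho m)"
  shows "hardy_is_RKHS E \<mu>
    \<and> (\<forall>S. is_hardy_kernel E \<mu> S \<longleftrightarrow>
          (\<forall>p\<in>E. \<forall>q\<in>E. S p q = of_real (egg_const n m) * (\<Sum>\<beta>. egg_term n m \<beta> p q)))
    \<and> (\<forall>p\<in>E. \<forall>q\<in>E. summable (\<lambda>\<beta>. norm (egg_term n m \<beta> p q)))
    \<and> (\<forall>x\<in>E \<times> E. \<exists>U. open U \<and> x \<in> U \<and> U \<subseteq> E \<times> E \<and>
          uniform_limit U (\<lambda>N (p, q). \<Sum>\<beta><N. egg_term n m \<beta> p q)
            (\<lambda>(p, q). \<Sum>\<beta>. egg_term n m \<beta> p q) sequentially)"
proof -
  have n: "n = CARD('k) + 1" using assms by simp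
  note m = \<open>m \<ge> 1\<close> and E = \<open>E = egg m\<close> and \<mu> = \<open>\<mu> = fefferman_measure E (egg_rho m)\<close>
  interpret H: hardy_reproducing E \<mu> "\<lambda>p q. of_real (egg_const n m) * egg_kernel m p q"
    unfolding \<mu> E by (rule egg_hardy_reproducing[OF m n])
  have dom: "(p, q) \<in> egg_domain m" if "p \<in> E" "q \<in> E" for p q
  proof (rule egg_pair_in_domain[OF m])
    show "egg_rho m p \<le> 0" "egg_rho m q < 0" using that unfolding E egg_eq_sublevel by simp_all
  qed
  have suminf: "(\<Sum>\<beta>. egg_term n m \<beta> p q) = egg_kernel m p q" if "p \<in> E" "q \<in> E" for p q
    using egg_kernel_sums(2)[OF m dom[OF that] n] by (rule sums_unique[symmetric])
  have "\<exists>U. open U \<and> x \<in> U \<and> U \<subseteq> E \<times> E \<and>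
          uniform_limit U (\<lambda>N (p, q). \<Sum>\<beta><N. egg_term n m \<beta> p q)
            (\<lambda>(p, q). \<Sum>\<beta>. egg_term n m \<beta> p q) sequentially" if x: "x \<in> E \<times> E" for x
  proof -
    have "x \<in> egg_domain m" using dom x by auto
    then obtain U where U: "open U" "x \<in> U"
      "uniform_limit U (\<lambda>N (p, q). \<Sum>\<beta><N. egg_term n m \<beta> p q) (\<lambda>(p, q). egg_kernel m p q) sequentially"
      by (rule egg_kernel_locally_uniform[OF m _ n])
    have "uniform_limit (U \<inter> E \<times> E) (\<lambda>N (p, q). \<Sum>\<beta><N. egg_term n m \<beta> p q)
        (\<lambda>(p, q). egg_kernel m p q) sequentially"
      by (rule uniform_limit_on_subset[OF U(3)]) blast
    then have "uniform_limit (U \<inter> E \<times> E) (\<lambda>N (p, q). \<Sum>\<beta><N. egg_term n m \<beta> p q)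
        (\<lambda>(p, q). \<Sum>\<beta>. egg_term n m \<beta> p q) sequentially"
      by (rule uniform_limit_cong'[THEN iffD1, rotated 2]) (auto simp: suminf)
    moreover have "open (U \<inter> E \<times> E)" unfolding E by (intro open_Int open_Times open_egg U(1))
    ultimately show ?thesis using U(2) x by (intro exI[of _ "U \<inter> E \<times> E"]) simp
  qed
  moreover have "is_hardy_kernel E \<mu> S \<longleftrightarrow>
      (\<forall>p\<in>E. \<forall>q\<in>E. S p q = of_real (egg_const n m) * (\<Sum>\<beta>. egg_term n m \<beta> p q))" for S
    unfolding H.hardy_kernel_iff by (simp add: suminf)
  moreover have "\<forall>p\<in>E. \<forall>q\<in>E. summable (\<lambda>\<beta>. norm (egg_term n m \<beta> p q))"
    by (intro ballI egg_kernel_sums(1)[OF m _ n] dom)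
  ultimately show ?thesis using H.is_RKHS by (intro conjI allI ballI) simp_all
qed

end
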